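(* Let $m\ge 2$, $1<p_0<\infty$, $\frac1{p_0}+\frac1{p_0'}=1$, $p_0'<t<\infty$, $0<\alpha t<mn$, and let $T_\alpha$ be an $m$-linear fractional integral operator with generalized kernel on $\mathbb{R}^n$ (with constants $C_k$, $k\ge1$, in its smoothness condition) such that $\sum_{k=1}^\infty kC_k<\infty$. Let $\vec b=(b_1,\ldots,b_m)\in\mathrm{BMO}^m$, $\vec P=(p_1,\ldots,p_m)$, $\frac1p=\frac1{p_1}+\cdots+\frac1{p_m}$ with $t\le p_j<\infty$ ($j=1,\ldots,m$), $\frac1q=\frac1p-\frac\alpha n>0$, and $\vec\omega=(\omega_1,\ldots,\omega_m)\in A_{\frac{\vec P}{t},\frac qt}$, and write $v_{\vec\omega}=\prod_{j=1}^m\omega_j$. Let $T_{\vec b,\alpha}$ be the $m$-linear commutator of $T_\alpha$ with $\vec b$. (i) If $t<p_j<\infty$ for all $j=1,\ldots,m$, then there is a constant $C>0$, independent of $\vec f$ and $\vec b$, such that for all $f_j\in L^{p_j}(\omega_j^{p_j/t})$, $j=1,\ldots,m$, $$\left\|T_{\vec b,\alpha}(f_1,\ldots,f_m)\right\|_{L^q\left(v_{\vec\omega}^{q/t}\right)}\le C\,\|\vec b\|_{(\mathrm{BMO})^m}\prod_{j=1}^m\|f_j\|_{L^{p_j}\left(\omega_j^{p_j/t}\right)}.$$ (ii) If $t\le p_j<\infty$ for all $j=1,\ldots,m$ and at least one $p_j$ equals $t$, then there is a constant $C>0$, independent of $\vec f$ and $\vec b$, such that for all $f_j\in L^{p_j}(\omega_j^{p_j/t})$,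 $j=1,\ldots,m$, $$\left\|T_{\vec b,\alpha}(f_1,\ldots,f_m)\right\|_{L^{q,\infty}\left(v_{\vec\omega}^{q/t}\right)}\le C\,\|\vec b\|_{(\mathrm{BMO})^m}\prod_{j=1}^m\|f_j\|_{L^{p_j}\left(\omega_j^{p_j/t}\right)}.$$
   Context: Cubes in $\mathbb{R}^n$ have sides parallel to the axes; $Q(x,r)$ is the cube centered at $x$ with side length $r$; $|E|$ is Lebesgue measure; for a set $E$, $(E)^m=E\times\cdots\times E$ ($m$ factors); $\vec y=(y_1,\ldots,y_m)\in(\mathbb{R}^n)^m$, $d\vec y=dy_1\cdots dy_m$. Operator. Fix $1<p_0<\infty$, $\frac1{p_0}+\frac1{p_0'}=1$, and $\alpha$ with $0<\alpha p_0'<mn$. Let $K_\alpha(x,y_1,\ldots,y_m)$ be a locally integrable function defined away from the diagonal $x=y_1=\cdots=y_m$ in $(\mathbb{R}^n)^{m+1}$. Let $T_\alpha:\mathscr S(\mathbb{R}^n)\times\cdots\times\mathscr S(\mathbb{R}^n)\to\mathscr S'(\mathbb{R}^n)$ be $m$-linear with $$T_\alpha(\vec f)(x)=\int_{(\mathbb{R}^n)^m}K_\alpha(x,\vec y)\prod_{j=1}^m f_j(y_j)\,d\vec y\quad\text{for } x\notin\bigcap_{j=1}^m\operatorname{supp}f_j .$$ $T_\alpha$ is called an $m$-linear fractional integral operator with generalized kernel if: (1a) (size) for some $A>0$, $|K_\alpha(x,\vec y)|\le A\big(\sum_{j=1}^m|x-y_j|\big)^{-(mn-\alpha)}$; (1b)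 (smoothness) there are a constant $C>0$ and positive constants $C_k$, $k\in\{1,2,\ldots\}$, such that for all $k\geq 1$ and all $x\ne x'$ in $\mathbb{R}^n$, $$\left(\int_{Q(x,2^{k+2}\sqrt{mn}|x-x'|)^m\setminus Q(x,2^{k+1}\sqrt{mn}|x-x'|)^m}|K_\alpha(x,\vec y)-K_\alpha(x',\vec y)|^{p_0}d\vec y\right)^{1/p_0}\le C\,C_k\,2^{k(\alpha-\frac{mn}{p_0'})}|x-x'|^{\alpha-\frac{mn}{p_0'}};$$ (2) for some fixed $1\le s_1,\ldots,s_m\le p_0'$ with $\frac1s=\frac1{s_1}+\cdots+\frac1{s_m}$, $T_\alpha$ maps $L^{s_1}\times\cdots\times L^{s_m}$ boundedly into $L^{\frac{sn}{n-s\alpha},\infty}$. By (2), $T_\alpha$ is defined on $L^{s_1}\times\cdots\times L^{s_m}$, in particular on tuples of bounded measurable functions with compact support (also after multiplying one of them by a BMO function), and is still given there by the kernel formula. Norm estimates are understood in the usual sense: they hold for all bounded compactly supported measurable $f_j$ in the spaces on the right-hand side, the operator on general tuples being the continuous extension from this dense class. Commutator. $T_{\vec b,\alpha}(\vec f)=\sum_{i=1}^m T^i_{\vec b,\alpha}(\vec f)$, where $T^i_{\vec b,\alpha}(\vec f)(x)=b_i(x)T_\alpha(f_1,\ldots,f_i,\ldots,f_m)(x)-T_\alpha(f_1,\ldots,b_if_i,\ldots,f_m)(x)$. BMO. $\|b\|_{\mathrm{BMO}}=\sup_Q\frac1{|Q|}\int_Q|b(x)-b_Q|dx$ with $b_Q=\frac1{|Q|}\int_Q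 b$, supremum over all cubes; $\vec b\in\mathrm{BMO}^m$ means each $b_j\in L^1_{loc}(\mathbb{R}^n)$ has $\|b_j\|_{\mathrm{BMO}}<\infty$; $\|\vec b\|_{(\mathrm{BMO})^m}=\max_{1\le i\le m}\|b_i\|_{\mathrm{BMO}}$. Weighted spaces. For a nonnegative function $w$, $\|f\|_{L^p(w)}=\left(\int|f|^p w\,dx\right)^{1/p}$ and $\|f\|_{L^{p,\infty}(w)}=\sup_{\lambda>0}\lambda\, \left(w(\{x:|f(x)|>\lambda\})\right)^{1/p}$, where $w(E)=\int_E w\,dx$. Weight class. For $\vec R=(r_1,\ldots,r_m)$ with $1\le r_j<\infty$, $\frac1r=\sum_j\frac1{r_j}$, $r\le u<\infty$, and nonnegative functions $\omega_1,\ldots,\omega_m$ on $\mathbb{R}^n$, $\vec\omega\in A_{\vec R,u}$ means $$\sup_Q\left(\frac1{|Q|}\int_Q v_{\vec\omega}(x)^{u}dx\right)^{1/u}\prod_{j=1}^m\left(\frac1{|Q|}\int_Q\omega_j(x)^{-r_j'}dx\right)^{1/r_j'}<\infty,\qquad v_{\vec\omega}=\prod_{j=1}^m\omega_j,$$ the supremum over all cubes $Q$, with $r_j'$ the conjugate exponent of $r_j$, and the $j$-th factor understood as $(\inf_Q\omega_j)^{-1}$ when $r_j=1$. Here $\vec P/t=(p_1/t,\ldots,p_m/t)$. *)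

theory Defs
  imports "HOL-Analysis.Analysis"
begin

text \<open>
  Throughout, \<open>real ^ 'n\<close> is the underlying Euclidean space (\<open>n = CARD('n)\<close>), a point
  \<open>y :: real ^ 'n ^ 'm\<close> is an \<open>m\<close>-tuple of points of it (\<open>m = CARD('m)\<close>), and a tuple of functions
  or exponents is indexed by \<open>'m\<close>. Functions are complex valued, and measurability is
  Lebesgue measurability.
\<close>


subsection \<open>Weighted Lebesgue and weak Lebesgue spaces\<close>

text \<open>Only used with exponent \<open>a > 0\<close>.\<close>

definition ennreal_powr :: "ennreal \<Rightarrow> real \<Rightarrow> ennreal"  (infixr "powe" 80)
  where "x powe a = (if x = top then top else ennreal (enn2real x powr a))"

definition Lp_norm :: "real \<Rightarrow> (real ^ 'n \<Rightarrow> real) \<Rightarrow> (real ^ 'n \<Rightarrow> complex) \<Rightarrow> ennreal"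
  where "Lp_norm p w f = (\<integral>\<^sup>+x. ennreal (cmod (f x) powr p) * ennreal (w x) \<partial>lebesgue) powe (1 / p)"

definition weight_measure :: "(real ^ 'n \<Rightarrow> real) \<Rightarrow> (real ^ 'n) set \<Rightarrow> ennreal"
  where "weight_measure w E = (\<integral>\<^sup>+x\<in>E. ennreal (w x) \<partial>lebesgue)"

definition weak_Lp_norm :: "real \<Rightarrow> (real ^ 'n \<Rightarrow> real) \<Rightarrow> (real ^ 'n \<Rightarrow> complex) \<Rightarrow> ennreal"
  where "weak_Lp_norm p w f =
    (SUP l\<in>{0<..}. ennreal l * weight_measure w {x. l < cmod (f x)} powe (1 / p))"

definition Lp_space :: "real \<Rightarrow> (real ^ 'n \<Rightarrow> real) \<Rightarrow> (real ^ 'n \<Rightarrow> complex) set"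
  where "Lp_space p w = {f. f \<in> borel_measurable lebesgue \<and> Lp_norm p w f < top}"

definition supp :: "('a::topological_space \<Rightarrow> complex) \<Rightarrow> 'a set"
  where "supp f = closure {x. f x \<noteq> 0}"

definition bounded_compact_support :: "(real ^ 'n \<Rightarrow> complex) set"
  where "bounded_compact_support =
    {f. f \<in> borel_measurable lebesgue \<and> bounded (range f) \<and> compact (supp f)}"


subsection \<open>Cubes, BMO and the multiple weight class\<close>

definition cube :: "real ^ 'n \<Rightarrow> real \<Rightarrow> (real ^ 'n) set"
  where "cube x r = {y. \<forall>i. \<bar>y $ i - x $ i\<bar> \<le> r / 2}"

definition cubes :: "(real ^ 'n) set set"
  where "cubes = {cube x r | x r. 0 < r}"

definition avg :: "(real ^ 'n) set \<Rightarrow> (real ^ 'n \<Rightarrow> ennreal) \<Rightarrow> ennreal"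
  where "avg Q g = (\<integral>\<^sup>+x\<in>Q. g x \<partial>lebesgue) / emeasure lebesgue Q"

definition mean :: "(real ^ 'n) set \<Rightarrow> (real ^ 'n \<Rightarrow> complex) \<Rightarrow> complex"
  where "mean Q b = (LINT x:Q|lebesgue. b x) /\<^sub>R measure lebesgue Q"

definition bmo_norm :: "(real ^ 'n \<Rightarrow> complex) \<Rightarrow> ennreal"
  where "bmo_norm b = (SUP Q\<in>cubes. avg Q (\<lambda>x. ennreal (cmod (b x - mean Q b))))"

definition BMO :: "(real ^ 'n \<Rightarrow> complex) set"
  where "BMO = {b. (\<forall>S. compact S \<longrightarrow> b absolutely_integrable_on S) \<and> bmo_norm b < top}"

definition bmo_vec_norm :: "('m::finite \<Rightarrow> real ^ 'n \<Rightarrow> complex) \<Rightarrow> ennreal"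
  where "bmo_vec_norm b = Max (range (\<lambda>i. bmo_norm (b i)))"

text \<open>
  The infimum of a weight over a cube is the essential infimum. Negative powers of a weight are
  taken in \<open>[0, \<infinity>]\<close>, so that they are \<open>\<infinity>\<close> where the weight vanishes.
\<close>

definition ess_inf :: "(real ^ 'n) set \<Rightarrow> (real ^ 'n \<Rightarrow> real) \<Rightarrow> ennreal"
  where "ess_inf Q w = Sup {c. AE x in lebesgue. x \<in> Q \<longrightarrow> c \<le> ennreal (w x)}"

definition conj_exp :: "real \<Rightarrow> real"
  where "conj_exp r = r / (r - 1)"

definition dual_factor :: "real \<Rightarrow> (real ^ 'n \<Rightarrow> real) \<Rightarrow> (real ^ 'n) set \<Rightarrow> ennreal"
  where "dual_factor r w Q =
    (if r = 1 then inverse (ess_inf Q w)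
     else avg Q (\<lambda>x. inverse (ennreal (w x powr conj_exp r))) powe (1 / conj_exp r))"

definition weight_prod :: "('m::finite \<Rightarrow> real ^ 'n \<Rightarrow> real) \<Rightarrow> real ^ 'n \<Rightarrow> real"
  where "weight_prod \<omega> x = (\<Prod>j\<in>UNIV. \<omega> j x)"

definition A_class :: "('m::finite \<Rightarrow> real) \<Rightarrow> real \<Rightarrow> ('m \<Rightarrow> real ^ 'n \<Rightarrow> real) set"
  where "A_class R u = {\<omega>. (\<forall>j. \<omega> j \<in> borel_measurable lebesgue \<and> (\<forall>x. 0 \<le> \<omega> j x)) \<and>
    (SUP Q\<in>cubes. avg Q (\<lambda>x. ennreal (weight_prod \<omega> x powr u)) powe (1 / u)
        * (\<Prod>j\<in>UNIV. dual_factor (R j) (\<omega> j) Q)) < top}"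


subsection \<open>Schwartz functions and tempered distributions\<close>

primrec iter_deriv :: "(real ^ 'n) list \<Rightarrow> (real ^ 'n \<Rightarrow> complex) \<Rightarrow> real ^ 'n \<Rightarrow> complex"
  where
    "iter_deriv [] f = f"
  | "iter_deriv (v # vs) f = (\<lambda>x. frechet_derivative (iter_deriv vs f) (at x) v)"

definition schwartz :: "(real ^ 'n \<Rightarrow> complex) set"
  where "schwartz = {f. \<forall>vs N. set vs \<subseteq> Basis \<longrightarrow>
    (\<forall>x. iter_deriv vs f differentiable (at x)) \<and>
    bounded (range (\<lambda>x. (1 + norm x) ^ N *\<^sub>R iter_deriv vs f x))}"

definition schwartz_null :: "(nat \<Rightarrow> real ^ 'n \<Rightarrow> complex) \<Rightarrow> bool"
  where "schwartz_null \<phi> \<longleftrightarrow> (\<forall>vs N. set vs \<subseteq> Basis \<longrightarrow>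
    uniform_limit UNIV (\<lambda>k x. (1 + norm x) ^ N *\<^sub>R iter_deriv vs (\<phi> k) x) (\<lambda>x. 0) sequentially)"

text \<open>As the Schwartz space is metrizable, sequential continuity at \<open>0\<close> is continuity.\<close>

definition tempered_distribution :: "((real ^ 'n \<Rightarrow> complex) \<Rightarrow> complex) \<Rightarrow> bool"
  where "tempered_distribution u \<longleftrightarrow>
    (\<forall>\<phi>\<in>schwartz. \<forall>\<psi>\<in>schwartz. \<forall>a b. u (\<lambda>x. a * \<phi> x + b * \<psi> x) = a * u \<phi> + b * u \<psi>) \<and>
    (\<forall>\<phi>. (\<forall>k. \<phi> k \<in> schwartz) \<and> schwartz_null \<phi> \<longrightarrow> (\<lambda>k. u (\<phi> k)) \<longlonglongrightarrow> 0)"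


subsection \<open>Multilinear fractional integral operators with generalized kernel\<close>

abbreviation dim_mn :: "'m::finite itself \<Rightarrow> 'n::finite itself \<Rightarrow> real"
  where "dim_mn _ _ \<equiv> real CARD('m) * real CARD('n)"

text \<open>
  The kernel is a function on the whole product space whose values on the diagonal are never used.
  Measurability of every section is what gives a meaning to the integrals in the smoothness
  condition, which is imposed for all pairs of distinct points.
\<close>

definition kernel_loc_integrable :: "(real ^ 'n \<Rightarrow> real ^ 'n ^ 'm \<Rightarrow> complex) \<Rightarrow> bool"
  where "kernel_loc_integrable K \<longleftrightarrow>
    (\<forall>S. compact S \<and> S \<inter> {(x, y). \<forall>j. y $ j = x} = {} \<longrightarrow>
        (\<lambda>(x, y). K x y) absolutely_integrable_on S) \<and>
    (\<forall>x. K x \<in> borel_measurable lebesgue)"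

definition kernel_size :: "real \<Rightarrow> (real ^ 'n \<Rightarrow> real ^ 'n ^ 'm \<Rightarrow> complex) \<Rightarrow> bool"
  where "kernel_size \<alpha> K \<longleftrightarrow>
    (\<exists>A>0. \<forall>x y. (\<exists>j. y $ j \<noteq> x) \<longrightarrow>
      cmod (K x y) \<le> A * (\<Sum>j\<in>UNIV. norm (x - y $ j))
        powr (- (dim_mn TYPE('m) TYPE('n) - \<alpha>)))"

definition cube_pow :: "real ^ 'n \<Rightarrow> real \<Rightarrow> (real ^ 'n ^ 'm) set"
  where "cube_pow x r = {y. \<forall>j. y $ j \<in> cube x r}"

definition kernel_smooth ::
  "real \<Rightarrow> real \<Rightarrow> real \<Rightarrow> (nat \<Rightarrow> real) \<Rightarrow> (real ^ 'n \<Rightarrow> real ^ 'n ^ 'm \<Rightarrow> complex) \<Rightarrow> bool"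
  where "kernel_smooth \<alpha> p0 p0' Ck K \<longleftrightarrow>
    (\<forall>k\<ge>1. 0 < Ck k) \<and>
    (\<exists>C>0. \<forall>k\<ge>1. \<forall>x x'. x \<noteq> x' \<longrightarrow>
      (let d = norm (x - x'); N = dim_mn TYPE('m) TYPE('n) in
        (\<integral>\<^sup>+y\<in>cube_pow x (2 ^ (k + 2) * sqrt N * d) - cube_pow x (2 ^ (k + 1) * sqrt N * d).
            ennreal (cmod (K x y - K x' y) powr p0) \<partial>lebesgue) powe (1 / p0)
        \<le> ennreal (C * Ck k * 2 powr (real k * (\<alpha> - N / p0')) * d powr (\<alpha> - N / p0'))))"

definition kernel_integrand ::
  "(real ^ 'n \<Rightarrow> real ^ 'n ^ 'm \<Rightarrow> complex) \<Rightarrow> ('m \<Rightarrow> real ^ 'n \<Rightarrow> complex) \<Rightarrow>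
    real ^ 'n \<Rightarrow> real ^ 'n ^ 'm \<Rightarrow> complex"
  where "kernel_integrand K f x y = K x y * (\<Prod>j\<in>UNIV. f j (y $ j))"

text \<open>
  \<open>schwartz_operator K T0\<close>: \<open>T0\<close> is an \<open>m\<close>-linear map from Schwartz functions to tempered
  distributions. Off the intersection of the supports, the distribution \<open>T0 f\<close> is the function
  given by the kernel formula, that is, it acts by integration on test functions supported there.
\<close>

definition schwartz_operator ::
  "(real ^ 'n \<Rightarrow> real ^ 'n ^ 'm \<Rightarrow> complex) \<Rightarrow>
    (('m \<Rightarrow> real ^ 'n \<Rightarrow> complex) \<Rightarrow> (real ^ 'n \<Rightarrow> complex) \<Rightarrow> complex) \<Rightarrow> bool"
  where "schwartz_operator K T0 \<longleftrightarrow>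
    (\<forall>f. (\<forall>j. f j \<in> schwartz) \<longrightarrow>
      tempered_distribution (T0 f) \<and>
      (\<forall>i. \<forall>g\<in>schwartz. \<forall>h\<in>schwartz. \<forall>\<phi>\<in>schwartz. \<forall>a b.
        T0 (f(i := \<lambda>x. a * g x + b * h x)) \<phi> = a * T0 (f(i := g)) \<phi> + b * T0 (f(i := h)) \<phi>) \<and>
      (\<forall>\<phi>\<in>schwartz. compact (supp \<phi>) \<and> supp \<phi> \<inter> (\<Inter>j. supp (f j)) = {} \<longrightarrow>
        has_bochner_integral lebesgue (\<lambda>x. (LINT y|lebesgue. kernel_integrand K f x y) * \<phi> x)
          (T0 f \<phi>)))"

text \<open>
  \<open>bounded_extension \<alpha> K s T0 T\<close>: \<open>T0\<close> maps the product of the \<open>L^(s j)\<close> boundedly into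
  \<open>L^(S n / (n - S \<alpha>), \<infinity>)\<close>, where \<open>1 / S\<close> is the sum of the \<open>1 / s j\<close>, and \<open>T\<close> is the resulting
  operator on that product, which is unique up to null sets since Schwartz functions are dense.
\<close>

definition bounded_extension ::
  "real \<Rightarrow> (real ^ 'n \<Rightarrow> real ^ 'n ^ 'm \<Rightarrow> complex) \<Rightarrow> ('m \<Rightarrow> real) \<Rightarrow>
    (('m \<Rightarrow> real ^ 'n \<Rightarrow> complex) \<Rightarrow> (real ^ 'n \<Rightarrow> complex) \<Rightarrow> complex) \<Rightarrow>
    (('m \<Rightarrow> real ^ 'n \<Rightarrow> complex) \<Rightarrow> real ^ 'n \<Rightarrow> complex) \<Rightarrow> bool"
  where "bounded_extension \<alpha> K s T0 T \<longleftrightarrow>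
    (\<forall>f. (\<forall>j. f j \<in> schwartz) \<longrightarrow>
      (\<forall>\<phi>\<in>schwartz. has_bochner_integral lebesgue (\<lambda>x. T f x * \<phi> x) (T0 f \<phi>))) \<and>
    (\<forall>f. (\<forall>j. f j \<in> Lp_space (s j) (\<lambda>x. 1)) \<longrightarrow>
      T f \<in> borel_measurable lebesgue \<and>
      (\<forall>i. \<forall>g\<in>Lp_space (s i) (\<lambda>x. 1). \<forall>h\<in>Lp_space (s i) (\<lambda>x. 1). \<forall>a b.
        AE x in lebesgue.
          T (f(i := \<lambda>x. a * g x + b * h x)) x = a * T (f(i := g)) x + b * T (f(i := h)) x) \<and>
      (AE x in lebesgue. x \<notin> (\<Inter>j. supp (f j)) \<longrightarrow>
        has_bochner_integral lebesgue (kernel_integrand K f x) (T f x))) \<and>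
    (let S = 1 / (\<Sum>j\<in>UNIV. 1 / s j); n = real CARD('n) in
      \<exists>B>0. \<forall>f. (\<forall>j. f j \<in> Lp_space (s j) (\<lambda>x. 1)) \<longrightarrow>
        weak_Lp_norm (S * n / (n - S * \<alpha>)) (\<lambda>x. 1) (T f)
          \<le> ennreal B * (\<Prod>j\<in>UNIV. Lp_norm (s j) (\<lambda>x. 1) (f j)))"

definition fractional_integral_operator ::
  "real \<Rightarrow> real \<Rightarrow> real \<Rightarrow> (real ^ 'n \<Rightarrow> real ^ 'n ^ 'm \<Rightarrow> complex) \<Rightarrow> (nat \<Rightarrow> real) \<Rightarrow> ('m \<Rightarrow> real) \<Rightarrow>
    (('m \<Rightarrow> real ^ 'n \<Rightarrow> complex) \<Rightarrow> (real ^ 'n \<Rightarrow> complex) \<Rightarrow> complex) \<Rightarrow>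
    (('m \<Rightarrow> real ^ 'n \<Rightarrow> complex) \<Rightarrow> real ^ 'n \<Rightarrow> complex) \<Rightarrow> bool"
  where "fractional_integral_operator \<alpha> p0 p0' K Ck s T0 T \<longleftrightarrow>
    0 < \<alpha> * p0' \<and> \<alpha> * p0' < dim_mn TYPE('m) TYPE('n) \<and>
    kernel_loc_integrable K \<and> kernel_size \<alpha> K \<and> kernel_smooth \<alpha> p0 p0' Ck K \<and>
    schwartz_operator K T0 \<and>
    (\<forall>j. 1 \<le> s j \<and> s j \<le> p0') \<and> bounded_extension \<alpha> K s T0 T"

definition commutator ::
  "(('m::finite \<Rightarrow> real ^ 'n \<Rightarrow> complex) \<Rightarrow> real ^ 'n \<Rightarrow> complex) \<Rightarrow> ('m \<Rightarrow> real ^ 'n \<Rightarrow> complex) \<Rightarrow>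
    ('m \<Rightarrow> real ^ 'n \<Rightarrow> complex) \<Rightarrow> real ^ 'n \<Rightarrow> complex"
  where "commutator T b f x =
    (\<Sum>i\<in>UNIV. b i x * T f x - T (f(i := \<lambda>y. b i y * f i y)) x)"


subsection \<open>Continuous extension from the dense class\<close>

text \<open>
  \<open>continuous_extension N p w U S\<close>: on the product of the weighted spaces \<open>L^(p j) (w j)\<close>, with
  values measured by the (quasi-)norm \<open>N\<close>, the operator \<open>S\<close> is the continuous extension of the
  restriction of \<open>U\<close> to tuples of bounded measurable functions with compact support.
\<close>

definition continuous_extension ::
  "((real ^ 'n \<Rightarrow> complex) \<Rightarrow> ennreal) \<Rightarrow> ('m::finite \<Rightarrow> real) \<Rightarrow> ('m \<Rightarrow> real ^ 'n \<Rightarrow> real) \<Rightarrow>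
    (('m \<Rightarrow> real ^ 'n \<Rightarrow> complex) \<Rightarrow> real ^ 'n \<Rightarrow> complex) \<Rightarrow>
    (('m \<Rightarrow> real ^ 'n \<Rightarrow> complex) \<Rightarrow> real ^ 'n \<Rightarrow> complex) \<Rightarrow> bool"
  where "continuous_extension N p w U S \<longleftrightarrow>
    (\<forall>f. (\<forall>j. f j \<in> Lp_space (p j) (w j) \<inter> bounded_compact_support) \<longrightarrow>
      (AE x in lebesgue. S f x = U f x)) \<and>
    (\<forall>f. (\<forall>j. f j \<in> Lp_space (p j) (w j)) \<longrightarrow>
      S f \<in> borel_measurable lebesgue \<and>
      (\<forall>F. (\<forall>k j. F k j \<in> Lp_space (p j) (w j)) \<and>
          (\<forall>j. (\<lambda>k. Lp_norm (p j) (w j) (\<lambda>x. F k j x - f j x)) \<longlonglongrightarrow> 0) \<longrightarrow>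
        (\<lambda>k. N (\<lambda>x. S (F k) x - S f x)) \<longlonglongrightarrow> 0))"

end

theory Submission imports Defs begin

text \<open>
  On bounded functions with compact support, \<open>T f\<close> is almost everywhere the integral of the kernel:
  cutting one factor after another to a small cell around \<open>x\<close> leaves a local part, which the weak
  type bound and \<open>\<alpha> > 0\<close> make negligible. By the size condition, the commutator is
  then dominated by the sum over \<open>l\<close> of the integrals of
  \<open>\<bar>b l x - b l (y $ l)\<bar> * rad x y powr (\<alpha> - m n) * (\<Prod>j. \<bar>f j (y $ j)\<bar>)\<close>, where
  \<open>rad x y\<close> is the sum of the distances from \<open>x\<close> to the \<open>y $ j\<close>.

  Since every bounded set lies in a cell of comparable size of one of finitely many shifted dyadic
  grids, this positive operator is a sum over dyadic levels. A factor \<open>\<alpha>\<close> of the decay pays for all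
  levels but sparse ones. On a cell, the John-Nirenberg inequality and Hoelder's inequality replace
  the oscillation of \<open>b\<close> by \<open>L^r\<close> averages of the \<open>f j\<close> with \<open>1 < r < t\<close>. As \<open>r < t\<close>, the weight
  condition with exponents \<open>p j / t\<close> and \<open>q / t\<close> controls these by \<open>L^e\<close> averages of
  \<open>f j * \<omega> j powr (1 / t)\<close> with some \<open>e < p j\<close>, so that the maximal function gives a strong bound,
  even if some \<open>p j\<close> equals \<open>t\<close>. The same bound applied to differences gives the continuous
  extension.
\<close>

subsection \<open>Powers and sums in the extended nonnegative reals\<close>

text \<open>The obstacle is the factor \<open>b x\<close>, which stays outside all averages in
  \<open>y\<close>. It leaves a level sum of terms \<open>a i x * B i x\<close> with
  \<open>a i\<close> constant on cells but \<open>B i\<close>, the distance of \<open>b\<close> to a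
  constant of the cell, unbounded. Its power \<open>q\<close> is integrated against
  \<open>v powr U\<close>, so the John-Nirenberg inequality is needed for this weighted measure too.
  Its proof asks little of a measure: a subset filling half of a cell must carry a fixed fraction of
  its mass, and this the weight condition supplies. With \<open>q \<le> 1\<close> the power moves
  inside the level sum; with \<open>q > 1\<close> duality takes its place, and \<open>B i\<close> is
  averaged against the test function. Sparse levels enter through the parts of cells that later
  levels leave uncovered: they are disjoint and keep a fixed fraction of each cell in both measures.
  The gain \<open>1 / P - 1 / q = \<alpha> / n\<close> shows up as \<open>q > P\<close>: of the
  power \<open>q\<close> of the averages, \<open>q - P\<close> is bounded by norms through Hoelder's
  inequality on one cell, and the rest \<open>P\<close> is the exponent at which the maximal theorem
  sums disjoint parts.\<close>

lemma powe_top [simp]: "top powe a = top"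
  by (simp add: ennreal_powr_def)

lemma powe_ennreal: "0 \<le> x \<Longrightarrow> ennreal x powe a = ennreal (x powr a)"
  by (simp add: ennreal_powr_def)

lemma powe_zero [simp]: "0 powe a = 0"
  by (simp add: ennreal_powr_def)

lemma powe_1_left [simp]: "1 powe a = 1"
  by (simp add: ennreal_powr_def)

lemma powe_1 [simp]: "x powe 1 = x"
  by (cases x) (auto simp: powe_ennreal)

lemma powe_le_iff: "0 < a \<Longrightarrow> x powe a \<le> y powe a \<longleftrightarrow> x \<le> y"
proof (cases x; cases y)
  fix r s assume "0 < a" "x = ennreal r" "0 \<le> r" "y = ennreal s" "0 \<le> s"
  then show ?thesis
    using powr_mono2[of a r s] powr_less_mono2[of a s r] by (force simp: powe_ennreal not_le)
qed (auto simp: powe_ennreal top_unique)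

lemma powe_mono: "0 < a \<Longrightarrow> x \<le> y \<Longrightarrow> x powe a \<le> y powe a"
  by (simp add: powe_le_iff)

lemma powe_eq_0_iff [simp]: "0 < a \<Longrightarrow> x powe a = 0 \<longleftrightarrow> x = 0"
  by (cases x) (auto simp: powe_ennreal)

lemma powe_eq_top_iff [simp]: "x powe a = top \<longleftrightarrow> x = top"
  by (cases x) (auto simp: powe_ennreal)

lemma powe_less_top_iff [simp]: "x powe a < top \<longleftrightarrow> x < top"
  by (simp add: less_top[symmetric])

lemma powe_mult: "0 < a \<Longrightarrow> (x * y) powe a = x powe a * y powe a"
proof -
  assume a: "0 < a"
  consider "x = 0" | "y = 0" | "x \<noteq> 0" "y \<noteq> 0" "x = top \<or> y = top" | r s where "x = ennreal r" "0 \<le> r" "y = ennreal s" "0 \<le> s"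
    by (cases x; cases y) auto
  then show ?thesis
  proof cases
    case 3 then show ?thesis using a by (auto simp: ennreal_mult_top ennreal_top_mult)
  next
    case 4 then show ?thesis using a by (simp add: powe_ennreal ennreal_mult[symmetric] powr_mult)
  qed auto
qed

lemma powe_powe: "(x powe a) powe b = x powe (a * b)"
  by (cases x) (auto simp: powe_ennreal powr_powr)

text \<open>No sign condition on the exponents: at 0 all three powers are 0, since
  \<open>0 powr a = 0\<close> for every \<open>a\<close>, and at \<open>top\<close> all are
  \<open>top\<close>. So a power can be split into exponents such as \<open>a\<close> and
  \<open>1 - a\<close> without cases.\<close>

lemma powe_add: "x powe (a + b) = x powe a * x powe b"
  by (cases x) (auto simp: powe_ennreal powr_add ennreal_mult[symmetric])

lemma powe_prod:
  assumes "0 < a"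
  shows "(\<Prod>i\<in>I. f i) powe a = (\<Prod>i\<in>I. f i powe a)"
  by (induction I rule: infinite_finite_induct) (auto simp: powe_mult assms)

lemma powe_inverse: "0 < a \<Longrightarrow> inverse x powe a = inverse (x powe a)"
proof (cases x)
  case (real r)
  assume "0 < a"
  then show ?thesis using real
    by (cases "r = 0") (auto simp: powe_ennreal inverse_ennreal inverse_powr)
qed auto

lemma measurable_powe [measurable (raw)]:
  assumes [measurable]: "f \<in> borel_measurable M"
  shows "(\<lambda>x. f x powe a) \<in> borel_measurable M"
  unfolding ennreal_powr_def by measurable

lemma powe_SUP:
  assumes "0 < a"
  shows "(SUP i\<in>I. f i) powe a = (SUP i\<in>I. f i powe a)"
proof (rule antisym)
  have "(SUP i\<in>I. f i) \<le> (SUP i\<in>I. f i powe a) powe (1 / a)"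
  proof (rule SUP_least)
    fix i assume "i \<in> I"
    then have "(f i powe a) powe (1 / a) \<le> (SUP i\<in>I. f i powe a) powe (1 / a)"
      using assms by (intro powe_mono SUP_upper) auto
    then show "f i \<le> (SUP i\<in>I. f i powe a) powe (1 / a)" using assms by (simp add: powe_powe)
  qed
  then have "(SUP i\<in>I. f i) powe a \<le> ((SUP i\<in>I. f i powe a) powe (1 / a)) powe a"
    using assms by (intro powe_mono) auto
  then show "(SUP i\<in>I. f i) powe a \<le> (SUP i\<in>I. f i powe a)" using assms by (simp add: powe_powe)
qed (use assms in \<open>auto intro!: SUP_least powe_mono SUP_upper\<close>)

lemma powe_max: "0 < a \<Longrightarrow> max x y powe a = max (x powe a) (y powe a)"
  by (auto simp: max_def powe_le_iff)

lemma powe_add_le: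
  assumes "0 < a"
  shows "(x + y) powe a \<le> ennreal (2 powr a) * (x powe a + y powe a)"
proof -
  have "x + y \<le> ennreal 2 * max x y"
    by (simp add: mult_2 add_mono)
  then have "(x + y) powe a \<le> (ennreal 2 * max x y) powe a"
    using assms by (rule powe_mono[rotated])
  also have "\<dots> = ennreal (2 powr a) * max (x powe a) (y powe a)"
    using assms powe_ennreal[of 2 a] by (simp add: powe_mult powe_max)
  also have "\<dots> \<le> ennreal (2 powr a) * (x powe a + y powe a)"
    by (intro mult_left_mono) (auto simp: max_def)
  finally show ?thesis .
qed

text \<open>The sum is at most \<open>card I\<close> times its largest term. The crude constant
  serves exponents below and above 1 alike.\<close>

lemma powe_sum_le:
  assumes "0 < a" "finite I"
  shows "(\<Sum>i\<in>I. f i) powe a \<le> ennreal (real (card I) powr a) * (\<Sum>i\<in>I. f i powe a)"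
proof (cases "I = {}")
  case False
  define m where "m = Max (f ` I)"
  have "(\<Sum>i\<in>I. f i) \<le> (\<Sum>i\<in>I. m)"
    using assms False by (intro sum_mono) (auto simp: m_def)
  also have "\<dots> = ennreal (real (card I)) * m" by (simp add: ennreal_of_nat_eq_real_of_nat)
  finally have "(\<Sum>i\<in>I. f i) powe a \<le> (ennreal (real (card I)) * m) powe a"
    using assms by (intro powe_mono)
  also have "\<dots> = ennreal (real (card I) powr a) * m powe a"
    using assms by (simp add: powe_mult powe_ennreal)
  also have "m powe a \<le> (\<Sum>i\<in>I. f i powe a)"
  proof -
    have "m \<in> f ` I" using assms False unfolding m_def by (intro Max_in) auto
    then obtain i where "i \<in> I" "m = f i" by auto
    then show ?thesis using assms by (auto intro!: member_le_sum)
  qed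
  finally show ?thesis by (simp add: mult_left_mono)
qed auto

lemma powr_add_le_concave:
  assumes "0 < a" "a \<le> 1" "0 \<le> x" "0 \<le> (y::real)"
  shows "(x + y) powr a \<le> x powr a + y powr a"
proof (cases "x + y = 0")
  case False
  then have p: "x + y > 0" using assms by simp
  have 1: "u \<le> u powr a" if "0 \<le> u" "u \<le> 1" for u
    using powr_mono'[of a 1 u] that assms by (auto)
  have "1 = x / (x + y) + y / (x + y)" using p by (simp add: add_divide_distrib[symmetric])
  also have "\<dots> \<le> (x / (x + y)) powr a + (y / (x + y)) powr a"
    using assms p by (intro add_mono 1) auto
  also have "\<dots> = (x powr a + y powr a) / (x + y) powr a"
    using assms p by (simp add: powr_divide add_divide_distrib)
  finally show ?thesis using p by (simp add: field_simps)
qed (use assms in auto)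

lemma powe_add_le_concave:
  assumes "0 < a" "a \<le> 1"
  shows "(x + y) powe a \<le> x powe a + y powe a"
  using powr_add_le_concave[OF assms]
  by (cases x; cases y) (auto simp: powe_ennreal ennreal_plus[symmetric] ennreal_leI simp del: ennreal_plus)

text \<open>Replaces the triangle inequality in the range \<open>q \<le> 1\<close>; partial sums
  suffice because \<open>powe\<close> commutes with suprema.\<close>

lemma powe_suminf_le_concave:
  assumes "0 < a" "a \<le> 1"
  shows "(\<Sum>i. f i) powe a \<le> (\<Sum>i. f i powe a)"
proof -
  have "(\<Sum>i<k. f i) powe a \<le> (\<Sum>i<k. f i powe a)" for k
    by (induction k) (auto intro: order_trans[OF powe_add_le_concave[OF assms]] add_mono)
  then show ?thesis
    unfolding suminf_eq_SUP powe_SUP[OF assms(1)] by (intro SUP_mono) auto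
qed

section \<open>Hoelder's inequality for two and for finitely many functions\<close>

lemma nn_integral_Holder:
  assumes [measurable]: "f \<in> borel_measurable M" "g \<in> borel_measurable M"
    and a: "0 < a" "a < 1"
  shows "(\<integral>\<^sup>+x. f x powe a * g x powe (1 - a) \<partial>M) \<le> (\<integral>\<^sup>+x. f x \<partial>M) powe a * (\<integral>\<^sup>+x. g x \<partial>M) powe (1 - a)"
    (is "?L \<le> ?I powe a * ?J powe _")
proof -
  consider "?I = 0 \<or> ?J = 0" | "?I \<noteq> 0" "?J \<noteq> 0" "?I = top \<or> ?J = top"
    | "?I \<noteq> 0" "?J \<noteq> 0" "?I \<noteq> top" "?J \<noteq> top" by blast
  then show ?thesis
  proof cases
    case 1
    \<comment> \<open>If one integral vanishes, that function is zero almost everywhere; this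
      includes the case that the other integral is infinite.\<close>
    then have "AE x in M. f x powe a * g x powe (1 - a) = 0"
      using a by (auto simp: nn_integral_0_iff_AE)
    then have "?L = 0" by (subst nn_integral_0_iff_AE) auto
    then show ?thesis by simp
  next
    case 2
    then have "?I powe a * ?J powe (1 - a) = top" using a
      by (auto simp: ennreal_mult_eq_top_iff)
    then show ?thesis by (metis top_greatest)
  next
    case 3
    then obtain I J where IJ: "?I = ennreal I" "?J = ennreal J" "I > 0" "J > 0"
      by (metis ennreal_cases ennreal_0 order_le_less)
    \<comment> \<open>Young's inequality for \<open>u / I\<close> and \<open>v / J\<close>,
      multiplied by \<open>I powr a * J powr (1 - a)\<close>; integrating the bracket gives
      \<open>a + (1 - a) = 1\<close>.\<close>
    have pt: "f x powe a * g x powe (1 - a)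
      \<le> ennreal (I powr a * J powr (1 - a)) * (ennreal (a / I) * f x + ennreal ((1 - a) / J) * g x)" for x
    proof (cases "f x = top \<or> g x = top")
      case True
      then show ?thesis using a IJ by (auto simp: ennreal_mult_top)
    next
      case False
      then obtain u v where uv: "f x = ennreal u" "g x = ennreal v" "0 \<le> u" "0 \<le> v"
        by (metis ennreal_cases)
      have "(u / I) powr a * (v / J) powr (1 - a) \<le> a * (u / I) + (1 - a) * (v / J)"
        using a IJ uv Youngs_inequality_0[of a "1 - a" "u / I" "v / J"] by (cases "u = 0 \<or> v = 0") auto
      then have "u powr a * v powr (1 - a) \<le> (I powr a * J powr (1 - a)) * (a / I * u + (1 - a) / J * v)"
        using IJ uv by (simp add: powr_divide field_simps)
      then show ?thesis using a IJ uv
        by (simp add: powe_ennreal ennreal_mult[symmetric] ennreal_plus[symmetric] ennreal_leI del: ennreal_plus)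
    qed
    have "?L \<le> (\<integral>\<^sup>+x. ennreal (I powr a * J powr (1 - a)) * (ennreal (a / I) * f x + ennreal ((1 - a) / J) * g x) \<partial>M)"
      by (intro nn_integral_mono pt)
    also have "\<dots> = ennreal (I powr a * J powr (1 - a)) * (ennreal (a / I) * ennreal I + ennreal ((1 - a) / J) * ennreal J)"
      by (simp add: nn_integral_cmult nn_integral_add IJ)
    also have "\<dots> = ennreal (I powr a * J powr (1 - a))"
      using a IJ by (simp add: ennreal_mult[symmetric] ennreal_plus[symmetric] del: ennreal_plus)
    also have "\<dots> = ?I powe a * ?J powe (1 - a)"
      using IJ by (simp add: powe_ennreal ennreal_mult)
    finally show ?thesis .
  qed
qed

lemma nn_integral_Holder_prod:
  assumes "finite I" "I \<noteq> {}" and m: "\<And>i. i \<in> I \<Longrightarrow> f i \<in> borel_measurable M"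
    and a: "\<And>i. i \<in> I \<Longrightarrow> 0 < a i" "(\<Sum>i\<in>I. a i) = (1::real)"
  shows "(\<integral>\<^sup>+x. (\<Prod>i\<in>I. f i x powe a i) \<partial>M) \<le> (\<Prod>i\<in>I. (\<integral>\<^sup>+x. f i x \<partial>M) powe a i)"
  using assms
proof (induction I arbitrary: a rule: finite_ne_induct)
  case (singleton x) then show ?case by simp
next
  case (insert l I)
  note [measurable] = insert.prems(1)
  \<comment> \<open>The exponents on \<open>I\<close> are divided by their sum
    \<open>s = 1 - a l\<close>, so that the induction hypothesis applies; the outer power
    \<open>s\<close> in the inequality for two functions restores them.\<close>
  define s where "s = (\<Sum>i\<in>I. a i)"
  have s: "s = 1 - a l" using insert by (simp add: s_def)
  have s0: "0 < s" unfolding s_def using insert by (intro sum_pos) auto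
  have al: "0 < a l" "a l < 1" using insert.prems s s0 by auto
  have IH: "(\<integral>\<^sup>+x. (\<Prod>i\<in>I. f i x powe (a i / s)) \<partial>M) \<le> (\<Prod>i\<in>I. (\<integral>\<^sup>+x. f i x \<partial>M) powe (a i / s))"
    using insert.prems s0 by (intro insert.IH) (auto simp: sum_divide_distrib[symmetric] s_def[symmetric])
  have e: "(\<Prod>i\<in>I. h i powe (a i / s)) powe s = (\<Prod>i\<in>I. h i powe (a i))" for h
    using s0 by (simp add: powe_prod powe_powe)
  have "(\<integral>\<^sup>+x. (\<Prod>i\<in>insert l I. f i x powe a i) \<partial>M) =
    (\<integral>\<^sup>+x. f l x powe a l * (\<Prod>i\<in>I. f i x powe (a i / s)) powe (1 - a l) \<partial>M)"
    using insert.hyps s by (simp add: e[unfolded s])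
  also have "\<dots> \<le> (\<integral>\<^sup>+x. f l x \<partial>M) powe a l * (\<integral>\<^sup>+x. (\<Prod>i\<in>I. f i x powe (a i / s)) \<partial>M) powe (1 - a l)"
    using al by (intro nn_integral_Holder borel_measurable_prod_ennreal) auto
  also have "\<dots> \<le> (\<integral>\<^sup>+x. f l x \<partial>M) powe a l * (\<Prod>i\<in>I. (\<integral>\<^sup>+x. f i x \<partial>M) powe (a i / s)) powe (1 - a l)"
    using al by (intro mult_left_mono powe_mono IH) auto
  also have "\<dots> = (\<Prod>i\<in>insert l I. (\<integral>\<^sup>+x. f i x \<partial>M) powe a i)"
    using insert.hyps by (simp add: e[unfolded s] s)
  finally show ?case .
qed

section \<open>Double series, division, and sums over dyadic levels\<close>

lemma ennreal_suminf_triangle_swap: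
  fixes f :: "nat \<Rightarrow> nat \<Rightarrow> ennreal"
  shows "(\<Sum>i. \<Sum>j. f i j) = (\<Sum>j. \<Sum>i. f i j)"
  unfolding nn_integral_count_space_nat[symmetric]
  by (rule nn_integral_count_space_nn_integral) auto

lemma ennreal_divide_mult_self:
  fixes a b :: ennreal
  assumes "b \<noteq> 0" "b \<noteq> top"
  shows "a / b * b = a"
  unfolding ennreal_divide_times using assms by (simp add: less_top)

lemma ennreal_divide_mult_le: "a / b * b \<le> (a::ennreal)"
  using ennreal_divide_mult_self[of b a] by (cases "b = 0 \<or> b = top") auto

text \<open>A discrete layer-cake formula. One term suffices: the \<open>k\<close> with
  \<open>2 powr (k + 1) < u \<le> 2 powr (k + 2)\<close>. Writing the sum as an integral for
  counting measure lets it be exchanged with an integral over any measure.\<close>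

lemma powe_le_dyadic_sum:
  assumes "0 < s"
  shows "u powe s \<le> (\<integral>\<^sup>+k. ennreal (2 powr ((real_of_int k + 2) * s))
    * indicator {k. ennreal (2 * 2 powr real_of_int k) < u} k \<partial>count_space (UNIV::int set))" (is "_ \<le> ?R")
proof -
  have ge: "ennreal (2 powr ((real_of_int k + 2) * s)) \<le> ?R" if "ennreal (2 * 2 powr real_of_int k) < u" for k
    using that nn_integral_ge_point[of k UNIV "\<lambda>k. ennreal (2 powr ((real_of_int k + 2) * s))
    * indicator {k. ennreal (2 * 2 powr real_of_int k) < u} k"] by simp
  show ?thesis
  proof (cases u)
    case (real r)
    show ?thesis
    proof (cases "r = 0")
      case False
      then have r: "0 < r" using real by simp
      \<comment> \<open>The ceiling makes the lower bound strict, as the level sets are defined by a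
        strict inequality.\<close>
      define k where "k = \<lceil>log 2 r\<rceil> - 2"
      have k: "real_of_int k + 1 < log 2 r" "log 2 r \<le> real_of_int k + 2"
        unfolding k_def by linarith+
      have "2 powr (real_of_int k + 1) < r" using k(1) r by (simp add: less_log_iff)
      then have "ennreal (2 * 2 powr real_of_int k) < u"
        using real by (simp add: powr_add ennreal_less_iff mult.commute)
      then have "ennreal (2 powr ((real_of_int k + 2) * s)) \<le> ?R" by (rule ge)
      moreover have "r powr s \<le> 2 powr ((real_of_int k + 2) * s)"
      proof -
        have "r \<le> 2 powr (real_of_int k + 2)" using k(2) r by (simp add: log_le_iff)
        then have "r powr s \<le> (2 powr (real_of_int k + 2)) powr s" using r assms by (intro powr_mono2) auto
        then show ?thesis by (simp add: powr_powr)
      qed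
      ultimately have "ennreal (r powr s) \<le> ?R" by (meson ennreal_leI order_trans)
      then show ?thesis using real by (simp only: powe_ennreal)
    qed (use real assms in simp)
  next
    case top
    \<comment> \<open>For \<open>u = top\<close> all levels are present, and already the single
      terms are unbounded.\<close>
    have "of_nat n \<le> ?R" for n
    proof -
      obtain k :: nat where "real n \<le> (2 powr s) ^ k"
        using real_arch_pow[of "2 powr s" "real n"] assms by (auto intro: less_imp_le)
      also have "\<dots> = 2 powr (s * real k)" by (simp add: powr_powr[symmetric] powr_realpow)
      also have "\<dots> \<le> 2 powr ((real_of_int (int k) + 2) * s)"
        using assms by (intro powr_mono) (auto simp: algebra_simps)
      finally have "ennreal (real n) \<le> ennreal (2 powr ((real_of_int (int k) + 2) * s))" by (rule ennreal_leI)
      also have "\<dots> \<le> ?R" using top by (intro ge) auto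
      finally show ?thesis by (simp add: ennreal_of_nat_eq_real_of_nat)
    qed
    have "?R = top"
    proof (rule ccontr)
      assume "?R \<noteq> top"
      then obtain r where r: "?R = ennreal r" "0 \<le> r" by (cases ?R) auto
      obtain n where "r < real n" using reals_Archimedean2 by blast
      then show False
        using \<open>of_nat n \<le> ?R\<close> r(2) unfolding r(1) by (auto simp: ennreal_of_nat_eq_real_of_nat ennreal_le_iff2)
    qed
    then show ?thesis by simp
  qed
qed

text \<open>Summed downwards from the largest admissible level, this is a geometric series of ratio
  \<open>2 powr (- b)\<close>.\<close>

lemma geometric_sum_below:
  assumes "0 < b"
  shows "(\<integral>\<^sup>+k. ennreal (2 powr (b * real_of_int k)) * indicator {k. ennreal (2 powr real_of_int k) < u} k
      \<partial>count_space (UNIV::int set)) \<le> ennreal (1 / (1 - 2 powr (- b))) * u powe b" (is "?L \<le> _")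
proof -
  have q: "0 < (2::real) powr (- b)" "(2::real) powr (- b) < 1"
    using assms powr_less_mono[of "- b" 0 2] by auto
  show ?thesis
  proof (cases u)
    case (real r)
    show ?thesis
    proof (cases "r = 0")
      case False
      then have r: "0 < r" using real by simp
      define K where "K = \<lceil>log 2 r\<rceil> - 1"
      have "ennreal (2 powr real_of_int k) < u \<longleftrightarrow> k \<le> K" for k
      proof -
        have "ennreal (2 powr real_of_int k) < u \<longleftrightarrow> real_of_int k < log 2 r"
          using real r by (simp add: ennreal_less_iff less_log_iff)
        also have "\<dots> \<longleftrightarrow> k \<le> K" unfolding K_def by linarith
        finally show ?thesis .
      qed
      then have "?L = (\<integral>\<^sup>+k\<in>{..K}. ennreal (2 powr (b * real_of_int k)) \<partial>count_space UNIV)"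
        by (intro nn_integral_cong) (auto simp: indicator_def)
      also have "\<dots> = (\<integral>\<^sup>+k. ennreal (2 powr (b * real_of_int k)) \<partial>count_space {..K})"
        by (rule nn_integral_count_space_indicator[symmetric]) simp
      also have "\<dots> = (\<integral>\<^sup>+i. ennreal (2 powr (b * real_of_int (K - int i))) \<partial>count_space UNIV)"
        by (rule nn_integral_bij_count_space[symmetric])
          (auto simp: bij_betw_def inj_on_def image_def intro!: exI[of _ "nat (K - _)"])
      also have "\<dots> = (\<Sum>i. ennreal (2 powr (b * real_of_int K) * (2 powr (- b)) ^ i))"
        unfolding nn_integral_count_space_nat
      proof (intro suminf_cong arg_cong[where f=ennreal])
        fix i :: nat
        have "(2 powr (- b)) ^ i = 2 powr (- b * real i)"
          by (subst powr_realpow[symmetric]) (auto simp: powr_powr)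
        then show "2 powr (b * real_of_int (K - int i)) = 2 powr (b * real_of_int K) * (2 powr (- b)) ^ i"
          by (simp add: powr_add[symmetric] algebra_simps)
      qed
      also have "\<dots> = ennreal (2 powr (b * real_of_int K) * (1 / (1 - 2 powr (- b))))"
        using q by (intro suminf_ennreal_eq sums_mult geometric_sums) auto
      also have "\<dots> \<le> ennreal (r powr b * (1 / (1 - 2 powr (- b))))"
      proof (intro ennreal_leI mult_right_mono)
        have "real_of_int K < log 2 r" unfolding K_def by linarith
        then have "2 powr real_of_int K \<le> r" using r by (simp add: less_log_iff)
        then have "(2 powr real_of_int K) powr b \<le> r powr b" using assms by (intro powr_mono2) auto
        then show "2 powr (b * real_of_int K) \<le> r powr b" by (simp add: powr_powr mult.commute)
      qed (use q in auto)
      finally show ?thesis using real q by (simp add: powe_ennreal ennreal_mult[symmetric] mult.commute)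
    qed (use real in simp)
  next
    case top
    then show ?thesis using q assms by (simp add: ennreal_mult_top)
  qed
qed

subsection \<open>Dyadic grids and the maximal function\<close>

text \<open>\<open>c i x\<close> labels the cell of generation \<open>i\<close> that contains
  \<open>x\<close>; labels in \<open>nat\<close> make every generation countable. Generation 0 is
  the coarsest, with side \<open>h\<close>, so that a search for the first cell with some property
  has a place to start; large scales are reached later by letting \<open>h\<close> grow. A cell only
  has to lie in a cube of its own volume, since half-open boxes are not cubes in the sense of
  \<open>cube\<close>.\<close>

locale dyadic =
  fixes c :: "nat \<Rightarrow> real ^ 'n \<Rightarrow> nat" and h :: real
  assumes h_pos: "0 < h"
    and nested_Suc: "c (Suc i) x = c (Suc i) y \<Longrightarrow> c i x = c i y"
    and cell_borel: "{x. c i x = z} \<in> sets borel"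
    and cell_subset_cube: "\<exists>w. {y. c i y = c i x} \<subseteq> cube w (h / 2 ^ i)"
    and emeasure_cell: "emeasure lebesgue {y. c i y = c i x} = ennreal ((h / 2 ^ i) ^ CARD('n))"
begin

definition side :: "nat \<Rightarrow> real"
  where "side i = h / 2 ^ i"

definition vol :: "nat \<Rightarrow> real"
  where "vol i = side i ^ CARD('n)"

definition cell :: "nat \<Rightarrow> real ^ 'n \<Rightarrow> (real ^ 'n) set"
  where "cell i x = {y. c i y = c i x}"

definition cellwise :: "nat \<Rightarrow> (real ^ 'n \<Rightarrow> 'b) \<Rightarrow> bool"
  where "cellwise i \<phi> \<longleftrightarrow> (\<forall>x y. c i x = c i y \<longrightarrow> \<phi> x = \<phi> y)"

text \<open>The average is 0 both on null cells, where the integral vanishes too, and on cells of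
  infinite measure.\<close>

definition cavg :: "(real ^ 'n) measure \<Rightarrow> nat \<Rightarrow> (real ^ 'n \<Rightarrow> ennreal) \<Rightarrow> real ^ 'n \<Rightarrow> ennreal"
  where "cavg M i g x = (\<integral>\<^sup>+y\<in>cell i x. g y \<partial>M) / emeasure M (cell i x)"

lemma side_pos: "0 < side i"
  using h_pos by (simp add: side_def)

lemma vol_pos: "0 < vol i"
  using side_pos by (simp add: vol_def)

lemma lebesgue_cell: "emeasure lebesgue (cell i x) = ennreal (vol i)"
  using emeasure_cell by (simp add: cell_def vol_def side_def)

lemma nested: "i \<le> j \<Longrightarrow> c j x = c j y \<Longrightarrow> c i x = c i y"
  by (induction j rule: dec_induct) (auto dest: nested_Suc)

lemma cell_self [simp]: "x \<in> cell i x"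
  by (simp add: cell_def)

lemma cell_eq: "y \<in> cell i x \<Longrightarrow> cell i y = cell i x"
  by (auto simp: cell_def)

lemma cell_mono: "i \<le> j \<Longrightarrow> cell j x \<subseteq> cell i x"
  by (auto simp: cell_def dest: nested)

lemma cellwiseD: "cellwise i \<phi> \<Longrightarrow> y \<in> cell i x \<Longrightarrow> \<phi> y = \<phi> x"
  unfolding cellwise_def cell_def by blast

lemma cellwise_factor:
  assumes "cellwise i \<phi>"
  obtains \<psi> where "\<phi> = (\<lambda>x. \<psi> (c i x))"
proof
  show "\<phi> = (\<lambda>x. (\<lambda>z. \<phi> (SOME y. c i y = z)) (c i x))"
  proof
    fix x
    have "c i (SOME y. c i y = c i x) = c i x" by (rule someI) simp
    then show "\<phi> x = (\<lambda>z. \<phi> (SOME y. c i y = z)) (c i x)"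
      using assms unfolding cellwise_def by metis
  qed
qed

lemma cellwise_cavg [simp]: "cellwise i (cavg M i g)"
  by (simp add: cellwise_def cavg_def cell_def)

lemma cellwise_cell [simp]: "cellwise i (cell i)"
  by (simp add: cellwise_def cell_def)

lemma cell_lebesgue: "{x. c i x = z} \<in> sets lebesgue"
  using cell_borel[of i z] by simp

lemma cell_sets [measurable, simp]: "cell i x \<in> sets lebesgue"
  unfolding cell_def by (rule cell_lebesgue)

lemma c_measurable:
  assumes "sets M = sets lebesgue"
  shows "c i \<in> M \<rightarrow>\<^sub>M count_space UNIV"
proof (rule measurable_count_space_eq_countable[THEN iffD2])
  have s: "space M = UNIV" using sets_eq_imp_space_eq[OF assms] by simp
  have "c i -` {z} \<inter> space M = {x. c i x = z}" for z by (auto simp: s)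
  then show "c i \<in> space M \<rightarrow> UNIV \<and> (\<forall>a\<in>UNIV. c i -` {a} \<inter> space M \<in> sets M)"
    using cell_lebesgue assms by auto
qed auto

lemma cellwise_measurable:
  assumes "sets M = sets lebesgue" "cellwise i \<phi>" "\<And>x. \<phi> x \<in> space N"
  shows "\<phi> \<in> M \<rightarrow>\<^sub>M N"
proof -
  define \<psi> where "\<psi> z = \<phi> (SOME y. c i y = z)" for z
  have \<phi>: "\<phi> = \<psi> \<circ> c i"
  proof
    fix x
    have "c i (SOME y. c i y = c i x) = c i x" by (rule someI) simp
    then show "\<phi> x = (\<psi> \<circ> c i) x"
      using assms(2) unfolding cellwise_def \<psi>_def comp_def by metis
  qed
  have "\<psi> \<in> count_space UNIV \<rightarrow>\<^sub>M N"
    using assms(3) by (auto simp: \<psi>_def)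
  then show ?thesis
    unfolding \<phi> by (rule measurable_comp[OF c_measurable[OF assms(1)]])
qed

lemma borel_measurable_cellwise:
  fixes \<phi> :: "real ^ 'n \<Rightarrow> 'b::topological_space"
  assumes "sets M = sets lebesgue" "cellwise i \<phi>"
  shows "\<phi> \<in> borel_measurable M"
  by (rule cellwise_measurable[OF assms]) simp

lemma cellwise_sets:
  assumes "sets M = sets lebesgue" "cellwise i (\<lambda>x. x \<in> D)"
  shows "D \<in> sets M"
proof -
  have "(\<lambda>x. x \<in> D) \<in> M \<rightarrow>\<^sub>M count_space UNIV"
    by (rule cellwise_measurable[OF assms]) simp
  then have "(\<lambda>x. x \<in> D) -` {True} \<inter> space M \<in> sets M" by (rule measurable_sets) simp
  moreover have "(\<lambda>x. x \<in> D) -` {True} \<inter> space M = D"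
    using sets_eq_imp_space_eq[OF assms(1)] by auto
  ultimately show ?thesis by simp
qed

lemma cavg_measurable [measurable]:
  assumes "sets M = sets lebesgue"
  shows "cavg N i g \<in> borel_measurable M"
  by (rule borel_measurable_cellwise[OF assms cellwise_cavg])

lemma cavg_mono: "(\<And>y. g y \<le> g' y) \<Longrightarrow> cavg M i g x \<le> cavg M i g' x"
  unfolding cavg_def by (intro divide_right_mono_ennreal nn_integral_mono mult_right_mono) auto

section \<open>Integrals decomposed over the cells of one generation\<close>

context
  fixes M :: "(real ^ 'n) measure"
  assumes sets_M [simp, measurable_cong]: "sets M = sets lebesgue"
begin

lemma space_M [simp]: "space M = UNIV"
  using sets_eq_imp_space_eq[OF sets_M] by simp

lemma nn_integral_cells:
  assumes [measurable]: "g \<in> borel_measurable M"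
  shows "(\<integral>\<^sup>+x. g x \<partial>M) = (\<Sum>z. \<integral>\<^sup>+x. g x * indicator {x. c i x = z} x \<partial>M)"
proof -
  have [measurable]: "{x. c i x = z} \<in> sets M" for z using cell_lebesgue by simp
  have "(\<Sum>z. g x * indicator {x. c i x = z} x) = g x" for x
  proof -
    have "disjoint_family (\<lambda>z. {x. c i x = z})"
      by (auto simp: disjoint_family_on_def)
    then have "(\<Sum>z. indicator {x. c i x = z} x :: ennreal) = indicator (\<Union>z. {x. c i x = z}) x"
      by (rule suminf_indicator)
    also have "\<dots> = 1" by simp
    finally show ?thesis by simp
  qed
  then show ?thesis by (subst nn_integral_suminf[symmetric]) auto
qed

lemma cavg_mult_le: "cavg M i g x * emeasure M (cell i x) \<le> (\<integral>\<^sup>+y\<in>cell i x. g y \<partial>M)"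
  unfolding cavg_def by (rule ennreal_divide_mult_le)

lemma cavg_mult_eq:
  assumes "g \<in> borel_measurable M" "emeasure M (cell i x) < top"
  shows "cavg M i g x * emeasure M (cell i x) = (\<integral>\<^sup>+y\<in>cell i x. g y \<partial>M)"
proof (cases "emeasure M (cell i x) = 0")
  case True
  then have "AE y in M. y \<notin> cell i x" by (intro AE_not_in) (auto simp: null_sets_def)
  then have "(\<integral>\<^sup>+y\<in>cell i x. g y \<partial>M) = (\<integral>\<^sup>+y. 0 \<partial>M)"
    by (intro nn_integral_cong_AE) (auto elim!: eventually_mono)
  then show ?thesis using True by simp
next
  case False
  then show ?thesis using assms(2)
    unfolding cavg_def by (intro ennreal_divide_mult_self) auto
qed

lemma nn_integral_cellwise_cells:
  assumes [measurable]: "g \<in> borel_measurable M" and \<phi>: "\<phi> = (\<lambda>x. \<psi> (c i x))"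
  shows "(\<integral>\<^sup>+x. \<phi> x * g x \<partial>M) = (\<Sum>z. \<psi> z * (\<integral>\<^sup>+x. g x * indicator {x. c i x = z} x \<partial>M))"
proof -
  have [measurable]: "\<phi> \<in> borel_measurable M"
    by (rule borel_measurable_cellwise[where i=i]) (auto simp: \<phi> cellwise_def)
  have [measurable]: "{x. c i x = z} \<in> sets M" for z using cell_lebesgue by simp
  have "(\<integral>\<^sup>+x. \<phi> x * g x \<partial>M) = (\<Sum>z. \<integral>\<^sup>+x. \<phi> x * g x * indicator {x. c i x = z} x \<partial>M)"
    by (rule nn_integral_cells) measurable
  also have "\<dots> = (\<Sum>z. \<integral>\<^sup>+x. \<psi> z * (g x * indicator {x. c i x = z} x) \<partial>M)"
    by (intro suminf_cong nn_integral_cong) (auto simp: \<phi> indicator_def)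
  also have "\<dots> = (\<Sum>z. \<psi> z * (\<integral>\<^sup>+x. g x * indicator {x. c i x = z} x \<partial>M))"
    by (intro suminf_cong nn_integral_cmult) measurable
  finally show ?thesis .
qed

text \<open>How estimates on single cells become global: a cellwise factor is constant on each cell,
  leaves the integral there, and the cells of one generation are summed. Only cells where the factor
  is nonzero have to be checked.\<close>

lemma nn_integral_cellwise_mono:
  assumes "cellwise i \<phi>" and [measurable]: "g \<in> borel_measurable M" "g' \<in> borel_measurable M"
    and le: "\<And>x. \<phi> x \<noteq> 0 \<Longrightarrow> (\<integral>\<^sup>+y\<in>cell i x. g y \<partial>M) \<le> (\<integral>\<^sup>+y\<in>cell i x. g' y \<partial>M)"
  shows "(\<integral>\<^sup>+x. \<phi> x * g x \<partial>M) \<le> (\<integral>\<^sup>+x. \<phi> x * g' x \<partial>M)"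
proof -
  obtain \<psi> where \<psi>: "\<phi> = (\<lambda>x. \<psi> (c i x))" using cellwise_factor[OF assms(1)] .
  have "\<psi> z * (\<integral>\<^sup>+x. g x * indicator {x. c i x = z} x \<partial>M) \<le> \<psi> z * (\<integral>\<^sup>+x. g' x * indicator {x. c i x = z} x \<partial>M)" for z
  \<comment> \<open>A label that no point carries has an empty cell.\<close>
  proof (cases "z \<in> range (c i) \<and> \<psi> z \<noteq> 0")
    case True
    then obtain x where "z = c i x" by auto
    with True show ?thesis using le[of x] by (auto simp: cell_def \<psi> intro: mult_left_mono)
  next
    case False
    then have "\<psi> z = 0 \<or> {x. c i x = z} = {}" by auto
    then show ?thesis by auto
  qed
  then show ?thesis
    unfolding nn_integral_cellwise_cells[OF assms(2) \<psi>] nn_integral_cellwise_cells[OF assms(3) \<psi>]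
    by (intro suminf_le) auto
qed

text \<open>On each cell the average integrates to at most the integral of \<open>g\<close>. For the
  reverse inequality below the cells must have finite measure, as the average over an infinite cell
  is 0.\<close>

lemma nn_integral_cavg_le:
  assumes "cellwise i \<phi>" and [measurable]: "g \<in> borel_measurable M"
  shows "(\<integral>\<^sup>+x. \<phi> x * cavg M i g x \<partial>M) \<le> (\<integral>\<^sup>+x. \<phi> x * g x \<partial>M)"
proof (rule nn_integral_cellwise_mono[OF assms(1)])
  fix x
  have "(\<integral>\<^sup>+y\<in>cell i x. cavg M i g y \<partial>M) = (\<integral>\<^sup>+y\<in>cell i x. cavg M i g x \<partial>M)"
    by (intro nn_integral_cong) (auto simp: indicator_def cavg_def dest: cell_eq)
  also have "\<dots> \<le> (\<integral>\<^sup>+y\<in>cell i x. g y \<partial>M)"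
    by (subst nn_integral_cmult_indicator) (auto simp: cavg_mult_le)
  finally show "(\<integral>\<^sup>+y\<in>cell i x. cavg M i g y \<partial>M) \<le> (\<integral>\<^sup>+y\<in>cell i x. g y \<partial>M)" .
qed (auto simp: cavg_measurable)

lemma nn_integral_le_cavg:
  assumes "cellwise i \<phi>" and [measurable]: "g \<in> borel_measurable M"
    and fin: "\<And>x. emeasure M (cell i x) < top"
  shows "(\<integral>\<^sup>+x. \<phi> x * g x \<partial>M) \<le> (\<integral>\<^sup>+x. \<phi> x * cavg M i g x \<partial>M)"
proof (rule nn_integral_cellwise_mono[OF assms(1)])
  fix x
  have "(\<integral>\<^sup>+y\<in>cell i x. cavg M i g y \<partial>M) = (\<integral>\<^sup>+y\<in>cell i x. cavg M i g x \<partial>M)"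
    by (intro nn_integral_cong) (auto simp: indicator_def cavg_def dest: cell_eq)
  also have "\<dots> = (\<integral>\<^sup>+y\<in>cell i x. g y \<partial>M)"
    by (subst nn_integral_cmult_indicator) (auto simp: cavg_mult_eq fin)
  finally show "(\<integral>\<^sup>+y\<in>cell i x. g y \<partial>M) \<le> (\<integral>\<^sup>+y\<in>cell i x. cavg M i g y \<partial>M)" by simp
qed (auto simp: cavg_measurable)

text \<open>Each point is assigned to the first generation from \<open>j\<close> on at which the
  average exceeds \<open>l\<close>. The resulting sets are disjoint and consist of whole cells, so
  the average may be replaced by \<open>g\<close> on them; the constant is 1 for every
  measure.\<close>

lemma weak_type_cavg:
  assumes [measurable]: "g \<in> borel_measurable M" and D: "cellwise j (\<lambda>x. x \<in> D)"
  shows "l * emeasure M {x\<in>D. \<exists>i\<ge>j. l < cavg M i g x} \<le> (\<integral>\<^sup>+x\<in>D. g x \<partial>M)"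
proof -
  define S where "S i = {x\<in>D. j \<le> i \<and> l < cavg M i g x \<and> (\<forall>i'\<in>{j..<i}. \<not> l < cavg M i' g x)}" for i
  \<comment> \<open>Membership in \<open>S i\<close> depends on \<open>D\<close> and on averages of
    generations up to \<open>i\<close>, all of which are constant on cells of generation
    \<open>i\<close>.\<close>
  have cw: "cellwise i (\<lambda>x. x \<in> S i)" for i
    unfolding cellwise_def
  proof (intro allI impI)
    fix x y assume e: "c i x = c i y"
    have "i' \<le> i \<Longrightarrow> cavg M i' g x = cavg M i' g y" for i'
      using nested[OF _ e] cellwise_cavg[of i'] unfolding cellwise_def by blast
    moreover have "j \<le> i \<Longrightarrow> x \<in> D \<longleftrightarrow> y \<in> D"
      using nested[OF _ e] D unfolding cellwise_def by blast
    ultimately show "x \<in> S i \<longleftrightarrow> y \<in> S i" by (auto simp: S_def)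
  qed
  have cwi: "cellwise i (indicator (S i) :: _ \<Rightarrow> ennreal)" for i
    unfolding cellwise_def
  proof (intro allI impI)
    fix x y assume "c i x = c i y"
    then have "x \<in> S i \<longleftrightarrow> y \<in> S i" using cw unfolding cellwise_def by blast
    then show "(indicator (S i) x :: ennreal) = indicator (S i) y" by (simp add: indicator_def)
  qed
  have [measurable]: "D \<in> sets M" "S i \<in> sets M" for i
    using cellwise_sets[OF sets_M D] cellwise_sets[OF sets_M cw] by auto
  have Sm: "S i \<in> sets lebesgue" for i
    using cellwise_sets[OF refl cw] .
  have U: "{x\<in>D. \<exists>i\<ge>j. l < cavg M i g x} = (\<Union>i. S i)"
  proof safe
    fix x i assume "x \<in> D" "j \<le> i" "l < cavg M i g x"
    define i0 where "i0 = (LEAST i. j \<le> i \<and> l < cavg M i g x)"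
    have "j \<le> i0 \<and> l < cavg M i0 g x" unfolding i0_def
      using \<open>j \<le> i\<close> \<open>l < cavg M i g x\<close> by (intro LeastI) auto
    moreover have "\<forall>i'\<in>{j..<i0}. \<not> l < cavg M i' g x"
      unfolding i0_def by (auto dest!: not_less_Least)
    ultimately show "x \<in> (\<Union>i. S i)" using \<open>x \<in> D\<close> by (auto simp: S_def)
  qed (auto simp: S_def)
  have disj: "disjoint_family S"
    unfolding disjoint_family_on_def
  proof (intro ballI impI)
    fix a b :: nat assume "a \<noteq> b"
    then show "S a \<inter> S b = {}"
      by (cases a b rule: linorder_cases) (auto simp: S_def)
  qed
  have "l * emeasure M (\<Union>i. S i) = (\<Sum>i. l * emeasure M (S i))"
    using disj by (subst suminf_emeasure[symmetric]) (auto simp: image_subset_iff Sm)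
  also have "\<dots> \<le> (\<Sum>i. \<integral>\<^sup>+x. indicator (S i) x * g x \<partial>M)"
  proof (intro suminf_le)
    fix i
    have "l * emeasure M (S i) = (\<integral>\<^sup>+x. l * indicator (S i) x \<partial>M)"
      by (subst nn_integral_cmult_indicator) (auto simp: Sm)
    also have "\<dots> \<le> (\<integral>\<^sup>+x. indicator (S i) x * cavg M i g x \<partial>M)"
      by (intro nn_integral_mono) (auto simp: S_def indicator_def)
    also have "\<dots> \<le> (\<integral>\<^sup>+x. indicator (S i) x * g x \<partial>M)"
      by (rule nn_integral_cavg_le[OF cwi]) simp
    finally show "l * emeasure M (S i) \<le> (\<integral>\<^sup>+x. indicator (S i) x * g x \<partial>M)" .
  qed auto
  also have "\<dots> = (\<integral>\<^sup>+x. (\<Sum>i. indicator (S i) x) * g x \<partial>M)"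
    by (subst nn_integral_suminf[symmetric]) auto
  also have "\<dots> \<le> (\<integral>\<^sup>+x\<in>D. g x \<partial>M)"
  proof (intro nn_integral_mono)
    fix x
    have "(\<Sum>i. indicator (S i) x) = (indicator (\<Union>i. S i) x :: ennreal)"
      by (rule suminf_indicator[OF disj])
    also have "\<dots> \<le> indicator D x" by (auto simp: indicator_def S_def)
    finally show "(\<Sum>i. indicator (S i) x) * g x \<le> g x * indicator D x"
      by (metis mult.commute mult_right_mono zero_le)
  qed
  finally show ?thesis unfolding U .
qed


section \<open>The dyadic maximal function of an arbitrary measure\<close>

definition cmax :: "(real ^ 'n \<Rightarrow> ennreal) \<Rightarrow> real ^ 'n \<Rightarrow> ennreal"
  where "cmax g x = (SUP i. cavg M i g x)"

lemma cmax_measurable [measurable]: "cmax g \<in> borel_measurable M"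
  unfolding cmax_def[abs_def] by (intro borel_measurable_SUP cavg_measurable) auto

lemma cavg_const_le: "cavg M i (\<lambda>_. l) x \<le> l"
proof -
  have "cavg M i (\<lambda>_. l) x = l * emeasure M (cell i x) / emeasure M (cell i x)"
    unfolding cavg_def by (subst nn_integral_cmult_indicator) auto
  then show ?thesis
    using ennreal_mult_divide_eq[of "emeasure M (cell i x)" l]
    by (cases "emeasure M (cell i x) = 0 \<or> emeasure M (cell i x) = top") auto
qed

lemma cavg_add:
  assumes [measurable]: "f \<in> borel_measurable M" "g \<in> borel_measurable M"
  shows "cavg M i (\<lambda>x. f x + g x) x = cavg M i f x + cavg M i g x"
  unfolding cavg_def by (subst add_divide_distrib_ennreal[symmetric], subst nn_integral_add[symmetric])
    (auto simp: distrib_right)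

lemma cmax_weak_type_truncated:
  assumes [measurable]: "g \<in> borel_measurable M"
  shows "l * emeasure M {x. 2 * l < cmax g x} \<le> (\<integral>\<^sup>+x. g x * indicator {x. l < g x} x \<partial>M)"
proof -
  let ?g = "\<lambda>x. g x * indicator {x. l < g x} x"
  have "{x. 2 * l < cmax g x} \<subseteq> {x\<in>UNIV. \<exists>i\<ge>0. l < cavg M i ?g x}"
  proof safe
    fix x assume "2 * l < cmax g x"
    then obtain i where i: "2 * l < cavg M i g x" unfolding cmax_def less_SUP_iff by auto
    \<comment> \<open>The part of \<open>g\<close> below \<open>l\<close> contributes at most
      \<open>l\<close> to any average, so half of the level \<open>2 * l\<close> must come from the
      part above.\<close>
    have "cavg M i g x \<le> cavg M i (\<lambda>x. l + ?g x) x"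
      by (intro cavg_mono) (auto simp: indicator_def not_less)
    also have "\<dots> \<le> l + cavg M i ?g x"
      by (subst cavg_add) (auto intro!: add_mono cavg_const_le)
    finally have "l + l < l + cavg M i ?g x" using i[unfolded mult_2] by (meson less_le_trans)
    then have "l < cavg M i ?g x" by (meson add_left_mono leD not_le)
    then show "\<exists>i\<ge>0. l < cavg M i ?g x" by auto
  qed simp
  then have "l * emeasure M {x. 2 * l < cmax g x} \<le> l * emeasure M {x\<in>UNIV. \<exists>i\<ge>0. l < cavg M i ?g x}"
  proof (intro mult_left_mono emeasure_mono)
    have "{x \<in> space M. \<exists>i\<in>{0..}. l < cavg M i ?g x} \<in> sets M" by measurable
    then show "{x\<in>UNIV. \<exists>i\<ge>0. l < cavg M i ?g x} \<in> sets M" by (simp del: sets_M)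
  qed auto
  also have "\<dots> \<le> (\<integral>\<^sup>+x\<in>UNIV. ?g x \<partial>M)"
    by (rule weak_type_cavg) (auto simp: cellwise_def)
  finally show ?thesis by simp
qed

text \<open>Marcinkiewicz interpolation in dyadic form, from the truncated weak type bound at all
  levels \<open>2 powr k\<close>. As the constant does not depend on the measure, the theorem serves
  Lebesgue measure and weighted measures alike.\<close>

theorem cmax_strong_type:
  assumes [measurable]: "g \<in> borel_measurable M" and s: "1 < s"
  shows "(\<integral>\<^sup>+x. cmax g x powe s \<partial>M)
    \<le> ennreal (2 powr (2 * s) / (1 - 2 powr (1 - s))) * (\<integral>\<^sup>+x. g x powe s \<partial>M)"
proof -
  let ?C = "count_space (UNIV::int set)"
  define e where "e k = ennreal (2 powr real_of_int k)" for k
  define w where "w k = ennreal (2 powr ((real_of_int k + 2) * s))" for k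
  have "(\<integral>\<^sup>+x. cmax g x powe s \<partial>M) \<le> (\<integral>\<^sup>+x. (\<integral>\<^sup>+k. w k * indicator {x. 2 * e k < cmax g x} x \<partial>?C) \<partial>M)"
  proof (rule nn_integral_mono)
    fix x
    have "cmax g x powe s \<le> (\<integral>\<^sup>+k. w k * indicator {k. ennreal (2 * 2 powr real_of_int k) < cmax g x} k \<partial>?C)"
      unfolding w_def using s by (intro powe_le_dyadic_sum) auto
    then show "cmax g x powe s \<le> (\<integral>\<^sup>+k. w k * indicator {x. 2 * e k < cmax g x} x \<partial>?C)"
      by (simp add: e_def indicator_def ennreal_mult)
  qed
  also have "\<dots> = (\<integral>\<^sup>+k. (\<integral>\<^sup>+x. w k * indicator {x. 2 * e k < cmax g x} x \<partial>M) \<partial>?C)"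
    by (rule nn_integral_count_space_nn_integral) (auto simp del: sets_M)
  also have "\<dots> \<le> (\<integral>\<^sup>+k. (\<integral>\<^sup>+x. ennreal (2 powr (2 * s)) * (g x * (ennreal (2 powr ((s - 1) * real_of_int k)) * indicator {x. e k < g x} x)) \<partial>M) \<partial>?C)"
  proof (rule nn_integral_mono)
    fix k
    let ?a = "ennreal (2 powr ((real_of_int k + 2) * s - real_of_int k))"
    \<comment> \<open>One factor \<open>2 powr k\<close> is spent on the weak type bound. Of the
      exponent \<open>k * s\<close> there remains \<open>k * (s - 1)\<close>, whose sum over the
      levels below \<open>g x\<close> is geometric.\<close>
    have w: "w k = ?a * e k"
      by (simp add: w_def e_def ennreal_mult[symmetric] powr_add[symmetric])
    have "{x\<in>space M. 2 * e k < cmax g x} \<in> sets M" by measurable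
    then have [measurable]: "{x. 2 * e k < cmax g x} \<in> sets M" by (simp del: sets_M)
    have "(\<integral>\<^sup>+x. w k * indicator {x. 2 * e k < cmax g x} x \<partial>M) = w k * emeasure M {x. 2 * e k < cmax g x}"
      by (subst nn_integral_cmult_indicator) (auto simp del: sets_M)
    also have "\<dots> = ?a * (e k * emeasure M {x. 2 * e k < cmax g x})"
      by (simp add: w mult.assoc)
    also have "\<dots> \<le> ?a * (\<integral>\<^sup>+x. g x * indicator {x. e k < g x} x \<partial>M)"
      by (intro mult_left_mono cmax_weak_type_truncated) auto
    also have "\<dots> = (\<integral>\<^sup>+x. ?a * (g x * indicator {x. e k < g x} x) \<partial>M)"
      by (subst nn_integral_cmult) (auto simp del: sets_M)
    also have "?a = ennreal (2 powr (2 * s)) * ennreal (2 powr ((s - 1) * real_of_int k))"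
      by (simp add: ennreal_mult[symmetric] powr_add[symmetric] algebra_simps)
    finally show "(\<integral>\<^sup>+x. w k * indicator {x. 2 * e k < cmax g x} x \<partial>M)
      \<le> (\<integral>\<^sup>+x. ennreal (2 powr (2 * s)) * (g x * (ennreal (2 powr ((s - 1) * real_of_int k)) * indicator {x. e k < g x} x)) \<partial>M)"
      by (simp add: mult_ac)
  qed
  also have "\<dots> = (\<integral>\<^sup>+x. (\<integral>\<^sup>+k. ennreal (2 powr (2 * s)) * (g x * (ennreal (2 powr ((s - 1) * real_of_int k)) * indicator {x. e k < g x} x)) \<partial>?C) \<partial>M)"
    by (rule nn_integral_count_space_nn_integral[symmetric]) (auto simp del: sets_M)
  also have "\<dots> \<le> (\<integral>\<^sup>+x. ennreal (2 powr (2 * s)) * (g x * (ennreal (1 / (1 - 2 powr (1 - s))) * g x powe (s - 1))) \<partial>M)"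
  proof (rule nn_integral_mono)
    fix x
    have "(\<integral>\<^sup>+k. ennreal (2 powr (2 * s)) * (g x * (ennreal (2 powr ((s - 1) * real_of_int k)) * indicator {x. e k < g x} x)) \<partial>?C)
      = ennreal (2 powr (2 * s)) * (g x * (\<integral>\<^sup>+k. ennreal (2 powr ((s - 1) * real_of_int k)) * indicator {k. ennreal (2 powr real_of_int k) < g x} k \<partial>?C))"
      by (simp add: nn_integral_cmult e_def indicator_def)
    also have "\<dots> \<le> ennreal (2 powr (2 * s)) * (g x * (ennreal (1 / (1 - 2 powr (- (s - 1)))) * g x powe (s - 1)))"
      using s by (intro mult_left_mono geometric_sum_below) auto
    finally show "(\<integral>\<^sup>+k. ennreal (2 powr (2 * s)) * (g x * (ennreal (2 powr ((s - 1) * real_of_int k)) * indicator {x. e k < g x} x)) \<partial>?C)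
      \<le> ennreal (2 powr (2 * s)) * (g x * (ennreal (1 / (1 - 2 powr (1 - s))) * g x powe (s - 1)))" by simp
  qed
  also have "\<dots> = (\<integral>\<^sup>+x. ennreal (2 powr (2 * s) / (1 - 2 powr (1 - s))) * g x powe s \<partial>M)"
  proof (rule nn_integral_cong)
    fix x
    have "g x * g x powe (s - 1) = g x powe s"
      using powe_add[of "g x" 1 "s - 1"] by simp
    moreover have "ennreal (2 powr (2 * s) / (1 - 2 powr (1 - s))) = ennreal (2 powr (2 * s)) * ennreal (1 / (1 - 2 powr (1 - s)))"
    proof -
      have "2 powr (1 - s) < 2 powr 0" using s by (intro powr_less_mono) auto
      then show ?thesis by (subst ennreal_mult[symmetric]) auto
    qed
    ultimately show "ennreal (2 powr (2 * s)) * (g x * (ennreal (1 / (1 - 2 powr (1 - s))) * g x powe (s - 1)))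
      = ennreal (2 powr (2 * s) / (1 - 2 powr (1 - s))) * g x powe s"
      by (simp only: ac_simps) (simp only: ac_simps flip: \<open>g x * g x powe (s - 1) = g x powe s\<close>)
  qed
  also have "\<dots> = ennreal (2 powr (2 * s) / (1 - 2 powr (1 - s))) * (\<integral>\<^sup>+x. g x powe s \<partial>M)"
    by (rule nn_integral_cmult) (auto simp del: sets_M)
  finally show ?thesis .
qed

end

section \<open>A one-sided differentiation theorem\<close>

lemma cell_subset_open:
  assumes "open U" "x \<in> U"
  shows "\<exists>i\<ge>j. cell i x \<subseteq> U"
proof -
  obtain e where e: "0 < e" "ball x e \<subseteq> U" using assms open_contains_ball by blast
  have "(\<lambda>i. real CARD('n) * (h / 2 ^ i)) \<longlonglongrightarrow> real CARD('n) * 0"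
    by (intro tendsto_mult tendsto_const LIMSEQ_divide_realpow_zero) auto
  then have "\<forall>\<^sub>F i in sequentially. real CARD('n) * (h / 2 ^ i) < e"
    using e(1) by (auto dest: order_tendstoD(2))
  then obtain i0 where i0: "\<And>i. i \<ge> i0 \<Longrightarrow> real CARD('n) * (h / 2 ^ i) < e"
    unfolding eventually_sequentially by auto
  define i where "i = max i0 j"
  obtain w where w: "cell i x \<subseteq> cube w (h / 2 ^ i)"
    using cell_subset_cube[of i x] unfolding cell_def by auto
  have "cell i x \<subseteq> U"
  proof
    fix y assume y: "y \<in> cell i x"
    have "\<bar>y $ l - w $ l\<bar> \<le> h / 2 ^ i / 2 \<and> \<bar>x $ l - w $ l\<bar> \<le> h / 2 ^ i / 2" for l
      using w y cell_self[of x i] unfolding cube_def by blast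
    note a = this
    have "\<bar>(y - x) $ l\<bar> \<le> h / 2 ^ i / 2 + h / 2 ^ i / 2" for l
      unfolding vector_minus_component using abs_triangle_ineq4[of "y $ l - w $ l" "x $ l - w $ l"] a[of l] by simp
    then have "\<bar>(y - x) $ l\<bar> \<le> h / 2 ^ i" for l
      by (simp only: field_sum_of_halves)
    then have "norm (y - x) \<le> (\<Sum>l\<in>(UNIV::'n set). h / 2 ^ i)"
      by (intro order_trans[OF norm_le_l1_cart] sum_mono)
    also have "\<dots> < e" using i0[of i] by (simp add: i_def)
    finally show "y \<in> U" using e(2) by (auto simp: dist_norm norm_minus_commute)
  qed
  then show ?thesis unfolding i_def by (intro exI[of _ "max i0 j"]) auto
qed

text \<open>If \<open>g\<close> exceeded \<open>l\<close> on a set of positive measure, this set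
  could be covered by a hardly larger open set, which splits into disjoint maximal cells; every cell
  that meets the set has average at most \<open>l\<close>, a contradiction.\<close>

lemma AE_le_of_cavg_le:
  assumes g [measurable]: "g \<in> borel_measurable lebesgue" and D [measurable]: "D \<in> sets lebesgue"
    and le: "\<And>x i. x \<in> D \<Longrightarrow> j \<le> i \<Longrightarrow> cavg lebesgue i g x \<le> l"
  shows "AE x in lebesgue. x \<in> D \<longrightarrow> g x \<le> l"
proof (cases "l = top")
  case False
  have [measurable]: "{x. c i x = z} \<in> sets lebesgue" for i z by (rule cell_lebesgue)
  \<comment> \<open>The excess \<open>1 / (n + 1)\<close> makes the inequality strict by a fixed
    amount, and restriction to one cell of generation 0 makes the measure finite.\<close>
  define H where "H n z = {x. l + ennreal (1 / real (Suc n)) < g x} \<inter> D \<inter> {x. c 0 x = z}" for n z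
  have Hm [measurable]: "H n z \<in> sets lebesgue" for n z
    unfolding H_def by measurable
  have null: "emeasure lebesgue (H n z) = 0" for n z
  proof -
    let ?e = "ennreal (1 / real (Suc n))"
    have fin: "emeasure lebesgue (H n z) < top"
    proof (cases "H n z = {}")
      case False
      then obtain x where "x \<in> H n z" by auto
      then have "H n z \<subseteq> cell 0 x" by (auto simp: H_def cell_def)
      then have "emeasure lebesgue (H n z) \<le> emeasure lebesgue (cell 0 x)"
        by (intro emeasure_mono) auto
      then show ?thesis by (simp add: lebesgue_cell le_less_trans)
    qed simp
    have key: "(l + ?e) * emeasure lebesgue (H n z) \<le> l * emeasure lebesgue U" if U: "open U" "H n z \<subseteq> U" for U
    proof -
      \<comment> \<open>\<open>S i\<close> collects the cells of generation \<open>i\<close> that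
        are maximal inside \<open>U\<close> among the generations from \<open>j\<close> on.\<close>
      define S where "S i = {x. j \<le> i \<and> cell i x \<subseteq> U \<and> (\<forall>i'\<in>{j..<i}. \<not> cell i' x \<subseteq> U)}" for i
      have cw: "cellwise i (\<lambda>x. x \<in> S i)" for i
        unfolding cellwise_def
      proof (intro allI impI)
        fix x y assume e: "c i x = c i y"
        have "i' \<le> i \<Longrightarrow> cell i' x = cell i' y" for i'
          using nested[OF _ e] unfolding cell_def by auto
        then show "x \<in> S i \<longleftrightarrow> y \<in> S i" by (auto simp: S_def)
      qed
      have Sm [measurable]: "S i \<in> sets lebesgue" for i by (rule cellwise_sets[OF refl cw])
      have cwi: "cellwise i (indicator (S i) :: _ \<Rightarrow> ennreal)" for i
        unfolding cellwise_def
      proof (intro allI impI)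
        fix x y assume "c i x = c i y"
        then have "x \<in> S i \<longleftrightarrow> y \<in> S i" using cw unfolding cellwise_def by blast
        then show "(indicator (S i) x :: ennreal) = indicator (S i) y" by (simp add: indicator_def)
      qed
      have disj: "disjoint_family S"
        unfolding disjoint_family_on_def
      proof (intro ballI impI)
        fix a b :: nat assume "a \<noteq> b"
        then show "S a \<inter> S b = {}"
          by (cases a b rule: linorder_cases) (auto simp: S_def)
      qed
      have cov: "(\<Union>i. S i) = U"
      proof
        show "(\<Union>i. S i) \<subseteq> U" using cell_self unfolding S_def by blast
        show "U \<subseteq> (\<Union>i. S i)"
        proof
          fix x assume "x \<in> U"
          then have ex: "\<exists>i. j \<le> i \<and> cell i x \<subseteq> U" using cell_subset_open[OF U(1)] by blast
          define i0 where "i0 = (LEAST i. j \<le> i \<and> cell i x \<subseteq> U)"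
          have "j \<le> i0 \<and> cell i0 x \<subseteq> U" unfolding i0_def by (rule LeastI_ex[OF ex])
          moreover have "\<forall>i'\<in>{j..<i0}. \<not> cell i' x \<subseteq> U"
            unfolding i0_def using not_less_Least by fastforce
          ultimately show "x \<in> (\<Union>i. S i)" by (auto simp: S_def)
        qed
      qed
      have "(l + ?e) * emeasure lebesgue (H n z \<inter> S i) \<le> l * emeasure lebesgue (S i)" for i
      proof -
        have "(l + ?e) * emeasure lebesgue (H n z \<inter> S i) = (\<integral>\<^sup>+x. indicator (S i) x * ((l + ?e) * indicator (H n z) x) \<partial>lebesgue)"
          by (subst nn_integral_cmult_indicator[symmetric]) (auto intro!: nn_integral_cong simp: indicator_def)
        also have "\<dots> \<le> (\<integral>\<^sup>+x. indicator (S i) x * l \<partial>lebesgue)"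
        proof (rule nn_integral_cellwise_mono[OF refl cwi])
          fix x assume "indicator (S i) x \<noteq> (0::ennreal)"
          then have xS: "x \<in> S i" by (auto simp: indicator_def split: if_splits)
          show "(\<integral>\<^sup>+y\<in>cell i x. ((l + ?e) * indicator (H n z) y) \<partial>lebesgue) \<le> (\<integral>\<^sup>+y\<in>cell i x. l \<partial>lebesgue)"
          proof (cases "cell i x \<inter> H n z = {}")
            case True
            then have "(\<integral>\<^sup>+y\<in>cell i x. ((l + ?e) * indicator (H n z) y) \<partial>lebesgue) = (\<integral>\<^sup>+(y::real^'n). 0 \<partial>lebesgue)"
              by (intro nn_integral_cong) (auto simp: indicator_def)
            then show ?thesis by simp
          next
            case False
            \<comment> \<open>The average is the same at all points of the cell, so the hypothesis
              at one point of \<open>H n z\<close> speaks about the whole cell.\<close>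
            then obtain y where y: "y \<in> cell i x" "y \<in> H n z" by auto
            then have "cavg lebesgue i g x \<le> l"
              using le[of y i] xS cellwiseD[OF cellwise_cavg y(1)] by (auto simp: S_def H_def)
            have "(\<integral>\<^sup>+y\<in>cell i x. ((l + ?e) * indicator (H n z) y) \<partial>lebesgue) \<le> (\<integral>\<^sup>+y\<in>cell i x. g y \<partial>lebesgue)"
              by (intro nn_integral_mono) (auto simp: indicator_def H_def)
            also have "\<dots> = cavg lebesgue i g x * emeasure lebesgue (cell i x)"
              by (rule cavg_mult_eq[symmetric]) (auto simp: lebesgue_cell)
            also have "\<dots> \<le> l * emeasure lebesgue (cell i x)"
              by (intro mult_right_mono) (fact | simp)+
            also have "\<dots> = (\<integral>\<^sup>+y\<in>cell i x. l \<partial>lebesgue)"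
              by (subst nn_integral_cmult_indicator) auto
            finally show ?thesis .
          qed
        qed auto
        also have "\<dots> = l * emeasure lebesgue (S i)"
          by (subst nn_integral_cmult_indicator[symmetric]) (auto intro!: nn_integral_cong simp: mult.commute)
        finally show ?thesis .
      qed
      then have "(\<Sum>i. (l + ?e) * emeasure lebesgue (H n z \<inter> S i)) \<le> (\<Sum>i. l * emeasure lebesgue (S i))"
        by (intro suminf_le) auto
      moreover have "(\<Sum>i. emeasure lebesgue (S i)) = emeasure lebesgue U"
        using disj cov by (subst suminf_emeasure) (auto simp: Sm)
      moreover have "(\<Sum>i. emeasure lebesgue (H n z \<inter> S i)) = emeasure lebesgue (H n z)"
      proof (subst suminf_emeasure)
        show "disjoint_family (\<lambda>i. H n z \<inter> S i)" using disj by (auto simp: disjoint_family_on_def)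
        have "(\<Union>i. H n z \<inter> S i) = H n z" using U(2) cov by blast
        then show "emeasure lebesgue (\<Union>i. H n z \<inter> S i) = emeasure lebesgue (H n z)" by simp
      qed (auto simp: Sm Hm)
      ultimately show ?thesis by simp
    qed
    obtain l' where l': "l = ennreal l'" "0 \<le> l'" using False by (cases l) auto
    obtain m where m: "emeasure lebesgue (H n z) = ennreal m" "0 \<le> m" using fin by (cases "emeasure lebesgue (H n z)") auto
    have "(l' + 1 / real (Suc n)) * m \<le> l' * (m + d)" if "0 < d" for d
    proof -
      obtain U where U: "open U" "H n z \<subseteq> U" "U - H n z \<in> lmeasurable" "emeasure lebesgue (U - H n z) < ennreal d"
        using sets_lebesgue_outer_open[OF Hm \<open>0 < d\<close>] by metis
      have "emeasure lebesgue U = emeasure lebesgue (H n z \<union> (U - H n z))"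
        using U(2) by (intro arg_cong[where f="emeasure lebesgue"]) auto
      also have "\<dots> \<le> emeasure lebesgue (H n z) + emeasure lebesgue (U - H n z)"
        using U(3) by (intro emeasure_subadditive) (auto simp: fmeasurable_def)
      also have "\<dots> \<le> ennreal m + ennreal d" using U(4) m by (intro add_mono) auto
      finally have "(l + ?e) * ennreal m \<le> l * (ennreal m + ennreal d)"
        using key[OF U(1,2)] m by (metis mult_left_mono order_trans zero_le)
      then show ?thesis using l' m that
        by (simp add: ennreal_mult[symmetric] ennreal_plus[symmetric] del: ennreal_plus)
    qed
    then have le': "(1 / real (Suc n)) * m \<le> l' * d" if "0 < d" for d using that by (simp add: algebra_simps)
    have "(1 / real (Suc n)) * m \<le> 0"
    proof (rule field_le_epsilon)
      fix d :: real assume "0 < d"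
      \<comment> \<open>Dividing by \<open>l' + 1\<close> instead of \<open>l'\<close> admits
        \<open>l' = 0\<close>.\<close>
      then have "(1 / real (Suc n)) * m \<le> l' * (d / (l' + 1))"
        using l' by (intro le') auto
      also have "\<dots> \<le> d" using l' \<open>0 < d\<close> by (simp add: field_simps)
      finally show "(1 / real (Suc n)) * m \<le> 0 + d" by simp
    qed
    then have "m = 0" using m by (simp add: field_simps)
    then show ?thesis using m by simp
  qed
  have "AE x in lebesgue. \<forall>n z. x \<notin> H n z"
    unfolding AE_all_countable using null by (auto intro!: AE_not_in simp: null_sets_def)
  moreover have "g x \<le> l" if x: "\<forall>n z. x \<notin> H n z" "x \<in> D" for x
  proof (rule ccontr)
    assume "\<not> g x \<le> l"
    note a = x this
    obtain l' where l': "l = ennreal l'" "0 \<le> l'" using False by (cases l) auto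
    have "\<exists>n. l + ennreal (1 / real (Suc n)) < g x"
    proof (cases "g x")
      case (real r)
      then have "0 < r - l'" using a l' by (auto simp: not_le ennreal_less_iff)
      then obtain n where "1 / real (Suc n) < r - l'" using nat_approx_posE by blast
      then show ?thesis using real l'
        by (auto simp: ennreal_plus[symmetric] ennreal_less_iff intro!: exI[of _ n] simp del: ennreal_plus)
    qed (auto simp: l' ennreal_plus[symmetric] simp del: ennreal_plus)
    then show False using a by (auto simp: H_def)
  qed
  ultimately show ?thesis by (auto elim: eventually_mono)
qed simp

end

subsection \<open>The John-Nirenberg inequality\<close>

text \<open>By how many oscillations the constant of a stopping cell can differ from that of the
  original cell: the parent has average at most 2 oscillations, passing to the child costs a factor
  \<open>2 ^ N\<close>, and one more oscillation compares the average with the constant.\<close>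

definition jn_step :: "nat \<Rightarrow> real"
  where "jn_step N = 1 + 2 * 2 ^ N"

text \<open>Half of the decay rate of the John-Nirenberg level sets, so that the exponential moment
  of this rate is bounded by a geometric series of ratio
  \<open>sqrt (1 - 1 / \<kappa>)\<close>.\<close>

definition jn_rate :: "nat \<Rightarrow> real \<Rightarrow> real"
  where "jn_rate N \<kappa> = - ln (1 - 1 / \<kappa>) / (2 * jn_step N)"

text \<open>With \<open>d\<close> the rate, \<open>(s / d) powr s\<close> comes from bounding a
  power by an exponential, the first summand from points at distance at most
  \<open>2 * \<beta>\<close>, the second from the geometric series over the level sets.\<close>

definition jn_const :: "nat \<Rightarrow> real \<Rightarrow> real \<Rightarrow> real"
  where "jn_const N \<kappa> s = (s / jn_rate N \<kappa>) powr s
    * (exp (3 * jn_rate N \<kappa>) + exp (jn_rate N \<kappa> * (3 + jn_step N)) / (1 - sqrt (1 - 1 / \<kappa>)))"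

context dyadic
begin

section \<open>Stopping generations and averages over children\<close>

definition stop :: "(nat \<Rightarrow> real ^ 'n \<Rightarrow> bool) \<Rightarrow> nat \<Rightarrow> (real ^ 'n) set \<Rightarrow> nat \<Rightarrow> (real ^ 'n) set"
  where "stop P j D i = {x\<in>D. j \<le> i \<and> P i x \<and> (\<forall>i'\<in>{j..<i}. \<not> P i' x)}"

lemma cellwise_stop:
  assumes P: "\<And>i. cellwise i (P i)" and D: "cellwise j (\<lambda>x. x \<in> D)"
  shows "cellwise i (\<lambda>x. x \<in> stop P j D i)"
  unfolding cellwise_def
proof (intro allI impI)
  fix x y assume e: "c i x = c i y"
  have "i' \<le> i \<Longrightarrow> P i' x = P i' y" for i'
    using nested[OF _ e] P[of i'] unfolding cellwise_def by blast
  moreover have "j \<le> i \<Longrightarrow> x \<in> D \<longleftrightarrow> y \<in> D"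
    using nested[OF _ e] D unfolding cellwise_def by blast
  ultimately show "x \<in> stop P j D i \<longleftrightarrow> y \<in> stop P j D i" by (auto simp: stop_def)
qed

lemma cellwise_indicator:
  assumes "cellwise i (\<lambda>x. x \<in> S)"
  shows "cellwise i (indicator S :: _ \<Rightarrow> ennreal)"
  unfolding cellwise_def
proof (intro allI impI)
  fix x y assume "c i x = c i y"
  then have "x \<in> S \<longleftrightarrow> y \<in> S" using assms unfolding cellwise_def by blast
  then show "(indicator S x :: ennreal) = indicator S y" by (simp add: indicator_def)
qed

lemma cellwise_const [simp]: "cellwise i (\<lambda>_. k)"
  by (simp add: cellwise_def)

lemma cellwise_comp2:
  assumes "cellwise i f" "cellwise i g"
  shows "cellwise i (\<lambda>x. op (f x) (g x))"
  unfolding cellwise_def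
proof (intro allI impI)
  fix x y assume "c i x = c i y"
  then have "f x = f y" "g x = g y" using assms unfolding cellwise_def by blast+
  then show "op (f x) (g x) = op (f y) (g y)" by simp
qed

lemma cellwise_comp:
  assumes "cellwise i f"
  shows "cellwise i (\<lambda>x. op (f x))"
  using cellwise_comp2[OF assms assms, of "\<lambda>u _. op u"] .

lemma cellwise_prod:
  assumes "\<And>j. cellwise i (f j)"
  shows "cellwise i (\<lambda>x. \<Prod>j\<in>I. f j x)"
  unfolding cellwise_def
proof (intro allI impI prod.cong refl)
  fix x y j assume "c i x = c i y"
  then show "f j x = f j y" using assms[of j] unfolding cellwise_def by blast
qed

lemma cellwise_in_cell: "cellwise i (\<lambda>y. y \<in> cell i x)"
  unfolding cellwise_def cell_def by auto

lemma disjoint_stop: "disjoint_family (stop P j D)"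
  unfolding disjoint_family_on_def
proof (intro ballI impI)
  fix a b :: nat assume "a \<noteq> b"
  then show "stop P j D a \<inter> stop P j D b = {}"
    by (cases a b rule: linorder_cases) (auto simp: stop_def)
qed

lemma Union_stop: "(\<Union>i. stop P j D i) = {x\<in>D. \<exists>i\<ge>j. P i x}"
proof safe
  fix x i assume x: "x \<in> D" "j \<le> i" "P i x"
  define i0 where "i0 = (LEAST i. j \<le> i \<and> P i x)"
  have "j \<le> i0 \<and> P i0 x" unfolding i0_def using x by (intro LeastI) auto
  moreover have "\<forall>i'\<in>{j..<i0}. \<not> P i' x"
    unfolding i0_def using not_less_Least by fastforce
  ultimately show "x \<in> (\<Union>i. stop P j D i)" using x by (auto simp: stop_def)
qed (auto simp: stop_def)

lemma cavg_mono_on: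
  assumes "\<And>y. y \<in> cell i x \<Longrightarrow> g y \<le> g' y"
  shows "cavg M i g x \<le> cavg M i g' x"
  unfolding cavg_def
  by (intro divide_right_mono_ennreal nn_integral_mono) (auto simp: indicator_def assms)

lemma cavg_parent_le:
  assumes "g \<in> borel_measurable lebesgue"
  shows "cavg lebesgue (Suc i) g x \<le> ennreal (2 ^ CARD('n)) * cavg lebesgue i g x"
proof -
  have v: "vol i = 2 ^ CARD('n) * vol (Suc i)"
    by (simp add: vol_def side_def power_divide power_mult_distrib)
  have "(\<integral>\<^sup>+y\<in>cell (Suc i) x. g y \<partial>lebesgue) \<le> (\<integral>\<^sup>+y\<in>cell i x. g y \<partial>lebesgue)"
    using cell_mono[of i "Suc i" x] by (intro nn_integral_mono) (auto simp: indicator_def)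
  then have "cavg lebesgue (Suc i) g x \<le> (\<integral>\<^sup>+y\<in>cell i x. g y \<partial>lebesgue) / ennreal (vol (Suc i))"
    unfolding cavg_def lebesgue_cell by (intro divide_right_mono_ennreal)
  also have "\<dots> = cavg lebesgue i g x * ennreal (vol i) / ennreal (vol (Suc i))"
    using cavg_mult_eq[OF refl assms, of i x] by (simp add: lebesgue_cell)
  also have "\<dots> = cavg lebesgue i g x * (ennreal (vol i) / ennreal (vol (Suc i)))"
    by (simp add: ennreal_times_divide)
  also have "ennreal (vol i) / ennreal (vol (Suc i)) = ennreal (2 ^ CARD('n))"
    using vol_pos[of "Suc i"] by (simp add: v divide_ennreal)
  finally show ?thesis by (simp add: mult.commute)
qed

lemma cavg_const_lebesgue: "cavg lebesgue i (\<lambda>_. l) x = l"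
  unfolding cavg_def using vol_pos[of i]
  by (subst nn_integral_cmult_indicator) (auto simp: lebesgue_cell ennreal_mult_divide_eq)

end

text \<open>\<open>A_inf\<close> is the A-infinity property on cells at the fixed proportion one
  half. Lebesgue measure and weighted measures are both instances, so that John-Nirenberg and the
  sparse estimates are proved once.\<close>

locale dyadic_weight = dyadic c h for c :: "nat \<Rightarrow> real ^ 'n \<Rightarrow> nat" and h +
  fixes M :: "(real ^ 'n) measure" and \<kappa> :: real
  assumes sets_M: "sets M = sets lebesgue"
    and AE_M: "\<And>P. (AE x in lebesgue. P x) \<Longrightarrow> AE x in M. P x"
    and finite_M: "emeasure M (cell i x) < top"
    and kappa: "1 < \<kappa>"
    and A_inf: "\<lbrakk>E \<in> sets lebesgue; E \<subseteq> cell i x; emeasure lebesgue (cell i x) \<le> 2 * emeasure lebesgue E\<rbrakk>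
      \<Longrightarrow> emeasure M (cell i x) \<le> ennreal \<kappa> * emeasure M E"

text \<open>The constants \<open>bm i x\<close> need not be means over the cell itself; they will be
  means over a cube that contains it.\<close>

locale dyadic_bmo = dyadic_weight c h M \<kappa> for c :: "nat \<Rightarrow> real ^ 'n \<Rightarrow> nat" and h M \<kappa> +
  fixes b :: "real ^ 'n \<Rightarrow> complex" and bm :: "nat \<Rightarrow> real ^ 'n \<Rightarrow> complex" and \<beta> :: real
  assumes b_measurable [measurable]: "b \<in> borel_measurable lebesgue"
    and bm_cellwise: "cellwise i (bm i)"
    and beta: "0 < \<beta>"
    and osc: "cavg lebesgue i (\<lambda>y. ennreal (cmod (b y - bm i x))) x \<le> ennreal \<beta>"
begin

lemma b_measurable_M [measurable]: "b \<in> borel_measurable M"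
  using b_measurable sets_M measurable_cong_sets by blast

text \<open>The constant \<open>bm i' y - bm i x\<close> is its own average over
  \<open>cell i' y\<close>, and under this average it is split at \<open>b z\<close>.\<close>

lemma mean_diff_le:
  assumes "y \<in> cell i x" "cavg lebesgue i' (\<lambda>z. ennreal (cmod (b z - bm i x))) y \<le> ennreal l" "0 \<le> l"
  shows "cmod (bm i' y - bm i x) \<le> \<beta> + l"
proof -
  have "ennreal (cmod (bm i' y - bm i x)) = cavg lebesgue i' (\<lambda>z. ennreal (cmod (bm i' y - bm i x))) y"
    by (simp add: cavg_const_lebesgue)
  also have "\<dots> \<le> cavg lebesgue i' (\<lambda>z. ennreal (cmod (b z - bm i' y)) + ennreal (cmod (b z - bm i x))) y"
  proof (rule cavg_mono)
    fix z
    have "cmod (bm i' y - bm i x) \<le> cmod (b z - bm i' y) + cmod (b z - bm i x)"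
      using norm_triangle_ineq4[of "b z - bm i x" "b z - bm i' y"] by (simp add: algebra_simps)
    then show "ennreal (cmod (bm i' y - bm i x)) \<le> ennreal (cmod (b z - bm i' y)) + ennreal (cmod (b z - bm i x))"
      by (simp add: ennreal_plus[symmetric] ennreal_leI del: ennreal_plus)
  qed
  also have "\<dots> = cavg lebesgue i' (\<lambda>z. ennreal (cmod (b z - bm i' y))) y + cavg lebesgue i' (\<lambda>z. ennreal (cmod (b z - bm i x))) y"
    by (rule cavg_add[OF refl]) measurable
  also have "\<dots> \<le> ennreal \<beta> + ennreal l" by (intro add_mono osc assms)
  finally show ?thesis using beta assms(3) by (simp add: ennreal_plus[symmetric] del: ennreal_plus)
qed

lemma mean_child_diff: "cmod (bm (Suc i) x - bm i x) \<le> (1 + 2 ^ CARD('n)) * \<beta>"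
proof -
  have "cavg lebesgue (Suc i) (\<lambda>z. ennreal (cmod (b z - bm i x))) x \<le> ennreal (2 ^ CARD('n)) * ennreal \<beta>"
    by (rule order_trans[OF cavg_parent_le]) (auto intro!: mult_left_mono osc)
  then have "cmod (bm (Suc i) x - bm i x) \<le> \<beta> + 2 ^ CARD('n) * \<beta>"
    using beta by (intro mean_diff_le) (auto simp: ennreal_mult)
  then show ?thesis by (simp add: algebra_simps)
qed

lemma mean_descendant_diff: "cmod (bm (i + d) x - bm i x) \<le> real d * (1 + 2 ^ CARD('n)) * \<beta>"
proof (induction d)
  case (Suc d)
  have "cmod (bm (i + Suc d) x - bm i x) \<le> cmod (bm (Suc (i + d)) x - bm (i + d) x) + cmod (bm (i + d) x - bm i x)"
    using norm_triangle_ineq[of "bm (Suc (i + d)) x - bm (i + d) x" "bm (i + d) x - bm i x"] by simp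
  also have "\<dots> \<le> (1 + 2 ^ CARD('n)) * \<beta> + real d * (1 + 2 ^ CARD('n)) * \<beta>"
    by (intro add_mono Suc mean_child_diff)
  finally show ?case by (simp add: algebra_simps)
qed simp

abbreviation \<gamma> where "\<gamma> \<equiv> 1 - 1 / \<kappa>"

lemma L_pos: "0 < jn_step N"
  by (simp add: jn_step_def add_pos_pos)

lemma gamma: "0 < \<gamma>" "\<gamma> < 1"
  using kappa by (auto simp: field_simps)

text \<open>The exceptional set is controlled through its complement, so that only the lower bound
  \<open>A_inf\<close> on \<open>M\<close> is needed.\<close>

lemma stopping_set_small:
  shows "emeasure M {y\<in>cell i x. \<exists>i'\<ge>i. ennreal (2 * \<beta>) < cavg lebesgue i' (\<lambda>z. ennreal (cmod (b z - bm i x))) y}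
    \<le> ennreal \<gamma> * emeasure M (cell i x)" (is "emeasure M ?\<Omega> \<le> _")
proof -
  let ?g = "\<lambda>z. ennreal (cmod (b z - bm i x))"
  define W where "W = ?\<Omega>"
  have g: "?g \<in> borel_measurable lebesgue" by measurable
  have "{y\<in>space lebesgue. y \<in> cell i x \<and> (\<exists>i'\<in>{i..}. ennreal (2 * \<beta>) < cavg lebesgue i' ?g y)} \<in> sets lebesgue"
    by measurable
  moreover have "{y\<in>space lebesgue. y \<in> cell i x \<and> (\<exists>i'\<in>{i..}. ennreal (2 * \<beta>) < cavg lebesgue i' ?g y)} = W" by (auto simp: W_def)
  ultimately have \<Omega>: "W \<in> sets lebesgue" by (rule back_subst[of "\<lambda>S. S \<in> sets lebesgue"])
  \<comment> \<open>The weak type bound at twice the oscillation leaves at least half of the cell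
    outside \<open>W\<close>, which is what \<open>A_inf\<close> asks for.\<close>
  have "ennreal (2 * \<beta>) * emeasure lebesgue W \<le> (\<integral>\<^sup>+y\<in>cell i x. ?g y \<partial>lebesgue)"
    unfolding W_def by (rule weak_type_cavg[OF refl g cellwise_in_cell])
  also have "\<dots> = cavg lebesgue i ?g x * emeasure lebesgue (cell i x)"
    by (rule cavg_mult_eq[OF refl g, symmetric]) (simp add: lebesgue_cell)
  also have "\<dots> \<le> ennreal \<beta> * emeasure lebesgue (cell i x)"
    by (intro mult_right_mono osc) simp
  finally have le1: "ennreal (2 * \<beta>) * emeasure lebesgue W \<le> ennreal \<beta> * ennreal (vol i)" 
    unfolding lebesgue_cell .
  have sub: "W \<subseteq> cell i x" by (auto simp: W_def)
  have "emeasure lebesgue W \<le> ennreal (vol i)"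
    using emeasure_mono[OF sub, of lebesgue] by (simp add: lebesgue_cell)
  then obtain w where w: "emeasure lebesgue W = ennreal w" "0 \<le> w" by (cases "emeasure lebesgue W") (auto simp: top_unique)
  have w2: "2 * w \<le> vol i"
    using le1 beta w vol_pos[of i] by (simp add: ennreal_mult[symmetric])
  have dif: "emeasure lebesgue (cell i x - W) = ennreal (vol i - w)"
    using \<Omega> sub w by (subst emeasure_Diff) (auto simp: lebesgue_cell ennreal_minus)
  have "emeasure M (cell i x) \<le> ennreal \<kappa> * emeasure M (cell i x - W)"
  proof (rule A_inf)
    show "emeasure lebesgue (cell i x) \<le> 2 * emeasure lebesgue (cell i x - W)"
    proof -
      have "ennreal (vol i) \<le> ennreal (2 * (vol i - w))" using w2 by (intro ennreal_leI) auto
      also have "\<dots> = 2 * ennreal (vol i - w)" using w2 w by (subst ennreal_mult) auto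
      finally show ?thesis unfolding dif lebesgue_cell .
    qed
  qed (use \<Omega> sub in auto)
  moreover have "emeasure M (cell i x - W) = emeasure M (cell i x) - emeasure M W"
    using \<Omega> sub finite_M[of i x] emeasure_mono[of W "cell i x" M] by (intro emeasure_Diff) (auto simp: sets_M top_unique)
  ultimately have le: "emeasure M (cell i x) \<le> ennreal \<kappa> * (emeasure M (cell i x) - emeasure M W)" by simp
  have mono: "emeasure M W \<le> emeasure M (cell i x)" using sub by (rule emeasure_mono) (auto simp: sets_M)
  obtain u v where u: "emeasure M (cell i x) = ennreal u" "0 \<le> u" and v: "emeasure M W = ennreal v" "0 \<le> v"
    using finite_M[of i x] mono by (metis ennreal_cases leD top.not_eq_extremum)
  \<comment> \<open>Solving for \<open>v\<close> produces the factor
    \<open>1 - 1 / \<kappa>\<close>.\<close>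
  have "u \<le> \<kappa> * (u - v)" using le mono u v kappa by (simp add: ennreal_minus ennreal_mult[symmetric] ennreal_le_iff)
  then have "v \<le> \<gamma> * u" using kappa by (simp add: field_simps)
  then show ?thesis unfolding W_def[symmetric] using u v gamma by (simp add: ennreal_mult[symmetric] ennreal_leI)
qed

text \<open>Induction over stopping rounds, for all cells at once. Almost all of the exceptional set
  lies in the stopping cells. There the reference constant has moved by at most
  \<open>jn_step\<close> oscillations, so the previous level set of each stopping cell contains it,
  and the stopping cells together carry at most a fraction \<open>\<gamma>\<close> of the
  mass.\<close>

lemma John_Nirenberg:
  "emeasure M {y\<in>cell i x. (2 + real k * jn_step CARD('n)) * \<beta> < cmod (b y - bm i x)} \<le> ennreal (\<gamma> ^ k) * emeasure M (cell i x)"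
proof (induction k arbitrary: i x)
  case 0
  show ?case by (auto intro!: emeasure_mono simp: sets_M)
next
  case (Suc k)
  let ?g = "\<lambda>z. ennreal (cmod (b z - bm i x))"
  have g: "?g \<in> borel_measurable lebesgue" by measurable
  define P where "P i' y = (ennreal (2 * \<beta>) < cavg lebesgue i' ?g y)" for i' y
  define S where "S = stop P i (cell i x)"
  have cP: "cellwise i' (P i')" for i'
    unfolding P_def by (rule cellwise_comp[OF cellwise_cavg])
  have cS: "cellwise i' (\<lambda>y. y \<in> S i')" for i'
    unfolding S_def by (rule cellwise_stop[OF cP cellwise_in_cell])
  have Sm [measurable]: "S i' \<in> sets lebesgue" "S i' \<in> sets M" for i'
    using cellwise_sets[OF refl cS] sets_M by auto
  define H where "H = {y\<in>cell i x. (2 + real (Suc k) * jn_step CARD('n)) * \<beta> < cmod (b y - bm i x)}"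
  define R where "R i' = {y. (2 + real k * jn_step CARD('n)) * \<beta> < cmod (b y - bm i' y)}" for i'
  have bmm: "bm i' \<in> borel_measurable N" if "sets N = sets lebesgue" for i' and N :: "(real^'n) measure"
    by (rule borel_measurable_cellwise[OF that bm_cellwise])
  have Rm [measurable]: "R i' \<in> sets lebesgue" "R i' \<in> sets M" for i'
  proof -
    have [measurable]: "bm i' \<in> borel_measurable lebesgue" by (rule bmm) simp
    have "{y\<in>space lebesgue. (2 + real k * jn_step CARD('n)) * \<beta> < cmod (b y - bm i' y)} \<in> sets lebesgue" by measurable
    then show "R i' \<in> sets lebesgue" "R i' \<in> sets M" by (auto simp: R_def sets_M)
  qed
  have Hm [measurable]: "H \<in> sets lebesgue" "H \<in> sets M"
  proof -
    have "{y\<in>space lebesgue. y \<in> cell i x \<and> (2 + real (Suc k) * jn_step CARD('n)) * \<beta> < cmod (b y - bm i x)} \<in> sets lebesgue" by measurable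
    moreover have "{y\<in>space lebesgue. y \<in> cell i x \<and> (2 + real (Suc k) * jn_step CARD('n)) * \<beta> < cmod (b y - bm i x)} = H"
      by (auto simp: H_def)
    ultimately show "H \<in> sets lebesgue" by (rule back_subst[of "\<lambda>S. S \<in> sets lebesgue"])
    then show "H \<in> sets M" unfolding sets_M .
  qed
  have ae: "AE y in M. y \<in> H \<longrightarrow> y \<in> (\<Union>i'. S i')"
  proof (rule AE_M)
    have [measurable]: "(\<Union>i'. S i') \<in> sets lebesgue" by auto
    \<comment> \<open>Where nothing stops, all averages are at most \<open>2 * \<beta>\<close>,
      hence almost everywhere so is the function itself.\<close>
    have "AE y in lebesgue. y \<in> cell i x - (\<Union>i'. S i') \<longrightarrow> ?g y \<le> ennreal (2 * \<beta>)"
    proof (rule AE_le_of_cavg_le[where j=i])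
      fix y i' assume "y \<in> cell i x - (\<Union>i'. S i')" "i \<le> i'"
      then show "cavg lebesgue i' ?g y \<le> ennreal (2 * \<beta>)"
        unfolding S_def Union_stop by (auto simp: P_def not_less)
    qed auto
    moreover have "y \<in> (\<Union>i'. S i')"
      if a': "y \<in> cell i x - (\<Union>i'. S i') \<longrightarrow> ?g y \<le> ennreal (2 * \<beta>)" "y \<in> H" for y
    proof (rule ccontr)
      assume "y \<notin> (\<Union>i'. S i')"
      with a' have a: "y \<in> cell i x - (\<Union>i'. S i') \<longrightarrow> ?g y \<le> ennreal (2 * \<beta>)" "y \<in> H" "y \<notin> (\<Union>i'. S i')" by auto
      then have "cmod (b y - bm i x) \<le> 2 * \<beta>" using beta by (simp add: H_def)
      also have "\<dots> \<le> (2 + real (Suc k) * jn_step CARD('n)) * \<beta>" using beta less_imp_le[OF L_pos] by (intro mult_right_mono) auto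
      finally show False using a by (simp add: H_def)
    qed
    ultimately show "AE y in lebesgue. y \<in> H \<longrightarrow> y \<in> (\<Union>i'. S i')"
      by (auto elim: eventually_mono)
  qed
  have HS: "H \<inter> S i' \<subseteq> S i' \<inter> R i'" for i'
  proof
    fix y assume y: "y \<in> H \<inter> S i'"
    then have yi: "y \<in> cell i x" "i \<le> i'" "P i' y" "\<And>i''. i \<le> i'' \<Longrightarrow> i'' < i' \<Longrightarrow> \<not> P i'' y"
      by (auto simp: S_def stop_def)
    \<comment> \<open>The original cell does not stop, so a stopping cell has a parent inside the
      original cell that did not stop.\<close>
    have "\<not> P i y"
    proof -
      have "cavg lebesgue i ?g y = cavg lebesgue i ?g x" using yi(1) by (rule cellwiseD[OF cellwise_cavg])
      also have "\<dots> \<le> ennreal \<beta>" by (rule osc)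
      also have "\<dots> \<le> ennreal (2 * \<beta>)" using beta by (intro ennreal_leI) auto
      finally show ?thesis by (simp add: P_def not_less)
    qed
    then have "i \<noteq> i'" using yi(3) by auto
    then obtain j where j: "i' = Suc j" "i \<le> j" using yi(2) by (cases i') auto
    have "cavg lebesgue i' ?g y \<le> ennreal (2 ^ CARD('n)) * cavg lebesgue j ?g y"
      unfolding j by (rule cavg_parent_le[OF g])
    also have "\<dots> \<le> ennreal (2 ^ CARD('n)) * ennreal (2 * \<beta>)"
      using yi(4)[of j] j by (intro mult_left_mono) (auto simp: P_def not_less)
    also have "\<dots> = ennreal (2 * 2 ^ CARD('n) * \<beta>)"
      using beta by (simp add: ennreal_mult[symmetric] mult_ac)
    finally have "cmod (bm i' y - bm i x) \<le> \<beta> + 2 * 2 ^ CARD('n) * \<beta>"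
      using beta by (intro mean_diff_le[OF yi(1)]) auto
    also have "\<dots> = jn_step CARD('n) * \<beta>" by (simp add: jn_step_def algebra_simps)
    finally have "cmod (b y - bm i x) \<le> cmod (b y - bm i' y) + jn_step CARD('n) * \<beta>"
      using norm_triangle_ineq[of "b y - bm i' y" "bm i' y - bm i x"] by simp
    moreover have "(2 + real (Suc k) * jn_step CARD('n)) * \<beta> < cmod (b y - bm i x)" using y by (simp add: H_def)
    ultimately have "(2 + real k * jn_step CARD('n)) * \<beta> < cmod (b y - bm i' y)" by (simp add: algebra_simps)
    then show "y \<in> S i' \<inter> R i'" using y by (simp add: R_def)
  qed
  have SR: "emeasure M (S i' \<inter> R i') \<le> ennreal (\<gamma> ^ k) * emeasure M (S i')" for i'
  proof -
    have "emeasure M (S i' \<inter> R i') = (\<integral>\<^sup>+y. indicator (S i') y * indicator (R i') y \<partial>M)"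
      by (simp add: indicator_inter_arith[symmetric])
    also have "\<dots> \<le> (\<integral>\<^sup>+y. indicator (S i') y * ennreal (\<gamma> ^ k) \<partial>M)"
    proof (rule nn_integral_cellwise_mono[OF sets_M cellwise_indicator[OF cS]])
      fix y
      have "(\<integral>\<^sup>+z\<in>cell i' y. indicator (R i') z \<partial>M) = emeasure M (R i' \<inter> cell i' y)"
        by (simp add: indicator_inter_arith[symmetric] sets_M)
      also have "R i' \<inter> cell i' y = {z\<in>cell i' y. (2 + real k * jn_step CARD('n)) * \<beta> < cmod (b z - bm i' y)}"
        using cellwiseD[OF bm_cellwise] by (auto simp: R_def)
      also have "emeasure M \<dots> \<le> ennreal (\<gamma> ^ k) * emeasure M (cell i' y)" by (rule Suc.IH)
      also have "\<dots> = (\<integral>\<^sup>+z\<in>cell i' y. ennreal (\<gamma> ^ k) \<partial>M)"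
        by (subst nn_integral_cmult_indicator) (auto simp: sets_M)
      finally show "(\<integral>\<^sup>+z\<in>cell i' y. indicator (R i') z \<partial>M) \<le> (\<integral>\<^sup>+z\<in>cell i' y. ennreal (\<gamma> ^ k) \<partial>M)" .
    qed auto
    also have "\<dots> = ennreal (\<gamma> ^ k) * emeasure M (S i')"
      by (subst nn_integral_cmult_indicator[symmetric]) (auto intro!: nn_integral_cong simp: mult.commute)
    finally show ?thesis .
  qed
  have "emeasure M H \<le> emeasure M (\<Union>i'. S i' \<inter> R i')"
  proof (rule emeasure_mono_AE)
    show "AE y in M. y \<in> H \<longrightarrow> y \<in> (\<Union>i'. S i' \<inter> R i')"
      using ae by (rule eventually_mono) (use HS in blast)
  qed auto
  also have "\<dots> \<le> (\<Sum>i'. emeasure M (S i' \<inter> R i'))"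
    by (rule emeasure_subadditive_countably) auto
  also have "\<dots> \<le> (\<Sum>i'. ennreal (\<gamma> ^ k) * emeasure M (S i'))"
    by (intro suminf_le SR) auto
  also have "\<dots> = ennreal (\<gamma> ^ k) * emeasure M (\<Union>i'. S i')"
    by (subst ennreal_suminf_cmult, subst suminf_emeasure) (auto simp: S_def disjoint_stop Sm[unfolded S_def])
  also have "(\<Union>i'. S i') = {y\<in>cell i x. \<exists>i'\<ge>i. ennreal (2 * \<beta>) < cavg lebesgue i' ?g y}"
    unfolding S_def Union_stop P_def ..
  also have "ennreal (\<gamma> ^ k) * emeasure M \<dots> \<le> ennreal (\<gamma> ^ k) * (ennreal \<gamma> * emeasure M (cell i x))"
    by (intro mult_left_mono stopping_set_small) simp
  also have "\<dots> = ennreal (\<gamma> ^ Suc k) * emeasure M (cell i x)"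
    using gamma by (simp add: mult.assoc[symmetric] ennreal_mult[symmetric] mult.commute)
  finally show ?case unfolding H_def .
qed

end

subsection \<open>Sparse sums\<close>

lemma ennreal_le_suminf: "f k \<le> (\<Sum>k. f k :: ennreal)"
  using ennreal_suminf_lessD[of f "f k" k] by (meson less_irrefl not_le)

text \<open>The converse of Hoelder's inequality, tested on \<open>G powe (q - 1)\<close> for a
  truncation \<open>G\<close> of \<open>g\<close>. Truncation in height and to \<open>V N\<close>
  makes the integral finite, so that a power of it can be cancelled; monotone convergence then
  removes the truncation.\<close>

lemma nn_integral_powe_le_by_duality:
  fixes Y :: ennreal
  assumes [measurable]: "g \<in> borel_measurable M" "\<And>N. V N \<in> sets M"
    and V: "incseq V" "(\<Union>N. V N) = space M" "\<And>N. emeasure M (V N) < top" and q: "1 < q"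
    and dual: "\<And>H. H \<in> borel_measurable M \<Longrightarrow>
      (\<integral>\<^sup>+x. g x * H x \<partial>M) \<le> Y * (\<integral>\<^sup>+x. H x powe (q / (q - 1)) \<partial>M) powe (1 - 1 / q)"
  shows "(\<integral>\<^sup>+x. g x powe q \<partial>M) \<le> Y powe q"
proof -
  define G where "G N x = min (g x) (of_nat N) * indicator (V N) x" for N :: nat and x
  have Gm [measurable]: "G N \<in> borel_measurable M" for N unfolding G_def[abs_def] by measurable
  have le: "(\<integral>\<^sup>+x. G N x powe q \<partial>M) \<le> Y powe q" for N
  proof -
    define I where "I = (\<integral>\<^sup>+x. G N x powe q \<partial>M)"
    have "I \<le> (\<integral>\<^sup>+x. (of_nat N powe q) * indicator (V N) x \<partial>M)"
      unfolding I_def using q by (intro nn_integral_mono) (auto simp: G_def indicator_def intro!: powe_mono)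
    also have "\<dots> = of_nat N powe q * emeasure M (V N)"
      by (rule nn_integral_cmult_indicator) simp
    also have "\<dots> < top" using V(3)[of N] by (simp add: ennreal_mult_less_top of_nat_less_top)
    finally have fin: "I < top" .
    have "I = (\<integral>\<^sup>+x. G N x * G N x powe (q - 1) \<partial>M)"
      unfolding I_def using powe_add[of _ 1 "q - 1"] by (intro nn_integral_cong) simp
    also have "\<dots> \<le> (\<integral>\<^sup>+x. g x * G N x powe (q - 1) \<partial>M)"
      by (intro nn_integral_mono mult_right_mono) (auto simp: G_def indicator_def)
    also have "\<dots> \<le> Y * (\<integral>\<^sup>+x. (G N x powe (q - 1)) powe (q / (q - 1)) \<partial>M) powe (1 - 1 / q)"
      by (rule dual) measurable
    also have "\<dots> = Y * I powe (1 - 1 / q)"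
      using q by (simp add: powe_powe I_def)
    finally have "I \<le> Y * I powe (1 - 1 / q)" .
    moreover have "I = I powe (1 / q) * I powe (1 - 1 / q)"
      using powe_add[of I "1 / q" "1 - 1 / q"] by simp
    ultimately have l: "I powe (1 - 1 / q) * I powe (1 / q) \<le> I powe (1 - 1 / q) * Y"
      by (simp add: mult.commute)
    show ?thesis
    proof (cases "I = 0")
      case False
      then have "I powe (1 / q) \<le> Y"
        using l fin q by (subst (asm) ennreal_mult_le_mult_iff) auto
      then have "(I powe (1 / q)) powe q \<le> Y powe q" using q by (intro powe_mono) auto
      then show ?thesis using q by (simp add: powe_powe I_def)
    qed (simp add: I_def)
  qed
  have inc: "G N x \<le> G (Suc N) x" for N x
    using V(1) by (auto simp: G_def indicator_def incseq_Suc_iff min_def intro: order_trans)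
  have sup: "(SUP N. G N x) = g x" if x: "x \<in> space M" for x
  proof (rule antisym)
    show "(SUP N. G N x) \<le> g x" by (auto intro!: SUP_least simp: G_def indicator_def)
    obtain N0 where "x \<in> V N0" using V(2) x by blast
    then have xV: "x \<in> V N" if "N0 \<le> N" for N using that V(1) by (auto simp: incseq_def)
    have ge: "min (g x) (of_nat N) \<le> (SUP N. G N x)" for N
    proof -
      have "min (g x) (of_nat N) \<le> G (max N N0) x"
        using xV[of "max N N0"] by (auto simp: G_def intro: min.coboundedI2)
      also have "\<dots> \<le> (SUP N. G N x)" by (rule SUP_upper) simp
      finally show ?thesis .
    qed
    show "g x \<le> (SUP N. G N x)"
    proof (cases "g x")
      case (real r)
      obtain N where "r \<le> real N" using real_arch_simple by blast
      then have "min (g x) (of_nat N) = g x"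
        using real by (auto simp: min_def ennreal_of_nat_eq_real_of_nat)
      then show ?thesis using ge[of N] by simp
    next
      case top
      then have "(SUP N. of_nat N) \<le> (SUP N. G N x)" using ge by (intro SUP_least) simp
      then show ?thesis by (simp only: ennreal_SUP_of_nat_eq_top top)
    qed
  qed
  have "(\<integral>\<^sup>+x. g x powe q \<partial>M) = (\<integral>\<^sup>+x. (SUP N. G N x powe q) \<partial>M)"
    using q by (intro nn_integral_cong) (simp add: powe_SUP[symmetric] sup)
  also have "\<dots> = (SUP N. \<integral>\<^sup>+x. G N x powe q \<partial>M)"
    using q inc by (intro nn_integral_monotone_convergence_SUP) (auto simp: incseq_Suc_iff le_fun_def intro!: powe_mono)
  also have "\<dots> \<le> Y powe q" by (intro SUP_least le)
  finally show ?thesis .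
qed

section \<open>Hoelder's inequality and power means on a cell\<close>

context dyadic
begin

lemma cavg_Holder:
  assumes M: "sets M = sets lebesgue"
    and [measurable]: "f \<in> borel_measurable M" "g \<in> borel_measurable M" and a: "0 < a" "a < 1"
  shows "cavg M i (\<lambda>y. f y * g y) x
    \<le> cavg M i (\<lambda>y. f y powe (1 / a)) x powe a * cavg M i (\<lambda>y. g y powe (1 / (1 - a))) x powe (1 - a)"
proof -
  have [measurable]: "cell i x \<in> sets M" by (simp add: M)
  let ?f = "\<lambda>y. f y powe (1 / a) * indicator (cell i x) y"
  let ?g = "\<lambda>y. g y powe (1 / (1 - a)) * indicator (cell i x) y"
  have "(\<integral>\<^sup>+y\<in>cell i x. (f y * g y) \<partial>M) = (\<integral>\<^sup>+y. ?f y powe a * ?g y powe (1 - a) \<partial>M)"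
    using a by (intro nn_integral_cong) (auto simp: powe_powe indicator_def)
  also have "\<dots> \<le> (\<integral>\<^sup>+y. ?f y \<partial>M) powe a * (\<integral>\<^sup>+y. ?g y \<partial>M) powe (1 - a)"
    using a by (intro nn_integral_Holder) auto
  finally have "cavg M i (\<lambda>y. f y * g y) x
    \<le> ((\<integral>\<^sup>+y. ?f y \<partial>M) powe a * (\<integral>\<^sup>+y. ?g y \<partial>M) powe (1 - a)) * inverse (emeasure M (cell i x))"
    unfolding cavg_def divide_ennreal_def by (rule mult_right_mono) simp
  also have "inverse (emeasure M (cell i x)) = inverse (emeasure M (cell i x)) powe a * inverse (emeasure M (cell i x)) powe (1 - a)"
    using powe_add[of "inverse (emeasure M (cell i x))" a "1 - a"] by simp
  finally show ?thesis
    using a by (simp add: cavg_def divide_ennreal_def powe_mult mult_ac)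
qed

lemma cavg_power_mean:
  assumes M: "sets M = sets lebesgue" and [measurable]: "F \<in> borel_measurable M" and ab: "0 < a" "a \<le> b"
  shows "cavg M i (\<lambda>y. F y powe a) x powe (1 / a) \<le> cavg M i (\<lambda>y. F y powe b) x powe (1 / b)"
proof (cases "a = b")
  case False
  then have l: "0 < a / b" "a / b < 1" using ab by auto
  have "cavg M i (\<lambda>y. F y powe a * 1) x
    \<le> cavg M i (\<lambda>y. (F y powe a) powe (1 / (a / b))) x powe (a / b) * cavg M i (\<lambda>y. 1 powe (1 / (1 - a / b))) x powe (1 - a / b)"
    using l by (intro cavg_Holder[OF M]) auto
  also have "\<dots> \<le> cavg M i (\<lambda>y. F y powe b) x powe (a / b) * 1 powe (1 - a / b)"
    using l ab cavg_const_le[OF M, of i 1 x] by (intro mult_mono powe_mono) (auto simp: powe_powe)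
  finally have "cavg M i (\<lambda>y. F y powe a) x powe (1 / a) \<le> (cavg M i (\<lambda>y. F y powe b) x powe (a / b)) powe (1 / a)"
    using ab by (intro powe_mono) auto
  then show ?thesis using ab by (simp add: powe_powe)
qed simp

end

section \<open>Sparse families and their cores\<close>

context dyadic_weight
begin

lemma cell_sets_M [measurable, simp]: "cell i x \<in> sets M"
  by (simp add: sets_M)

context
  fixes G :: "nat \<Rightarrow> (real ^ 'n) set"
  assumes G_cellwise: "\<And>i. cellwise i (\<lambda>x. x \<in> G i)"
    and sparse: "\<And>i x. x \<in> G i \<Longrightarrow> 2 * emeasure lebesgue {y\<in>cell i x. \<exists>i'>i. y \<in> G i'} \<le> emeasure lebesgue (cell i x)"
begin

text \<open>The part of \<open>G i\<close> that no later generation of the family covers. The cores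
  are pairwise disjoint, and by sparseness a core fills at least half of every cell of
  \<open>G i\<close>.\<close>

definition core :: "nat \<Rightarrow> (real ^ 'n) set"
  where "core i = {x\<in>G i. \<forall>i'>i. x \<notin> G i'}"

lemma G_sets: "G i \<in> sets lebesgue" "G i \<in> sets M"
  using cellwise_sets[OF refl G_cellwise] sets_M by auto

lemma core_eq: "core i = G i - (\<Union>i'\<in>{i<..}. G i')"
  by (auto simp: core_def)

lemma core_sets: "core i \<in> sets lebesgue" "core i \<in> sets M"
  using G_sets by (auto simp: core_eq)

lemma core_unique: "x \<in> core i \<Longrightarrow> x \<in> core i' \<Longrightarrow> i = i'"
  by (cases i i' rule: linorder_cases) (auto simp: core_def)

text \<open>\<open>A_inf\<close> turns the half of Lebesgue measure that the core keeps in each cell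
  into a fraction \<open>1 / \<kappa>\<close> of the weighted mass. A cellwise factor takes the same
  value on the cell and on its core.\<close>

lemma nn_integral_sparse_le_core:
  assumes \<phi>: "cellwise i \<phi>"
  shows "(\<integral>\<^sup>+x. indicator (G i) x * \<phi> x \<partial>M) \<le> ennreal \<kappa> * (\<integral>\<^sup>+x. indicator (core i) x * \<phi> x \<partial>M)"
proof -
  note [measurable] = core_sets
  have \<phi>m [measurable]: "\<phi> \<in> borel_measurable M" by (rule borel_measurable_cellwise[OF sets_M \<phi>])
  have "(\<integral>\<^sup>+x. (indicator (G i) x * \<phi> x) * 1 \<partial>M) \<le> (\<integral>\<^sup>+x. (indicator (G i) x * \<phi> x) * (ennreal \<kappa> * indicator (core i) x) \<partial>M)"
  proof (rule nn_integral_cellwise_mono[OF sets_M, where i=i])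
    show "cellwise i (\<lambda>x. indicator (G i) x * \<phi> x)"
      by (rule cellwise_comp2[where op="(*)", OF cellwise_indicator[OF G_cellwise] \<phi>])
  next
    fix x assume "indicator (G i) x * \<phi> x \<noteq> 0"
    then have x: "x \<in> G i" by (auto simp: indicator_def split: if_splits)
    define W where "W = {y\<in>cell i x. \<exists>i'>i. y \<in> G i'}"
    have W: "W \<in> sets lebesgue" "W \<subseteq> cell i x"
    proof -
      have "W = cell i x \<inter> (\<Union>i'\<in>{i<..}. G i')" by (auto simp: W_def)
      then show "W \<in> sets lebesgue" "W \<subseteq> cell i x" using G_sets by auto
    qed
    have cx: "cell i x - W = core i \<inter> cell i x"
    proof -
      have "y \<in> G i" if "y \<in> cell i x" for y
        using cellwiseD[OF G_cellwise that] x by simp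
      then show ?thesis by (auto simp: W_def core_def)
    qed
    have "emeasure M (cell i x) \<le> ennreal \<kappa> * emeasure M (cell i x - W)"
    proof (rule A_inf)
      have l: "2 * emeasure lebesgue W \<le> ennreal (vol i)" using sparse[OF x] unfolding W_def lebesgue_cell .
      have "emeasure lebesgue W \<le> ennreal (vol i)"
        using emeasure_mono[OF W(2), of lebesgue] by (simp add: lebesgue_cell)
      then obtain w where w: "emeasure lebesgue W = ennreal w" "0 \<le> w" by (cases "emeasure lebesgue W") (auto simp: top_unique)
      have w2: "2 * w \<le> vol i"
      proof -
        have "ennreal (2 * w) = 2 * ennreal w" using w by (subst ennreal_mult) auto
        then have "ennreal (2 * w) \<le> ennreal (vol i)" using l w by simp
        then show ?thesis using vol_pos[of i] by (subst (asm) ennreal_le_iff) auto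
      qed
      have "emeasure lebesgue (cell i x - W) = ennreal (vol i - w)"
        using W w by (subst emeasure_Diff) (auto simp: lebesgue_cell ennreal_minus)
      moreover have "ennreal (vol i) \<le> ennreal (2 * (vol i - w))" using w2 by (intro ennreal_leI) auto
      moreover have "ennreal (2 * (vol i - w)) = 2 * ennreal (vol i - w)" using w2 w by (subst ennreal_mult) auto
      ultimately show "emeasure lebesgue (cell i x) \<le> 2 * emeasure lebesgue (cell i x - W)"
        by (simp add: lebesgue_cell)
    qed (use W in auto)
    then have "emeasure M (cell i x) \<le> ennreal \<kappa> * emeasure M (core i \<inter> cell i x)" unfolding cx .
    moreover have "(\<integral>\<^sup>+y\<in>cell i x. (ennreal \<kappa> * indicator (core i) y) \<partial>M) = ennreal \<kappa> * emeasure M (core i \<inter> cell i x)"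
    proof -
      have "(\<integral>\<^sup>+y\<in>cell i x. (ennreal \<kappa> * indicator (core i) y) \<partial>M) = (\<integral>\<^sup>+y\<in>core i \<inter> cell i x. ennreal \<kappa> \<partial>M)"
        by (intro nn_integral_cong) (auto simp: indicator_def)
      then show ?thesis by (subst (asm) nn_integral_cmult_indicator) auto
    qed
    ultimately show "(\<integral>\<^sup>+y\<in>cell i x. 1 \<partial>M) \<le> (\<integral>\<^sup>+y\<in>cell i x. (ennreal \<kappa> * indicator (core i) y) \<partial>M)"
      by simp
  qed auto
  also have "\<dots> = (\<integral>\<^sup>+x. ennreal \<kappa> * (indicator (core i) x * \<phi> x) \<partial>M)"
    by (intro nn_integral_cong) (auto simp: indicator_def core_def mult.commute)
  also have "\<dots> = ennreal \<kappa> * (\<integral>\<^sup>+x. indicator (core i) x * \<phi> x \<partial>M)"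
    by (rule nn_integral_cmult) measurable
  finally show ?thesis by simp
qed

lemma suminf_core:
  assumes "x \<in> core i"
  shows "(\<Sum>i. indicator (core i) x * (f i :: ennreal)) = f i"
proof -
  have "(\<lambda>k. indicator (core k) x * f k) = (\<lambda>k. if k = i then f k else 0)"
    using assms core_unique by (fastforce simp: indicator_def)
  then show ?thesis using sums_single[of i f] by (simp add: sums_iff)
qed

lemma suminf_core_le:
  assumes "\<And>i. f i \<le> (l :: ennreal)"
  shows "(\<Sum>i. indicator (core i) x * f i) \<le> l"
proof (cases "\<exists>i. x \<in> core i")
  case True
  then obtain i where "x \<in> core i" by blast
  then show ?thesis using suminf_core[of x i f] assms[of i] by simp
qed (auto simp: indicator_def)

lemma suminf_core_powe:
  assumes "0 < q"
  shows "(\<Sum>i. indicator (core i) x * f i) powe q = (\<Sum>i. indicator (core i) x * (f i powe q))"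
proof (cases "\<exists>i. x \<in> core i")
  case True
  then obtain i where "x \<in> core i" by blast
  then show ?thesis using suminf_core[of x i f] suminf_core[of x i "\<lambda>i. f i powe q"] by simp
qed (auto simp: indicator_def)

end

end

definition max_const :: "real \<Rightarrow> real"
  where "max_const s = 2 powr (2 * s) / (1 - 2 powr (1 - s))"

text \<open>For \<open>q > 1\<close> the exponent \<open>s\<close> is the midpoint of 1 and
  \<open>q'\<close>: \<open>s > 1\<close> leaves a finite conjugate exponent for the moment of the
  oscillation, and \<open>s < q'\<close> leaves room for the maximal theorem with exponent
  \<open>q' / s\<close>.\<close>

definition embed_const :: "nat \<Rightarrow> real \<Rightarrow> real \<Rightarrow> real"
  where "embed_const N \<kappa> q = (if q \<le> 1 then jn_const N \<kappa> q else
    let q' = q / (q - 1); s = (1 + q') / 2; s' = s / (s - 1) in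
      (\<kappa> * jn_const N \<kappa> s' powr (1 / s') * max_const (q' / s) powr (1 - 1 / q)) powr q)"

lemma max_const_nonneg: "1 < s \<Longrightarrow> 0 \<le> max_const s"
  using powr_less_mono[of "1 - s" 0 2] by (simp add: max_const_def)

section \<open>Moments of the oscillation and sparse sums that contain it\<close>

context dyadic_bmo
begin

text \<open>The summand \<open>\<beta>\<close> bounds \<open>B\<close> from below, so that
  differences of the constants \<open>bm\<close>, which are multiples of \<open>\<beta>\<close>, are
  absorbed into a multiple of \<open>B\<close>.\<close>

definition B :: "nat \<Rightarrow> real ^ 'n \<Rightarrow> ennreal"
  where "B i x = ennreal (cmod (b x - bm i x) + \<beta>)"

lemma bm_measurable: "sets N = sets lebesgue \<Longrightarrow> bm i \<in> borel_measurable N"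
  by (rule borel_measurable_cellwise[OF _ bm_cellwise])

lemma B_measurable [measurable]: "B i \<in> borel_measurable lebesgue" "B i \<in> borel_measurable M"
proof -
  note [measurable] = bm_measurable[OF refl]
  show *: "B i \<in> borel_measurable lebesgue" unfolding B_def[abs_def] by measurable
  then show "B i \<in> borel_measurable M" using sets_M measurable_cong_sets by blast
qed

lemma jn_rate_pos: "0 < jn_rate CARD('n) \<kappa>"
  unfolding jn_rate_def using gamma L_pos[of "CARD('n)"] ln_less_zero[OF gamma]
  by (intro divide_pos_pos) linarith+

lemma jn_rate_ratio: "exp (jn_rate CARD('n) \<kappa> * jn_step CARD('n)) * \<gamma> = sqrt \<gamma>"
proof -
  have "jn_rate CARD('n) \<kappa> * jn_step CARD('n) = - (ln \<gamma> / 2)"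
    using L_pos[of "CARD('n)"] by (simp add: jn_rate_def)
  moreover have "\<gamma> = exp (ln \<gamma>)" using gamma by simp
  moreover have "sqrt \<gamma> = exp (ln \<gamma> / 2)"
    using gamma by (simp add: powr_half_sqrt[symmetric] powr_def)
  ultimately show ?thesis by (metis (no_types, opaque_lifting) exp_add add.commute field_sum_of_halves add_diff_cancel_left' uminus_add_conv_diff)
qed

lemma jn_const_nonneg: "0 \<le> jn_const CARD('n) \<kappa> s"
proof -
  have "sqrt \<gamma> < 1" using gamma by simp
  then show ?thesis unfolding jn_const_def by (intro mult_nonneg_nonneg add_nonneg_nonneg divide_nonneg_nonneg) auto
qed

text \<open>A power is bounded by an exponential, and the exponential by a step function on the
  John-Nirenberg level sets; the rate is small enough for the resulting series to converge.\<close>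

lemma B_moment:
  assumes s: "0 < s"
  shows "(\<integral>\<^sup>+y\<in>cell i x. (B i y powe s) \<partial>M)
    \<le> ennreal (jn_const CARD('n) \<kappa> s * \<beta> powr s) * emeasure M (cell i x)"
proof -
  define d where "d = jn_rate CARD('n) \<kappa>"
  define L where "L = jn_step CARD('n)"
  have d: "0 < d" "0 < L" using jn_rate_pos L_pos by (auto simp: d_def L_def)
  define H where "H k = {y\<in>cell i x. (2 + real k * L) * \<beta> < cmod (b y - bm i x)}" for k
  define A where "A = (s / d) powr s * \<beta> powr s"
  have A: "0 \<le> A" by (simp add: A_def)
  have Hm [measurable]: "H k \<in> sets M" for k
  proof -
    have "{y\<in>space M. y \<in> cell i x \<and> (2 + real k * L) * \<beta> < cmod (b y - bm i x)} \<in> sets M" by measurable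
    moreover have "{y\<in>space M. y \<in> cell i x \<and> (2 + real k * L) * \<beta> < cmod (b y - bm i x)} = H k"
      using space_M[OF sets_M] by (auto simp: H_def)
    ultimately show "H k \<in> sets M" by (rule back_subst[of "\<lambda>S. S \<in> sets M"])
  qed
  \<comment> \<open>From \<open>z \<le> exp z\<close> at \<open>z = d * (v + 1) / s\<close>, raised
    to the power \<open>s\<close>. Here \<open>v\<close> is the distance of \<open>b\<close> to the
    constant in units of \<open>\<beta>\<close>.\<close>
  have ex: "(v * \<beta> + \<beta>) powr s \<le> A * exp (d * (v + 1))" if v: "0 \<le> v" for v
  proof -
    have "d * (v + 1) / s \<le> exp (d * (v + 1) / s)" using exp_ge_add_one_self[of "d * (v + 1) / s"] by linarith
    then have "(d * (v + 1) / s) powr s \<le> exp (d * (v + 1) / s) powr s"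
      using d s v by (intro powr_mono2) auto
    also have "\<dots> = exp (d * (v + 1))" using s by (simp add: powr_def)
    finally have "(s / d) powr s * \<beta> powr s * (d * (v + 1) / s) powr s \<le> A * exp (d * (v + 1))"
      unfolding A_def by (intro mult_left_mono) auto
    moreover have "(s / d) powr s * \<beta> powr s * (d * (v + 1) / s) powr s = (s / d * \<beta> * (d * (v + 1) / s)) powr s"
      using d s v beta by (subst powr_mult, simp_all del: times_divide_eq_left times_divide_eq_right add: powr_mult)
    moreover have "s / d * \<beta> * (d * (v + 1) / s) = v * \<beta> + \<beta>" using d s by (simp add: field_simps)
    ultimately show ?thesis by simp
  qed
  define w where "w k = exp (d * (3 + real (Suc k) * L))" for k
  have pt: "B i y powe s * indicator (cell i x) y
    \<le> ennreal A * (ennreal (exp (3 * d)) * indicator (cell i x) y + (\<Sum>k. ennreal (w k) * indicator (H k) y))" for y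
  proof (cases "y \<in> cell i x")
    case True
    define u where "u = cmod (b y - bm i x)"
    have B: "B i y = ennreal (u + \<beta>)" using cellwiseD[OF bm_cellwise True] by (simp add: B_def u_def)
    define v where "v = u / \<beta>"
    have v: "0 \<le> v" "u = v * \<beta>" using beta by (auto simp: v_def u_def)
    have Bs: "B i y powe s \<le> ennreal A * ennreal (exp (d * (v + 1)))"
      using ex[OF v(1)] A v beta by (simp add: B powe_ennreal ennreal_mult[symmetric] ennreal_leI del: ennreal_plus)
    show ?thesis
    proof (cases "v \<le> 2")
      case True
      then have "exp (d * (v + 1)) \<le> exp (3 * d)" using d by (simp add: mult.commute)
      then have "ennreal (exp (d * (v + 1))) \<le> ennreal (exp (3 * d)) * indicator (cell i x) y"
        using \<open>y \<in> cell i x\<close> by (simp add: ennreal_leI)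
      also have "\<dots> \<le> ennreal (exp (3 * d)) * indicator (cell i x) y + (\<Sum>k. ennreal (w k) * indicator (H k) y)" by simp
      finally have "ennreal A * ennreal (exp (d * (v + 1)))
        \<le> ennreal A * (ennreal (exp (3 * d)) * indicator (cell i x) y + (\<Sum>k. ennreal (w k) * indicator (H k) y))"
        by (rule mult_left_mono) simp
      with Bs have "B i y powe s
        \<le> ennreal A * (ennreal (exp (3 * d)) * indicator (cell i x) y + (\<Sum>k. ennreal (w k) * indicator (H k) y))"
        by (rule order_trans)
      moreover have "B i y powe s * indicator (cell i x) y = B i y powe s" using \<open>y \<in> cell i x\<close> by simp
      ultimately show ?thesis by (simp only:)
    next
      case False
      \<comment> \<open>The last level exceeded:
        \<open>2 + k * L < v \<le> 2 + (k + 1) * L\<close>.\<close>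
      define k where "k = nat (\<lceil>(v - 2) / L\<rceil> - 1)"
      have "0 < (v - 2) / L" using False d by simp
      then have k: "real k < (v - 2) / L" "(v - 2) / L \<le> real (Suc k)" unfolding k_def by linarith+
      then have k': "2 + real k * L < v" "v + 1 \<le> 3 + real (Suc k) * L" using d by (auto simp: field_simps)
      have "y \<in> H k" using k'(1) True beta v by (auto simp: H_def u_def[symmetric])
      have "ennreal (exp (d * (v + 1))) \<le> ennreal (w k) * indicator (H k) y"
        using k'(2) d \<open>y \<in> H k\<close> by (auto simp: w_def intro!: ennreal_leI)
      also have "\<dots> \<le> (\<Sum>k. ennreal (w k) * indicator (H k) y)"
        by (rule ennreal_le_suminf)
      also have "\<dots> \<le> ennreal (exp (3 * d)) * indicator (cell i x) y + (\<Sum>k. ennreal (w k) * indicator (H k) y)" by simp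
      finally have "ennreal A * ennreal (exp (d * (v + 1)))
        \<le> ennreal A * (ennreal (exp (3 * d)) * indicator (cell i x) y + (\<Sum>k. ennreal (w k) * indicator (H k) y))"
        by (rule mult_left_mono) simp
      with Bs have "B i y powe s
        \<le> ennreal A * (ennreal (exp (3 * d)) * indicator (cell i x) y + (\<Sum>k. ennreal (w k) * indicator (H k) y))"
        by (rule order_trans)
      moreover have "B i y powe s * indicator (cell i x) y = B i y powe s" using \<open>y \<in> cell i x\<close> by simp
      ultimately show ?thesis by (simp only:)
    qed
  qed simp
  have HM: "emeasure M (H k) \<le> ennreal (\<gamma> ^ k) * emeasure M (cell i x)" for k
    unfolding H_def L_def by (rule John_Nirenberg)
  have "(\<integral>\<^sup>+y\<in>cell i x. (B i y powe s) \<partial>M)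
    \<le> (\<integral>\<^sup>+y. ennreal A * (ennreal (exp (3 * d)) * indicator (cell i x) y + (\<Sum>k. ennreal (w k) * indicator (H k) y)) \<partial>M)"
    by (intro nn_integral_mono pt)
  also have "\<dots> = ennreal A * (ennreal (exp (3 * d)) * emeasure M (cell i x) + (\<Sum>k. ennreal (w k) * emeasure M (H k)))"
    by (simp add: nn_integral_cmult nn_integral_add nn_integral_suminf nn_integral_cmult_indicator)
  also have "\<dots> \<le> ennreal A * (ennreal (exp (3 * d)) * emeasure M (cell i x) + (\<Sum>k. ennreal (w k) * (ennreal (\<gamma> ^ k) * emeasure M (cell i x))))"
    by (intro mult_left_mono add_left_mono suminf_le HM) auto
  also have "(\<Sum>k. ennreal (w k) * (ennreal (\<gamma> ^ k) * emeasure M (cell i x))) = (\<Sum>k. ennreal (w k * \<gamma> ^ k)) * emeasure M (cell i x)"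
    using gamma by (simp add: w_def ennreal_mult mult.assoc flip: ennreal_suminf_multc)
  also have "(\<Sum>k. ennreal (w k * \<gamma> ^ k)) = ennreal (exp (d * (3 + L)) * (1 / (1 - sqrt \<gamma>)))"
  proof (rule suminf_ennreal_eq)
    have "(\<lambda>k. exp (d * (3 + L)) * sqrt \<gamma> ^ k) sums (exp (d * (3 + L)) * (1 / (1 - sqrt \<gamma>)))"
      using gamma by (intro sums_mult geometric_sums) auto
    moreover have "w k * \<gamma> ^ k = exp (d * (3 + L)) * sqrt \<gamma> ^ k" for k
    proof -
      have "w k = exp (d * (3 + L)) * exp (d * L) ^ k"
        by (simp add: w_def exp_add[symmetric] exp_of_nat_mult[symmetric] algebra_simps)
      then show ?thesis using jn_rate_ratio by (simp add: power_mult_distrib[symmetric] d_def L_def)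
    qed
    ultimately show "(\<lambda>k. w k * \<gamma> ^ k) sums (exp (d * (3 + L)) * (1 / (1 - sqrt \<gamma>)))" by simp
  qed (use gamma in \<open>simp add: w_def\<close>)
  also have "ennreal A * (ennreal (exp (3 * d)) * emeasure M (cell i x) + ennreal (exp (d * (3 + L)) * (1 / (1 - sqrt \<gamma>))) * emeasure M (cell i x))
    = ennreal (jn_const CARD('n) \<kappa> s * \<beta> powr s) * emeasure M (cell i x)"
  proof -
    have g: "0 \<le> exp (d * (3 + L)) * (1 / (1 - sqrt \<gamma>))" using gamma by simp
    have "jn_const CARD('n) \<kappa> s * \<beta> powr s = A * (exp (3 * d) + exp (d * (3 + L)) * (1 / (1 - sqrt \<gamma>)))"
      by (simp add: jn_const_def A_def d_def L_def mult_ac)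
    then show ?thesis using A g
      by (simp only: ennreal_mult ennreal_plus distrib_right[symmetric] mult.assoc exp_ge_zero add_nonneg_nonneg)
  qed
  finally show ?thesis .
qed

context
  fixes G :: "nat \<Rightarrow> (real ^ 'n) set" and a :: "nat \<Rightarrow> real ^ 'n \<Rightarrow> ennreal"
  assumes G_cellwise: "\<And>i. cellwise i (\<lambda>x. x \<in> G i)"
    and sparse: "\<And>i x. x \<in> G i \<Longrightarrow> 2 * emeasure lebesgue {y\<in>cell i x. \<exists>i'>i. y \<in> G i'} \<le> emeasure lebesgue (cell i x)"
    and a_cellwise: "\<And>i. cellwise i (a i)"
begin

lemma a_measurable [measurable]: "a i \<in> borel_measurable M"
  by (rule borel_measurable_cellwise[OF sets_M a_cellwise])

lemma sparse_sum_measurable [measurable]: "(\<lambda>x. \<Sum>i. indicator (G i) x * a i x * B i x) \<in> borel_measurable M"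
proof -
  note [measurable] = G_sets(2)[OF G_cellwise sparse]
  have "(\<lambda>x. indicator (G i) x * a i x * B i x) \<in> borel_measurable M" for i
    by (intro borel_measurable_times_ennreal borel_measurable_indicator a_measurable B_measurable(2)) simp
  then show ?thesis by (rule borel_measurable_suminf_order)
qed

text \<open>For \<open>q \<le> 1\<close> the power passes inside the sum and each generation is
  integrated by itself: \<open>a i\<close> is constant on a cell, so only the moment of
  \<open>B i\<close> of order \<open>q\<close> enters.\<close>

lemma sparse_sum_bound_le1:
  assumes q: "0 < q" "q \<le> 1"
  shows "(\<integral>\<^sup>+x. (\<Sum>i. indicator (G i) x * a i x * B i x) powe q \<partial>M)
    \<le> ennreal (jn_const CARD('n) \<kappa> q * \<beta> powr q) * (\<Sum>i. \<integral>\<^sup>+x. indicator (G i) x * a i x powe q \<partial>M)"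
proof -
  note [measurable] = G_sets(2)[OF G_cellwise sparse]
  let ?C = "ennreal (jn_const CARD('n) \<kappa> q * \<beta> powr q)"
  have "(\<integral>\<^sup>+x. (\<Sum>i. indicator (G i) x * a i x * B i x) powe q \<partial>M)
    \<le> (\<integral>\<^sup>+x. (\<Sum>i. (indicator (G i) x * a i x powe q) * B i x powe q) \<partial>M)"
  proof (rule nn_integral_mono)
    fix x
    have "(\<Sum>i. indicator (G i) x * a i x * B i x) powe q \<le> (\<Sum>i. (indicator (G i) x * a i x * B i x) powe q)"
      by (rule powe_suminf_le_concave[OF q])
    also have "\<dots> = (\<Sum>i. (indicator (G i) x * a i x powe q) * B i x powe q)"
      using q by (intro suminf_cong) (auto simp: powe_mult indicator_def)
    finally show "(\<Sum>i. indicator (G i) x * a i x * B i x) powe q \<le> (\<Sum>i. (indicator (G i) x * a i x powe q) * B i x powe q)" .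
  qed
  also have "\<dots> = (\<Sum>i. \<integral>\<^sup>+x. (indicator (G i) x * a i x powe q) * B i x powe q \<partial>M)"
    by (rule nn_integral_suminf, intro borel_measurable_times_ennreal borel_measurable_indicator measurable_powe a_measurable B_measurable(2)) simp
  also have "\<dots> \<le> (\<Sum>i. \<integral>\<^sup>+x. (indicator (G i) x * a i x powe q) * ?C \<partial>M)"
  proof (intro suminf_le)
    fix i
    show "(\<integral>\<^sup>+x. (indicator (G i) x * a i x powe q) * B i x powe q \<partial>M) \<le> (\<integral>\<^sup>+x. (indicator (G i) x * a i x powe q) * ?C \<partial>M)"
    proof (rule nn_integral_cellwise_mono[OF sets_M, where i=i])
      show "cellwise i (\<lambda>x. indicator (G i) x * a i x powe q)"
        by (rule cellwise_comp2[where op="(*)", OF cellwise_indicator[OF G_cellwise] cellwise_comp[OF a_cellwise]])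
      fix x
      show "(\<integral>\<^sup>+y\<in>cell i x. (B i y powe q) \<partial>M) \<le> (\<integral>\<^sup>+y\<in>cell i x. ?C \<partial>M)"
        using B_moment[OF q(1), of i x] nn_integral_cmult_indicator[of "cell i x" M ?C] by simp
    qed auto
  qed auto
  also have "\<dots> = ?C * (\<Sum>i. \<integral>\<^sup>+x. indicator (G i) x * a i x powe q \<partial>M)"
    by (subst nn_integral_multc) (auto simp: mult.commute)
  finally show ?thesis .
qed

text \<open>On a cell, the average of \<open>B i\<close> times a test function \<open>H\<close> is
  at most a moment of \<open>B i\<close> times an average of order \<open>s > 1\<close> of
  \<open>H\<close>. Now all factors are cellwise, so the cells may be shrunk to their disjoint cores
  before the averages of \<open>H\<close> are replaced by a maximal function.\<close>

lemma sparse_sum_bound_gt1: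
  assumes q: "1 < q"
  shows "(\<integral>\<^sup>+x. (\<Sum>i. indicator (G i) x * a i x * B i x) powe q \<partial>M)
    \<le> ennreal (embed_const CARD('n) \<kappa> q * \<beta> powr q) * (\<Sum>i. \<integral>\<^sup>+x. indicator (G i) x * a i x powe q \<partial>M)"
proof -
  note [measurable] = G_sets(2)[OF G_cellwise sparse] core_sets(2)[OF G_cellwise sparse]
  define q' where "q' = q / (q - 1)"
  define s where "s = (1 + q') / 2"
  define s' where "s' = s / (s - 1)"
  have q': "1 < q'" "1 - 1 / q = 1 / q'" using q by (auto simp: q'_def field_simps)
  have s: "1 < s" "s < q'" "1 < q' / s" using q' by (auto simp: s_def field_simps)
  have s': "1 < s'" "1 - 1 / s' = 1 / s" using s by (auto simp: s'_def field_simps)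
  define J where "J = jn_const CARD('n) \<kappa> s' powr (1 / s') * \<beta>"
  define mc where "mc = max_const (q' / s)"
  define X where "X = (\<Sum>i. \<integral>\<^sup>+x. indicator (G i) x * a i x powe q \<partial>M)"
  define Y where "Y = ennreal (\<kappa> * J * mc powr (1 / q')) * X powe (1 / q)"
  have J: "0 \<le> J" "0 \<le> mc" using beta max_const_nonneg[OF s(3)] by (auto simp: J_def mc_def)
  have BH: "cavg M i (\<lambda>y. B i y * H y) x \<le> ennreal J * cavg M i (\<lambda>y. H y powe s) x powe (1 / s)"
    if [measurable]: "H \<in> borel_measurable M" for H i x
  proof -
    have "cavg M i (\<lambda>y. B i y * H y) x
      \<le> cavg M i (\<lambda>y. B i y powe (1 / (1 / s'))) x powe (1 / s') * cavg M i (\<lambda>y. H y powe (1 / (1 - 1 / s'))) x powe (1 - 1 / s')"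
      using s' by (intro cavg_Holder[OF sets_M]) auto
    also have "\<dots> = cavg M i (\<lambda>y. B i y powe s') x powe (1 / s') * cavg M i (\<lambda>y. H y powe s) x powe (1 / s)"
      using s' s by simp
    also have "\<dots> \<le> ennreal (jn_const CARD('n) \<kappa> s' * \<beta> powr s') powe (1 / s') * cavg M i (\<lambda>y. H y powe s) x powe (1 / s)"
    proof (intro mult_right_mono powe_mono)
      have "cavg M i (\<lambda>y. B i y powe s') x
        \<le> ennreal (jn_const CARD('n) \<kappa> s' * \<beta> powr s') * emeasure M (cell i x) / emeasure M (cell i x)"
        unfolding cavg_def using B_moment[of s' i x] s' by (intro divide_right_mono_ennreal) auto
      also have "\<dots> \<le> ennreal (jn_const CARD('n) \<kappa> s' * \<beta> powr s')"
        using ennreal_mult_divide_eq[of "emeasure M (cell i x)"]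
        by (cases "emeasure M (cell i x) = 0 \<or> emeasure M (cell i x) = top") auto
      finally show "cavg M i (\<lambda>y. B i y powe s') x \<le> ennreal (jn_const CARD('n) \<kappa> s' * \<beta> powr s')" .
    qed (use s' in auto)
    also have "ennreal (jn_const CARD('n) \<kappa> s' * \<beta> powr s') powe (1 / s') = ennreal J"
      using s' beta jn_const_nonneg[of s'] by (simp add: powe_ennreal powr_mult powr_powr J_def)
    finally show ?thesis .
  qed
  have "(\<integral>\<^sup>+x. (\<Sum>i. indicator (G i) x * a i x * B i x) powe q \<partial>M) \<le> Y powe q"
  \<comment> \<open>The cells of generation 0 with label below \<open>N\<close> are finitely many,
    so their union has finite mass; these unions exhaust the space.\<close>
  proof (rule nn_integral_powe_le_by_duality[where V="\<lambda>N. {x. c 0 x < N}"])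
    have V: "{x. c 0 x < N} = c 0 -` {..<N} \<inter> space M" for N using space_M[OF sets_M] by auto
    show Vm: "{x. c 0 x < N} \<in> sets M" for N
      unfolding V by (rule measurable_sets[OF c_measurable[OF sets_M]]) simp
    show "incseq (\<lambda>N. {x. c 0 x < N})" by (auto simp: incseq_def)
    show "(\<Union>N. {x. c 0 x < N}) = space M" using space_M[OF sets_M] by auto
    show "emeasure M {x. c 0 x < N} < top" for N
    proof -
      have cm: "{x. c 0 x = z} \<in> sets M" for z using cell_lebesgue sets_M by simp
      have "emeasure M {x. c 0 x = z} < top" for z
      proof (cases "{x. c 0 x = z} = {}")
        case False
        then obtain x where "c 0 x = z" by auto
        then have "{x. c 0 x = z} = cell 0 x" by (auto simp: cell_def)
        then show ?thesis using finite_M[of 0 x] by simp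
      qed simp
      then have fin: "(\<Sum>z<N. emeasure M {x. c 0 x = z}) < top" by (auto simp: less_top[symmetric])
      have le: "emeasure M (\<Union>z<N. {x. c 0 x = z}) \<le> (\<Sum>z<N. emeasure M {x. c 0 x = z})"
        using cm by (intro emeasure_subadditive_finite) auto
      have eq: "{x. c 0 x < N} = (\<Union>z<N. {x. c 0 x = z})" by auto
      show ?thesis unfolding eq by (rule le_less_trans[OF le fin])
    qed
    fix H :: "real ^ 'n \<Rightarrow> ennreal" assume [measurable]: "H \<in> borel_measurable M"
    define h where "h x = cmax M (\<lambda>y. H y powe s) x powe (1 / s)" for x
    have h [measurable]: "h \<in> borel_measurable M" unfolding h_def[abs_def] using cmax_measurable[OF sets_M] by measurable
    have t: "(\<integral>\<^sup>+x. indicator (G i) x * a i x * B i x * H x \<partial>M) \<le> ennreal (\<kappa> * J) * (\<integral>\<^sup>+x. indicator (core G i) x * a i x * h x \<partial>M)" for i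
    proof -
      have cw: "cellwise i (\<lambda>x. indicator (G i) x * a i x)"
        by (rule cellwise_comp2[where op="(*)", OF cellwise_indicator[OF G_cellwise] a_cellwise])
      have "(\<integral>\<^sup>+x. indicator (G i) x * a i x * B i x * H x \<partial>M) = (\<integral>\<^sup>+x. (indicator (G i) x * a i x) * (B i x * H x) \<partial>M)"
        by (simp add: mult.assoc)
      also have "\<dots> \<le> (\<integral>\<^sup>+x. (indicator (G i) x * a i x) * cavg M i (\<lambda>y. B i y * H y) x \<partial>M)"
        by (rule nn_integral_le_cavg[OF sets_M cw _ finite_M]) measurable
      also have "\<dots> \<le> (\<integral>\<^sup>+x. (indicator (G i) x * a i x) * (ennreal J * cavg M i (\<lambda>y. H y powe s) x powe (1 / s)) \<partial>M)"
        by (intro nn_integral_mono mult_left_mono BH) auto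
      also have "\<dots> = (\<integral>\<^sup>+x. indicator (G i) x * (a i x * (ennreal J * cavg M i (\<lambda>y. H y powe s) x powe (1 / s))) \<partial>M)"
        by (simp add: mult.assoc)
      also have "\<dots> \<le> ennreal \<kappa> * (\<integral>\<^sup>+x. indicator (core G i) x * (a i x * (ennreal J * cavg M i (\<lambda>y. H y powe s) x powe (1 / s))) \<partial>M)"
      proof (rule nn_integral_sparse_le_core[OF G_cellwise sparse])
        show "cellwise i (\<lambda>x. a i x * (ennreal J * cavg M i (\<lambda>y. H y powe s) x powe (1 / s)))"
          by (rule cellwise_comp2[where op="\<lambda>u v. u * (ennreal J * v powe (1 / s))", OF a_cellwise cellwise_cavg])
      qed
      also have "\<dots> \<le> ennreal \<kappa> * (\<integral>\<^sup>+x. ennreal J * (indicator (core G i) x * a i x * h x) \<partial>M)"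
      proof (intro mult_left_mono nn_integral_mono)
        fix x
        have "cavg M i (\<lambda>y. H y powe s) x powe (1 / s) \<le> h x"
          unfolding h_def cmax_def[OF sets_M] using s by (intro powe_mono SUP_upper) auto
        then have "indicator (core G i) x * a i x * ennreal J * cavg M i (\<lambda>y. H y powe s) x powe (1 / s)
          \<le> indicator (core G i) x * a i x * ennreal J * h x" by (rule mult_left_mono) simp
        then show "indicator (core G i) x * (a i x * (ennreal J * cavg M i (\<lambda>y. H y powe s) x powe (1 / s)))
          \<le> ennreal J * (indicator (core G i) x * a i x * h x)" by (simp add: mult_ac)
      qed simp
      also have "\<dots> = ennreal (\<kappa> * J) * (\<integral>\<^sup>+x. indicator (core G i) x * a i x * h x \<partial>M)"
        using J kappa by (subst nn_integral_cmult) (auto simp: ennreal_mult mult.assoc)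
      finally show ?thesis .
    qed
    define S where "S x = (\<Sum>i. indicator (core G i) x * a i x)" for x
    have [measurable]: "S \<in> borel_measurable M" unfolding S_def[abs_def] by measurable
    have "(\<integral>\<^sup>+x. (\<Sum>i. indicator (G i) x * a i x * B i x) * H x \<partial>M) = (\<Sum>i. \<integral>\<^sup>+x. indicator (G i) x * a i x * B i x * H x \<partial>M)"
      by (subst nn_integral_suminf[symmetric]) auto
    also have "\<dots> \<le> (\<Sum>i. ennreal (\<kappa> * J) * (\<integral>\<^sup>+x. indicator (core G i) x * a i x * h x \<partial>M))"
      by (intro suminf_le t) auto
    also have "\<dots> = ennreal (\<kappa> * J) * (\<integral>\<^sup>+x. S x * h x \<partial>M)"
      unfolding S_def by (subst ennreal_suminf_cmult, subst nn_integral_suminf[symmetric]) auto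
    also have "(\<integral>\<^sup>+x. S x * h x \<partial>M) \<le> (\<integral>\<^sup>+x. S x powe q \<partial>M) powe (1 / q) * (\<integral>\<^sup>+x. h x powe q' \<partial>M) powe (1 / q')"
    proof -
      have "(\<integral>\<^sup>+x. S x * h x \<partial>M) = (\<integral>\<^sup>+x. (S x powe q) powe (1 / q) * (h x powe q') powe (1 - 1 / q) \<partial>M)"
        using q q' by (simp add: powe_powe)
      also have "\<dots> \<le> (\<integral>\<^sup>+x. S x powe q \<partial>M) powe (1 / q) * (\<integral>\<^sup>+x. h x powe q' \<partial>M) powe (1 - 1 / q)"
        using q by (intro nn_integral_Holder) auto
      finally show ?thesis using q' by simp
    qed
    finally have le: "(\<integral>\<^sup>+x. (\<Sum>i. indicator (G i) x * a i x * B i x) * H x \<partial>M)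
      \<le> ennreal (\<kappa> * J) * ((\<integral>\<^sup>+x. S x powe q \<partial>M) powe (1 / q) * (\<integral>\<^sup>+x. h x powe q' \<partial>M) powe (1 / q'))"
      by (blast intro: mult_left_mono zero_le)
    have "(\<integral>\<^sup>+x. S x powe q \<partial>M) = (\<Sum>i. \<integral>\<^sup>+x. indicator (core G i) x * a i x powe q \<partial>M)"
    proof -
      have q0: "0 < q" using q by simp
      have m: "(\<lambda>x. indicator (core G i) x * a i x powe q) \<in> borel_measurable M" for i by measurable
      \<comment> \<open>At most one core contains \<open>x\<close>, so the power passes through the
        sum without loss.\<close>
      have "S x powe q = (\<Sum>i. indicator (core G i) x * a i x powe q)" for x
        unfolding S_def by (rule suminf_core_powe[OF G_cellwise sparse q0])
      then show ?thesis by (simp only: nn_integral_suminf[OF m])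
    qed
    also have "\<dots> \<le> X"
      unfolding X_def by (intro suminf_le nn_integral_mono mult_right_mono) (auto simp: core_def[OF G_cellwise sparse] indicator_def)
    finally have leS: "(\<integral>\<^sup>+x. S x powe q \<partial>M) \<le> X" .
    have leh: "(\<integral>\<^sup>+x. h x powe q' \<partial>M) \<le> ennreal mc * (\<integral>\<^sup>+x. H x powe q' \<partial>M)"
    proof -
      have "(\<integral>\<^sup>+x. h x powe q' \<partial>M) = (\<integral>\<^sup>+x. cmax M (\<lambda>y. H y powe s) x powe (q' / s) \<partial>M)"
        using s by (simp add: h_def powe_powe)
      also have "\<dots> \<le> ennreal mc * (\<integral>\<^sup>+x. (H x powe s) powe (q' / s) \<partial>M)"
        unfolding mc_def max_const_def by (rule cmax_strong_type[OF sets_M _ s(3)]) measurable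
      finally show ?thesis using s by (simp add: powe_powe)
    qed
    note le
    also have "ennreal (\<kappa> * J) * ((\<integral>\<^sup>+x. S x powe q \<partial>M) powe (1 / q) * (\<integral>\<^sup>+x. h x powe q' \<partial>M) powe (1 / q'))
      \<le> ennreal (\<kappa> * J) * (X powe (1 / q) * (ennreal mc * (\<integral>\<^sup>+x. H x powe q' \<partial>M)) powe (1 / q'))"
      using q q' by (intro mult_left_mono mult_mono powe_mono leS leh) auto
    also have "\<dots> = Y * (\<integral>\<^sup>+x. H x powe q' \<partial>M) powe (1 / q')"
      using q' J kappa by (simp add: Y_def powe_mult powe_ennreal ennreal_mult mult_ac)
    finally show "(\<integral>\<^sup>+x. (\<Sum>i. indicator (G i) x * a i x * B i x) * H x \<partial>M)
      \<le> Y * (\<integral>\<^sup>+x. H x powe (q / (q - 1)) \<partial>M) powe (1 - 1 / q)"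
      unfolding q'(2) q'_def[symmetric] .
  qed (use q in auto)
  also have "Y powe q = ennreal (embed_const CARD('n) \<kappa> q * \<beta> powr q) * X"
  proof -
    have "(\<kappa> * J * mc powr (1 / q')) powr q = (\<kappa> * jn_const CARD('n) \<kappa> s' powr (1 / s') * mc powr (1 - 1 / q)) powr q * \<beta> powr q"
      using beta kappa J q' by (subst powr_mult[symmetric]) (auto simp: J_def mult_ac)
    also have "\<dots> = embed_const CARD('n) \<kappa> q * \<beta> powr q"
    proof -
      have nq: "\<not> q \<le> 1" using q by simp
      show ?thesis unfolding embed_const_def Let_def if_not_P[OF nq] mc_def s'_def s_def q'_def ..
    qed
    finally show ?thesis using q J kappa by (simp add: Y_def powe_mult powe_powe powe_ennreal)
  qed
  finally show ?thesis unfolding X_def .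
qed

lemma sparse_sum_bound:
  assumes q: "0 < q"
  shows "(\<integral>\<^sup>+x. (\<Sum>i. indicator (G i) x * a i x * B i x) powe q \<partial>M)
    \<le> ennreal (embed_const CARD('n) \<kappa> q * \<beta> powr q) * (\<Sum>i. \<integral>\<^sup>+x. indicator (G i) x * a i x powe q \<partial>M)"
  using sparse_sum_bound_gt1[of q] sparse_sum_bound_le1[of q] q
  by (cases "q \<le> 1") (auto simp: embed_const_def)

end

text \<open>The loss is only linear in the number \<open>d\<close> of generations, hence harmless in
  a geometric series.\<close>

lemma B_descendant_le: "B (i + d) x \<le> ennreal (1 + real d * (1 + 2 ^ CARD('n))) * B i x"
proof -
  have "cmod (b x - bm (i + d) x) \<le> cmod (b x - bm i x) + cmod (bm (i + d) x - bm i x)"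
    using norm_triangle_ineq4[of "b x - bm i x" "bm (i + d) x - bm i x"] by simp
  also have "\<dots> \<le> cmod (b x - bm i x) + real d * (1 + 2 ^ CARD('n)) * \<beta>"
    by (intro add_left_mono mean_descendant_diff)
  finally have "cmod (b x - bm (i + d) x) + \<beta>
    \<le> cmod (b x - bm i x) + \<beta> + real d * (1 + 2 ^ CARD('n)) * \<beta>" by simp
  also have "\<dots> \<le> (1 + real d * (1 + 2 ^ CARD('n))) * (cmod (b x - bm i x) + \<beta>)"
    using beta by (simp add: algebra_simps)
  finally show ?thesis unfolding B_def
    using beta by (subst ennreal_mult[symmetric]) (auto intro!: ennreal_leI simp del: ennreal_plus)
qed

end

subsection \<open>Reduction to sparse levels\<close>

text \<open>Put \<open>\<Lambda> = 2 powr (\<alpha> * r * N / (2 * m))\<close>, so that the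
  condition reads \<open>2 * m \<le> \<Lambda>\<close>. If a product of \<open>m\<close> averages,
  each to the power \<open>1 / r\<close>, grows by more than
  \<open>2 powr (\<alpha> * N / 2)\<close>, then one average grows by more than
  \<open>\<Lambda>\<close>, and the weak type bounds of the \<open>m\<close> factors add up to at
  most one half.\<close>

definition sparse_gap :: "real \<Rightarrow> real \<Rightarrow> nat \<Rightarrow> nat \<Rightarrow> bool"
  where "sparse_gap \<alpha> r m N \<longleftrightarrow> 0 < N \<and> 2 * real m \<le> 2 powr (\<alpha> * r * real N / (2 * real m))"

text \<open>The sum of \<open>(d + 1) * z ^ d\<close> for
  \<open>z = 2 powr (- \<alpha> / 2)\<close>, times the rate at which \<open>B\<close> may grow per
  generation.\<close>

definition dom_const :: "nat \<Rightarrow> real \<Rightarrow> real"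
  where "dom_const N \<alpha> = (1 + 2 ^ N) * (1 / (1 - 2 powr (- \<alpha> / 2))\<^sup>2)"

lemma dom_const_nonneg: "0 \<le> dom_const N \<alpha>"
  by (simp add: dom_const_def)

context dyadic
begin

text \<open>A good generation beats all its ancestors by half of the decay that
  \<open>side i powr \<alpha>\<close> provides; the other half is kept for summing the levels that
  are not good.\<close>

definition good :: "real \<Rightarrow> (nat \<Rightarrow> real ^ 'n \<Rightarrow> ennreal) \<Rightarrow> nat \<Rightarrow> (real ^ 'n) set"
  where "good \<alpha> \<sigma> i = {x. \<forall>i'<i. ennreal (2 powr (\<alpha> / 2 * real (i - i'))) * \<sigma> i' x < \<sigma> i x}"

lemma cellwise_good:
  assumes "\<And>i. cellwise i (\<sigma> i)"
  shows "cellwise i (\<lambda>x. x \<in> good \<alpha> \<sigma> i)"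
  unfolding cellwise_def
proof (intro allI impI)
  fix x y assume e: "c i x = c i y"
  have "i' \<le> i \<Longrightarrow> \<sigma> i' x = \<sigma> i' y" for i'
    using nested[OF _ e] assms[of i'] unfolding cellwise_def by blast
  then show "x \<in> good \<alpha> \<sigma> i \<longleftrightarrow> y \<in> good \<alpha> \<sigma> i" by (auto simp: good_def)
qed

text \<open>A level that is not good is dominated, with geometric gain, by the good level obtained by
  going up as far as possible.\<close>

lemma good_ancestor:
  obtains j where "j \<le> i" "x \<in> good \<alpha> \<sigma> j" "\<sigma> i x \<le> ennreal (2 powr (\<alpha> / 2 * real (i - j))) * \<sigma> j x"
proof
  let ?P = "\<lambda>j. j \<le> i \<and> \<sigma> i x \<le> ennreal (2 powr (\<alpha> / 2 * real (i - j))) * \<sigma> j x"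
  define j where "j = (LEAST j. ?P j)"
  have "?P i" by simp
  then have P: "?P j" unfolding j_def by (rule LeastI)
  show "j \<le> i" "\<sigma> i x \<le> ennreal (2 powr (\<alpha> / 2 * real (i - j))) * \<sigma> j x" using P by auto
  show "x \<in> good \<alpha> \<sigma> j"
    unfolding good_def
  proof (clarify, rule ccontr)
    \<comment> \<open>An ancestor \<open>j'\<close> that violates goodness of \<open>j\<close> would
      satisfy \<open>?P\<close> itself, against minimality of \<open>j\<close>.\<close>
    fix j' assume j': "j' < j" "\<not> ennreal (2 powr (\<alpha> / 2 * real (j - j'))) * \<sigma> j' x < \<sigma> j x"
    have "\<sigma> i x \<le> ennreal (2 powr (\<alpha> / 2 * real (i - j))) * \<sigma> j x" using P by auto
    also have "\<dots> \<le> ennreal (2 powr (\<alpha> / 2 * real (i - j))) * (ennreal (2 powr (\<alpha> / 2 * real (j - j'))) * \<sigma> j' x)"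
      using j' by (intro mult_left_mono) auto
    also have "\<dots> = ennreal (2 powr (\<alpha> / 2 * real (i - j'))) * \<sigma> j' x"
    proof -
      have "\<alpha> / 2 * real (i - j) + \<alpha> / 2 * real (j - j') = \<alpha> / 2 * real (i - j')"
      proof -
        have "j \<le> i" "j' \<le> j" "j' \<le> i" using P j' by auto
        then have "real (i - j) = real i - real j" "real (j - j') = real j - real j'" "real (i - j') = real i - real j'"
          by (auto simp: of_nat_diff)
        then show ?thesis by (simp only:) (simp add: field_simps)
      qed
      then have "2 powr (\<alpha> / 2 * real (i - j)) * 2 powr (\<alpha> / 2 * real (j - j')) = (2::real) powr (\<alpha> / 2 * real (i - j'))"
        by (simp only: powr_add[symmetric])
      then show ?thesis by (simp add: mult.assoc[symmetric] ennreal_mult[symmetric])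
    qed
    finally have "?P j'" using P j' by auto
    then show False using j'(1) not_less_Least unfolding j_def by blast
  qed
qed

text \<open>A good cell at least \<open>N\<close> generations below \<open>cell i x\<close> forces
  one of the \<open>m\<close> averages above \<open>\<Lambda>\<close> times its value on
  \<open>cell i x\<close>; the weak type bound measures where this can happen.\<close>

lemma good_descendants_small:
  fixes g :: "'m::finite \<Rightarrow> real ^ 'n \<Rightarrow> ennreal"
  assumes gm: "\<And>j. g j \<in> borel_measurable lebesgue" and \<alpha>: "0 < \<alpha>" and r: "0 < r"
    and \<sigma>: "\<And>i x. \<sigma> i x = (\<Prod>j\<in>UNIV. cavg lebesgue i (g j) x powe (1 / r))"
    and N: "sparse_gap \<alpha> r CARD('m) N"
  shows "2 * emeasure lebesgue {y\<in>cell i x. \<exists>i'\<ge>i + N. y \<in> good \<alpha> \<sigma> i'} \<le> emeasure lebesgue (cell i x)"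
proof -
  note gm [measurable]
  define m where "m = real CARD('m)"
  have m: "0 < m" by (simp add: m_def)
  define \<Lambda> where "\<Lambda> = 2 powr (\<alpha> * r * real N / (2 * m))"
  have \<Lambda>: "0 < \<Lambda>" "2 * m \<le> \<Lambda>" using N by (auto simp: \<Lambda>_def m_def sparse_gap_def)
  define A where "A j = cavg lebesgue i (g j) x" for j
  define S where "S j = {y\<in>cell i x. \<exists>i'\<ge>i. ennreal \<Lambda> * A j < cavg lebesgue i' (g j) y}" for j
  have Sm: "S j \<in> sets lebesgue" for j
  proof -
    have "{y\<in>space lebesgue. y \<in> cell i x \<and> (\<exists>i'\<in>{i..}. ennreal \<Lambda> * A j < cavg lebesgue i' (g j) y)} \<in> sets lebesgue"
      by measurable
    moreover have "{y\<in>space lebesgue. y \<in> cell i x \<and> (\<exists>i'\<in>{i..}. ennreal \<Lambda> * A j < cavg lebesgue i' (g j) y)} = S j"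
      by (auto simp: S_def)
    ultimately show ?thesis by (rule back_subst[of "\<lambda>S. S \<in> sets lebesgue"])
  qed
  have sub: "{y\<in>cell i x. \<exists>i'\<ge>i + N. y \<in> good \<alpha> \<sigma> i'} \<subseteq> (\<Union>j. S j)"
  proof
    fix y assume "y \<in> {y\<in>cell i x. \<exists>i'\<ge>i + N. y \<in> good \<alpha> \<sigma> i'}"
    then obtain i' where y: "y \<in> cell i x" "i + N \<le> i'" "y \<in> good \<alpha> \<sigma> i'" by blast
    have Ay: "cavg lebesgue i (g j) y = A j" for j
      unfolding A_def using y(1) by (rule cellwiseD[OF cellwise_cavg])
    show "y \<in> (\<Union>j. S j)"
    proof (rule ccontr)
      assume "y \<notin> (\<Union>j. S j)"
      then have le: "cavg lebesgue i' (g j) y \<le> ennreal \<Lambda> * A j" for j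
        using y unfolding S_def by (metis (mono_tags, lifting) UNIV_I UN_iff add_leE mem_Collect_eq not_le)
      have "\<sigma> i' y \<le> (\<Prod>j\<in>(UNIV::'m set). (ennreal \<Lambda> * A j) powe (1 / r))"
        unfolding \<sigma> using r le by (intro prod_mono_ennreal powe_mono) auto
      also have "\<dots> = ennreal ((\<Lambda> powr (1 / r)) ^ CARD('m)) * \<sigma> i y"
        using r \<Lambda> by (simp add: \<sigma> powe_mult prod.distrib powe_ennreal Ay ennreal_power)
      also have "(\<Lambda> powr (1 / r)) ^ CARD('m) = \<Lambda> powr (m / r)"
        using \<Lambda> by (subst powr_realpow[symmetric]) (auto simp: powr_powr m_def)
      also have "\<dots> = 2 powr (\<alpha> / 2 * real N)"
        using r m by (simp add: \<Lambda>_def powr_powr)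
      also have "ennreal \<dots> * \<sigma> i y \<le> ennreal (2 powr (\<alpha> / 2 * real (i' - i))) * \<sigma> i y"
        using y(2) \<alpha> by (intro mult_right_mono ennreal_leI powr_mono) auto
      also have "\<dots> < \<sigma> i' y" using y N unfolding good_def sparse_gap_def by simp
      finally show False by simp
    qed
  qed
  have each: "ennreal \<Lambda> * emeasure lebesgue (S j) \<le> ennreal (vol i)" for j
  proof -
    have w: "ennreal \<Lambda> * A j * emeasure lebesgue (S j) \<le> A j * ennreal (vol i)"
    proof -
      have "ennreal \<Lambda> * A j * emeasure lebesgue (S j) \<le> (\<integral>\<^sup>+y\<in>cell i x. g j y \<partial>lebesgue)"
        unfolding S_def by (rule weak_type_cavg[OF refl gm cellwise_in_cell])
      also have "\<dots> = A j * ennreal (vol i)"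
        unfolding A_def using cavg_mult_eq[OF refl gm, of i x j] by (simp add: lebesgue_cell)
      finally show ?thesis .
    qed
    \<comment> \<open>The weak type bound can be divided by \<open>A j\<close> only if that is
      finite and nonzero; otherwise \<open>S j\<close> is empty.\<close>
    consider "A j = 0" | "A j = top" | "A j \<noteq> 0" "A j \<noteq> top" by blast
    then show ?thesis
    proof cases
      case 1
      then have z: "(\<integral>\<^sup>+y\<in>cell i x. g j y \<partial>lebesgue) = 0"
        unfolding A_def cavg_def lebesgue_cell by simp
      have "cavg lebesgue i' (g j) y = 0" if "y \<in> cell i x" "i \<le> i'" for y i'
      proof -
        have "cell i' y \<subseteq> cell i x" using cell_mono[OF that(2), of y] cell_eq[OF that(1)] by simp
        then have "(\<integral>\<^sup>+y\<in>cell i' y. g j y \<partial>lebesgue) \<le> (\<integral>\<^sup>+y\<in>cell i x. g j y \<partial>lebesgue)"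
          by (intro nn_integral_mono) (auto simp: indicator_def)
        then show ?thesis unfolding cavg_def z by simp
      qed
      then have "S j = {}" using 1 by (auto simp: S_def)
      then show ?thesis by simp
    next
      case 2
      then have "S j = {}" using \<Lambda> by (auto simp: S_def ennreal_mult_top)
      then show ?thesis by simp
    next
      case 3
      have "A j * (ennreal \<Lambda> * emeasure lebesgue (S j)) \<le> A j * ennreal (vol i)" using w by (simp add: mult_ac)
      then show ?thesis using 3 by (subst (asm) ennreal_mult_le_mult_iff) auto
    qed
  qed
  have each': "ennreal (2 * m) * emeasure lebesgue (S j) \<le> ennreal (vol i)" for j
    by (rule order_trans[OF mult_right_mono[OF ennreal_leI[OF \<Lambda>(2)]] each]) simp
  have "ennreal m * (2 * emeasure lebesgue (\<Union>j. S j)) \<le> ennreal m * ennreal (vol i)"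
  proof -
    have "emeasure lebesgue (\<Union>j. S j) \<le> (\<Sum>j\<in>UNIV. emeasure lebesgue (S j))"
      by (rule emeasure_subadditive_finite) (use Sm in auto)
    then have "ennreal m * (2 * emeasure lebesgue (\<Union>j. S j)) \<le> ennreal (2 * m) * (\<Sum>j\<in>UNIV. emeasure lebesgue (S j))"
      using m by (simp add: ennreal_mult mult_ac mult_left_mono)
    also have "\<dots> \<le> (\<Sum>j\<in>(UNIV::'m set). ennreal (vol i))"
      unfolding sum_distrib_left by (intro sum_mono each')
    also have "\<dots> = ennreal m * ennreal (vol i)" by (simp add: m_def ennreal_of_nat_eq_real_of_nat)
    finally show ?thesis .
  qed
  then have U: "2 * emeasure lebesgue (\<Union>j. S j) \<le> ennreal (vol i)"
    using m by (subst (asm) ennreal_mult_le_mult_iff) auto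
  have "2 * emeasure lebesgue {y\<in>cell i x. \<exists>i'\<ge>i + N. y \<in> good \<alpha> \<sigma> i'} \<le> 2 * emeasure lebesgue (\<Union>j. S j)"
    using Sm by (intro mult_left_mono emeasure_mono[OF sub]) auto
  with U show ?thesis unfolding lebesgue_cell by (rule order_trans[rotated])
qed

end

context dyadic_bmo
begin

text \<open>Every generation \<open>i\<close> is charged to a good ancestor \<open>j\<close>. With
  \<open>d = i - j\<close> the side gives \<open>2 powr (- \<alpha> * d)\<close>, the passage to the
  ancestor costs \<open>2 powr (\<alpha> * d / 2)\<close> and \<open>B\<close> costs a factor linear
  in \<open>d\<close>, so the charges to one \<open>j\<close> sum up to
  \<open>dom_const\<close>.\<close>

lemma sum_le_good_sum:
  fixes \<sigma> :: "nat \<Rightarrow> real ^ 'n \<Rightarrow> ennreal"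
  assumes \<alpha>: "0 < \<alpha>"
  shows "(\<Sum>i. ennreal (side i powr \<alpha>) * \<sigma> i x * B i x)
    \<le> ennreal (dom_const CARD('n) \<alpha>) * (\<Sum>i. indicator (good \<alpha> \<sigma> i) x * (ennreal (side i powr \<alpha>) * \<sigma> i x) * B i x)"
proof -
  define t where "t i = ennreal (side i powr \<alpha>) * \<sigma> i x * B i x" for i
  define u where "u i = indicator (good \<alpha> \<sigma> i) x * t i" for i
  define z where "z = (2::real) powr (- \<alpha> / 2)"
  have z: "0 < z" "z < 1" using \<alpha> powr_less_mono[of "- \<alpha> / 2" 0 2] by (auto simp: z_def)
  define \<psi> where "\<psi> d = ennreal ((1 + 2 ^ CARD('n)) * (real (Suc d) * z ^ d))" for d :: nat
  have term_le: "t i \<le> (\<Sum>j. u j * (if j \<le> i then \<psi> (i - j) else 0))" for i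
  proof -
    obtain j where j: "j \<le> i" "x \<in> good \<alpha> \<sigma> j" "\<sigma> i x \<le> ennreal (2 powr (\<alpha> / 2 * real (i - j))) * \<sigma> j x"
      by (rule good_ancestor)
    define d where "d = i - j"
    have i: "i = j + d" using j by (simp add: d_def)
    have "side i powr \<alpha> = side j powr \<alpha> * 2 powr (- \<alpha> * real d)"
    proof -
      have "side i = side j * 2 powr (- real d)"
        by (simp add: side_def i power_add powr_minus powr_realpow divide_simps)
      then show ?thesis using side_pos[of j] by (simp add: powr_mult powr_powr mult.commute)
    qed
    then have "t i \<le> ennreal (side j powr \<alpha> * 2 powr (- \<alpha> * real d)) * (ennreal (2 powr (\<alpha> / 2 * real d)) * \<sigma> j x)
      * (ennreal (1 + real d * (1 + 2 ^ CARD('n))) * B j x)"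
      unfolding t_def using j(3) B_descendant_le[of j d x]
      by (intro mult_mono) (auto simp: i)
    also have "\<dots> = t j * ennreal (2 powr (- \<alpha> * real d) * 2 powr (\<alpha> / 2 * real d) * (1 + real d * (1 + 2 ^ CARD('n))))"
    proof -
      have arr: "ennreal (p * a) * (ennreal b * s) * (ennreal k * v) = ennreal p * s * v * ennreal (a * b * k)"
        if "0 \<le> p" "0 \<le> a" "0 \<le> b" "0 \<le> k" for p a b k :: real and s v
        using that by (simp add: ennreal_mult mult_ac)
      show ?thesis unfolding t_def by (rule arr) auto
    qed
    also have "2 powr (- \<alpha> * real d) * 2 powr (\<alpha> / 2 * real d) = z ^ d"
    proof -
      have "z ^ d = z powr real d" using z by (simp add: powr_realpow)
      then show ?thesis by (simp add: z_def powr_powr powr_add[symmetric] algebra_simps)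
    qed
    also have "t j * ennreal (z ^ d * (1 + real d * (1 + 2 ^ CARD('n)))) \<le> t j * \<psi> d"
      unfolding \<psi>_def using z
    proof (intro mult_left_mono ennreal_leI)
      have "1 + real d * (1 + 2 ^ CARD('n)) \<le> (1 + 2 ^ CARD('n)) * real (Suc d)"
        by (simp add: algebra_simps)
      then show "z ^ d * (1 + real d * (1 + 2 ^ CARD('n))) \<le> (1 + 2 ^ CARD('n)) * (real (Suc d) * z ^ d)"
        using z mult_left_mono[of "1 + real d * (1 + 2 ^ CARD('n))" "(1 + 2 ^ CARD('n)) * real (Suc d)" "z ^ d"]
        by (simp add: mult_ac)
    qed auto
    also have "t j * \<psi> d = u j * (if j \<le> i then \<psi> (i - j) else 0)"
      using j by (simp add: u_def d_def)
    also have "\<dots> \<le> (\<Sum>j. u j * (if j \<le> i then \<psi> (i - j) else 0))"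
      by (rule ennreal_le_suminf)
    finally show ?thesis .
  qed
  have tail: "(\<Sum>i. if j \<le> i then \<psi> (i - j) else 0) = (\<Sum>d. \<psi> d)" for j
  proof -
    have "(\<Sum>i. if j \<le> i then \<psi> (i - j) else 0) = (\<Sum>i. (if j \<le> i + j then \<psi> (i + j - j) else 0)) + (\<Sum>i<j. if j \<le> i then \<psi> (i - j) else 0)"
      by (rule suminf_offset) simp
    then show ?thesis by simp
  qed
  have "(\<Sum>i. t i) \<le> (\<Sum>i. \<Sum>j. u j * (if j \<le> i then \<psi> (i - j) else 0))"
    by (intro suminf_le term_le) auto
  also have "\<dots> = (\<Sum>j. \<Sum>i. u j * (if j \<le> i then \<psi> (i - j) else 0))"
    by (rule ennreal_suminf_triangle_swap)
  also have "\<dots> = (\<Sum>j. u j) * (\<Sum>d. \<psi> d)"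
    by (simp add: tail)
  also have "(\<Sum>d. \<psi> d) = ennreal (dom_const CARD('n) \<alpha>)"
    unfolding \<psi>_def dom_const_def z_def[symmetric]
    using z geometric_deriv_sums[of z] by (intro suminf_ennreal_eq sums_mult) auto
  finally show ?thesis unfolding t_def u_def by (simp add: mult_ac)
qed

end

section \<open>Sparse sums of averages in terms of norms\<close>

context dyadic_weight
begin

lemma lebesgue_dyadic_weight: "dyadic_weight c h lebesgue 2"
  by unfold_locales (auto simp: lebesgue_cell)

text \<open>A cellwise function sees a measure only through the masses of cells, so the measure may
  be replaced by a cellwise density. Afterwards the weight hypothesis, which bounds just these
  masses, applies cell by cell, and the maximal theorem is used for Lebesgue measure.\<close>

lemma nn_integral_cellwise_eq_lebesgue:
  assumes "cellwise i \<phi>"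
  shows "(\<integral>\<^sup>+x. \<phi> x \<partial>M) = (\<integral>\<^sup>+x. \<phi> x * (emeasure M (cell i x) / ennreal (vol i)) \<partial>lebesgue)"
proof -
  obtain \<psi> where \<psi>: "\<phi> = (\<lambda>x. \<psi> (c i x))" using cellwise_factor[OF assms] .
  define g where "g x = emeasure M (cell i x) / ennreal (vol i)" for x
  have cg: "cellwise i g" unfolding g_def by (rule cellwise_comp[OF cellwise_cell])
  have gm: "g \<in> borel_measurable lebesgue" by (rule borel_measurable_cellwise[OF refl cg])
  have "(\<integral>\<^sup>+x. \<phi> x \<partial>M) = (\<integral>\<^sup>+x. \<phi> x * 1 \<partial>M)" by simp
  also have "\<dots> = (\<Sum>z. \<psi> z * (\<integral>\<^sup>+x. 1 * indicator {x. c i x = z} x \<partial>M))"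
    by (rule nn_integral_cellwise_cells[OF sets_M _ \<psi>]) simp
  also have "\<dots> = (\<Sum>z. \<psi> z * (\<integral>\<^sup>+x. g x * indicator {x. c i x = z} x \<partial>lebesgue))"
  proof (intro suminf_cong arg_cong2[where f="(*)"] refl)
    fix z
    show "(\<integral>\<^sup>+x. 1 * indicator {x. c i x = z} x \<partial>M) = (\<integral>\<^sup>+x. g x * indicator {x. c i x = z} x \<partial>lebesgue)"
    proof (cases "{x. c i x = z} = {}")
      case False
      then obtain x where x: "{y. c i y = z} = cell i x" by (auto simp: cell_def)
      have "(\<integral>\<^sup>+y. g y * indicator (cell i x) y \<partial>lebesgue) = (\<integral>\<^sup>+y. g x * indicator (cell i x) y \<partial>lebesgue)"
        using cellwiseD[OF cg] by (intro nn_integral_cong) (auto simp: indicator_def)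
      also have "\<dots> = emeasure M (cell i x)"
        using vol_pos[of i] by (subst nn_integral_cmult_indicator) (auto simp: lebesgue_cell g_def ennreal_divide_mult_self)
      finally show ?thesis unfolding x by (simp add: nn_integral_indicator)
    qed simp
  qed
  also have "\<dots> = (\<integral>\<^sup>+x. \<phi> x * g x \<partial>lebesgue)"
    by (rule nn_integral_cellwise_cells[OF refl gm \<psi>, symmetric])
  finally show ?thesis unfolding g_def .
qed

text \<open>As \<open>q > P\<close>, split \<open>Y powe q = Y powe (q - P) * Y powe P\<close>. The
  volume factor left by \<open>q / P > 1\<close> makes the first power at most a power of the
  product of the norms. The second is summed over disjoint cores and bounded by maximal functions,
  whose exponents \<open>p j / e j\<close> exceed 1.\<close>

lemma weighted_sparse_sum:
  fixes F :: "'m::finite \<Rightarrow> real ^ 'n \<Rightarrow> ennreal" and p e :: "'m \<Rightarrow> real"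
  assumes G_cellwise: "\<And>i. cellwise i (\<lambda>x. x \<in> G i)"
    and sparse: "\<And>i x. x \<in> G i \<Longrightarrow> 2 * emeasure lebesgue {y\<in>cell i x. \<exists>i'>i. y \<in> G i'} \<le> emeasure lebesgue (cell i x)"
    and a_cellwise: "\<And>i. cellwise i (a i)"
    and F: "\<And>j. F j \<in> borel_measurable lebesgue"
    and e: "\<And>j. 0 < e j" "\<And>j. e j < p j" and P: "1 / P = (\<Sum>j\<in>UNIV. 1 / p j)" and q: "0 < P" "P < q"
    and w: "\<And>i x. a i x powe q * emeasure M (cell i x)
      \<le> W * ennreal (vol i powr (q / P)) * (\<Prod>j\<in>UNIV. cavg lebesgue i (\<lambda>y. F j y powe e j) x powe (q / e j))"
  shows "(\<Sum>i. \<integral>\<^sup>+x. indicator (G i) x * a i x powe q \<partial>M)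
    \<le> W * ennreal (2 * (\<Prod>j\<in>UNIV. max_const (p j / e j) powr (P / p j)))
      * (\<Prod>j\<in>UNIV. (\<integral>\<^sup>+x. F j x powe p j \<partial>lebesgue) powe (q / p j))"
proof -
  interpret L: dyadic_weight c h lebesgue 2 by (rule lebesgue_dyadic_weight)
  note F [measurable]
  have p: "0 < p j" for j using e(1)[of j] e(2)[of j] by simp
  define I where "I j = (\<integral>\<^sup>+x. F j x powe p j \<partial>lebesgue)" for j
  define NN where "NN = (\<Prod>j\<in>UNIV. I j powe (1 / p j))"
  define Y where "Y i x = (\<Prod>j\<in>UNIV. cavg lebesgue i (\<lambda>y. F j y powe e j) x powe (1 / e j))" for i x
  define mc where "mc = (\<Prod>j\<in>UNIV. max_const (p j / e j) powr (P / p j))"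
  have mc: "0 \<le> mc" unfolding mc_def by (intro prod_nonneg) auto
  have Ycw: "cellwise i (Y i)" for i
    unfolding Y_def by (intro cellwise_prod cellwise_comp[OF cellwise_cavg])
  have [measurable]: "Y i \<in> borel_measurable lebesgue" for i
    by (rule borel_measurable_cellwise[OF refl Ycw])
  have "vol i powr (1 / P) = (\<Prod>j\<in>UNIV. vol i powr (1 / p j))" for i
    unfolding P using vol_pos[of i] by (intro powr_sum) auto
  \<comment> \<open>\<open>vol i powr (1 / P)\<close> is distributed over the factors, and the
    averages are raised from order \<open>e j\<close> to order \<open>p j\<close>, where volume
    times average is an integral.\<close>
  then have volY: "ennreal (vol i powr (1 / P)) * Y i x \<le> NN" for i x
  proof -
    assume "\<And>i. vol i powr (1 / P) = (\<Prod>j\<in>UNIV. vol i powr (1 / p j))"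
    then have "ennreal (vol i powr (1 / P)) * Y i x
      = (\<Prod>j\<in>UNIV. ennreal (vol i powr (1 / p j)) * cavg lebesgue i (\<lambda>y. F j y powe e j) x powe (1 / e j))"
      by (simp add: Y_def prod.distrib prod_ennreal)
    also have "\<dots> \<le> (\<Prod>j\<in>UNIV. I j powe (1 / p j))"
    proof (intro prod_mono_ennreal)
      fix j
      have "ennreal (vol i powr (1 / p j)) * cavg lebesgue i (\<lambda>y. F j y powe e j) x powe (1 / e j)
        \<le> ennreal (vol i) powe (1 / p j) * cavg lebesgue i (\<lambda>y. F j y powe p j) x powe (1 / p j)"
        using vol_pos[of i] e(1)[of j] e(2)[of j] by (intro mult_mono cavg_power_mean[OF refl]) (auto simp: powe_ennreal)
      also have "\<dots> = (cavg lebesgue i (\<lambda>y. F j y powe p j) x * emeasure lebesgue (cell i x)) powe (1 / p j)"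
        using p by (simp add: powe_mult lebesgue_cell mult.commute)
      also have "\<dots> = (\<integral>\<^sup>+y\<in>cell i x. (F j y powe p j) \<partial>lebesgue) powe (1 / p j)"
        by (subst cavg_mult_eq[OF refl]) (auto simp: lebesgue_cell)
      also have "\<dots> \<le> I j powe (1 / p j)"
        unfolding I_def using p by (intro powe_mono nn_integral_mono) (auto simp: indicator_def)
      finally show "ennreal (vol i powr (1 / p j)) * cavg lebesgue i (\<lambda>y. F j y powe e j) x powe (1 / e j) \<le> I j powe (1 / p j)" .
    qed
    finally show ?thesis unfolding NN_def .
  qed
  have acw: "cellwise i (\<lambda>x. indicator (G i) x * a i x powe q)" for i
    by (rule cellwise_comp2[where op="(*)", OF cellwise_indicator[OF G_cellwise] cellwise_comp[OF a_cellwise]])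
  have term_le: "(\<integral>\<^sup>+x. indicator (G i) x * a i x powe q \<partial>M) \<le> W * NN powe (q - P) * (2 * (\<integral>\<^sup>+x. indicator (L.core G i) x * Y i x powe P \<partial>lebesgue))" for i
  proof -
    have pt: "a i x powe q * (emeasure M (cell i x) / ennreal (vol i)) \<le> W * NN powe (q - P) * Y i x powe P" for x
    proof -
      have "a i x powe q * (emeasure M (cell i x) / ennreal (vol i)) = (a i x powe q * emeasure M (cell i x)) * inverse (ennreal (vol i))"
        by (simp add: divide_ennreal_def mult.assoc)
      also have "\<dots> \<le> (W * ennreal (vol i powr (q / P)) * (\<Prod>j\<in>UNIV. cavg lebesgue i (\<lambda>y. F j y powe e j) x powe (q / e j))) * inverse (ennreal (vol i))"
        by (intro mult_right_mono w) auto
      also have "(\<Prod>j\<in>UNIV. cavg lebesgue i (\<lambda>y. F j y powe e j) x powe (q / e j)) = Y i x powe q"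
        unfolding Y_def using q by (simp add: powe_prod powe_powe)
      also have "(W * ennreal (vol i powr (q / P)) * Y i x powe q) * inverse (ennreal (vol i))
        = W * ennreal (vol i powr ((q - P) / P)) * Y i x powe q"
      proof -
        have "vol i powr (q / P) * inverse (vol i) = vol i powr ((q - P) / P)"
        proof -
          have "(q - P) / P = q / P + (- 1)" using q by (simp add: field_simps)
          then show ?thesis using vol_pos[of i] by (simp add: powr_diff divide_inverse)
        qed
        then have "ennreal (vol i powr (q / P)) * inverse (ennreal (vol i)) = ennreal (vol i powr ((q - P) / P))"
          using vol_pos[of i] by (simp add: inverse_ennreal ennreal_mult[symmetric])
        then show ?thesis by (simp add: mult_ac)
      qed
      also have "Y i x powe q = Y i x powe (q - P) * Y i x powe P"
        using powe_add[of "Y i x" "q - P" P] by simp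
      also have "W * ennreal (vol i powr ((q - P) / P)) * (Y i x powe (q - P) * Y i x powe P)
        = W * (ennreal (vol i powr (1 / P)) * Y i x) powe (q - P) * Y i x powe P"
        using q by (simp add: powe_mult powe_ennreal powr_powr mult_ac)
      also have "\<dots> \<le> W * NN powe (q - P) * Y i x powe P"
        using q by (intro mult_right_mono mult_left_mono powe_mono volY) auto
      finally show ?thesis .
    qed
    have "(\<integral>\<^sup>+x. indicator (G i) x * a i x powe q \<partial>M)
      = (\<integral>\<^sup>+x. indicator (G i) x * (a i x powe q * (emeasure M (cell i x) / ennreal (vol i))) \<partial>lebesgue)"
      by (subst nn_integral_cellwise_eq_lebesgue[OF acw]) (simp add: mult.assoc)
    also have "\<dots> \<le> (\<integral>\<^sup>+x. indicator (G i) x * (W * NN powe (q - P) * Y i x powe P) \<partial>lebesgue)"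
      by (intro nn_integral_mono mult_left_mono pt) auto
    also have "\<dots> \<le> ennreal 2 * (\<integral>\<^sup>+x. indicator (L.core G i) x * (W * NN powe (q - P) * Y i x powe P) \<partial>lebesgue)"
      by (rule L.nn_integral_sparse_le_core[OF G_cellwise sparse]) (assumption, rule cellwise_comp[OF Ycw])
    also have "\<dots> = ennreal 2 * (\<integral>\<^sup>+x. (W * NN powe (q - P)) * (indicator (L.core G i) x * Y i x powe P) \<partial>lebesgue)"
      by (simp add: mult_ac)
    also have "\<dots> = ennreal 2 * ((W * NN powe (q - P)) * (\<integral>\<^sup>+x. indicator (L.core G i) x * Y i x powe P \<partial>lebesgue))"
      using L.core_sets(1)[OF G_cellwise sparse] by (subst nn_integral_cmult) auto
    finally show ?thesis by (simp add: mult_ac)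
  qed
  have "(\<Sum>i. \<integral>\<^sup>+x. indicator (G i) x * a i x powe q \<partial>M)
    \<le> (\<Sum>i. W * NN powe (q - P) * (2 * (\<integral>\<^sup>+x. indicator (L.core G i) x * Y i x powe P \<partial>lebesgue)))"
    by (intro suminf_le term_le) auto
  also have "\<dots> = W * NN powe (q - P) * (2 * (\<Sum>i. \<integral>\<^sup>+x. indicator (L.core G i) x * Y i x powe P \<partial>lebesgue))"
    by simp
  also have "(\<Sum>i. \<integral>\<^sup>+x. indicator (L.core G i) x * Y i x powe P \<partial>lebesgue)
    = (\<integral>\<^sup>+x. (\<Sum>i. indicator (L.core G i) x * Y i x powe P) \<partial>lebesgue)"
    using L.core_sets(1)[OF G_cellwise sparse] by (subst nn_integral_suminf) auto
  also have "\<dots> \<le> (\<integral>\<^sup>+x. (\<Prod>j\<in>UNIV. (cmax lebesgue (\<lambda>y. F j y powe e j) x powe (p j / e j)) powe (P / p j)) \<partial>lebesgue)"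
  proof (intro nn_integral_mono L.suminf_core_le[OF G_cellwise sparse])
    fix x i
    have "Y i x powe P = (\<Prod>j\<in>UNIV. cavg lebesgue i (\<lambda>y. F j y powe e j) x powe (P / e j))"
      using q by (simp add: Y_def powe_prod powe_powe)
    also have "\<dots> \<le> (\<Prod>j\<in>UNIV. cmax lebesgue (\<lambda>y. F j y powe e j) x powe (P / e j))"
      using q e(1) unfolding cmax_def[OF refl] by (intro prod_mono_ennreal powe_mono SUP_upper) auto
    also have "\<dots> = (\<Prod>j\<in>UNIV. (cmax lebesgue (\<lambda>y. F j y powe e j) x powe (p j / e j)) powe (P / p j))"
    proof (intro prod.cong refl)
      fix j
      have "p j / e j * (P / p j) = P / e j" using p[of j] by simp
      then show "cmax lebesgue (\<lambda>y. F j y powe e j) x powe (P / e j) = (cmax lebesgue (\<lambda>y. F j y powe e j) x powe (p j / e j)) powe (P / p j)"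
        by (simp only: powe_powe)
    qed
    finally show "Y i x powe P \<le> (\<Prod>j\<in>UNIV. (cmax lebesgue (\<lambda>y. F j y powe e j) x powe (p j / e j)) powe (P / p j))" .
  qed
  also have "\<dots> \<le> (\<Prod>j\<in>UNIV. (\<integral>\<^sup>+x. cmax lebesgue (\<lambda>y. F j y powe e j) x powe (p j / e j) \<partial>lebesgue) powe (P / p j))"
  proof (rule nn_integral_Holder_prod)
    have "(\<Sum>j\<in>UNIV. P / p j) = P * (\<Sum>j\<in>UNIV. 1 / p j)" by (simp add: sum_distrib_left)
    also have "\<dots> = 1" using q by (simp add: P[symmetric])
    finally show "(\<Sum>j\<in>UNIV. P / p j) = 1" .
    show "(\<lambda>x. cmax lebesgue (\<lambda>y. F j y powe e j) x powe (p j / e j)) \<in> borel_measurable lebesgue" for j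
      by (intro measurable_powe cmax_measurable[OF refl])
  qed (use p q in auto)
  also have "\<dots> \<le> (\<Prod>j\<in>UNIV. (ennreal (max_const (p j / e j)) * I j) powe (P / p j))"
  proof (intro prod_mono_ennreal powe_mono)
    fix j
    have s: "1 < p j / e j" using e(1)[of j] e(2)[of j] by simp
    have "(\<integral>\<^sup>+x. cmax lebesgue (\<lambda>y. F j y powe e j) x powe (p j / e j) \<partial>lebesgue)
      \<le> ennreal (max_const (p j / e j)) * (\<integral>\<^sup>+x. (F j x powe e j) powe (p j / e j) \<partial>lebesgue)"
      unfolding max_const_def by (rule cmax_strong_type[OF refl _ s]) measurable
    then show "(\<integral>\<^sup>+x. cmax lebesgue (\<lambda>y. F j y powe e j) x powe (p j / e j) \<partial>lebesgue) \<le> ennreal (max_const (p j / e j)) * I j"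
      using e(1)[of j] by (simp add: powe_powe I_def)
  qed (use p q in auto)
  also have "\<dots> = ennreal mc * NN powe P"
  proof -
    have "(ennreal (max_const (p j / e j)) * I j) powe (P / p j)
      = ennreal (max_const (p j / e j) powr (P / p j)) * (I j powe (1 / p j)) powe P" for j
    proof -
      have s: "1 < p j / e j" using e(1)[of j] e(2)[of j] by simp
      then show ?thesis using q p[of j] by (simp add: powe_mult powe_powe powe_ennreal max_const_nonneg)
    qed
    then show ?thesis using q by (simp add: prod.distrib prod_ennreal mc_def NN_def powe_prod)
  qed
  finally have "(\<Sum>i. \<integral>\<^sup>+x. indicator (G i) x * a i x powe q \<partial>M) \<le> W * NN powe (q - P) * (2 * (ennreal mc * NN powe P))"
    by (blast intro: mult_left_mono zero_le)
  also have "\<dots> = W * ennreal (2 * mc) * (NN powe (q - P) * NN powe P)"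
    using mc by (simp add: ennreal_mult mult_ac)
  also have "NN powe (q - P) * NN powe P = NN powe q" using powe_add[of NN "q - P" P] by simp
  also have "\<dots> = (\<Prod>j\<in>UNIV. I j powe (q / p j))"
    using q by (simp add: NN_def powe_prod powe_powe)
  finally show ?thesis unfolding mc_def I_def .
qed

end

text \<open>From the outside in: reduction to good levels, the number \<open>N\<close> of residue
  classes as the cost of a power of a sum and as the number of summands, the sparse estimate, and
  the maximal theorem.\<close>

definition grid_const :: "nat \<Rightarrow> real \<Rightarrow> real \<Rightarrow> real \<Rightarrow> nat \<Rightarrow> real \<Rightarrow> ('m::finite \<Rightarrow> real) \<Rightarrow> ('m \<Rightarrow> real) \<Rightarrow> real"
  where "grid_const n \<kappa> q \<alpha> N P p e = dom_const n \<alpha> powr q * (real N powr q * (real N * (embed_const n \<kappa> q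
    * (2 * (\<Prod>j\<in>UNIV. max_const (p j / e j) powr (P / p j))))))"

context dyadic_bmo
begin

lemma embed_const_nonneg: "0 \<le> embed_const CARD('n) \<kappa> q"
  using jn_const_nonneg by (simp add: embed_const_def Let_def)

theorem grid_bound:
  fixes f F :: "'m::finite \<Rightarrow> real ^ 'n \<Rightarrow> ennreal" and p e :: "'m \<Rightarrow> real" and r :: real
  defines "\<sigma> \<equiv> \<lambda>i x. \<Prod>j\<in>UNIV. cavg lebesgue i (\<lambda>y. f j y powe r) x powe (1 / r)"
  assumes f: "\<And>j. f j \<in> borel_measurable lebesgue" and F: "\<And>j. F j \<in> borel_measurable lebesgue"
    and e: "\<And>j. 0 < e j" "\<And>j. e j < p j" and P: "1 / P = (\<Sum>j\<in>UNIV. 1 / p j)"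
    and q: "1 / q = 1 / P - \<alpha> / real CARD('n)" "0 < q" and \<alpha>: "0 < \<alpha>" and r: "0 < r"
    and N: "sparse_gap \<alpha> r CARD('m) N"
    and w: "\<And>i x. \<sigma> i x powe q * emeasure M (cell i x)
      \<le> W * ennreal (vol i) * (\<Prod>j\<in>UNIV. cavg lebesgue i (\<lambda>y. F j y powe e j) x powe (q / e j))"
  shows "(\<integral>\<^sup>+x. (\<Sum>i. ennreal (side i powr \<alpha>) * \<sigma> i x * B i x) powe q \<partial>M)
    \<le> ennreal (grid_const CARD('n) \<kappa> q \<alpha> N P p e * \<beta> powr q) * W
      * (\<Prod>j\<in>UNIV. (\<integral>\<^sup>+x. F j x powe p j \<partial>lebesgue) powe (q / p j))"
proof -
  define n where "n = real CARD('n)"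
  have n: "0 < n" by (simp add: n_def)
  have P0: "0 < P"
  proof -
    have "0 < 1 / q" using q(2) by simp
    then have "0 < 1 / P" unfolding q(1) using divide_pos_pos[OF \<alpha> n] unfolding n_def by linarith
    then show ?thesis by (simp add: zero_less_divide_iff)
  qed
  have Pq: "P < q"
  proof -
    have "1 / q < 1 / P" unfolding q(1) using \<alpha> n by (simp add: n_def)
    then show ?thesis using P0 q(2) by (simp add: field_simps)
  qed
  have N0: "0 < N" using N by (simp add: sparse_gap_def)
  define a where "a i x = ennreal (side i powr \<alpha>) * \<sigma> i x" for i x
  have \<sigma>cw: "cellwise i (\<sigma> i)" for i
    unfolding \<sigma>_def by (intro cellwise_prod cellwise_comp[OF cellwise_cavg])
  have acw: "cellwise i (a i)" for i
    unfolding a_def by (rule cellwise_comp[OF \<sigma>cw])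
  \<comment> \<open>Good descendants of a cell are sparse only from \<open>N\<close> generations on;
    within one residue class modulo \<open>N\<close>, different generations are that far
    apart.\<close>
  define G where "G \<rho> i = (if i mod N = \<rho> then good \<alpha> \<sigma> i else {})" for \<rho> i
  have Gcw: "cellwise i (\<lambda>x. x \<in> G \<rho> i)" for \<rho> i
    using cellwise_good[OF \<sigma>cw, of i \<alpha>] by (cases "i mod N = \<rho>") (auto simp: G_def)
  have sparse: "2 * emeasure lebesgue {y\<in>cell i x. \<exists>i'>i. y \<in> G \<rho> i'} \<le> emeasure lebesgue (cell i x)"
    if x: "x \<in> G \<rho> i" for \<rho> i x
  proof -
    have "2 * emeasure lebesgue {y\<in>cell i x. \<exists>i'>i. y \<in> G \<rho> i'} \<le> 2 * emeasure lebesgue {y\<in>cell i x. \<exists>i'\<ge>i + N. y \<in> good \<alpha> \<sigma> i'}"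
    proof (intro mult_left_mono emeasure_mono)
      have "i + N \<le> i'" if "i < i'" "y \<in> G \<rho> i'" for i' y
      proof -
        have "i' mod N = i mod N" using x that by (auto simp: G_def split: if_splits)
        then obtain k where "i' = i + k * N" using \<open>i < i'\<close> by (metis less_imp_le mod_eq_nat2E mult.commute)
        then show ?thesis using \<open>i < i'\<close> by (cases k) auto
      qed
      then show "{y\<in>cell i x. \<exists>i'>i. y \<in> G \<rho> i'} \<subseteq> {y\<in>cell i x. \<exists>i'\<ge>i + N. y \<in> good \<alpha> \<sigma> i'}"
        by (fastforce simp: G_def split: if_splits)
      have "{y\<in>cell i x. \<exists>i'\<ge>i + N. y \<in> good \<alpha> \<sigma> i'} = cell i x \<inter> (\<Union>i'\<in>{i + N..}. good \<alpha> \<sigma> i')" by auto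
      moreover have "good \<alpha> \<sigma> i' \<in> sets lebesgue" for i' by (rule cellwise_sets[OF refl cellwise_good[OF \<sigma>cw]])
      ultimately show "{y\<in>cell i x. \<exists>i'\<ge>i + N. y \<in> good \<alpha> \<sigma> i'} \<in> sets lebesgue" by simp
    qed simp
    also have "\<dots> \<le> emeasure lebesgue (cell i x)"
      by (rule good_descendants_small[OF _ \<alpha> r _ N, where g="\<lambda>j y. f j y powe r"]) (auto simp: \<sigma>_def intro!: measurable_powe f)
    finally show ?thesis .
  qed
  have wa: "a i x powe q * emeasure M (cell i x)
      \<le> W * ennreal (vol i powr (q / P)) * (\<Prod>j\<in>UNIV. cavg lebesgue i (\<lambda>y. F j y powe e j) x powe (q / e j))" for i x
  proof -
    \<comment> \<open>Here \<open>1 / q = 1 / P - \<alpha> / n\<close> enters, in the form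
      \<open>\<alpha> * q + n = n * (q / P)\<close>.\<close>
    have "side i powr (\<alpha> * q) * vol i = vol i powr (q / P)"
    proof -
      have v: "vol i = side i powr n" using side_pos[of i] by (simp add: vol_def n_def powr_realpow)
      have "\<alpha> * q + n = n * (q / P)"
        using q n P0 by (simp add: n_def[symmetric] field_simps)
      then have "side i powr (\<alpha> * q) * side i powr n = side i powr (n * (q / P))"
        using powr_add[of "side i" "\<alpha> * q" n] by simp
      then show ?thesis unfolding v by (simp add: powr_powr)
    qed
    have "a i x powe q * emeasure M (cell i x) = ennreal (side i powr (\<alpha> * q)) * (\<sigma> i x powe q * emeasure M (cell i x))"
      using q by (simp add: a_def powe_mult powe_ennreal powr_powr mult.assoc)
    also have "\<dots> \<le> ennreal (side i powr (\<alpha> * q)) * (W * ennreal (vol i) * (\<Prod>j\<in>UNIV. cavg lebesgue i (\<lambda>y. F j y powe e j) x powe (q / e j)))"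
      by (intro mult_left_mono w) simp
    also have "\<dots> = W * ennreal (side i powr (\<alpha> * q) * vol i) * (\<Prod>j\<in>UNIV. cavg lebesgue i (\<lambda>y. F j y powe e j) x powe (q / e j))"
      using vol_pos[of i] by (simp add: ennreal_mult mult_ac)
    finally show ?thesis using \<open>side i powr (\<alpha> * q) * vol i = vol i powr (q / P)\<close> by simp
  qed
  define R where "R = W * ennreal (2 * (\<Prod>j\<in>UNIV. max_const (p j / e j) powr (P / p j)))
      * (\<Prod>j\<in>UNIV. (\<integral>\<^sup>+x. F j x powe p j \<partial>lebesgue) powe (q / p j))"
  define S where "S \<rho> x = (\<Sum>i. indicator (G \<rho> i) x * a i x * B i x)" for \<rho> x
  have Sm [measurable]: "S \<rho> \<in> borel_measurable M" for \<rho>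
    unfolding S_def[abs_def] by (rule sparse_sum_measurable[OF Gcw sparse acw])
  have Sle: "(\<integral>\<^sup>+x. S \<rho> x powe q \<partial>M) \<le> ennreal (embed_const CARD('n) \<kappa> q * \<beta> powr q) * R" for \<rho>
  proof -
    have "(\<integral>\<^sup>+x. S \<rho> x powe q \<partial>M) \<le> ennreal (embed_const CARD('n) \<kappa> q * \<beta> powr q) * (\<Sum>i. \<integral>\<^sup>+x. indicator (G \<rho> i) x * a i x powe q \<partial>M)"
      unfolding S_def by (rule sparse_sum_bound[OF Gcw sparse acw q(2)])
    also have "\<dots> \<le> ennreal (embed_const CARD('n) \<kappa> q * \<beta> powr q) * R"
      unfolding R_def
      by (intro mult_left_mono weighted_sparse_sum[OF Gcw sparse acw F e P P0 Pq wa]) auto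
    finally show ?thesis .
  qed
  have "(\<integral>\<^sup>+x. (\<Sum>i. ennreal (side i powr \<alpha>) * \<sigma> i x * B i x) powe q \<partial>M)
    \<le> (\<integral>\<^sup>+x. ennreal (dom_const CARD('n) \<alpha> powr q) * (ennreal (real N powr q) * (\<Sum>\<rho><N. S \<rho> x powe q)) \<partial>M)"
  proof (rule nn_integral_mono)
    fix x
    have "(\<Sum>i. ennreal (side i powr \<alpha>) * \<sigma> i x * B i x)
      \<le> ennreal (dom_const CARD('n) \<alpha>) * (\<Sum>i. indicator (good \<alpha> \<sigma> i) x * (ennreal (side i powr \<alpha>) * \<sigma> i x) * B i x)"
      by (rule sum_le_good_sum[OF \<alpha>])
    also have "(\<Sum>i. indicator (good \<alpha> \<sigma> i) x * (ennreal (side i powr \<alpha>) * \<sigma> i x) * B i x) = (\<Sum>\<rho><N. S \<rho> x)"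
    proof -
      have ind: "indicator (good \<alpha> \<sigma> i) x = (\<Sum>\<rho><N. indicator (G \<rho> i) x :: ennreal)" for i
      proof -
        have "(\<Sum>\<rho><N. indicator (G \<rho> i) x :: ennreal) = (\<Sum>\<rho><N. if i mod N = \<rho> then indicator (good \<alpha> \<sigma> i) x else 0)"
          by (intro sum.cong) (auto simp: G_def)
        also have "\<dots> = indicator (good \<alpha> \<sigma> i) x" using N0 by (subst sum.delta') auto
        finally show ?thesis by simp
      qed
      have "(\<Sum>i. indicator (good \<alpha> \<sigma> i) x * (ennreal (side i powr \<alpha>) * \<sigma> i x) * B i x)
        = (\<Sum>i. \<Sum>\<rho><N. indicator (G \<rho> i) x * a i x * B i x)"
        unfolding ind a_def by (simp only: sum_distrib_right)
      also have "\<dots> = (\<Sum>\<rho><N. S \<rho> x)" unfolding S_def by (rule suminf_sum) simp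
      finally show ?thesis .
    qed
    finally have "(\<Sum>i. ennreal (side i powr \<alpha>) * \<sigma> i x * B i x) powe q
      \<le> (ennreal (dom_const CARD('n) \<alpha>) * (\<Sum>\<rho><N. S \<rho> x)) powe q" using q by (intro powe_mono)
    also have "\<dots> = ennreal (dom_const CARD('n) \<alpha> powr q) * (\<Sum>\<rho><N. S \<rho> x) powe q"
      using q dom_const_nonneg by (simp add: powe_mult powe_ennreal)
    also have "\<dots> \<le> ennreal (dom_const CARD('n) \<alpha> powr q) * (ennreal (real N powr q) * (\<Sum>\<rho><N. S \<rho> x powe q))"
      using powe_sum_le[OF q(2), of "{..<N}" "\<lambda>\<rho>. S \<rho> x"] by (intro mult_left_mono) auto
    finally show "(\<Sum>i. ennreal (side i powr \<alpha>) * \<sigma> i x * B i x) powe q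
      \<le> ennreal (dom_const CARD('n) \<alpha> powr q) * (ennreal (real N powr q) * (\<Sum>\<rho><N. S \<rho> x powe q))" .
  qed
  also have "\<dots> = ennreal (dom_const CARD('n) \<alpha> powr q) * (ennreal (real N powr q) * (\<Sum>\<rho><N. \<integral>\<^sup>+x. S \<rho> x powe q \<partial>M))"
    by (simp add: nn_integral_cmult nn_integral_sum)
  also have "\<dots> \<le> ennreal (dom_const CARD('n) \<alpha> powr q) * (ennreal (real N powr q) * (\<Sum>\<rho><N. ennreal (embed_const CARD('n) \<kappa> q * \<beta> powr q) * R))"
    by (intro mult_left_mono sum_mono Sle) auto
  also have "\<dots> = ennreal (dom_const CARD('n) \<alpha> powr q) * (ennreal (real N powr q) * (ennreal (real N) * (ennreal (embed_const CARD('n) \<kappa> q * \<beta> powr q) * R)))"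
    by (simp add: ennreal_of_nat_eq_real_of_nat)
  also have "\<dots> = ennreal (grid_const CARD('n) \<kappa> q \<alpha> N P p e * \<beta> powr q) * W
      * (\<Prod>j\<in>UNIV. (\<integral>\<^sup>+x. F j x powe p j \<partial>lebesgue) powe (q / p j))"
  proof -
    have m: "0 \<le> (\<Prod>j\<in>UNIV. max_const (p j / e j) powr (P / p j))" by (intro prod_nonneg) auto
    have arr: "ennreal a * (ennreal b * (ennreal d * (ennreal (E * B) * (W * ennreal M * Z)))) = ennreal (a * (b * (d * (E * M))) * B) * W * Z"
      if "0 \<le> a" "0 \<le> b" "0 \<le> d" "0 \<le> E" "0 \<le> B" "0 \<le> M" for a b d E B M Z
      using that by (simp add: ennreal_mult mult_ac)
    show ?thesis unfolding R_def grid_const_def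
      by (rule arr) (use embed_const_nonneg m in auto)
  qed
  finally show ?thesis .
qed

end

subsection \<open>Shifted grids\<close>

lemma cube_eq_cbox: "cube x r = cbox (x - (\<chi> i. r / 2)) (x + (\<chi> i. r / 2))"
proof -
  have "\<bar>y $ i - x $ i\<bar> \<le> r / 2 \<longleftrightarrow> x $ i - r / 2 \<le> y $ i \<and> y $ i \<le> x $ i + r / 2" for y i
    by linarith
  then show ?thesis by (simp add: set_eq_iff cube_def mem_box_cart)
qed

lemma cube_sets [measurable, simp]: "cube x r \<in> sets borel"
  by (simp add: cube_eq_cbox)

lemma emeasure_cbox_side:
  fixes a :: "real ^ 'n"
  assumes "0 < s"
  shows "emeasure lborel (cbox a (a + (\<chi> i. s))) = ennreal (s ^ CARD('n))"
    and "emeasure lborel (box a (a + (\<chi> i. s))) = ennreal (s ^ CARD('n))"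
proof -
  have b: "b \<in> Basis \<Longrightarrow> (\<chi> i. s) \<bullet> b = s" for b :: "real ^ 'n"
    by (auto simp: Basis_vec_def inner_axis)
  have *: "b \<in> Basis \<Longrightarrow> a \<bullet> b \<le> (a + (\<chi> i. s)) \<bullet> b" for b
    using assms by (simp add: inner_add_left b)
  have p: "(\<Prod>b\<in>Basis. (a + (\<chi> i. s) - a) \<bullet> b) = s ^ CARD('n)"
    by (simp add: b)
  show "emeasure lborel (cbox a (a + (\<chi> i. s))) = ennreal (s ^ CARD('n))"
    using emeasure_lborel_cbox[OF *] p by simp
  show "emeasure lborel (box a (a + (\<chi> i. s))) = ennreal (s ^ CARD('n))"
    using emeasure_lborel_box[OF *] p by simp
qed

lemma emeasure_lborel_cube [simp]:
  assumes "0 < r"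
  shows "emeasure lborel (cube (x :: real ^ 'n) r) = ennreal (r ^ CARD('n))"
proof -
  have "cube x r = cbox (x - (\<chi> i. r / 2)) (x - (\<chi> i. r / 2) + (\<chi> i. r))"
    unfolding cube_eq_cbox by (rule arg_cong2[where f=cbox]) (auto simp: vec_eq_iff)
  then show ?thesis using emeasure_cbox_side(1)[OF assms] by simp
qed

lemma emeasure_cube:
  "0 < r \<Longrightarrow> emeasure lebesgue (cube (x :: real ^ 'n) r) = ennreal (r ^ CARD('n))"
  by simp

definition grid1 :: "bool \<Rightarrow> real \<Rightarrow> nat \<Rightarrow> real \<Rightarrow> int"
  where "grid1 b h i t = \<lfloor>t * 2 ^ i / h - (if b then (-1) ^ i / 3 else 0)\<rfloor>"

text \<open>One flag per coordinate gives \<open>2 ^ n\<close> grids. Index vectors form a countable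
  type, so \<open>to_nat\<close> turns them into labels.\<close>

definition grid :: "('n \<Rightarrow> bool) \<Rightarrow> real \<Rightarrow> nat \<Rightarrow> real ^ 'n \<Rightarrow> nat"
  where "grid \<tau> h i x = to_nat (\<lambda>l. grid1 (\<tau> l) h i (x $ l))"

lemma grid_eq_iff: "grid \<tau> h i x = grid \<tau> h i y \<longleftrightarrow> (\<forall>l. grid1 (\<tau> l) h i (x $ l) = grid1 (\<tau> l) h i (y $ l))"
  by (simp add: grid_def fun_eq_iff)

text \<open>The alternating sign of the shift makes the shifted intervals nested, since
  \<open>2 (-1) ^ i / 3\<close> and \<open>(-1) ^ (i + 1) / 3\<close> differ by an integer.\<close>

lemma grid1_nested:
  assumes "0 < h"
  shows "grid1 b h i t = (if b then (grid1 b h (Suc i) t - (-1) ^ i) div 2 else grid1 b h (Suc i) t div 2)"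
proof (cases b)
  case True
  let ?u = "t * 2 ^ Suc i / h - (-1) ^ Suc i / 3"
  have eq: "t * 2 ^ i / h - (-1) ^ i / 3 = (?u - real_of_int ((-1) ^ i)) / real_of_int 2"
    using assms by (simp add: field_simps)
  then have "grid1 b h i t = \<lfloor>(?u - real_of_int ((-1) ^ i)) / real_of_int 2\<rfloor>"
    using True by (simp only: grid1_def if_True eq)
  also have "\<dots> = \<lfloor>?u - real_of_int ((-1) ^ i)\<rfloor> div 2"
    by (rule floor_divide_real_eq_div) simp
  also have "\<lfloor>?u - real_of_int ((-1) ^ i)\<rfloor> = \<lfloor>?u\<rfloor> - (-1) ^ i"
    by (rule floor_diff_of_int)
  finally show ?thesis using True by (simp add: grid1_def)
next
  case False
  have eq: "t * 2 ^ i / h = (t * 2 ^ Suc i / h) / real_of_int 2"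
    using assms by (simp add: field_simps)
  then have "grid1 b h i t = \<lfloor>(t * 2 ^ Suc i / h) / real_of_int 2\<rfloor>"
    using False by (simp only: grid1_def if_False eq diff_0_right)
  also have "\<dots> = \<lfloor>t * 2 ^ Suc i / h\<rfloor> div 2"
    by (rule floor_divide_real_eq_div) simp
  finally show ?thesis using False by (simp add: grid1_def)
qed

text \<open>The cell is a half-open box. The open and the closed box around it have equal measure,
  which yields its volume and shows that its boundary is null.\<close>

lemma grid_cell:
  fixes x :: "real ^ 'n"
  assumes h: "0 < h"
  obtains a where "{y. grid \<tau> h i y = grid \<tau> h i x} \<subseteq> cbox a (a + (\<chi> l. h / 2 ^ i))"
    "box a (a + (\<chi> l. h / 2 ^ i)) \<subseteq> {y. grid \<tau> h i y = grid \<tau> h i x}"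
proof
  let ?s = "h / 2 ^ i"
  define sh where "sh l = (if \<tau> l then (-1) ^ i / 3 else 0 :: real)" for l
  define a :: "real ^ 'n" where "a = (\<chi> l. (real_of_int (grid1 (\<tau> l) h i (x $ l)) + sh l) * ?s)"
  have s: "0 < ?s" using h by simp
  have iff: "grid1 (\<tau> l) h i u = grid1 (\<tau> l) h i (x $ l) \<longleftrightarrow> a $ l \<le> u \<and> u < a $ l + ?s" for l u
  proof -
    have "grid1 (\<tau> l) h i u = grid1 (\<tau> l) h i (x $ l) \<longleftrightarrow>
      real_of_int (grid1 (\<tau> l) h i (x $ l)) \<le> u * 2 ^ i / h - sh l \<and> u * 2 ^ i / h - sh l < real_of_int (grid1 (\<tau> l) h i (x $ l)) + 1"
      by (subst grid1_def) (simp add: sh_def floor_eq_iff)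
    also have "\<dots> \<longleftrightarrow> a $ l \<le> u \<and> u < a $ l + ?s"
      using h by (simp add: a_def field_simps)
    finally show ?thesis .
  qed
  show "{y. grid \<tau> h i y = grid \<tau> h i x} \<subseteq> cbox a (a + (\<chi> l. ?s))"
    unfolding grid_eq_iff iff by (auto simp: mem_box_cart less_imp_le)
  show "box a (a + (\<chi> l. ?s)) \<subseteq> {y. grid \<tau> h i y = grid \<tau> h i x}"
    unfolding grid_eq_iff iff by (auto simp: mem_box_cart less_imp_le)
qed

lemma grid_borel: "{x :: real ^ 'n. grid \<tau> h i x = z} \<in> sets borel"
proof (cases "z \<in> range (to_nat :: ('n \<Rightarrow> int) \<Rightarrow> nat)")
  case True
  then obtain w :: "'n \<Rightarrow> int" where w: "z = to_nat w" by blast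
  have "{x :: real ^ 'n. grid \<tau> h i x = z} = (\<Inter>l. {x\<in>space borel. grid1 (\<tau> l) h i (x $ l) = w l})"
    by (auto simp: grid_def w fun_eq_iff)
  also have "\<dots> \<in> sets borel"
  proof (intro sets.countable_INT'')
    fix l
    show "{x\<in>space borel. grid1 (\<tau> l) h i ((x :: real ^ 'n) $ l) = w l} \<in> sets borel"
      unfolding grid1_def by measurable
  qed auto
  finally show ?thesis .
next
  case False
  then have "{x :: real ^ 'n. grid \<tau> h i x = z} = {}" by (auto simp: grid_def)
  then show ?thesis by simp
qed

lemma dyadic_grid:
  assumes h: "0 < h"
  shows "dyadic (grid \<tau> h :: nat \<Rightarrow> real ^ 'n \<Rightarrow> nat) h"
proof
  show "0 < h" by (rule h)
  show "grid \<tau> h (Suc i) x = grid \<tau> h (Suc i) y \<Longrightarrow> grid \<tau> h i x = grid \<tau> h i y" for i and x y :: "real ^ 'n"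
  proof -
    assume e: "grid \<tau> h (Suc i) x = grid \<tau> h (Suc i) y"
    have "grid1 (\<tau> l) h i (x $ l) = grid1 (\<tau> l) h i (y $ l)" for l
      using e by (simp only: grid1_nested[OF h, of "\<tau> l" i] grid_eq_iff)
    then show ?thesis by (simp add: grid_eq_iff)
  qed
  show "{x :: real ^ 'n. grid \<tau> h i x = z} \<in> sets borel" for i z by (rule grid_borel)
  fix i and x :: "real ^ 'n"
  have s: "0 < h / 2 ^ i" using h by simp
  obtain a where a: "{y. grid \<tau> h i y = grid \<tau> h i x} \<subseteq> cbox a (a + (\<chi> l. h / 2 ^ i))"
    "box a (a + (\<chi> l. h / 2 ^ i)) \<subseteq> {y. grid \<tau> h i y = grid \<tau> h i x}" by (rule grid_cell[OF h])
  have "cbox a (a + (\<chi> l. h / 2 ^ i)) = cube (a + (\<chi> l. h / 2 ^ i / 2)) (h / 2 ^ i)"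
    unfolding cube_eq_cbox by (rule arg_cong2[where f=cbox]) (auto simp: vec_eq_iff)
  then show "\<exists>w. {y. grid \<tau> h i y = grid \<tau> h i x} \<subseteq> cube w (h / 2 ^ i)" using a(1) by metis
  have "emeasure lborel {y. grid \<tau> h i y = grid \<tau> h i x} \<le> ennreal ((h / 2 ^ i) ^ CARD('n))"
    using emeasure_mono[OF a(1), of lborel] unfolding emeasure_cbox_side(1)[OF s] by simp
  moreover have "ennreal ((h / 2 ^ i) ^ CARD('n)) \<le> emeasure lborel {y. grid \<tau> h i y = grid \<tau> h i x}"
    using emeasure_mono[OF a(2), of lborel] grid_borel[of \<tau> h i "grid \<tau> h i x"] unfolding emeasure_cbox_side(2)[OF s] by simp
  ultimately have "emeasure lborel {y. grid \<tau> h i y = grid \<tau> h i x} = ennreal ((h / 2 ^ i) ^ CARD('n))" by (rule antisym)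
  then show "emeasure lebesgue {y. grid \<tau> h i y = grid \<tau> h i x} = ennreal ((h / 2 ^ i) ^ CARD('n))"
    using grid_borel[of \<tau> h i "grid \<tau> h i x"] by simp
qed

text \<open>Integers and integers shifted by one third are at distance at least one third.\<close>

lemma one_third_trick_1d:
  assumes h: "0 < h" and close: "\<And>t t'. t \<in> S \<Longrightarrow> t' \<in> S \<Longrightarrow> t - t' < h / 2 ^ i / 3"
  shows "\<exists>b. \<forall>t\<in>S. \<forall>t'\<in>S. grid1 b h i t = grid1 b h i t'"
proof (rule ccontr)
  assume n: "\<nexists>b. \<forall>t\<in>S. \<forall>t'\<in>S. grid1 b h i t = grid1 b h i t'"
  have ex: "\<exists>t\<in>S. \<exists>t'\<in>S. grid1 b h i t < grid1 b h i t'" for b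
  proof -
    obtain t t' where "t \<in> S" "t' \<in> S" "grid1 b h i t \<noteq> grid1 b h i t'" using n by blast
    then show ?thesis by (cases "grid1 b h i t < grid1 b h i t'") (auto simp: not_less le_less)
  qed
  define e :: int where "e = (-1) ^ i"
  have e: "e = 1 \<or> e = -1" unfolding e_def by (metis neg_one_even_power neg_one_odd_power)
  define u where "u t = t * 2 ^ i / h" for t
  have cl: "u t - u t' < 1 / 3" if "t \<in> S" "t' \<in> S" for t t'
    using close[OF that] h by (simp add: u_def field_simps)
  have g: "grid1 False h i t = \<lfloor>u t\<rfloor>" "grid1 True h i t = \<lfloor>u t - real_of_int e / 3\<rfloor>" for t
    by (simp_all add: grid1_def u_def e_def)
  obtain t1 t2 where t12: "t1 \<in> S" "t2 \<in> S" "\<lfloor>u t1\<rfloor> < \<lfloor>u t2\<rfloor>" using ex[of False] g by auto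
  obtain t3 t4 where t34: "t3 \<in> S" "t4 \<in> S" "\<lfloor>u t3 - real_of_int e / 3\<rfloor> < \<lfloor>u t4 - real_of_int e / 3\<rfloor>"
    using ex[of True] g by auto
  \<comment> \<open>If both grids separated points of \<open>S\<close>, then an integer
    \<open>A\<close> and a shifted integer \<open>A' + e / 3\<close> would both lie between points
    of \<open>S\<close>, hence less than one third apart. Then \<open>3 * (A - A') - e\<close> is an
    integer of modulus below 1, so 3 would divide \<open>e\<close>.\<close>
  define A where "A = \<lfloor>u t2\<rfloor>"
  define A' where "A' = \<lfloor>u t4 - real_of_int e / 3\<rfloor>"
  have "u t1 < real_of_int A" "real_of_int A \<le> u t2" using t12 unfolding A_def by linarith+
  moreover have "u t3 < real_of_int A' + real_of_int e / 3" "real_of_int A' + real_of_int e / 3 \<le> u t4"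
    using t34 unfolding A'_def by linarith+
  ultimately have "\<bar>real_of_int A - (real_of_int A' + real_of_int e / 3)\<bar> < 1 / 3"
    using cl[OF t12(2) t34(1)] cl[OF t34(2) t12(1)] by linarith
  moreover have "real_of_int (3 * (A - A') - e) = 3 * (real_of_int A - (real_of_int A' + real_of_int e / 3))" by simp
  ultimately have "\<bar>real_of_int (3 * (A - A') - e)\<bar> < 1" by (simp only: abs_mult) simp
  then have "3 * (A - A') = e" by linarith
  then show False using e by presburger
qed

lemma one_third_trick:
  fixes S :: "(real ^ 'n) set"
  assumes h: "0 < h" and close: "\<And>y y' l. y \<in> S \<Longrightarrow> y' \<in> S \<Longrightarrow> y $ l - y' $ l < h / 2 ^ i / 3"
  obtains \<tau> where "\<And>y y'. y \<in> S \<Longrightarrow> y' \<in> S \<Longrightarrow> grid \<tau> h i y = grid \<tau> h i y'"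
proof -
  have "\<exists>b. \<forall>y\<in>S. \<forall>y'\<in>S. grid1 b h i (y $ l) = grid1 b h i (y' $ l)" for l
    using one_third_trick_1d[OF h, of "(\<lambda>y. y $ l) ` S" i] close by auto
  then obtain \<tau> where "\<forall>l. \<forall>y\<in>S. \<forall>y'\<in>S. grid1 (\<tau> l) h i (y $ l) = grid1 (\<tau> l) h i (y' $ l)"
    by metis
  then have "grid \<tau> h i y = grid \<tau> h i y'" if "y \<in> S" "y' \<in> S" for y y'
    unfolding grid_eq_iff using that by blast
  then show ?thesis by (rule that)
qed

subsection \<open>Multiple weights\<close>

text \<open>The supremum is approached along a sequence, so that the exceptional null sets can be
  united.\<close>

lemma ess_inf_AE: "AE x in lebesgue. x \<in> Q \<longrightarrow> ess_inf Q w \<le> ennreal (w x)"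
proof -
  let ?A = "{c. AE x in lebesgue. x \<in> Q \<longrightarrow> c \<le> ennreal (w x)}"
  have "?A \<noteq> {}" by (auto intro!: exI[of _ 0])
  then obtain f :: "nat \<Rightarrow> ennreal" where f: "range f \<subseteq> ?A" "Sup ?A = (SUP i. f i)"
    using ennreal_Sup_countable_SUP[of ?A] by blast
  have "AE x in lebesgue. x \<in> Q \<longrightarrow> f i \<le> ennreal (w x)" for i
    using f(1) by blast
  then have "AE x in lebesgue. \<forall>i. x \<in> Q \<longrightarrow> f i \<le> ennreal (w x)"
    unfolding AE_all_countable by blast
  moreover have "x \<in> Q \<longrightarrow> ess_inf Q w \<le> ennreal (w x)" if "\<forall>i. x \<in> Q \<longrightarrow> f i \<le> ennreal (w x)" for x
    unfolding ess_inf_def f(2) using that by (auto intro!: SUP_least)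
  ultimately show ?thesis by (rule eventually_mono)
qed

lemma dual_exponent_nonneg: "1 \<le> R \<Longrightarrow> 0 \<le> 1 - 1 / (R :: real)"
  by (simp add: divide_le_eq_1)

lemma inverse_conj_exp: "1 < R \<Longrightarrow> 1 / conj_exp R = 1 - 1 / R"
  by (simp add: conj_exp_def field_simps)

lemma conj_exp_pos: "1 < R \<Longrightarrow> 0 < conj_exp R"
  by (simp add: conj_exp_def)

text \<open>At \<open>y = 0\<close> both sides are \<open>top\<close>, in accordance with the
  convention for negative powers of weights.\<close>

lemma inverse_powr_powe:
  assumes "0 \<le> y" "0 < a"
  shows "inverse (ennreal (y powr a)) = inverse (ennreal y) powe a"
  using assms by (simp add: powe_inverse powe_ennreal)

lemma ennreal_inverse_antimono: "x \<le> y \<Longrightarrow> inverse y \<le> inverse (x :: ennreal)"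
proof (cases x; cases y)
  fix r s assume "x \<le> y" "x = ennreal r" "0 \<le> r" "y = ennreal s" "0 \<le> s"
  then show ?thesis by (cases "r = 0") (auto simp: inverse_ennreal intro!: ennreal_leI le_imp_inverse_le)
qed (auto simp: top_unique)

lemma ennreal_mult_inverse_self: "0 < x \<Longrightarrow> ennreal x * inverse (ennreal x) = 1"
  by (simp add: inverse_ennreal ennreal_mult[symmetric] less_imp_le)

lemma avg_mono_AE:
  assumes "AE x in lebesgue. x \<in> Q \<longrightarrow> f x \<le> g x"
  shows "avg Q f \<le> avg Q g"
  unfolding avg_def
proof (intro divide_right_mono_ennreal nn_integral_mono_AE)
  show "AE x in lebesgue. f x * indicator Q x \<le> g x * indicator Q x"
    using assms by (rule eventually_mono) (auto simp: indicator_def)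
qed

text \<open>Writing the inverse of the conjugate exponent as \<open>1 - 1 / R\<close> unites the two
  cases of \<open>dual_factor\<close>: for \<open>R = 1\<close> it is 0, and a pointwise bound by
  the essential infimum takes the place of Hoelder's inequality.\<close>

lemma dual_Holder:
  assumes Q [measurable]: "Q \<in> sets lebesgue" and [measurable]: "w \<in> borel_measurable lebesgue" "G \<in> borel_measurable lebesgue"
    and w0: "\<And>x. 0 \<le> w x" and R: "1 \<le> R" and a: "0 < a" "a * (1 - 1 / R) < 1"
  shows "avg Q (\<lambda>x. G x * inverse (ennreal (w x)) powe a)
    \<le> avg Q (\<lambda>x. G x powe (1 / (1 - a * (1 - 1 / R)))) powe (1 - a * (1 - 1 / R)) * dual_factor R w Q powe a"
proof (cases "R = 1")
  case True
  let ?D = "dual_factor R w Q"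
  have D: "?D = inverse (ess_inf Q w)" using True by (simp add: dual_factor_def)
  have ae: "AE x in lebesgue. x \<in> Q \<longrightarrow> G x * inverse (ennreal (w x)) powe a \<le> G x * ?D powe a"
    using ess_inf_AE[of Q w]
    by (rule eventually_mono) (auto simp: D a intro!: mult_left_mono powe_mono ennreal_inverse_antimono)
  have "avg Q (\<lambda>x. G x * inverse (ennreal (w x)) powe a) \<le> avg Q (\<lambda>x. G x * ?D powe a)"
    by (rule avg_mono_AE[OF ae])
  also have "\<dots> = avg Q G * ?D powe a"
  proof -
    have "(\<integral>\<^sup>+x\<in>Q. (G x * ?D powe a) \<partial>lebesgue) = (\<integral>\<^sup>+x. (G x * indicator Q x) * ?D powe a \<partial>lebesgue)"
      by (simp add: mult_ac)
    also have "\<dots> = (\<integral>\<^sup>+x\<in>Q. G x \<partial>lebesgue) * ?D powe a" by (rule nn_integral_multc) measurable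
    finally show ?thesis by (simp add: avg_def divide_ennreal_def mult_ac)
  qed
  finally show ?thesis using True by simp
next
  case False
  then have R1: "1 < R" using R by simp
  define k where "k = 1 - 1 / R"
  have k: "0 < k" "a * k < 1" "1 / conj_exp R = k" using R1 a inverse_conj_exp[OF R1] by (auto simp: k_def)
  have ck: "conj_exp R * (a * k) = a"
    unfolding k(3)[symmetric] using conj_exp_pos[OF R1] by simp
  let ?f = "\<lambda>x. inverse (ennreal (w x powr conj_exp R)) * indicator Q x"
  let ?g = "\<lambda>x. G x powe (1 / (1 - a * k)) * indicator Q x"
  let ?m = "inverse (emeasure lebesgue Q)"
  have "(\<integral>\<^sup>+x\<in>Q. (G x * inverse (ennreal (w x)) powe a) \<partial>lebesgue) = (\<integral>\<^sup>+x. ?f x powe (a * k) * ?g x powe (1 - a * k) \<partial>lebesgue)"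
  proof (rule nn_integral_cong)
    fix x
    show "G x * inverse (ennreal (w x)) powe a * indicator Q x = ?f x powe (a * k) * ?g x powe (1 - a * k)"
      using k a by (auto simp: indicator_def inverse_powr_powe[OF w0 conj_exp_pos[OF R1]] powe_powe ck mult.commute)
  qed
  also have "\<dots> \<le> (\<integral>\<^sup>+x. ?f x \<partial>lebesgue) powe (a * k) * (\<integral>\<^sup>+x. ?g x \<partial>lebesgue) powe (1 - a * k)"
    using k a by (intro nn_integral_Holder) auto
  finally have "avg Q (\<lambda>x. G x * inverse (ennreal (w x)) powe a)
    \<le> ((\<integral>\<^sup>+x. ?f x \<partial>lebesgue) powe (a * k) * (\<integral>\<^sup>+x. ?g x \<partial>lebesgue) powe (1 - a * k)) * ?m"
    unfolding avg_def divide_ennreal_def by (rule mult_right_mono) simp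
  also have "?m = ?m powe (a * k) * ?m powe (1 - a * k)" using powe_add[of ?m "a * k" "1 - a * k"] by simp
  finally have "avg Q (\<lambda>x. G x * inverse (ennreal (w x)) powe a)
    \<le> ((\<integral>\<^sup>+x. ?g x \<partial>lebesgue) * ?m) powe (1 - a * k) * ((\<integral>\<^sup>+x. ?f x \<partial>lebesgue) * ?m) powe (k * a)"
    using k a by (simp add: powe_mult mult_ac)
  also have "((\<integral>\<^sup>+x. ?f x \<partial>lebesgue) * ?m) powe (k * a) = dual_factor R w Q powe a"
    using False k by (simp add: dual_factor_def avg_def divide_ennreal_def powe_powe)
  finally show ?thesis by (simp add: avg_def divide_ennreal_def k_def)
qed

lemma dual_Holder_prod:
  assumes "finite J" and Q: "Q \<in> sets lebesgue" and w: "\<And>j. w j \<in> borel_measurable lebesgue" and G: "G \<in> borel_measurable lebesgue"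
    and w0: "\<And>j x. 0 \<le> w j x" and R: "\<And>j. 1 \<le> R j" and a: "0 < a" "a * (\<Sum>j\<in>J. 1 - 1 / R j) < 1"
  shows "avg Q (\<lambda>x. G x * (\<Prod>j\<in>J. inverse (ennreal (w j x)) powe a))
    \<le> avg Q (\<lambda>x. G x powe (1 / (1 - a * (\<Sum>j\<in>J. 1 - 1 / R j)))) powe (1 - a * (\<Sum>j\<in>J. 1 - 1 / R j))
      * (\<Prod>j\<in>J. dual_factor (R j) (w j) Q powe a)"
  using assms(1) G a
proof (induction J arbitrary: G a rule: finite_induct)
  case empty
  then show ?case by simp
next
  case (insert l J)
  note w [measurable] note insert.prems(1) [measurable]
  define K where "K = (\<Sum>j\<in>J. 1 - 1 / R j)"
  have K0: "0 \<le> K" unfolding K_def by (intro sum_nonneg dual_exponent_nonneg R)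
  have kl: "0 \<le> 1 - 1 / R l" by (rule dual_exponent_nonneg[OF R])
  \<comment> \<open>What the factor \<open>l\<close> leaves of the total exponent 1. Dividing the
    remaining powers by \<open>s\<close> puts them into the form of the induction hypothesis, and
    the outer power \<open>s\<close> undoes this.\<close>
  define s where "s = 1 - a * (1 - 1 / R l)"
  have K1: "a * (1 - 1 / R l + K) < 1" using insert by (simp add: K_def)
  then have s: "a * K < s" "0 < s" using K0 kl insert.prems(2) by (auto simp: s_def algebra_simps)
       (smt (verit) mult_nonneg_nonneg)
  have al: "a * (1 - 1 / R l) < 1" using s by (simp add: s_def)
  define u where "u = 1 - a / s * K"
  have IH: "avg Q (\<lambda>x. G x powe (1 / s) * (\<Prod>j\<in>J. inverse (ennreal (w j x)) powe (a / s)))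
    \<le> avg Q (\<lambda>x. (G x powe (1 / s)) powe (1 / (u))) powe (u)
      * (\<Prod>j\<in>J. dual_factor (R j) (w j) Q powe (a / s))"
    unfolding u_def K_def using s insert.prems by (intro insert.IH) (auto simp: K_def[symmetric] field_simps)
  have sK: "u * s = s - a * K" "s * u = s - a * K" "0 < u"
    using s by (auto simp: u_def field_simps)
  have "avg Q (\<lambda>x. G x * (\<Prod>j\<in>insert l J. inverse (ennreal (w j x)) powe a))
    = avg Q (\<lambda>x. (G x * (\<Prod>j\<in>J. inverse (ennreal (w j x)) powe a)) * inverse (ennreal (w l x)) powe a)"
    using insert.hyps by (simp add: mult_ac)
  also have "\<dots> \<le> avg Q (\<lambda>x. (G x * (\<Prod>j\<in>J. inverse (ennreal (w j x)) powe a)) powe (1 / s)) powe s * dual_factor (R l) (w l) Q powe a"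
    unfolding s_def by (rule dual_Holder[OF Q w _ w0 R insert.prems(2) al]) measurable
  also have "(\<lambda>x. (G x * (\<Prod>j\<in>J. inverse (ennreal (w j x)) powe a)) powe (1 / s))
    = (\<lambda>x. G x powe (1 / s) * (\<Prod>j\<in>J. inverse (ennreal (w j x)) powe (a / s)))"
    using s by (simp add: powe_mult powe_prod powe_powe)
  also have "avg Q \<dots> powe s * dual_factor (R l) (w l) Q powe a
    \<le> (avg Q (\<lambda>x. (G x powe (1 / s)) powe (1 / (u))) powe (u)
      * (\<Prod>j\<in>J. dual_factor (R j) (w j) Q powe (a / s))) powe s * dual_factor (R l) (w l) Q powe a"
    using s by (intro mult_right_mono powe_mono IH) auto
  also have "\<dots> = avg Q (\<lambda>x. G x powe (1 / (s - a * K))) powe (s - a * K) * (\<Prod>j\<in>insert l J. dual_factor (R j) (w j) Q powe a)"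
    using insert.hyps s by (simp add: powe_mult powe_prod powe_powe sK mult_ac)
  also have "s - a * K = 1 - a * (\<Sum>j\<in>insert l J. 1 - 1 / R j)"
    using insert.hyps by (simp add: s_def K_def algebra_simps)
  finally show ?case .
qed

lemma cube_in_cubes: "0 < r \<Longrightarrow> cube x r \<in> cubes"
  by (auto simp: cubes_def)

lemma cube_lebesgue [measurable, simp]: "cube x r \<in> sets lebesgue"
  using cube_sets[of x r] by simp

text \<open>If \<open>v\<close> vanishes almost everywhere, the weight condition may merely read
  \<open>0 * top = 0\<close>. Once this is excluded by \<open>nondegenerate\<close>, the condition
  makes all its factors finite and the weights positive almost everywhere.\<close>

locale multiple_weight =
  fixes \<omega> :: "'m::finite \<Rightarrow> real ^ 'n \<Rightarrow> real" and R :: "'m \<Rightarrow> real" and U :: real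
  assumes A: "\<omega> \<in> A_class R U" and R: "\<And>j. 1 \<le> R j" and U: "0 < U"
    and nondegenerate: "\<not> (AE x in lebesgue. weight_prod \<omega> x = 0)"
begin

abbreviation v where "v \<equiv> weight_prod \<omega>"

definition M :: "(real ^ 'n) measure"
  where "M = density lebesgue (\<lambda>x. ennreal (v x powr U))"

definition A0 :: real
  where "A0 = enn2real (SUP Q\<in>cubes. avg Q (\<lambda>x. ennreal (v x powr U)) powe (1 / U) * (\<Prod>j\<in>UNIV. dual_factor (R j) (\<omega> j) Q))"

lemma omega [measurable]: "\<omega> j \<in> borel_measurable lebesgue"
  and omega_nonneg: "0 \<le> \<omega> j x"
  using A by (auto simp: A_class_def)

lemma v_measurable [measurable]: "v \<in> borel_measurable lebesgue"
  unfolding weight_prod_def[abs_def] by measurable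

lemma v_nonneg: "0 \<le> v x"
  unfolding weight_prod_def using omega_nonneg by (intro prod_nonneg) auto

lemma sets_M: "sets M = sets lebesgue"
  by (simp add: M_def)

lemma A0_nonneg: "0 \<le> A0"
  by (simp add: A0_def)

lemma A_bound:
  assumes "0 < r"
  shows "avg (cube x r) (\<lambda>x. ennreal (v x powr U)) powe (1 / U) * (\<Prod>j\<in>UNIV. dual_factor (R j) (\<omega> j) (cube x r)) \<le> ennreal A0"
proof -
  have "(SUP Q\<in>cubes. avg Q (\<lambda>x. ennreal (v x powr U)) powe (1 / U) * (\<Prod>j\<in>UNIV. dual_factor (R j) (\<omega> j) Q)) < top"
    using A by (simp add: A_class_def)
  then show ?thesis unfolding A0_def
    by (subst ennreal_enn2real) (auto intro!: SUP_upper2[OF cube_in_cubes[OF assms]])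
qed

section \<open>Positivity and local finiteness of the weights\<close>

lemma cube_not_null:
  assumes "0 < r" shows "\<not> (AE y in lebesgue. y \<notin> cube (x :: real ^ 'n) r)"
proof
  assume "AE y in lebesgue. y \<notin> cube x r"
  then have "emeasure lebesgue (cube x r) = 0"
    by (subst (asm) AE_iff_measurable[where N="cube x r"]) auto
  then show False using assms emeasure_cube[OF assms, of x] by simp
qed

lemma dual_factor_pos:
  assumes r: "0 < r"
  shows "dual_factor (R j) (\<omega> j) (cube x r) \<noteq> 0"
proof (cases "R j = 1")
  case True
  have "ess_inf (cube x r) (\<omega> j) \<noteq> top"
  proof
    assume "ess_inf (cube x r) (\<omega> j) = top"
    then have "AE y in lebesgue. y \<notin> cube x r"
      using ess_inf_AE[of "cube x r" "\<omega> j"] by (auto simp: top_unique)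
    then show False using cube_not_null[OF r] by blast
  qed
  then show ?thesis using True by (simp add: dual_factor_def)
next
  case False
  then have R1: "1 < R j" using R[of j] by simp
  have "(\<integral>\<^sup>+y\<in>cube x r. inverse (ennreal (\<omega> j y powr conj_exp (R j))) \<partial>lebesgue) \<noteq> 0"
  proof
    assume "(\<integral>\<^sup>+y\<in>cube x r. inverse (ennreal (\<omega> j y powr conj_exp (R j))) \<partial>lebesgue) = 0"
    then have "AE y in lebesgue. inverse (ennreal (\<omega> j y powr conj_exp (R j))) * indicator (cube x r) y = 0"
      by (subst (asm) nn_integral_0_iff_AE) auto
    then have "AE y in lebesgue. y \<notin> cube x r"
      by (rule eventually_mono) (auto simp: indicator_def)
    then show False using cube_not_null[OF r] by blast
  qed
  then have "avg (cube x r) (\<lambda>y. inverse (ennreal (\<omega> j y powr conj_exp (R j)))) \<noteq> 0"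
    by (simp add: avg_def emeasure_cube[OF r])
  then show ?thesis
    using False conj_exp_pos[OF R1] by (simp add: dual_factor_def)
qed

lemma AE_omega_pos_of_dual_finite:
  assumes fin: "dual_factor (R j) (\<omega> j) (cube x r) < top" and r: "0 < r"
  shows "AE y in lebesgue. y \<in> cube x r \<longrightarrow> 0 < \<omega> j y"
proof (cases "R j = 1")
  case True
  then have "0 < ess_inf (cube x r) (\<omega> j)"
    using fin by (auto simp: dual_factor_def zero_less_iff_neq_zero)
  then have "0 < ennreal (\<omega> j y)" if "ess_inf (cube x r) (\<omega> j) \<le> ennreal (\<omega> j y)" for y
    using that less_le_trans by blast
  then show ?thesis using ess_inf_AE[of "cube x r" "\<omega> j"] by (auto elim!: eventually_mono)
next
  case False
  then have R1: "1 < R j" using R[of j] by simp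
  have "avg (cube x r) (\<lambda>y. inverse (ennreal (\<omega> j y powr conj_exp (R j)))) < top"
    using False fin conj_exp_pos[OF R1] by (simp add: dual_factor_def)
  then have "(\<integral>\<^sup>+y\<in>cube x r. inverse (ennreal (\<omega> j y powr conj_exp (R j))) \<partial>lebesgue) \<noteq> \<infinity>"
    by (auto simp: avg_def emeasure_cube[OF r] ennreal_top_divide)
  then have "AE y in lebesgue. inverse (ennreal (\<omega> j y powr conj_exp (R j))) * indicator (cube x r) y \<noteq> \<infinity>"
    by (intro nn_integral_noteq_infinite) auto
  then show ?thesis
  proof (rule eventually_mono)
    fix y assume "inverse (ennreal (\<omega> j y powr conj_exp (R j))) * indicator (cube x r) y \<noteq> \<infinity>"
    then show "y \<in> cube x r \<longrightarrow> 0 < \<omega> j y" using omega_nonneg[of j y] by (cases "\<omega> j y = 0") auto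
  qed
qed

text \<open>A finite product in \<open>[0, \<infinity>]\<close> has finite factors once none of them
  is 0. The dual factors never are, and the average of \<open>v powr U\<close> is not when
  \<open>v\<close> is not null on the cube.\<close>

lemma finite_of_v_nonzero:
  assumes r: "0 < r" and v: "\<not> (AE y in lebesgue. y \<in> cube x r \<longrightarrow> v y = 0)"
  shows "avg (cube x r) (\<lambda>x. ennreal (v x powr U)) < top" "dual_factor (R j) (\<omega> j) (cube x r) < top"
proof -
  let ?a = "avg (cube x r) (\<lambda>x. ennreal (v x powr U)) powe (1 / U)"
  have "(\<integral>\<^sup>+y\<in>cube x r. ennreal (v y powr U) \<partial>lebesgue) \<noteq> 0"
  proof
    assume "(\<integral>\<^sup>+y\<in>cube x r. ennreal (v y powr U) \<partial>lebesgue) = 0"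
    then have "AE y in lebesgue. ennreal (v y powr U) * indicator (cube x r) y = 0"
      by (subst (asm) nn_integral_0_iff_AE) auto
    then have "AE y in lebesgue. y \<in> cube x r \<longrightarrow> v y = 0"
      by (rule eventually_mono) (auto simp: indicator_def ennreal_eq_0_iff)
    with v show False by blast
  qed
  then have a0: "?a \<noteq> 0" using U by (simp add: avg_def emeasure_cube[OF r])
  have lt: "?a * (\<Prod>j\<in>UNIV. dual_factor (R j) (\<omega> j) (cube x r)) < top"
    using A_bound[OF r, of x] by (rule le_less_trans) simp
  have P0: "(\<Prod>j\<in>UNIV. dual_factor (R j) (\<omega> j) (cube x r)) \<noteq> 0"
    using dual_factor_pos[OF r] by simp
  have "?a < top" and Pt: "(\<Prod>j\<in>UNIV. dual_factor (R j) (\<omega> j) (cube x r)) < top"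
    using lt a0 P0 by (auto simp: ennreal_mult_less_top)
  then show "avg (cube x r) (\<lambda>x. ennreal (v x powr U)) < top" by simp
  have "(\<Prod>j\<in>UNIV. dual_factor (R j) (\<omega> j) (cube x r))
    = dual_factor (R j) (\<omega> j) (cube x r) * (\<Prod>j\<in>UNIV - {j}. dual_factor (R j) (\<omega> j) (cube x r))"
    by (subst prod.remove[of _ j]) auto
  moreover have "(\<Prod>j\<in>UNIV - {j}. dual_factor (R j) (\<omega> j) (cube x r)) \<noteq> 0"
    using dual_factor_pos[OF r] by simp
  ultimately show "dual_factor (R j) (\<omega> j) (cube x r) < top"
    using Pt by (auto simp: ennreal_mult_less_top dual_factor_pos[OF r])
qed

lemma bounded_in_cube:
  fixes S :: "(real ^ 'n) set"
  assumes "bounded S"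
  shows "\<exists>k::nat. 0 < k \<and> S \<subseteq> cube 0 (real k)"
proof -
  obtain B where B: "\<And>y. y \<in> S \<Longrightarrow> norm y \<le> B" using assms by (auto simp: bounded_iff)
  obtain k :: nat where k: "2 * \<bar>B\<bar> + 1 \<le> real k" using real_arch_simple by blast
  have "y \<in> cube 0 (real k)" if "y \<in> S" for y
  proof -
    have "\<bar>y $ i\<bar> \<le> real k / 2" for i
      using component_le_norm_cart[of y i] B[OF that] k by linarith
    then show ?thesis by (simp add: cube_def)
  qed
  moreover have "0 < k" using k by (cases k) auto
  ultimately show ?thesis by (intro exI[of _ k]) auto
qed

lemma bounded_cube: "bounded (cube x r)"
  by (simp add: cube_eq_cbox)

lemma cube_mono: "r \<le> s \<Longrightarrow> cube x r \<subseteq> cube x s"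
  by (auto simp: cube_def intro: order_trans)

lemma big_cube_nonzero: "\<exists>k0::nat. \<forall>k\<ge>k0. \<not> (AE y in lebesgue. y \<in> cube 0 (real k) \<longrightarrow> v y = 0)"
proof (rule ccontr)
  assume "\<not> ?thesis"
  then have ex: "\<exists>k\<ge>k0. AE y in lebesgue. y \<in> cube 0 (real k) \<longrightarrow> v y = 0" for k0 by blast
  have "AE y in lebesgue. y \<in> cube 0 (real k0) \<longrightarrow> v y = 0" for k0
  proof -
    obtain k where "k0 \<le> k" "AE y in lebesgue. y \<in> cube 0 (real k) \<longrightarrow> v y = 0" using ex by blast
    note k = this
    have "cube 0 (real k0) \<subseteq> (cube 0 (real k) :: (real ^ 'n) set)" using k(1) by (intro cube_mono) simp
    then have "y \<in> cube 0 (real k0) \<longrightarrow> v y = 0" if "y \<in> cube 0 (real k) \<longrightarrow> v y = 0" for y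
      using that by blast
    with k(2) show ?thesis by (rule eventually_mono)
  qed
  then have "AE y in lebesgue. \<forall>k0. y \<in> cube 0 (real k0) \<longrightarrow> v y = 0"
    unfolding AE_all_countable by blast
  moreover have "v y = 0" if "\<forall>k0. y \<in> cube 0 (real k0) \<longrightarrow> v y = 0" for y
    using bounded_in_cube[of "{y}"] that by auto
  ultimately have "AE y in lebesgue. v y = 0" by (rule eventually_mono)
  then show False using nondegenerate by blast
qed

text \<open>On all large cubes \<open>v\<close> is not null, so the dual factors are finite and the
  weights positive almost everywhere there. Through this detour positivity reaches small cubes, on
  which \<open>v\<close> might have been null at first sight.\<close>

lemma AE_omega_pos: "AE y in lebesgue. \<forall>j. 0 < \<omega> j y"
proof -
  obtain k0 where k0: "\<And>k. k0 \<le> k \<Longrightarrow> \<not> (AE y in lebesgue. y \<in> cube 0 (real k) \<longrightarrow> v y = 0)"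
    using big_cube_nonzero by blast
  \<comment> \<open>The side is raised to at least \<open>k0\<close>, so that \<open>v\<close> is
    not null on the cube, and to at least 1, so that it is positive.\<close>
  have "AE y in lebesgue. y \<in> cube 0 (real (max 1 (max k k0))) \<longrightarrow> 0 < \<omega> j y" for j k
    by (rule AE_omega_pos_of_dual_finite[OF finite_of_v_nonzero(2)[OF _ k0]]) auto
  then have "AE y in lebesgue. \<forall>j\<in>UNIV. y \<in> cube 0 (real (max 1 (max k k0))) \<longrightarrow> 0 < \<omega> j y" for k
    by (subst AE_finite_all) (simp, blast)
  then have "AE y in lebesgue. \<forall>k. \<forall>j\<in>UNIV. y \<in> cube 0 (real (max 1 (max k k0))) \<longrightarrow> 0 < \<omega> j y"
    unfolding AE_all_countable by blast
  moreover have "\<forall>j. 0 < \<omega> j y" if a: "\<forall>k. \<forall>j\<in>UNIV. y \<in> cube 0 (real (max 1 (max k k0))) \<longrightarrow> 0 < \<omega> j y" for y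
  proof
    fix j
    obtain k where "y \<in> cube 0 (real k)" using bounded_in_cube[of "{y}"] by auto
    moreover have "cube 0 (real k) \<subseteq> (cube 0 (real (max 1 (max k k0))) :: (real ^ 'n) set)"
      by (intro cube_mono) simp
    ultimately have "y \<in> cube 0 (real (max 1 (max k k0)))" by blast
    then show "0 < \<omega> j y" using a by blast
  qed
  ultimately show ?thesis by (rule eventually_mono)
qed

lemma AE_v_pos: "AE y in lebesgue. 0 < v y"
  using AE_omega_pos by (rule eventually_mono) (auto simp: weight_prod_def intro!: prod_pos)

lemma cube_finite:
  assumes r: "0 < r"
  shows "avg (cube x r) (\<lambda>x. ennreal (v x powr U)) < top" "dual_factor (R j) (\<omega> j) (cube x r) < top"
proof -
  have "\<not> (AE y in lebesgue. y \<in> cube x r \<longrightarrow> v y = 0)"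
  proof
    assume "AE y in lebesgue. y \<in> cube x r \<longrightarrow> v y = 0"
    with AE_v_pos have "AE y in lebesgue. y \<notin> cube x r" by eventually_elim auto
    then show False using cube_not_null[OF r] by blast
  qed
  then show "avg (cube x r) (\<lambda>x. ennreal (v x powr U)) < top" "dual_factor (R j) (\<omega> j) (cube x r) < top"
    using finite_of_v_nonzero[OF r] by blast+
qed

lemma emeasure_M_cube:
  assumes r: "0 < r"
  shows "emeasure M (cube x r) = avg (cube x r) (\<lambda>x. ennreal (v x powr U)) * emeasure lebesgue (cube x r)"
proof -
  have "emeasure M (cube x r) = (\<integral>\<^sup>+y\<in>cube x r. ennreal (v y powr U) \<partial>lebesgue)"
    unfolding M_def by (subst emeasure_density) auto
  then show ?thesis
    unfolding avg_def using r by (subst ennreal_divide_mult_self) (auto simp: emeasure_cube)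
qed

lemma emeasure_M_cube_finite: "0 < r \<Longrightarrow> emeasure M (cube x r) < top"
  using cube_finite(1)[of r x] unfolding emeasure_M_cube emeasure_cube by (simp add: ennreal_mult_less_top)

lemma AE_M: "(AE x in lebesgue. P x) \<Longrightarrow> AE x in M. P x"
  unfolding M_def by (subst AE_density) (auto elim: eventually_mono)

lemma AE_of_AE_M: "(AE x in M. P x) \<Longrightarrow> AE x in lebesgue. P x"
proof -
  assume "AE x in M. P x"
  then have "AE x in lebesgue. 0 < ennreal (v x powr U) \<longrightarrow> P x"
    unfolding M_def by (subst (asm) AE_density) auto
  with AE_v_pos show ?thesis by eventually_elim (auto simp: zero_less_iff_neq_zero ennreal_eq_0_iff not_le)
qed

text \<open>The power for which the Hoelder exponents \<open>\<theta> / U\<close> of the weighted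
  mass and \<open>\<theta> * (1 - 1 / R j)\<close> of the dual factors add up to 1.\<close>

definition \<theta> :: real
  where "\<theta> = 1 / (1 / U + (\<Sum>j\<in>UNIV. 1 - 1 / R j))"

text \<open>The maximum with 2 secures \<open>1 < \<kappa>\<close> for
  \<open>dyadic_weight\<close>.\<close>

definition A_inf_const :: real
  where "A_inf_const = max 2 (2 powr (U / \<theta>) * A0 powr U)"

lemma theta: "0 < \<theta>" "1 - \<theta> * (\<Sum>j\<in>UNIV. 1 - 1 / R j) = \<theta> / U"
proof -
  have "0 \<le> (\<Sum>j\<in>UNIV. 1 - 1 / R j)" by (intro sum_nonneg dual_exponent_nonneg R)
  then have p: "0 < 1 / U + (\<Sum>j\<in>UNIV. 1 - 1 / R j)" using U by (simp add: add_pos_nonneg)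
  then show "0 < \<theta>" by (simp add: \<theta>_def)
  have "\<theta> * (1 / U + (\<Sum>j\<in>UNIV. 1 - 1 / R j)) = 1" using p by (simp add: \<theta>_def)
  then show "1 - \<theta> * (\<Sum>j\<in>UNIV. 1 - 1 / R j) = \<theta> / U" by (simp add: algebra_simps)
qed

text \<open>Almost everywhere on \<open>E\<close>, the number 1 is \<open>v powr \<theta>\<close>
  times the product of the \<open>\<omega> j powr (- \<theta>)\<close>. Hoelder's inequality bounds
  the relative Lebesgue measure of \<open>E\<close> by a power of its weighted mass and the dual
  factors. After multiplication with the average of \<open>v powr U\<close> over the cube, the
  weight condition absorbs the dual factors.\<close>

lemma A_infinity:
  assumes r: "0 < r" and E: "E \<in> sets lebesgue" "E \<subseteq> cube x r"
    and big: "emeasure lebesgue (cube x r) \<le> 2 * emeasure lebesgue E"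
  shows "emeasure M (cube x r) \<le> ennreal A_inf_const * emeasure M E"
proof -
  let ?C = "cube x r" and ?D = "\<lambda>j. dual_factor (R j) (\<omega> j) (cube x r)"
  note E(1) [measurable]
  let ?G = "\<lambda>y. indicator E y * ennreal (v y) powe \<theta>"
  define m where "m = emeasure lebesgue ?C"
  have m: "m \<noteq> 0" "m \<noteq> top" "0 < m" using r by (auto simp: m_def emeasure_cube)
  define V where "V = avg ?C (\<lambda>x. ennreal (v x powr U))"
  have ME: "emeasure M E = (\<integral>\<^sup>+y\<in>E. ennreal (v y powr U) \<partial>lebesgue)"
    unfolding M_def by (subst emeasure_density) auto
  have MC: "emeasure M ?C = V * m" unfolding V_def m_def by (rule emeasure_M_cube[OF r])
  have "emeasure lebesgue E / m = avg ?C (\<lambda>y. indicator E y)"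
  proof -
    have "(\<integral>\<^sup>+y\<in>?C. indicator E y \<partial>lebesgue) = (\<integral>\<^sup>+y. indicator E y \<partial>lebesgue)"
      using E(2) by (intro nn_integral_cong) (auto simp: indicator_def)
    then show ?thesis by (simp add: avg_def m_def)
  qed
  also have "\<dots> \<le> avg ?C (\<lambda>y. ?G y * (\<Prod>j\<in>UNIV. inverse (ennreal (\<omega> j y)) powe \<theta>))"
  proof (rule avg_mono_AE)
    show "AE y in lebesgue. y \<in> ?C \<longrightarrow> indicator E y \<le> ?G y * (\<Prod>j\<in>UNIV. inverse (ennreal (\<omega> j y)) powe \<theta>)"
      using AE_omega_pos
    proof (rule eventually_mono, intro impI)
      fix y assume p: "\<forall>j. 0 < \<omega> j y"
      have "ennreal (v y) powe \<theta> * (\<Prod>j\<in>UNIV. inverse (ennreal (\<omega> j y)) powe \<theta>)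
        = (\<Prod>j\<in>UNIV. (ennreal (\<omega> j y) * inverse (ennreal (\<omega> j y))) powe \<theta>)"
        unfolding weight_prod_def using theta(1) omega_nonneg
        by (simp add: prod_ennreal[symmetric] powe_prod powe_mult prod.distrib)
      also have "\<dots> = 1"
        using p by (intro prod.neutral) (auto simp: ennreal_mult_inverse_self)
      finally show "indicator E y \<le> ?G y * (\<Prod>j\<in>UNIV. inverse (ennreal (\<omega> j y)) powe \<theta>)"
        by (simp add: mult.assoc)
    qed
  qed
  also have "\<dots> \<le> avg ?C (\<lambda>y. ?G y powe (1 / (\<theta> / U))) powe (\<theta> / U) * (\<Prod>j\<in>UNIV. ?D j powe \<theta>)"
    using dual_Holder_prod[of UNIV ?C \<omega> ?G R \<theta>] theta R omega_nonneg divide_pos_pos[OF theta(1) U]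
    by (simp add: theta(2))
  also have "avg ?C (\<lambda>y. ?G y powe (1 / (\<theta> / U))) = emeasure M E / m"
  proof -
    have "(\<integral>\<^sup>+y\<in>?C. (?G y powe (1 / (\<theta> / U))) \<partial>lebesgue) = emeasure M E"
      unfolding ME using E(2) theta(1) U v_nonneg
      by (intro nn_integral_cong) (auto simp: indicator_def powe_powe powe_ennreal powr_powr)
    then show ?thesis by (simp add: avg_def m_def)
  qed
  finally have 1: "emeasure lebesgue E / m \<le> (emeasure M E / m) powe (\<theta> / U) * (\<Prod>j\<in>UNIV. ?D j) powe \<theta>"
    using theta(1) by (simp add: powe_prod)
  have "V powe (\<theta> / U) * (\<Prod>j\<in>UNIV. ?D j) powe \<theta> = (V powe (1 / U) * (\<Prod>j\<in>UNIV. ?D j)) powe \<theta>"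
    using theta(1) by (simp add: powe_mult powe_powe)
  also have "\<dots> \<le> ennreal A0 powe \<theta>"
    unfolding V_def using theta(1) by (intro powe_mono A_bound r) auto
  finally have 2: "V powe (\<theta> / U) * (\<Prod>j\<in>UNIV. ?D j) powe \<theta> \<le> ennreal A0 powe \<theta>" .
  have "1 \<le> 2 * (emeasure lebesgue E / m)"
  proof -
    have "1 = m / m" using m by (simp add: less_top)
    also have "\<dots> \<le> (2 * emeasure lebesgue E) / m" using big unfolding m_def by (rule divide_right_mono_ennreal)
    finally show ?thesis by (simp add: ennreal_times_divide)
  qed
  then have "V powe (\<theta> / U) \<le> V powe (\<theta> / U) * (2 * (emeasure lebesgue E / m))"
    using mult_left_mono[of 1 _ "V powe (\<theta> / U)"] by simp
  also have "\<dots> \<le> V powe (\<theta> / U) * (2 * ((emeasure M E / m) powe (\<theta> / U) * (\<Prod>j\<in>UNIV. ?D j) powe \<theta>))"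
    by (intro mult_left_mono 1) auto
  also have "\<dots> = 2 * (emeasure M E / m) powe (\<theta> / U) * (V powe (\<theta> / U) * (\<Prod>j\<in>UNIV. ?D j) powe \<theta>)"
    by (simp add: mult_ac)
  also have "\<dots> \<le> 2 * (emeasure M E / m) powe (\<theta> / U) * ennreal A0 powe \<theta>"
    by (intro mult_left_mono 2) auto
  finally have "(V powe (\<theta> / U)) powe (U / \<theta>) \<le> (2 * (emeasure M E / m) powe (\<theta> / U) * ennreal A0 powe \<theta>) powe (U / \<theta>)"
    using theta(1) U by (intro powe_mono) auto
  then have "V \<le> 2 powe (U / \<theta>) * (emeasure M E / m) * ennreal A0 powe U"
    using theta(1) U by (simp add: powe_mult powe_powe)
  then have "V * m \<le> 2 powe (U / \<theta>) * (emeasure M E / m) * ennreal A0 powe U * m"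
    by (rule mult_right_mono) simp
  also have "\<dots> = (2 powe (U / \<theta>) * ennreal A0 powe U) * (emeasure M E / m * m)" by (simp add: mult_ac)
  also have "emeasure M E / m * m = emeasure M E" using m by (intro ennreal_divide_mult_self) auto
  also have "2 powe (U / \<theta>) * ennreal A0 powe U = ennreal (2 powr (U / \<theta>) * A0 powr U)"
    using powe_ennreal[of 2 "U / \<theta>"] A0_nonneg by (simp add: powe_ennreal ennreal_mult)
  also have "\<dots> * emeasure M E \<le> ennreal A_inf_const * emeasure M E"
    unfolding A_inf_const_def by (intro mult_right_mono ennreal_leI) auto
  finally show ?thesis unfolding MC .
qed

text \<open>\<open>f j powe r\<close> is \<open>(f j * \<omega> j powe (1 / t)) powe r\<close> times
  the power \<open>- r / t\<close> of the weight, to which \<open>dual_Holder\<close> applies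
  because \<open>r / t < 1\<close>. The averages run over a cube, where the weight condition holds,
  but of functions cut to \<open>Q\<close>, which will be a cell.\<close>

lemma weight_inequality:
  fixes f :: "'m \<Rightarrow> real ^ 'n \<Rightarrow> ennreal"
  assumes r: "0 < s" and Q: "Q \<in> sets lebesgue" "Q \<subseteq> cube x s"
    and [measurable]: "\<And>j. f j \<in> borel_measurable lebesgue"
    and t: "0 < r" "r < t" and e: "\<And>j. 1 / e j = 1 / r - (1 - 1 / R j) / t"
    and q: "q = U * t"
  shows "(\<Prod>j\<in>UNIV. avg (cube x s) (\<lambda>y. f j y powe r * indicator Q y) powe (1 / r)) powe q * emeasure M Q
    \<le> ennreal (A0 powr U) * emeasure lebesgue (cube x s)
      * (\<Prod>j\<in>UNIV. avg (cube x s) (\<lambda>y. (f j y * ennreal (\<omega> j y) powe (1 / t)) powe e j * indicator Q y) powe (q / e j))"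
proof -
  let ?C = "cube x s"
  let ?D = "\<lambda>j. dual_factor (R j) (\<omega> j) ?C"
  note Q(1) [measurable]
  define k where "k j = 1 - 1 / R j" for j
  have k: "0 \<le> k j" "k j < 1" for j using R[of j] dual_exponent_nonneg[OF R[of j]] by (auto simp: k_def)
  have ak: "r / t * k j < 1" for j
  proof -
    have "r / t * k j \<le> r / t * 1" using k[of j] t by (intro mult_left_mono) auto
    then show ?thesis using t by simp (smt (verit) divide_less_eq_1_pos)
  qed
  have e1: "1 / e j = (1 - r / t * k j) / r" for j
    using e[of j] t by (simp add: k_def[symmetric] field_simps)
  have e0: "0 < e j" for j
  proof -
    have "0 < 1 / e j" unfolding e1 using ak[of j] t by simp
    then show ?thesis by (simp add: zero_less_divide_iff)
  qed
  have e2: "r * (1 / (1 - r / t * k j)) = e j" for j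
    using e1[of j] e0[of j] ak[of j] t by (simp add: field_simps)
  have one: "avg ?C (\<lambda>y. f j y powe r * indicator Q y) powe (1 / r)
    \<le> avg ?C (\<lambda>y. (f j y * ennreal (\<omega> j y) powe (1 / t)) powe e j * indicator Q y) powe (1 / e j) * ?D j powe (1 / t)" for j
  proof -
    let ?G = "\<lambda>y. (f j y * ennreal (\<omega> j y) powe (1 / t)) powe r * indicator Q y"
    have "avg ?C (\<lambda>y. f j y powe r * indicator Q y) \<le> avg ?C (\<lambda>y. ?G y * inverse (ennreal (\<omega> j y)) powe (r / t))"
    proof (rule avg_mono_AE)
      show "AE y in lebesgue. y \<in> ?C \<longrightarrow> f j y powe r * indicator Q y \<le> ?G y * inverse (ennreal (\<omega> j y)) powe (r / t)"
        using AE_omega_pos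
      proof (rule eventually_mono, intro impI)
        fix y assume "\<forall>j. 0 < \<omega> j y"
        then have "ennreal (\<omega> j y) * inverse (ennreal (\<omega> j y)) = 1"
          by (intro ennreal_mult_inverse_self) auto
        then have "(ennreal (\<omega> j y) * inverse (ennreal (\<omega> j y))) powe (r / t) = 1" by simp
        then have "(ennreal (\<omega> j y) powe (1 / t)) powe r * inverse (ennreal (\<omega> j y)) powe (r / t) = 1"
          using t by (simp add: powe_mult powe_powe)
        then have "?G y * inverse (ennreal (\<omega> j y)) powe (r / t) = f j y powe r * indicator Q y"
          using t by (simp add: powe_mult mult_ac)
        then show "f j y powe r * indicator Q y \<le> ?G y * inverse (ennreal (\<omega> j y)) powe (r / t)" by simp
      qed
    qed
    also have "\<dots> \<le> avg ?C (\<lambda>y. ?G y powe (1 / (1 - r / t * k j))) powe (1 - r / t * k j) * ?D j powe (r / t)"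
      unfolding k_def using t ak[of j] R[of j] omega_nonneg
      by (intro dual_Holder) (auto simp: k_def)
    also have "(\<lambda>y. ?G y powe (1 / (1 - r / t * k j))) = (\<lambda>y. (f j y * ennreal (\<omega> j y) powe (1 / t)) powe e j * indicator Q y)"
      using ak[of j] e2[of j] by (auto simp: fun_eq_iff indicator_def powe_powe)
    finally have "avg ?C (\<lambda>y. f j y powe r * indicator Q y) powe (1 / r)
      \<le> (avg ?C (\<lambda>y. (f j y * ennreal (\<omega> j y) powe (1 / t)) powe e j * indicator Q y) powe (1 - r / t * k j) * ?D j powe (r / t)) powe (1 / r)"
      using t by (intro powe_mono) auto
    then show ?thesis using t by (simp add: powe_mult powe_powe e1)
  qed
  have q0: "0 < q" using U t by (simp add: q)
  have "(\<Prod>j\<in>UNIV. avg ?C (\<lambda>y. f j y powe r * indicator Q y) powe (1 / r)) powe q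
    \<le> (\<Prod>j\<in>UNIV. avg ?C (\<lambda>y. (f j y * ennreal (\<omega> j y) powe (1 / t)) powe e j * indicator Q y) powe (1 / e j) * ?D j powe (1 / t)) powe q"
    using q0 by (intro powe_mono prod_mono_ennreal one)
  also have "\<dots> = (\<Prod>j\<in>UNIV. avg ?C (\<lambda>y. (f j y * ennreal (\<omega> j y) powe (1 / t)) powe e j * indicator Q y) powe (q / e j))
    * (\<Prod>j\<in>UNIV. ?D j) powe U"
    using q0 t U by (simp add: prod.distrib powe_prod powe_mult powe_powe q)
  finally have "(\<Prod>j\<in>UNIV. avg ?C (\<lambda>y. f j y powe r * indicator Q y) powe (1 / r)) powe q * emeasure M Q
    \<le> ((\<Prod>j\<in>UNIV. avg ?C (\<lambda>y. (f j y * ennreal (\<omega> j y) powe (1 / t)) powe e j * indicator Q y) powe (q / e j))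
    * (\<Prod>j\<in>UNIV. ?D j) powe U) * emeasure M ?C"
    using emeasure_mono[OF Q(2), of M] by (intro mult_mono) (auto simp: sets_M)
  also have "\<dots> = (\<Prod>j\<in>UNIV. avg ?C (\<lambda>y. (f j y * ennreal (\<omega> j y) powe (1 / t)) powe e j * indicator Q y) powe (q / e j))
    * ((avg ?C (\<lambda>x. ennreal (v x powr U)) powe (1 / U) * (\<Prod>j\<in>UNIV. ?D j)) powe U * emeasure lebesgue ?C)"
    using U by (simp add: emeasure_M_cube[OF r] powe_mult powe_powe mult_ac)
  also have "\<dots> \<le> (\<Prod>j\<in>UNIV. avg ?C (\<lambda>y. (f j y * ennreal (\<omega> j y) powe (1 / t)) powe e j * indicator Q y) powe (q / e j))
    * (ennreal A0 powe U * emeasure lebesgue ?C)"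
    using U by (intro mult_left_mono mult_right_mono powe_mono A_bound r) auto
  finally show ?thesis using A0_nonneg by (simp add: powe_ennreal mult_ac)
qed

end

subsection \<open>Domination of the kernel\<close>

lemma vec_lambda_measurable:
  "(vec_lambda :: ('m::finite \<Rightarrow> real ^ 'n) \<Rightarrow> real ^ 'n ^ 'm) \<in> borel_measurable (Pi\<^sub>M UNIV (\<lambda>_. lborel))"
proof (subst borel_measurable_euclidean_space, intro ballI)
  fix B :: "real ^ 'n ^ 'm" assume "B \<in> Basis"
  then obtain j b where B: "B = axis j b" by (auto simp: Basis_vec_def)
  have "(\<lambda>x. x j \<bullet> b) \<in> borel_measurable (Pi\<^sub>M (UNIV :: 'm set) (\<lambda>_. lborel :: (real ^ 'n) measure))" by measurable
  moreover have "(\<lambda>x. vec_lambda x \<bullet> B) = (\<lambda>x. x j \<bullet> b)" by (simp add: B inner_axis fun_eq_iff)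
  ultimately show "(\<lambda>x. vec_lambda x \<bullet> B) \<in> borel_measurable (Pi\<^sub>M (UNIV :: 'm set) (\<lambda>_. lborel :: (real ^ 'n) measure))"
    by simp
qed

lemma prod_Basis_vec:
  fixes g :: "real ^ 'n ^ 'm \<Rightarrow> real"
  shows "(\<Prod>B\<in>Basis. g B) = (\<Prod>j\<in>UNIV. \<Prod>b\<in>(Basis :: (real ^ 'n) set). g (axis j b))"
proof -
  have B: "(Basis :: (real ^ 'n ^ 'm) set) = (\<lambda>(j, b). axis j b) ` (UNIV \<times> Basis)"
    by (auto simp: Basis_vec_def image_iff)
  have "inj_on (\<lambda>(j, b). axis j b :: real ^ 'n ^ 'm) (UNIV \<times> Basis)"
    by (auto simp: inj_on_def axis_eq_axis)
  then show ?thesis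
    unfolding B by (subst prod.reindex) (auto simp: prod.cartesian_product intro!: prod.cong)
qed

text \<open>Lebesgue measure is determined by boxes, and a box of tuples is a product of
  boxes.\<close>

lemma lborel_vec:
  "(lborel :: (real ^ 'n ^ 'm) measure) = distr (Pi\<^sub>M UNIV (\<lambda>_. lborel)) borel vec_lambda"
proof (rule lborel_eqI)
  fix l u :: "real ^ 'n ^ 'm" assume le: "\<And>b. b \<in> Basis \<Longrightarrow> l \<bullet> b \<le> u \<bullet> b"
  interpret product_sigma_finite "\<lambda>_ :: 'm. lborel :: (real ^ 'n) measure" ..
  have le': "(l $ j) \<bullet> b \<le> (u $ j) \<bullet> b" if "b \<in> Basis" for j b
    using le[of "axis j b"] that by (auto simp: inner_axis Basis_vec_def)
  have box: "(vec_lambda y \<in> box l u) \<longleftrightarrow> (\<forall>j. y j \<in> box (l $ j) (u $ j))" for y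
    by (auto simp: box_def Basis_vec_def inner_axis)
  have "emeasure (distr (Pi\<^sub>M UNIV (\<lambda>_. lborel)) borel vec_lambda) (box l u)
    = emeasure (Pi\<^sub>M UNIV (\<lambda>_. lborel)) (Pi\<^sub>E UNIV (\<lambda>j. box (l $ j) (u $ j)))"
    by (subst emeasure_distr[OF vec_lambda_measurable])
      (auto intro!: arg_cong2[where f=emeasure] simp: space_PiM box PiE_def Pi_def)
  also have "\<dots> = (\<Prod>j\<in>UNIV. emeasure lborel (box (l $ j) (u $ j)))"
    by (rule emeasure_PiM) auto
  also have "\<dots> = (\<Prod>j\<in>UNIV. ennreal (\<Prod>b\<in>Basis. (u $ j - l $ j) \<bullet> b))"
    using le' by (intro prod.cong refl emeasure_lborel_box) auto
  also have "\<dots> = ennreal (\<Prod>j\<in>UNIV. \<Prod>b\<in>Basis. (u $ j - l $ j) \<bullet> b)"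
    using le' by (intro prod_ennreal prod_nonneg) (auto simp: inner_diff_left)
  also have "\<dots> = ennreal (\<Prod>b\<in>Basis. (u - l) \<bullet> b)"
    by (simp add: prod_Basis_vec inner_axis)
  finally show "emeasure (distr (Pi\<^sub>M UNIV (\<lambda>_. lborel)) borel vec_lambda) (box l u) = ennreal (\<Prod>b\<in>Basis. (u - l) \<bullet> b)" .
qed simp

lemma nn_integral_lborel_vec:
  fixes g :: "'m::finite \<Rightarrow> real ^ 'n \<Rightarrow> ennreal"
  assumes g [measurable]: "\<And>j. g j \<in> borel_measurable borel"
  shows "(\<integral>\<^sup>+y. (\<Prod>j\<in>UNIV. g j (y $ j)) \<partial>lborel) = (\<Prod>j\<in>UNIV. \<integral>\<^sup>+x. g j x \<partial>lborel)"
proof -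
  interpret product_sigma_finite "\<lambda>_ :: 'm. lborel :: (real ^ 'n) measure" ..
  have m: "(\<lambda>y :: real ^ 'n ^ 'm. \<Prod>j\<in>UNIV. g j (y $ j)) \<in> borel_measurable borel"
  proof (intro borel_measurable_prod_ennreal)
    fix j :: 'm
    have "(\<lambda>y :: real ^ 'n ^ 'm. y $ j) \<in> borel_measurable borel"
      by (intro borel_measurable_continuous_onI continuous_intros)
    then show "(\<lambda>y :: real ^ 'n ^ 'm. g j (y $ j)) \<in> borel_measurable borel"
      by (rule measurable_compose) (rule g)
  qed
  have "(\<integral>\<^sup>+y. (\<Prod>j\<in>UNIV. g j (y $ j)) \<partial>(lborel :: (real ^ 'n ^ 'm) measure))
    = (\<integral>\<^sup>+y. (\<Prod>j\<in>UNIV. g j (vec_lambda y $ j)) \<partial>Pi\<^sub>M UNIV (\<lambda>_. lborel))"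
    unfolding lborel_vec by (rule nn_integral_distr[OF vec_lambda_measurable]) (use m in simp)
  also have "\<dots> = (\<Prod>j\<in>UNIV. \<integral>\<^sup>+x. g j x \<partial>lborel)"
    by (simp add: product_nn_integral_prod)
  finally show ?thesis .
qed

lemma null_sets_proj:
  assumes "N \<in> null_sets (lborel :: (real ^ 'n) measure)"
  shows "{y :: real ^ 'n ^ 'm. y $ j \<in> N} \<in> null_sets lborel"
proof -
  have N: "N \<in> sets borel" "emeasure lborel N = 0" using assms by (auto simp: null_sets_def)
  have "(\<lambda>y :: real ^ 'n ^ 'm. y $ j) \<in> borel_measurable borel"
    by (intro borel_measurable_continuous_onI continuous_intros)
  then have "(\<lambda>y :: real ^ 'n ^ 'm. y $ j) -` N \<inter> space borel \<in> sets borel"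
    by (rule measurable_sets) (rule N)
  then have s: "{y :: real ^ 'n ^ 'm. y $ j \<in> N} \<in> sets borel" by (simp add: vimage_def)
  define g where "g k = (if k = j then indicator N else (\<lambda>_. 1 :: ennreal))" for k :: 'm
  have g: "g k \<in> borel_measurable borel" for k using N by (simp add: g_def)
  have "emeasure lborel {y :: real ^ 'n ^ 'm. y $ j \<in> N} = (\<integral>\<^sup>+y. indicator {y :: real ^ 'n ^ 'm. y $ j \<in> N} y \<partial>lborel)"
    using s by simp
  also have "\<dots> = (\<integral>\<^sup>+y. (\<Prod>k\<in>UNIV. g k ((y :: real ^ 'n ^ 'm) $ k)) \<partial>lborel)"
  proof (intro nn_integral_cong)
    fix y :: "real ^ 'n ^ 'm"
    have "(\<Prod>k\<in>UNIV. g k (y $ k)) = g j (y $ j) * (\<Prod>k\<in>UNIV - {j}. g k (y $ k))"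
      by (subst prod.remove[of _ j]) auto
    also have "(\<Prod>k\<in>UNIV - {j}. g k (y $ k)) = 1" by (intro prod.neutral) (auto simp: g_def)
    finally show "indicator {y :: real ^ 'n ^ 'm. y $ j \<in> N} y = (\<Prod>k\<in>UNIV. g k (y $ k))"
      by (simp add: g_def indicator_def)
  qed
  also have "\<dots> = (\<Prod>k\<in>UNIV. \<integral>\<^sup>+x. g k x \<partial>lborel)" by (rule nn_integral_lborel_vec[OF g])
  also have "\<dots> = 0"
    using N by (intro prod_zero) (auto intro!: bexI[of _ j] simp: g_def)
  finally show ?thesis using s by (simp add: null_sets_def)
qed

lemma AE_proj:
  assumes "AE x in lebesgue. P (x :: real ^ 'n)"
  shows "AE y in lebesgue. P ((y :: real ^ 'n ^ 'm) $ j)"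
proof -
  have "AE x in lborel. P x" using assms by (simp add: AE_completion_iff)
  then obtain N where N: "N \<in> null_sets lborel" "{x. \<not> P x} \<subseteq> N"
    by (auto simp: eventually_ae_filter)
  have "AE y in lborel. P ((y :: real ^ 'n ^ 'm) $ j)"
    using null_sets_proj[OF N(1), of j] N(2) by (intro AE_I'[of "{y. y $ j \<in> N}"]) auto
  then show ?thesis by (rule AE_completion)
qed

text \<open>A Lebesgue measurable function composed with a continuous map may fail to be measurable;
  projections are safe because preimages of null sets under them are null.\<close>

lemma borel_measurable_proj:
  fixes f :: "real ^ 'n \<Rightarrow> 'b::topological_space"
  assumes f: "f \<in> borel_measurable lebesgue"
  shows "(\<lambda>y :: real ^ 'n ^ 'm. f (y $ j)) \<in> borel_measurable lebesgue"
proof (rule measurable_compose[OF _ f], rule measurableI)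
  fix A :: "(real ^ 'n) set" assume "A \<in> sets lebesgue"
  then obtain S N N' where A: "A = S \<union> N" "N \<subseteq> N'" "N' \<in> null_sets lborel" "S \<in> sets lborel"
    by (rule sets_completionE)
  have p: "(\<lambda>y :: real ^ 'n ^ 'm. y $ j) \<in> borel_measurable borel"
    by (intro borel_measurable_continuous_onI continuous_intros)
  have "(\<lambda>y :: real ^ 'n ^ 'm. y $ j) -` S \<inter> space borel \<in> sets borel"
    by (rule measurable_sets[OF p]) (use A in simp)
  then have "{y :: real ^ 'n ^ 'm. y $ j \<in> S} \<in> sets lebesgue" by (simp add: vimage_def)
  moreover have "{y :: real ^ 'n ^ 'm. y $ j \<in> N} \<in> sets lebesgue"
  proof -
    have "{y :: real ^ 'n ^ 'm. y $ j \<in> N} \<in> null_sets (completion lborel)"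
      using null_sets_proj[OF A(3), of j] A(2) by (intro null_sets_completion_subset[OF _ null_sets_completionI]) auto
    then show ?thesis by (simp add: null_sets_def)
  qed
  moreover have "(\<lambda>y :: real ^ 'n ^ 'm. y $ j) -` A \<inter> space lebesgue = {y. y $ j \<in> S} \<union> {y. y $ j \<in> N}"
    by (auto simp: A)
  ultimately show "(\<lambda>y :: real ^ 'n ^ 'm. y $ j) -` A \<inter> space lebesgue \<in> sets lebesgue" by auto
qed simp

lemma nn_integral_lebesgue_vec:
  fixes f :: "'m::finite \<Rightarrow> real ^ 'n \<Rightarrow> ennreal"
  assumes f: "\<And>j. f j \<in> borel_measurable lebesgue"
  shows "(\<integral>\<^sup>+y. (\<Prod>j\<in>UNIV. f j (y $ j)) \<partial>lebesgue) = (\<Prod>j\<in>UNIV. \<integral>\<^sup>+x. f j x \<partial>lebesgue)"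
proof -
  have "\<exists>g\<in>borel_measurable lborel. AE x in lborel. f j x = g x" for j
    by (rule completion_ex_borel_measurable[OF f])
  then obtain g where g: "\<And>j. g j \<in> borel_measurable lborel" "\<And>j. AE x in lborel. f j x = g j x" by metis
  have ae: "AE y in lebesgue. f j ((y :: real ^ 'n ^ 'm) $ j) = g j (y $ j)" for j
    by (rule AE_proj) (rule AE_completion[OF g(2)])
  have "AE y in lebesgue. \<forall>j\<in>UNIV. f j ((y :: real ^ 'n ^ 'm) $ j) = g j (y $ j)"
    by (subst AE_finite_all) (use ae in auto)
  then have "(\<integral>\<^sup>+y. (\<Prod>j\<in>UNIV. f j (y $ j)) \<partial>(lebesgue :: (real ^ 'n ^ 'm) measure)) = (\<integral>\<^sup>+y. (\<Prod>j\<in>UNIV. g j (y $ j)) \<partial>lebesgue)"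
    by (intro nn_integral_cong_AE) (auto elim!: eventually_mono intro!: prod.cong)
  also have "\<dots> = (\<integral>\<^sup>+y. (\<Prod>j\<in>UNIV. g j (y $ j)) \<partial>lborel)" by (rule nn_integral_completion)
  also have "\<dots> = (\<Prod>j\<in>UNIV. \<integral>\<^sup>+x. g j x \<partial>lborel)"
    using g by (intro nn_integral_lborel_vec) auto
  also have "\<dots> = (\<Prod>j\<in>UNIV. \<integral>\<^sup>+x. f j x \<partial>lebesgue)"
  proof (intro prod.cong refl)
    fix j
    have "(\<integral>\<^sup>+x. g j x \<partial>lborel) = (\<integral>\<^sup>+x. g j x \<partial>lebesgue)" by (rule nn_integral_completion[symmetric])
    also have "\<dots> = (\<integral>\<^sup>+x. f j x \<partial>lebesgue)"
      using AE_completion[OF g(2)[of j]] by (intro nn_integral_cong_AE) (auto elim!: eventually_mono)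
    finally show "(\<integral>\<^sup>+x. g j x \<partial>lborel) = (\<integral>\<^sup>+x. f j x \<partial>lebesgue)" .
  qed
  finally show ?thesis .
qed

lemma locally_integrable_measurable:
  fixes b :: "real ^ 'n \<Rightarrow> complex"
  assumes "\<And>S. compact S \<Longrightarrow> b absolutely_integrable_on S"
  shows "b \<in> borel_measurable lebesgue"
proof (rule borel_measurable_LIMSEQ_metric)
  fix k :: nat
  have "set_integrable lebesgue (cball 0 (real k)) b" by (rule assms) simp
  then show "(\<lambda>x. indicator (cball 0 (real k)) x *\<^sub>R b x) \<in> borel_measurable lebesgue"
    unfolding set_integrable_def by (rule borel_measurable_integrable)
next
  fix x :: "real ^ 'n"
  obtain k0 :: nat where "norm x \<le> real k0" using real_arch_simple by blast
  then have "indicator (cball 0 (real k)) x *\<^sub>R b x = b x" if "k0 \<le> k" for k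
    using that by (auto simp: indicator_def dist_norm intro: order_trans)
  then show "(\<lambda>k. indicator (cball 0 (real k)) x *\<^sub>R b x) \<longlonglongrightarrow> b x"
    by (intro tendsto_eventually) (auto simp: eventually_sequentially)
qed

section \<open>Cells and the cubes that enclose them\<close>

context dyadic
begin

text \<open>The choice depends on the cell and not on the point \<open>x\<close> in it, so all data
  of the enclosing cube are constant on cells.\<close>

definition center :: "nat \<Rightarrow> real ^ 'n \<Rightarrow> real ^ 'n"
  where "center i x = (SOME w. cell i x \<subseteq> cube w (side i))"

definition envelope :: "nat \<Rightarrow> real ^ 'n \<Rightarrow> (real ^ 'n) set"
  where "envelope i x = cube (center i x) (side i)"

lemma cell_subset_envelope: "cell i x \<subseteq> envelope i x"
  unfolding envelope_def center_def
  by (rule someI_ex[where P="\<lambda>w. cell i x \<subseteq> cube w (side i)"]) (use cell_subset_cube[of i x] in \<open>simp add: cell_def side_def\<close>)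

lemma emeasure_envelope: "emeasure lebesgue (envelope i x) = ennreal (vol i)"
  using side_pos[of i] by (simp add: envelope_def vol_def)

lemma cellwise_envelope: "cellwise i (envelope i)"
  unfolding envelope_def[abs_def] center_def[abs_def] by (rule cellwise_comp[OF cellwise_cell])

lemma cavg_eq_avg: "cavg lebesgue i g x = avg (envelope i x) (\<lambda>y. g y * indicator (cell i x) y)"
proof -
  have "(\<integral>\<^sup>+y\<in>envelope i x. (g y * indicator (cell i x) y) \<partial>lebesgue) = (\<integral>\<^sup>+y\<in>cell i x. g y \<partial>lebesgue)"
    using cell_subset_envelope[of i x] by (intro nn_integral_cong) (auto simp: indicator_def)
  then show ?thesis by (simp only: avg_def cavg_def emeasure_envelope lebesgue_cell)
qed

lemma cavg_le_avg: "cavg lebesgue i g x \<le> avg (envelope i x) g"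
  unfolding cavg_eq_avg avg_def
  by (intro divide_right_mono_ennreal nn_integral_mono) (auto simp: indicator_def)

end

text \<open>Cell and enclosing cube have the same volume, so the average over the cell is at most
  the average over the cube.\<close>

lemma (in dyadic_weight) dyadic_bmo_mean:
  assumes b: "\<And>S. compact S \<Longrightarrow> b absolutely_integrable_on S" and "bmo_norm b \<le> ennreal \<beta>" "0 < \<beta>"
  shows "dyadic_bmo c h M \<kappa> b (\<lambda>i x. mean (envelope i x) b) \<beta>"
proof
  show "b \<in> borel_measurable lebesgue" by (rule locally_integrable_measurable[OF b])
  show "cellwise i (\<lambda>x. mean (envelope i x) b)" for i by (rule cellwise_comp[OF cellwise_envelope])
  show "0 < \<beta>" by fact
  fix i x
  have "cavg lebesgue i (\<lambda>y. ennreal (cmod (b y - mean (envelope i x) b))) x \<le> avg (envelope i x) (\<lambda>y. ennreal (cmod (b y - mean (envelope i x) b)))"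
    by (rule cavg_le_avg)
  also have "\<dots> \<le> bmo_norm b"
    unfolding bmo_norm_def envelope_def by (intro SUP_upper cube_in_cubes side_pos)
  finally show "cavg lebesgue i (\<lambda>y. ennreal (cmod (b y - mean (envelope i x) b))) x \<le> ennreal \<beta>"
    using assms(2) by (rule order_trans)
qed

definition osc_const :: "nat \<Rightarrow> real \<Rightarrow> real"
  where "osc_const N r = jn_const N 2 (r / (r - 1)) powr (1 - 1 / r)"

context dyadic_bmo
begin

lemma lebesgue_dyadic_bmo: "dyadic_bmo c h lebesgue 2 b bm \<beta>"
proof -
  interpret L: dyadic_weight c h lebesgue 2 by (rule lebesgue_dyadic_weight)
  show ?thesis by unfold_locales (auto intro: bm_cellwise beta osc)
qed

text \<open>The reason for averages of order \<open>r > 1\<close>: the oscillation takes the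
  conjugate exponent, where John-Nirenberg for Lebesgue measure bounds its moment.\<close>

lemma cavg_osc_mult_le:
  assumes [measurable]: "f \<in> borel_measurable lebesgue" and r: "1 < r"
  shows "cavg lebesgue i (\<lambda>y. (ennreal (cmod (b y - bm i x)) + ennreal \<beta>) * f y) x
    \<le> ennreal (osc_const CARD('n) r * \<beta>) * cavg lebesgue i (\<lambda>y. f y powe r) x powe (1 / r)"
proof -
  interpret L: dyadic_bmo c h lebesgue 2 b bm \<beta> by (rule lebesgue_dyadic_bmo)
  define r' where "r' = r / (r - 1)"
  have r': "0 < r'" "1 - 1 / r = 1 / r'" using r by (auto simp: r'_def field_simps)
  have "cavg lebesgue i (\<lambda>y. (ennreal (cmod (b y - bm i x)) + ennreal \<beta>) * f y) x = cavg lebesgue i (\<lambda>y. B i y * f y) x"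
  proof (rule antisym; rule cavg_mono_on)
    fix y assume "y \<in> cell i x"
    then have "B i y = ennreal (cmod (b y - bm i x)) + ennreal \<beta>"
      using cellwiseD[OF bm_cellwise] beta by (simp add: B_def)
    then show "(ennreal (cmod (b y - bm i x)) + ennreal \<beta>) * f y \<le> B i y * f y"
      "B i y * f y \<le> (ennreal (cmod (b y - bm i x)) + ennreal \<beta>) * f y" by simp_all
  qed
  also have "\<dots> \<le> cavg lebesgue i (\<lambda>y. B i y powe (1 / (1 - 1 / r))) x powe (1 - 1 / r)
    * cavg lebesgue i (\<lambda>y. f y powe (1 / (1 - (1 - 1 / r)))) x powe (1 - (1 - 1 / r))"
    using r by (intro cavg_Holder) auto
  also have "\<dots> = cavg lebesgue i (\<lambda>y. B i y powe r') x powe (1 / r') * cavg lebesgue i (\<lambda>y. f y powe r) x powe (1 / r)"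
  proof -
    have "1 - (1 - 1 / r) = 1 / r" "1 / (1 - (1 - 1 / r)) = r" "1 / (1 / r') = r'" by simp_all
    then show ?thesis by (simp only: r'(2))
  qed
  also have "\<dots> \<le> ennreal (jn_const CARD('n) 2 r' * \<beta> powr r') powe (1 / r') * cavg lebesgue i (\<lambda>y. f y powe r) x powe (1 / r)"
  proof (intro mult_right_mono powe_mono)
    have "cavg lebesgue i (\<lambda>y. B i y powe r') x
      \<le> ennreal (jn_const CARD('n) 2 r' * \<beta> powr r') * ennreal (vol i) / ennreal (vol i)"
      unfolding cavg_def lebesgue_cell using L.B_moment[of r' i x] r'
      by (intro divide_right_mono_ennreal) (simp add: lebesgue_cell)
    then show "cavg lebesgue i (\<lambda>y. B i y powe r') x \<le> ennreal (jn_const CARD('n) 2 r' * \<beta> powr r')"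
      using vol_pos[of i] by (simp add: ennreal_mult_divide_eq)
  qed (use r' in auto)
  also have "ennreal (jn_const CARD('n) 2 r' * \<beta> powr r') powe (1 / r') = ennreal (osc_const CARD('n) r * \<beta>)"
    using r' beta L.jn_const_nonneg[of r'] by (simp add: powe_ennreal powr_mult powr_powr osc_const_def r'_def[symmetric])
  finally show ?thesis .
qed

lemma cell_term:
  fixes f :: "'m::finite \<Rightarrow> real ^ 'n \<Rightarrow> ennreal"
  assumes f: "\<And>j. f j \<in> borel_measurable lebesgue" and r: "1 < r"
  shows "(\<integral>\<^sup>+y. ennreal (cmod (b x - b (y $ l)) + \<beta>) * (\<Prod>j\<in>UNIV. f j (y $ j) * indicator (cell i x) (y $ j)) \<partial>lebesgue)
    \<le> ennreal ((1 + osc_const CARD('n) r) * vol i ^ CARD('m))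
      * ((\<Prod>j\<in>UNIV. cavg lebesgue i (\<lambda>y. f j y powe r) x powe (1 / r)) * B i x)"
proof -
  note f [measurable]
  define D where "D y = ennreal (cmod (b y - bm i x)) + ennreal \<beta>" for y
  have [measurable]: "D \<in> borel_measurable lebesgue" unfolding D_def[abs_def] by measurable
  define g where "g j y = f j y * indicator (cell i x) y" for j y
  define g' where "g' j y = (if j = l then D y else 1) * g j y" for j y
  have gm [measurable]: "g j \<in> borel_measurable lebesgue" "g' j \<in> borel_measurable lebesgue" for j
    unfolding g_def[abs_def] g'_def[abs_def] by measurable
  define a where "a j = cavg lebesgue i (\<lambda>y. f j y powe r) x powe (1 / r)" for j
  define J where "J = osc_const CARD('n) r"
  have J: "0 \<le> J" by (simp add: J_def osc_const_def)
  have g_le: "(\<integral>\<^sup>+y. g j y \<partial>lebesgue) \<le> ennreal (vol i) * a j" for j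
  proof -
    have "(\<integral>\<^sup>+y. g j y \<partial>lebesgue) = cavg lebesgue i (f j) x * ennreal (vol i)"
      using cavg_mult_eq[OF refl f, of i x j] by (simp add: g_def lebesgue_cell)
    also have "cavg lebesgue i (f j) x \<le> a j"
      using cavg_power_mean[OF refl f, of 1 r i j x] r by (simp add: a_def)
    finally show ?thesis by (simp add: mult.commute mult_right_mono)
  qed
  have D_le: "(\<integral>\<^sup>+y. D y * g l y \<partial>lebesgue) \<le> ennreal (J * \<beta>) * (ennreal (vol i) * a l)"
  proof -
    have "(\<integral>\<^sup>+y. D y * g l y \<partial>lebesgue) = cavg lebesgue i (\<lambda>y. D y * f l y) x * ennreal (vol i)"
      using cavg_mult_eq[OF refl, of "\<lambda>y. D y * f l y" i x] by (simp add: g_def lebesgue_cell mult_ac)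
    also have "cavg lebesgue i (\<lambda>y. D y * f l y) x \<le> ennreal (J * \<beta>) * a l"
      unfolding D_def J_def a_def by (rule cavg_osc_mult_le[OF f r])
    finally show ?thesis by (simp add: mult_ac mult_right_mono)
  qed
  have "(\<integral>\<^sup>+y. ennreal (cmod (b x - b (y $ l)) + \<beta>) * (\<Prod>j\<in>UNIV. f j (y $ j) * indicator (cell i x) (y $ j)) \<partial>lebesgue)
    \<le> (\<integral>\<^sup>+y. B i x * (\<Prod>j\<in>UNIV. g j ((y :: real ^ 'n ^ 'm) $ j)) + (\<Prod>j\<in>UNIV. g' j (y $ j)) \<partial>lebesgue)"
  proof (rule nn_integral_mono)
    fix y :: "real ^ 'n ^ 'm"
    \<comment> \<open>The constant of the cell separates the variables: one part depends on
      \<open>x\<close> only and factors out, the other joins the factor \<open>l\<close>, where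
      \<open>cavg_osc_mult_le\<close> trades it for an average of order \<open>r\<close>.\<close>
    have "cmod (b x - b (y $ l)) + \<beta> \<le> (cmod (b x - bm i x) + \<beta>) + (cmod (b (y $ l) - bm i x) + \<beta>)"
      using norm_triangle_ineq4[of "b x - bm i x" "b (y $ l) - bm i x"] beta by simp
    then have "ennreal (cmod (b x - b (y $ l)) + \<beta>) \<le> B i x + D (y $ l)"
      unfolding B_def D_def using beta by (simp add: ennreal_plus[symmetric] ennreal_leI del: ennreal_plus)
    then have "ennreal (cmod (b x - b (y $ l)) + \<beta>) * (\<Prod>j\<in>UNIV. g j (y $ j)) \<le> (B i x + D (y $ l)) * (\<Prod>j\<in>UNIV. g j (y $ j))"
      by (rule mult_right_mono) simp
    also have "\<dots> = B i x * (\<Prod>j\<in>UNIV. g j (y $ j)) + D (y $ l) * (\<Prod>j\<in>UNIV. g j (y $ j))"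
      by (simp add: distrib_right)
    also have "D (y $ l) * (\<Prod>j\<in>UNIV. g j (y $ j)) = (\<Prod>j\<in>UNIV. g' j (y $ j))"
      unfolding g'_def prod.distrib by (subst prod.delta) auto
    finally show "ennreal (cmod (b x - b (y $ l)) + \<beta>) * (\<Prod>j\<in>UNIV. f j (y $ j) * indicator (cell i x) (y $ j))
      \<le> B i x * (\<Prod>j\<in>UNIV. g j (y $ j)) + (\<Prod>j\<in>UNIV. g' j (y $ j))" by (simp add: g_def)
  qed
  also have "\<dots> = B i x * (\<Prod>j\<in>UNIV. \<integral>\<^sup>+y. g j y \<partial>lebesgue) + (\<Prod>j\<in>UNIV. \<integral>\<^sup>+y. g' j y \<partial>lebesgue)"
  proof -
    have m: "(\<lambda>y :: real ^ 'n ^ 'm. \<Prod>j\<in>UNIV. g j (y $ j)) \<in> borel_measurable lebesgue"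
      "(\<lambda>y :: real ^ 'n ^ 'm. \<Prod>j\<in>UNIV. g' j (y $ j)) \<in> borel_measurable lebesgue"
      by (intro borel_measurable_prod_ennreal borel_measurable_proj gm)+
    show ?thesis
      using m by (subst nn_integral_add) (auto simp: nn_integral_cmult nn_integral_lebesgue_vec gm)
  qed
  also have "(\<Prod>j\<in>UNIV. \<integral>\<^sup>+y. g j y \<partial>lebesgue) \<le> (\<Prod>j\<in>UNIV. ennreal (vol i) * a j)"
    by (intro prod_mono_ennreal g_le)
  also have "(\<Prod>j\<in>UNIV. \<integral>\<^sup>+y. g' j y \<partial>lebesgue) \<le> (\<Prod>j\<in>UNIV. (if j = l then ennreal (J * \<beta>) else 1) * (ennreal (vol i) * a j))"
  proof (intro prod_mono_ennreal)
    fix j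
    show "(\<integral>\<^sup>+y. g' j y \<partial>lebesgue) \<le> (if j = l then ennreal (J * \<beta>) else 1) * (ennreal (vol i) * a j)"
      using D_le g_le[of j] by (cases "j = l") (auto simp: g'_def)
  qed
  also have "\<dots> = ennreal (J * \<beta>) * (\<Prod>j\<in>UNIV. ennreal (vol i) * a j)"
    unfolding prod.distrib by (subst prod.delta) auto
  also have "B i x * (\<Prod>j\<in>UNIV. ennreal (vol i) * a j) + ennreal (J * \<beta>) * (\<Prod>j\<in>UNIV. ennreal (vol i) * a j)
    \<le> B i x * (\<Prod>j\<in>UNIV. ennreal (vol i) * a j) + (ennreal J * B i x) * (\<Prod>j\<in>UNIV. ennreal (vol i) * a j)"
    using beta J unfolding B_def
    by (intro add_left_mono mult_right_mono) (auto simp: ennreal_mult[symmetric] simp del: ennreal_plus intro!: ennreal_leI mult_left_mono)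
  also have "\<dots> = ennreal ((1 + J) * vol i ^ CARD('m)) * ((\<Prod>j\<in>UNIV. a j) * B i x)"
  proof -
    have "ennreal ((1 + J) * vol i ^ CARD('m)) = (1 + ennreal J) * ennreal (vol i) ^ CARD('m)"
      using J vol_pos[of i] by (simp add: ennreal_mult ennreal_power)
    then show ?thesis by (simp add: prod.distrib distrib_right distrib_left mult_ac)
  qed
  finally show ?thesis unfolding a_def J_def by (blast intro: add_left_mono add_right_mono mult_left_mono zero_le)
qed

end

section \<open>The decay of the kernel as a sum over shifted grids\<close>

definition rad :: "real ^ 'n \<Rightarrow> real ^ 'n ^ 'm \<Rightarrow> real"
  where "rad x y = (\<Sum>j\<in>UNIV. norm (x - y $ j))"

lemma rad_nonneg: "0 \<le> rad x y"
  unfolding rad_def by (intro sum_nonneg) simp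

lemma norm_le_rad: "norm (x - y $ j) \<le> rad x y"
  unfolding rad_def by (rule member_le_sum) auto

lemma rad_continuous: "continuous_on UNIV (rad x)"
  unfolding rad_def[abs_def] by (intro continuous_intros)

lemma rad_measurable [measurable]: "rad x \<in> borel_measurable lebesgue"
  using borel_measurable_continuous_onI[OF rad_continuous, of x]
  by (intro measurable_completion) simp

text \<open>Take the generation \<open>i\<close> with
  \<open>6 * rad x y < h / 2 ^ i \<le> 12 * rad x y\<close>. Then \<open>x\<close> and all
  \<open>y $ j\<close> are close enough to share a cell of generation \<open>i\<close> in one of the
  grids, and the term of that cell is comparable to the left side.\<close>

lemma kernel_le_grid_sum:
  fixes x :: "real ^ 'n" and y :: "real ^ 'n ^ 'm"
  assumes h: "0 < h" and g: "0 < g" and rad: "0 < rad x y" "rad x y < h / 6"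
  shows "ennreal (rad x y powr (- g)) \<le> ennreal (12 powr g) *
    (\<Sum>\<tau>\<in>UNIV. \<Sum>i. ennreal ((h / 2 ^ i) powr (- g)) * (\<Prod>j\<in>UNIV. indicator {z. grid \<tau> h i z = grid \<tau> h i x} (y $ j)))"
proof -
  define L where "L = log 2 (h / (6 * rad x y))"
  have q: "1 < h / (6 * rad x y)" using rad by (simp add: field_simps)
  then have L: "0 < L" unfolding L_def by simp
  \<comment> \<open>Generations start at 0; this is possible since \<open>rad x y < h / 6\<close>
    makes \<open>L\<close> positive.\<close>
  define i where "i = nat (\<lceil>L\<rceil> - 1)"
  have i: "real i < L" "L \<le> real (Suc i)" using L unfolding i_def by linarith+
  have "2 powr (real i) < h / (6 * rad x y)" using i(1) q unfolding L_def by (simp add: less_log_iff)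
  then have i1: "rad x y < h / 2 ^ i / 6" using rad by (simp add: powr_realpow field_simps)
  have "h / (6 * rad x y) \<le> 2 powr (real (Suc i))" using i(2) q unfolding L_def by (simp add: log_le_iff del: of_nat_Suc)
  then have i2: "h / 2 ^ i \<le> 12 * rad x y" using rad by (simp add: powr_realpow field_simps del: of_nat_Suc)
  let ?S = "insert x (range (\<lambda>j. y $ j))"
  have cmp: "\<bar>z $ l - x $ l\<bar> \<le> rad x y" if "z \<in> ?S" for z l
    using that norm_le_rad[of x y] rad_nonneg[of x y] component_le_norm_cart[of "x - z" l]
    by (auto simp: abs_minus_commute intro: order_trans)
  have "z $ l - z' $ l < h / 2 ^ i / 3" if "z \<in> ?S" "z' \<in> ?S" for z z' l
  proof -
    define d where "d = h / 2 ^ i"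
    show ?thesis using cmp[OF that(1), of l] cmp[OF that(2), of l] i1
      unfolding d_def[symmetric] by (auto simp: abs_le_iff)
  qed
  then obtain \<tau> where \<tau>: "\<And>z z'. z \<in> ?S \<Longrightarrow> z' \<in> ?S \<Longrightarrow> grid \<tau> h i z = grid \<tau> h i z'"
    using one_third_trick[OF h, of ?S i] by blast
  have "rad x y powr (- g) \<le> 12 powr g * (h / 2 ^ i) powr (- g)"
  proof -
    have "(12 * rad x y) powr (- g) \<le> (h / 2 ^ i) powr (- g)"
      using i2 h g by (intro powr_mono2') auto
    then have "12 powr g * (12 * rad x y) powr (- g) \<le> 12 powr g * (h / 2 ^ i) powr (- g)"
      by (rule mult_left_mono) simp
    moreover have "12 powr g * (12 * rad x y) powr (- g) = rad x y powr (- g)"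
      using rad by (simp add: powr_mult powr_minus field_simps)
    ultimately show ?thesis by simp
  qed
  then have "ennreal (rad x y powr (- g)) \<le> ennreal (12 powr g) * ennreal ((h / 2 ^ i) powr (- g))"
    by (simp add: ennreal_mult[symmetric] ennreal_leI)
  also have "ennreal ((h / 2 ^ i) powr (- g)) = ennreal ((h / 2 ^ i) powr (- g)) * (\<Prod>j\<in>UNIV. indicator {z. grid \<tau> h i z = grid \<tau> h i x} (y $ j))"
    using \<tau> by (subst prod.neutral) auto
  also have "\<dots> \<le> (\<Sum>i. ennreal ((h / 2 ^ i) powr (- g)) * (\<Prod>j\<in>UNIV. indicator {z. grid \<tau> h i z = grid \<tau> h i x} (y $ j)))"
    by (rule ennreal_le_suminf)
  also have "\<dots> \<le> (\<Sum>\<tau>\<in>UNIV. \<Sum>i. ennreal ((h / 2 ^ i) powr (- g)) * (\<Prod>j\<in>UNIV. indicator {z. grid \<tau> h i z = grid \<tau> h i x} (y $ j)))"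
    by (rule member_le_sum[of \<tau>]) auto
  finally show ?thesis by (simp add: mult_left_mono)
qed

lemma sparse_gap_exists:
  fixes \<alpha> r :: real and m :: nat
  assumes "0 < \<alpha>" "0 < r" "0 < m"
  shows "\<exists>N. sparse_gap \<alpha> r m N"
proof -
  define c where "c = 2 powr (\<alpha> * r / (2 * real m))"
  have "1 < c" unfolding c_def using assms by (intro gr_one_powr) auto
  then obtain N where N: "2 * real m < c ^ N" using real_arch_pow by blast
  have "N \<noteq> 0" using N assms by (cases N) auto
  moreover have "c ^ N = 2 powr (\<alpha> * r * real N / (2 * real m))"
    by (simp add: c_def powr_realpow[symmetric] powr_powr)
  ultimately show ?thesis using N unfolding sparse_gap_def by (intro exI[of _ N]) auto
qed

lemma powe_liminf_le:
  fixes u :: "nat \<Rightarrow> ennreal"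
  assumes "0 < q"
  shows "liminf u powe q \<le> liminf (\<lambda>k. u k powe q)"
  unfolding liminf_SUP_INF powe_SUP[OF assms]
  by (intro SUP_mono) (auto intro!: INF_greatest powe_mono[OF assms] INF_lower)

section \<open>Weighted bounds for the positive operator\<close>

context multiple_weight
begin

text \<open>The A-infinity property passes from cubes to cells: a subset of half the volume of the
  cell also has half the volume of the enclosing cube.\<close>

lemma dyadic_weight_grid:
  assumes h: "0 < h"
  shows "dyadic_weight (grid \<tau> h) h M A_inf_const"
proof -
  interpret dyadic "grid \<tau> h" h by (rule dyadic_grid[OF h])
  show ?thesis
  proof
    show "sets M = sets lebesgue" by (rule sets_M)
    show "AE x in lebesgue. P x \<Longrightarrow> AE x in M. P x" for P by (rule AE_M)
    show "1 < A_inf_const" by (simp add: A_inf_const_def)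
    fix i x
    have le: "emeasure M (cell i x) \<le> emeasure M (envelope i x)"
      by (intro emeasure_mono cell_subset_envelope) (simp add: sets_M envelope_def)
    then show "emeasure M (cell i x) < top"
      using emeasure_M_cube_finite[OF side_pos[of i]] unfolding envelope_def by (rule le_less_trans)
    fix E assume E: "E \<in> sets lebesgue" "E \<subseteq> cell i x" "emeasure lebesgue (cell i x) \<le> 2 * emeasure lebesgue E"
    have "emeasure M (envelope i x) \<le> ennreal A_inf_const * emeasure M E"
      unfolding envelope_def
    proof (rule A_infinity[OF side_pos E(1)])
      show "E \<subseteq> cube (center i x) (side i)" using E(2) cell_subset_envelope[of i x] unfolding envelope_def by blast
      show "emeasure lebesgue (cube (center i x) (side i)) \<le> 2 * emeasure lebesgue E"
        using E(3) emeasure_envelope[of i x] unfolding envelope_def lebesgue_cell by simp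
    qed
    with le show "emeasure M (cell i x) \<le> ennreal A_inf_const * emeasure M E" by (rule order_trans)
  qed
qed

context
  fixes p :: "'m \<Rightarrow> real" and t P q \<alpha> r :: real and N :: nat
  assumes t: "1 < t" and r: "1 < r" "r < t" and p: "\<And>j. t \<le> p j" and Rp: "\<And>j. R j = p j / t"
    and P: "1 / P = (\<Sum>j\<in>UNIV. 1 / p j)" and q: "1 / q = 1 / P - \<alpha> / real CARD('n)" "0 < q" "U = q / t"
    and \<alpha>: "0 < \<alpha>" and N: "sparse_gap \<alpha> r CARD('m) N"
begin

text \<open>As \<open>r < t\<close>, the positive margin \<open>1 / r - 1 / t\<close> puts
  \<open>e j\<close> below \<open>p j\<close>. It does not depend on \<open>p j\<close>, so it
  survives at \<open>p j = t\<close>, where \<open>R j = 1\<close>.\<close>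

definition e :: "'m \<Rightarrow> real"
  where "e j = 1 / (1 / r - 1 / t + 1 / p j)"

definition C1 :: real
  where "C1 = grid_const CARD('n) A_inf_const q \<alpha> N P p e * A0 powr U"

lemma e: "1 / e j = 1 / r - (1 - 1 / R j) / t" "0 < e j" "e j < p j"
proof -
  have p0: "0 < p j" using p[of j] t by simp
  have rt: "1 / t < 1 / r" using r t by (simp add: frac_less2)
  then have pos: "1 / p j < 1 / r - 1 / t + 1 / p j" by simp
  have p1: "0 < 1 / p j" using p0 by simp
  then have s: "0 < 1 / r - 1 / t + 1 / p j" using pos by linarith
  then show "0 < e j" unfolding e_def by (simp only: zero_less_divide_1_iff)
  have "1 / (1 / r - 1 / t + 1 / p j) < 1 / (1 / p j)"
    by (rule divide_strict_left_mono[OF pos]) (use s p1 in \<open>simp_all only: mult_pos_pos zero_less_one\<close>)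
  then show "e j < p j" unfolding e_def by simp
  show "1 / e j = 1 / r - (1 - 1 / R j) / t" using p0 t by (simp add: e_def Rp field_simps)
qed

lemma grid_operator_bound:
  fixes f :: "'m \<Rightarrow> real ^ 'n \<Rightarrow> ennreal"
  assumes b: "\<And>S. compact S \<Longrightarrow> b absolutely_integrable_on S" and \<beta>: "bmo_norm b \<le> ennreal \<beta>" "0 < \<beta>"
    and f: "\<And>j. f j \<in> borel_measurable lebesgue" and h: "0 < h" and g: "g = real CARD('m) * real CARD('n) - \<alpha>"
  shows "\<exists>S\<in>borel_measurable lebesgue.
    (\<forall>x. (\<integral>\<^sup>+y. ennreal (cmod (b x - b (y $ l)) + \<beta>) * (\<Sum>i. ennreal ((h / 2 ^ i) powr (- g)) * (\<Prod>j\<in>UNIV. indicator {z. grid \<tau> h i z = grid \<tau> h i x} (y $ j)))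
        * (\<Prod>j\<in>UNIV. f j (y $ j)) \<partial>lebesgue) \<le> ennreal (1 + osc_const CARD('n) r) * S x) \<and>
    (\<integral>\<^sup>+x. S x powe q \<partial>M) \<le> ennreal (C1 * \<beta> powr q) * (\<Prod>j\<in>UNIV. (\<integral>\<^sup>+x. (f j x * ennreal (\<omega> j x) powe (1 / t)) powe p j \<partial>lebesgue) powe (q / p j))"
proof -
  interpret W: dyadic_weight "grid \<tau> h" h M A_inf_const by (rule dyadic_weight_grid[OF h])
  interpret D: dyadic_bmo "grid \<tau> h" h M A_inf_const b "\<lambda>i x. mean (W.envelope i x) b" \<beta>
    by (rule W.dyadic_bmo_mean[OF b \<beta>])
  note f [measurable]
  have bm [measurable]: "b \<in> borel_measurable lebesgue" by (rule locally_integrable_measurable[OF b])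
  define \<sigma> where "\<sigma> i x = (\<Prod>j\<in>UNIV. W.cavg lebesgue i (\<lambda>y. f j y powe r) x powe (1 / r))" for i x
  have \<sigma>m [measurable]: "\<sigma> i \<in> borel_measurable lebesgue" for i
  proof -
    have "W.cellwise i (\<sigma> i)" unfolding \<sigma>_def by (intro W.cellwise_prod W.cellwise_comp[OF W.cellwise_cavg])
    then show ?thesis by (rule W.borel_measurable_cellwise[OF refl])
  qed
  define S where "S x = (\<Sum>i. ennreal (W.side i powr \<alpha>) * \<sigma> i x * D.B i x)" for x
  have "S \<in> borel_measurable lebesgue" unfolding S_def[abs_def] by measurable
  moreover have "(\<integral>\<^sup>+y. ennreal (cmod (b x - b (y $ l)) + \<beta>) * (\<Sum>i. ennreal ((h / 2 ^ i) powr (- g)) * (\<Prod>j\<in>UNIV. indicator {z. grid \<tau> h i z = grid \<tau> h i x} (y $ j)))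
        * (\<Prod>j\<in>UNIV. f j (y $ j)) \<partial>lebesgue) \<le> ennreal (1 + osc_const CARD('n) r) * S x" for x
  proof -
    let ?J = "osc_const CARD('n) r"
    have J: "0 \<le> ?J" by (simp add: osc_const_def)
    define Z where "Z i y = ennreal (cmod (b x - b (y $ l)) + \<beta>) * (\<Prod>j\<in>UNIV. f j (y $ j) * indicator (W.cell i x) (y $ j))" for i and y :: "real ^ 'n ^ 'm"
    have Zm: "Z i \<in> borel_measurable lebesgue" for i
    proof -
      have 1: "(\<lambda>z. ennreal (cmod (b x - b z) + \<beta>)) \<in> borel_measurable lebesgue" by measurable
      have 2: "(\<lambda>z. f j z * indicator (W.cell i x) z) \<in> borel_measurable lebesgue" for j by measurable
      show ?thesis
        unfolding Z_def by (intro borel_measurable_times_ennreal borel_measurable_prod_ennreal borel_measurable_proj[OF 1] borel_measurable_proj[OF 2])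
    qed
    have "(\<integral>\<^sup>+y. ennreal (cmod (b x - b (y $ l)) + \<beta>) * (\<Sum>i. ennreal ((h / 2 ^ i) powr (- g)) * (\<Prod>j\<in>UNIV. indicator {z. grid \<tau> h i z = grid \<tau> h i x} (y $ j)))
        * (\<Prod>j\<in>UNIV. f j (y $ j)) \<partial>(lebesgue :: (real ^ 'n ^ 'm) measure))
      = (\<integral>\<^sup>+y. (\<Sum>i. ennreal (W.side i powr (- g)) * Z i y) \<partial>lebesgue)"
    proof (rule nn_integral_cong)
      fix y :: "real ^ 'n ^ 'm"
      let ?c = "ennreal (cmod (b x - b (y $ l)) + \<beta>)" and ?F = "\<Prod>j\<in>UNIV. f j (y $ j)"
      have "(\<Sum>i. ennreal (W.side i powr (- g)) * Z i y) = (\<Sum>i. (?c * ?F) * (ennreal ((h / 2 ^ i) powr (- g)) * (\<Prod>j\<in>UNIV. indicator {z. grid \<tau> h i z = grid \<tau> h i x} (y $ j))))"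
        by (intro suminf_cong) (simp add: Z_def W.side_def W.cell_def prod.distrib mult_ac)
      then show "?c * (\<Sum>i. ennreal ((h / 2 ^ i) powr (- g)) * (\<Prod>j\<in>UNIV. indicator {z. grid \<tau> h i z = grid \<tau> h i x} (y $ j))) * ?F
        = (\<Sum>i. ennreal (W.side i powr (- g)) * Z i y)" by (simp only: ennreal_suminf_cmult) (simp only: mult_ac)
    qed
    also have "\<dots> = (\<Sum>i. ennreal (W.side i powr (- g)) * (\<integral>\<^sup>+y. Z i y \<partial>lebesgue))"
      using Zm by (subst nn_integral_suminf) (auto simp: nn_integral_cmult)
    also have "\<dots> \<le> (\<Sum>i. ennreal (W.side i powr (- g)) * (ennreal ((1 + ?J) * W.vol i ^ CARD('m)) * (\<sigma> i x * D.B i x)))"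
      unfolding Z_def \<sigma>_def by (intro suminf_le mult_left_mono D.cell_term[OF f r(1)]) auto
    also have "\<dots> = (\<Sum>i. ennreal (1 + ?J) * (ennreal (W.side i powr \<alpha>) * \<sigma> i x * D.B i x))"
    proof (intro suminf_cong)
      fix i
      \<comment> \<open>The \<open>m\<close> integrals over a cell contribute
        \<open>vol i ^ m\<close> and the kernel \<open>side i powr (\<alpha> - m n)\<close>;
        together this is \<open>side i powr \<alpha>\<close>.\<close>
      have "W.side i powr (- g) * W.vol i ^ CARD('m) = W.side i powr \<alpha>"
      proof -
        have "W.vol i ^ CARD('m) = W.side i powr (real CARD('m) * real CARD('n))"
        proof -
          have "W.vol i ^ CARD('m) = W.side i ^ (CARD('n) * CARD('m))" by (simp add: W.vol_def power_mult)
          also have "\<dots> = W.side i powr real (CARD('n) * CARD('m))"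
            using W.side_pos[of i] by (simp only: powr_realpow)
          finally show ?thesis by (simp add: mult.commute)
        qed
        then show ?thesis using W.side_pos[of i] by (simp add: powr_add[symmetric] g)
      qed
      then have "ennreal (W.side i powr (- g)) * ennreal ((1 + ?J) * W.vol i ^ CARD('m)) = ennreal (1 + ?J) * ennreal (W.side i powr \<alpha>)"
        using J W.vol_pos[of i] by (simp add: ennreal_mult[symmetric] mult_ac del: ennreal_plus)
      then show "ennreal (W.side i powr (- g)) * (ennreal ((1 + ?J) * W.vol i ^ CARD('m)) * (\<sigma> i x * D.B i x))
        = ennreal (1 + ?J) * (ennreal (W.side i powr \<alpha>) * \<sigma> i x * D.B i x)"
        by (simp only: mult.assoc[symmetric])
    qed
    also have "\<dots> = ennreal (1 + ?J) * S x" unfolding S_def by (rule ennreal_suminf_cmult)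
    finally show ?thesis .
  qed
  moreover have "(\<integral>\<^sup>+x. S x powe q \<partial>M) \<le> ennreal (C1 * \<beta> powr q) * (\<Prod>j\<in>UNIV. (\<integral>\<^sup>+x. (f j x * ennreal (\<omega> j x) powe (1 / t)) powe p j \<partial>lebesgue) powe (q / p j))"
  proof -
    have w: "(\<Prod>j\<in>UNIV. W.cavg lebesgue i (\<lambda>y. f j y powe r) x powe (1 / r)) powe q * emeasure M (W.cell i x)
      \<le> ennreal (A0 powr U) * ennreal (W.vol i) * (\<Prod>j\<in>UNIV. W.cavg lebesgue i (\<lambda>y. (f j y * ennreal (\<omega> j y) powe (1 / t)) powe e j) x powe (q / e j))" for i x
      unfolding W.cavg_eq_avg W.emeasure_envelope[of i x, symmetric] unfolding W.envelope_def
    proof (rule weight_inequality[OF W.side_pos])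
      show "W.cell i x \<subseteq> cube (W.center i x) (W.side i)" using W.cell_subset_envelope[of i x] unfolding W.envelope_def .
    qed (use f r t e(1) q in auto)
    have "(\<integral>\<^sup>+x. S x powe q \<partial>M) \<le> ennreal (grid_const CARD('n) A_inf_const q \<alpha> N P p e * \<beta> powr q) * ennreal (A0 powr U)
      * (\<Prod>j\<in>UNIV. (\<integral>\<^sup>+x. (f j x * ennreal (\<omega> j x) powe (1 / t)) powe p j \<partial>lebesgue) powe (q / p j))"
      unfolding S_def \<sigma>_def
      by (rule D.grid_bound[OF f _ e(2,3) P q(1,2) \<alpha> _ N w]) (use r in auto)
    also have "ennreal (grid_const CARD('n) A_inf_const q \<alpha> N P p e * \<beta> powr q) * ennreal (A0 powr U) = ennreal (C1 * \<beta> powr q)"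
    proof -
      have "0 \<le> grid_const CARD('n) A_inf_const q \<alpha> N P p e"
        unfolding grid_const_def using D.embed_const_nonneg by (intro mult_nonneg_nonneg prod_nonneg) auto
      then show ?thesis by (simp add: C1_def ennreal_mult[symmetric] mult_ac)
    qed
    finally show ?thesis .
  qed
  ultimately show ?thesis by blast
qed

definition C2 :: real
  where "C2 = (12 powr (real CARD('m) * real CARD('n) - \<alpha>) * (1 + osc_const CARD('n) r)) powr q
    * (real CARD('n \<Rightarrow> bool) powr q * (real CARD('n \<Rightarrow> bool) * C1))"

text \<open>A measurable majorant is produced, so that the left side need not be measurable in
  \<open>x\<close>. Grids of coarsest side \<open>2 ^ k\<close> only see tuples with
  \<open>rad x y < 2 ^ k / 6\<close>. The bounds are uniform in \<open>k\<close>, but the majorants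
  \<open>W k\<close> are not known to be monotone, hence the lower limit and Fatou's lemma.\<close>

lemma kernel_domination:
  fixes f :: "'m \<Rightarrow> real ^ 'n \<Rightarrow> ennreal"
  assumes b: "\<And>S. compact S \<Longrightarrow> b absolutely_integrable_on S" and \<beta>: "bmo_norm b \<le> ennreal \<beta>" "0 < \<beta>"
    and f: "\<And>j. f j \<in> borel_measurable lebesgue" and g: "g = real CARD('m) * real CARD('n) - \<alpha>" "0 < g"
  shows "\<exists>W\<in>borel_measurable lebesgue.
    (\<forall>x. (\<integral>\<^sup>+y. ennreal (cmod (b x - b (y $ l)) + \<beta>) * ennreal (rad x y powr (- g)) * (\<Prod>j\<in>UNIV. f j (y $ j)) \<partial>lebesgue) \<le> W x) \<and>
    (\<integral>\<^sup>+x. W x powe q \<partial>M) \<le> ennreal (C2 * \<beta> powr q) * (\<Prod>j\<in>UNIV. (\<integral>\<^sup>+x. (f j x * ennreal (\<omega> j x) powe (1 / t)) powe p j \<partial>lebesgue) powe (q / p j))"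
proof -
  note f [measurable]
  have bm [measurable]: "b \<in> borel_measurable lebesgue" by (rule locally_integrable_measurable[OF b])
  define FF where "FF = (\<Prod>j\<in>UNIV. (\<integral>\<^sup>+x. (f j x * ennreal (\<omega> j x) powe (1 / t)) powe p j \<partial>lebesgue) powe (q / p j))"
  define J where "J = osc_const CARD('n) r"
  have J: "0 \<le> J" by (simp add: J_def osc_const_def)
  define T where "T \<tau> h x y = (\<Sum>i. ennreal ((h / 2 ^ i) powr (- g)) * (\<Prod>j\<in>UNIV. indicator {z. grid \<tau> h i z = grid \<tau> h i x} (y $ j)))"
    for \<tau> and h :: real and x :: "real ^ 'n" and y :: "real ^ 'n ^ 'm"
  define Q where "Q \<tau> k S \<longleftrightarrow> S \<in> borel_measurable lebesgue \<and>
    (\<forall>x. (\<integral>\<^sup>+y. ennreal (cmod (b x - b (y $ l)) + \<beta>) * T \<tau> (2 ^ k) x y * (\<Prod>j\<in>UNIV. f j (y $ j)) \<partial>lebesgue) \<le> ennreal (1 + J) * S x) \<and>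
    (\<integral>\<^sup>+x. S x powe q \<partial>M) \<le> ennreal (C1 * \<beta> powr q) * FF" for \<tau> and k :: nat and S
  have exQ: "\<exists>S. Q \<tau> k S" for \<tau> k
  proof -
    have h: "0 < (2 :: real) ^ k" by simp
    show ?thesis unfolding Q_def T_def FF_def J_def
      using grid_operator_bound[OF b \<beta> f h g(1), of l \<tau>] by (simp only: Bex_def)
  qed
  define S where "S \<tau> k = (SOME S. Q \<tau> k S)" for \<tau> k
  have SQ: "Q \<tau> k (S \<tau> k)" for \<tau> k unfolding S_def by (rule someI_ex[OF exQ])
  then have S: "\<And>\<tau> k. S \<tau> k \<in> borel_measurable lebesgue"
    "\<And>\<tau> k x. (\<integral>\<^sup>+y. ennreal (cmod (b x - b (y $ l)) + \<beta>) * T \<tau> (2 ^ k) x y * (\<Prod>j\<in>UNIV. f j (y $ j)) \<partial>lebesgue) \<le> ennreal (1 + J) * S \<tau> k x"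
    "\<And>\<tau> k. (\<integral>\<^sup>+x. S \<tau> k x powe q \<partial>M) \<le> ennreal (C1 * \<beta> powr q) * FF"
    unfolding Q_def by blast+
  note S(1) [measurable]
  have SM [measurable]: "S \<tau> k \<in> borel_measurable M" for \<tau> k
    using S(1) sets_M measurable_cong_sets by blast
  define c where "c = 12 powr g * (1 + J)"
  have c: "0 \<le> c" using J by (simp add: c_def)
  define W where "W k x = ennreal c * (\<Sum>\<tau>\<in>UNIV. S \<tau> k x)" for k x
  have Wm [measurable]: "W k \<in> borel_measurable lebesgue" "W k \<in> borel_measurable M" for k
    unfolding W_def[abs_def] by measurable
  define \<Phi> where "\<Phi> x y = ennreal (cmod (b x - b (y $ l)) + \<beta>) * ennreal (rad x y powr (- g)) * (\<Prod>j\<in>UNIV. f j (y $ j))"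
    for x and y :: "real ^ 'n ^ 'm"
  have pm: "(\<lambda>y :: real ^ 'n ^ 'm. ennreal (cmod (b x - b (y $ l)) + \<beta>)) \<in> borel_measurable lebesgue" for x
    by (rule borel_measurable_proj[of "\<lambda>z. ennreal (cmod (b x - b z) + \<beta>)"]) measurable
  have pf: "(\<lambda>y :: real ^ 'n ^ 'm. \<Prod>j\<in>UNIV. f j (y $ j)) \<in> borel_measurable lebesgue"
    by (intro borel_measurable_prod_ennreal borel_measurable_proj f)
  have \<Phi>m [measurable]: "\<Phi> x \<in> borel_measurable lebesgue" for x
  proof -
    have "(\<lambda>y :: real ^ 'n ^ 'm. ennreal (rad x y powr (- g))) \<in> borel_measurable lebesgue" by measurable
    then show ?thesis unfolding \<Phi>_def using pm pf by (intro borel_measurable_times_ennreal)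
  qed
  have Tm: "T \<tau> h x \<in> borel_measurable lebesgue" for \<tau> h x
  proof -
    have "(indicator {z. grid \<tau> h i z = grid \<tau> h i x} :: _ \<Rightarrow> ennreal) \<in> borel_measurable lebesgue" for i
      using grid_borel[of \<tau> h i "grid \<tau> h i x"] by (intro borel_measurable_indicator) simp
    then show ?thesis unfolding T_def
      by (intro borel_measurable_suminf_order borel_measurable_times_ennreal borel_measurable_prod_ennreal borel_measurable_proj) auto
  qed
  have trunc: "(\<integral>\<^sup>+y. \<Phi> x y * indicator {y. rad x y < 2 ^ k / 6} y \<partial>lebesgue) \<le> W k x" for k x
  proof -
    have "(\<integral>\<^sup>+y. \<Phi> x y * indicator {y. rad x y < 2 ^ k / 6} y \<partial>lebesgue)
      \<le> (\<integral>\<^sup>+y. (\<Sum>\<tau>\<in>UNIV. ennreal (12 powr g) * (ennreal (cmod (b x - b (y $ l)) + \<beta>) * T \<tau> (2 ^ k) x y * (\<Prod>j\<in>UNIV. f j (y $ j)))) \<partial>lebesgue)"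
    proof (rule nn_integral_mono)
      fix y :: "real ^ 'n ^ 'm"
      let ?c = "ennreal (cmod (b x - b (y $ l)) + \<beta>)" and ?F = "\<Prod>j\<in>UNIV. f j (y $ j)"
      have le: "ennreal (rad x y powr (- g)) * indicator {y. rad x y < 2 ^ k / 6} y \<le> ennreal (12 powr g) * (\<Sum>\<tau>\<in>UNIV. T \<tau> (2 ^ k) x y)"
      proof (cases "0 < rad x y \<and> rad x y < 2 ^ k / 6")
        case True
        then show ?thesis using kernel_le_grid_sum[of "2 ^ k" g x y] g(2) by (simp add: T_def)
      next
        case False
        \<comment> \<open>On the diagonal \<open>0 powr (- g) = 0\<close>, so the left side vanishes
          there.\<close>
        then have "rad x y = 0 \<or> \<not> rad x y < 2 ^ k / 6" using rad_nonneg[of x y] by linarith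
        then show ?thesis by auto
      qed
      have "\<Phi> x y * indicator {y. rad x y < 2 ^ k / 6} y = (?c * ?F) * (ennreal (rad x y powr (- g)) * indicator {y. rad x y < 2 ^ k / 6} y)"
        by (simp add: \<Phi>_def mult_ac)
      also have "\<dots> \<le> (?c * ?F) * (ennreal (12 powr g) * (\<Sum>\<tau>\<in>UNIV. T \<tau> (2 ^ k) x y))"
        by (intro mult_left_mono le) simp
      also have "\<dots> = (\<Sum>\<tau>\<in>UNIV. ennreal (12 powr g) * (?c * T \<tau> (2 ^ k) x y * ?F))"
        unfolding sum_distrib_left by (intro sum.cong) (simp_all only: mult_ac)
      finally show "\<Phi> x y * indicator {y. rad x y < 2 ^ k / 6} y \<le> (\<Sum>\<tau>\<in>UNIV. ennreal (12 powr g) * (?c * T \<tau> (2 ^ k) x y * ?F))" .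
    qed
    also have "\<dots> = (\<Sum>\<tau>\<in>UNIV. ennreal (12 powr g) * (\<integral>\<^sup>+y. ennreal (cmod (b x - b (y $ l)) + \<beta>) * T \<tau> (2 ^ k) x y * (\<Prod>j\<in>UNIV. f j (y $ j)) \<partial>lebesgue))"
      using Tm pm pf by (subst nn_integral_sum) (auto simp: nn_integral_cmult)
    also have "\<dots> \<le> (\<Sum>\<tau>\<in>UNIV. ennreal (12 powr g) * (ennreal (1 + J) * S \<tau> k x))"
      by (intro sum_mono mult_left_mono S(2)) auto
    also have "\<dots> = W k x"
      using J by (simp add: W_def c_def sum_distrib_left ennreal_mult mult.assoc del: ennreal_plus)
    finally show ?thesis .
  qed
  define V where "V x = liminf (\<lambda>k. W k x)" for x
  have Vm: "V \<in> borel_measurable lebesgue" unfolding V_def[abs_def] by measurable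
  have "(\<integral>\<^sup>+y. \<Phi> x y \<partial>lebesgue) \<le> V x" for x
  proof -
    have "\<Phi> x y = (SUP k. \<Phi> x y * indicator {y. rad x y < 2 ^ k / 6} y)" for y
    proof (rule antisym)
      obtain k where "6 * rad x y < 2 ^ k" using real_arch_pow[of 2 "6 * rad x y"] by auto
      then have "\<Phi> x y = \<Phi> x y * indicator {y. rad x y < 2 ^ k / 6} y" by simp
      also have "\<dots> \<le> (SUP k. \<Phi> x y * indicator {y. rad x y < 2 ^ k / 6} y)" by (rule SUP_upper) simp
      finally show "\<Phi> x y \<le> (SUP k. \<Phi> x y * indicator {y. rad x y < 2 ^ k / 6} y)" .
    qed (auto intro!: SUP_least simp: indicator_def)
    then have "(\<integral>\<^sup>+y. \<Phi> x y \<partial>lebesgue) = (\<integral>\<^sup>+y. (SUP k. \<Phi> x y * indicator {y. rad x y < 2 ^ k / 6} y) \<partial>lebesgue)" by simp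
    also have "\<dots> = (SUP k. \<integral>\<^sup>+y. \<Phi> x y * indicator {y. rad x y < 2 ^ k / 6} y \<partial>lebesgue)"
    proof (rule nn_integral_monotone_convergence_SUP)
      show "incseq (\<lambda>k y. \<Phi> x y * indicator {y. rad x y < 2 ^ k / 6} y)"
      proof (unfold incseq_Suc_iff le_fun_def, intro allI)
        fix k and y :: "real ^ 'n ^ 'm"
        have "rad x y < 2 ^ Suc k / 6" if "rad x y < 2 ^ k / 6"
          using that rad_nonneg[of x y] by (simp add: field_simps)
        then show "\<Phi> x y * indicator {y. rad x y < 2 ^ k / 6} y \<le> \<Phi> x y * indicator {y. rad x y < 2 ^ Suc k / 6} y"
          by (intro mult_left_mono) (auto simp: indicator_def)
      qed
      have "{y\<in>space lebesgue. rad x y < 2 ^ k / 6} \<in> sets (lebesgue :: (real ^ 'n ^ 'm) measure)" for k by measurable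
      then show "(\<lambda>y. \<Phi> x y * indicator {y. rad x y < 2 ^ k / 6} y) \<in> borel_measurable lebesgue" for k by simp
    qed
    also have "\<dots> \<le> V x"
    proof (rule SUP_least)
      fix k
      have mono: "(\<integral>\<^sup>+y. \<Phi> x y * indicator {y. rad x y < 2 ^ k / 6} y \<partial>lebesgue) \<le> W k' x" if "k \<le> k'" for k'
      proof -
        have "(2::real) ^ k \<le> 2 ^ k'" using that by (intro power_increasing) auto
        then have "rad x y < 2 ^ k' / 6" if "rad x y < 2 ^ k / 6" for y :: "real ^ 'n ^ 'm" using that by linarith
        then have "(\<integral>\<^sup>+y. \<Phi> x y * indicator {y. rad x y < 2 ^ k / 6} y \<partial>lebesgue) \<le> (\<integral>\<^sup>+y. \<Phi> x y * indicator {y. rad x y < 2 ^ k' / 6} y \<partial>lebesgue)"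
          by (intro nn_integral_mono mult_left_mono) (auto simp: indicator_def)
        also have "\<dots> \<le> W k' x" by (rule trunc)
        finally show ?thesis .
      qed
      then show "(\<integral>\<^sup>+y. \<Phi> x y * indicator {y. rad x y < 2 ^ k / 6} y \<partial>lebesgue) \<le> V x"
        unfolding V_def by (intro Liminf_bounded) (auto simp: eventually_sequentially)
    qed
    finally show ?thesis .
  qed
  moreover have "(\<integral>\<^sup>+x. V x powe q \<partial>M) \<le> ennreal (C2 * \<beta> powr q) * FF"
  proof -
    have Wle: "(\<integral>\<^sup>+x. W k x powe q \<partial>M) \<le> ennreal (C2 * \<beta> powr q) * FF" for k
    proof -
      let ?n = "real CARD('n \<Rightarrow> bool)"
      have "(\<integral>\<^sup>+x. W k x powe q \<partial>M) \<le> (\<integral>\<^sup>+x. ennreal (c powr q) * (ennreal (?n powr q) * (\<Sum>\<tau>\<in>UNIV. S \<tau> k x powe q)) \<partial>M)"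
        using q c powe_sum_le[OF q(2), of "UNIV :: ('n \<Rightarrow> bool) set"]
        by (intro nn_integral_mono) (auto simp: W_def powe_mult powe_ennreal intro!: mult_left_mono)
      also have "\<dots> = ennreal (c powr q) * (ennreal (?n powr q) * (\<Sum>\<tau>\<in>UNIV. \<integral>\<^sup>+x. S \<tau> k x powe q \<partial>M))"
        by (simp add: nn_integral_cmult nn_integral_sum)
      also have "\<dots> \<le> ennreal (c powr q) * (ennreal (?n powr q) * (\<Sum>\<tau>\<in>(UNIV :: ('n \<Rightarrow> bool) set). ennreal (C1 * \<beta> powr q) * FF))"
        by (intro mult_left_mono sum_mono S(3)) auto
      also have "\<dots> = ennreal (c powr q) * (ennreal (?n powr q) * (ennreal ?n * (ennreal (C1 * \<beta> powr q) * FF)))"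
        by (simp add: ennreal_of_nat_eq_real_of_nat del: card_fun)
      also have "\<dots> = ennreal (C2 * \<beta> powr q) * FF"
      proof (cases "0 \<le> C1")
        case True
        have arr: "ennreal a * (ennreal d * (ennreal n * (ennreal (C * B) * Z))) = ennreal (a * (d * (n * C)) * B) * Z"
          if "0 \<le> a" "0 \<le> d" "0 \<le> n" "0 \<le> C" "0 \<le> B" for a d n C B Z
          using that by (simp add: ennreal_mult mult_ac)
        show ?thesis unfolding C2_def J_def[symmetric] g(1)[symmetric] c_def[symmetric] by (rule arr) (use True in auto)
      next
        case False
        \<comment> \<open>Both constants then become 0 in \<open>ennreal\<close>, and both sides
          vanish.\<close>
        then have C1: "C1 \<le> 0" by simp
        have C2: "C2 \<le> 0" unfolding C2_def
          by (rule mult_nonneg_nonpos[OF _ mult_nonneg_nonpos[OF _ mult_nonneg_nonpos[OF _ C1]]]) (simp_all del: card_fun)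
        have "C1 * \<beta> powr q \<le> 0" "C2 * \<beta> powr q \<le> 0"
          by (rule mult_nonpos_nonneg, use C1 C2 in simp_all)+
        then show ?thesis by (simp add: ennreal_neg)
      qed
      finally show ?thesis .
    qed
    have "(\<integral>\<^sup>+x. V x powe q \<partial>M) \<le> (\<integral>\<^sup>+x. liminf (\<lambda>k. W k x powe q) \<partial>M)"
      unfolding V_def by (intro nn_integral_mono powe_liminf_le q)
    also have "\<dots> \<le> liminf (\<lambda>k. \<integral>\<^sup>+x. W k x powe q \<partial>M)"
      by (rule nn_integral_liminf) measurable
    also have "\<dots> \<le> liminf (\<lambda>k :: nat. ennreal (C2 * \<beta> powr q) * FF)"
      by (intro Liminf_mono always_eventually allI Wle)
    also have "\<dots> = ennreal (C2 * \<beta> powr q) * FF" by (rule Liminf_const) simp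
    finally show ?thesis .
  qed
  ultimately show ?thesis using Vm unfolding \<Phi>_def FF_def by blast
qed

end

end

subsection \<open>The kernel representation\<close>

lemma Lp_norm_1:
  assumes "0 < p"
  shows "Lp_norm p (\<lambda>x. 1) f = (\<integral>\<^sup>+x. ennreal (cmod (f x)) powe p \<partial>lebesgue) powe (1 / p)"
  by (simp add: Lp_norm_def powe_ennreal)

lemma Lp_space_1_iff:
  assumes "0 < p"
  shows "f \<in> Lp_space p (\<lambda>x. 1) \<longleftrightarrow> f \<in> borel_measurable lebesgue \<and> (\<integral>\<^sup>+x. ennreal (cmod (f x)) powe p \<partial>lebesgue) < top"
  using assms by (simp add: Lp_space_def Lp_norm_1)

lemma Lp_space_1_dominated:
  assumes p: "0 < p" and g: "g \<in> Lp_space p (\<lambda>x. 1)" and f: "f \<in> borel_measurable lebesgue" and le: "\<And>x. cmod (f x) \<le> cmod (g x)"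
  shows "f \<in> Lp_space p (\<lambda>x. 1)"
proof -
  have "(\<integral>\<^sup>+x. ennreal (cmod (f x)) powe p \<partial>lebesgue) \<le> (\<integral>\<^sup>+x. ennreal (cmod (g x)) powe p \<partial>lebesgue)"
    using le p by (intro nn_integral_mono powe_mono ennreal_leI)
  also have "\<dots> < top" using g by (simp add: Lp_space_1_iff[OF p])
  finally show ?thesis using f by (simp add: Lp_space_1_iff[OF p])
qed

lemma AE_interior_cell:
  fixes x :: "real ^ 'n"
  assumes h: "0 < h"
  shows "AE y in lebesgue. y \<in> {y. grid \<tau> h i y = z} \<longrightarrow> y \<in> interior {y :: real ^ 'n. grid \<tau> h i y = z}"
proof (cases "\<exists>x :: real ^ 'n. grid \<tau> h i x = z")
  case True
  then obtain x :: "real ^ 'n" where x: "grid \<tau> h i x = z" by blast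
  obtain a where a: "{y. grid \<tau> h i y = grid \<tau> h i x} \<subseteq> cbox a (a + (\<chi> l. h / 2 ^ i))"
    "box a (a + (\<chi> l. h / 2 ^ i)) \<subseteq> {y. grid \<tau> h i y = grid \<tau> h i x}" by (rule grid_cell[OF h])
  have "negligible (cbox a (a + (\<chi> l. h / 2 ^ i)) - box a (a + (\<chi> l. h / 2 ^ i)))"
    by (rule negligible_frontier_interval)
  then have "AE y in lebesgue. y \<notin> cbox a (a + (\<chi> l. h / 2 ^ i)) - box a (a + (\<chi> l. h / 2 ^ i))"
    by (intro AE_not_in) (simp add: negligible_iff_null_sets)
  moreover have "box a (a + (\<chi> l. h / 2 ^ i)) \<subseteq> interior {y. grid \<tau> h i y = z}"
    using a(2) x by (intro interior_maximal) auto
  ultimately show ?thesis using a(1) x by (auto elim!: eventually_mono)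
qed simp

lemma norm_le_of_decay:
  fixes u v :: "nat \<Rightarrow> real"
  assumes "\<And>i. a \<le> u i + v i" "u \<longlonglongrightarrow> 0" "v \<longlonglongrightarrow> 0"
  shows "a \<le> 0"
  using LIMSEQ_le_const[OF tendsto_add[OF assms(2,3)]] assms(1) by auto

locale kernel_operator =
  fixes \<alpha> :: real and K :: "real ^ 'n \<Rightarrow> real ^ 'n ^ 'm \<Rightarrow> complex" and s :: "'m::finite \<Rightarrow> real"
    and T :: "('m \<Rightarrow> real ^ 'n \<Rightarrow> complex) \<Rightarrow> real ^ 'n \<Rightarrow> complex" and S q B :: real
  assumes s: "\<And>j. 1 \<le> s j" and \<alpha>: "0 < \<alpha>"
    and S: "1 / S = (\<Sum>j\<in>UNIV. 1 / s j)" and q: "0 < q" "1 / q = 1 / S - \<alpha> / real CARD('n)" and B: "0 < B"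
    and T_measurable: "(\<And>j. f j \<in> Lp_space (s j) (\<lambda>x. 1)) \<Longrightarrow> T f \<in> borel_measurable lebesgue"
    and T_add: "\<lbrakk>\<And>j. f j \<in> Lp_space (s j) (\<lambda>x. 1); u \<in> Lp_space (s i) (\<lambda>x. 1); w \<in> Lp_space (s i) (\<lambda>x. 1)\<rbrakk>
      \<Longrightarrow> AE x in lebesgue. T (f(i := \<lambda>x. u x + w x)) x = T (f(i := u)) x + T (f(i := w)) x"
    and T_kernel: "(\<And>j. f j \<in> Lp_space (s j) (\<lambda>x. 1))
      \<Longrightarrow> AE x in lebesgue. x \<notin> (\<Inter>j. supp (f j)) \<longrightarrow> has_bochner_integral lebesgue (kernel_integrand K f x) (T f x)"
    and T_weak: "(\<And>j. f j \<in> Lp_space (s j) (\<lambda>x. 1))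
      \<Longrightarrow> weak_Lp_norm q (\<lambda>x. 1) (T f) \<le> ennreal B * (\<Prod>j\<in>UNIV. Lp_norm (s j) (\<lambda>x. 1) (f j))"
begin

lemma s_pos: "0 < s j"
  using s[of j] by simp

text \<open>The factors in \<open>J\<close> are cut to \<open>Q\<close> one at a time. Each
  difference contains a factor that vanishes on \<open>Q\<close>, so almost every \<open>x\<close>
  in \<open>Q\<close> lies off the common support and the kernel formula holds. The claim concerns
  the integral of a difference because neither integrand alone is known to be integrable
  here.\<close>

lemma localize:
  assumes g: "\<And>j. g j \<in> Lp_space (s j) (\<lambda>x. 1)" and Q: "Q \<in> sets lebesgue"
    and int: "AE x in lebesgue. x \<in> Q \<longrightarrow> x \<in> interior Q"
  shows "AE x in lebesgue. x \<in> Q \<longrightarrow> has_bochner_integral lebesgue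
    (\<lambda>y. kernel_integrand K g x y - kernel_integrand K (\<lambda>j y. if j \<in> J then indicator Q y * g j y else g j y) x y)
    (T g x - T (\<lambda>j y. if j \<in> J then indicator Q y * g j y else g j y) x)"
  using finite[of J]
proof (induction J rule: finite_induct)
  case empty
  show ?case by (simp add: has_bochner_integral_zero)
next
  case (insert l J)
  define gJ where "gJ = (\<lambda>j y. if j \<in> J then indicator Q y * g j y else g j y)"
  define gI where "gI = (\<lambda>j y. if j \<in> insert l J then indicator Q y * g j y else g j y)"
  define u where "u = (\<lambda>y. indicator Q y * g l y)"
  define w where "w = (\<lambda>y. indicator (- Q) y * g l y)"
  have gm: "g j \<in> borel_measurable lebesgue" for j using g[of j] by (simp add: Lp_space_def)
  note gm [measurable] Q [measurable]
  have [measurable]: "- Q \<in> sets lebesgue" using Q by (simp add: Compl_in_sets_lebesgue)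
  have u: "u \<in> Lp_space (s l) (\<lambda>x. 1)" unfolding u_def
    by (rule Lp_space_1_dominated[OF s_pos g]) (measurable, auto simp: indicator_def)
  have w: "w \<in> Lp_space (s l) (\<lambda>x. 1)" unfolding w_def
    by (rule Lp_space_1_dominated[OF s_pos g]) (measurable, auto simp: indicator_def)
  have gJ: "gJ j \<in> Lp_space (s j) (\<lambda>x. 1)" for j unfolding gJ_def
    by (rule Lp_space_1_dominated[OF s_pos g]) (auto simp: indicator_def)
  have split: "gJ(l := \<lambda>x. u x + w x) = gJ"
    using insert.hyps by (auto simp: fun_eq_iff gJ_def u_def w_def indicator_def)
  have gI: "gJ(l := u) = gI" using insert.hyps by (auto simp: fun_eq_iff gJ_def gI_def u_def)
  have gw: "(gJ(l := w)) j \<in> Lp_space (s j) (\<lambda>x. 1)" for j using gJ w by simp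
  \<comment> \<open>The support is a closure, so only interior points of \<open>Q\<close> are
    certain to avoid it.\<close>
  have supp_w: "x \<notin> (\<Inter>j. supp ((gJ(l := w)) j))" if "x \<in> interior Q" for x
  proof -
    have "{y. w y \<noteq> 0} \<subseteq> - Q" by (auto simp: w_def indicator_def)
    then have "supp w \<subseteq> - interior Q" unfolding supp_def by (metis closure_complement closure_mono)
    then have "x \<notin> supp w" using that by blast
    then show ?thesis by (auto intro!: exI[of _ l])
  qed
  have lin: "kernel_integrand K gJ x y = kernel_integrand K gI x y + kernel_integrand K (gJ(l := w)) x y" for x y
  proof -
    have r: "(\<Prod>j\<in>UNIV. f j (y $ j)) = f l (y $ l) * (\<Prod>j\<in>UNIV - {l}. f j (y $ j))" for f :: "'m \<Rightarrow> real ^ 'n \<Rightarrow> complex"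
      by (subst prod.remove[of _ l]) auto
    have e: "(\<Prod>j\<in>UNIV - {l}. (gJ(l := z)) j (y $ j)) = (\<Prod>j\<in>UNIV - {l}. gJ j (y $ j))" for z
      by (intro prod.cong) auto
    have "(\<Prod>j\<in>UNIV. gJ j (y $ j)) = (\<Prod>j\<in>UNIV. (gJ(l := u)) j (y $ j)) + (\<Prod>j\<in>UNIV. (gJ(l := w)) j (y $ j))"
      unfolding r e using fun_cong[OF fun_cong[OF split, of l], of "y $ l"] by (simp add: algebra_simps) (simp add: distrib_right[symmetric])
    then show ?thesis unfolding kernel_integrand_def gI by (simp add: algebra_simps)
  qed
  from insert.IH T_add[OF gJ u w] T_kernel[of "gJ(l := w)", OF gw] int
  show ?case
    unfolding gJ_def[symmetric] gI_def[symmetric] split gI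
  proof eventually_elim
    case (elim x)
    show ?case
    proof
      assume x: "x \<in> Q"
      have 1: "has_bochner_integral lebesgue (\<lambda>y. kernel_integrand K g x y - kernel_integrand K gJ x y) (T g x - T gJ x)"
        using elim(1) x by blast
      have 2: "has_bochner_integral lebesgue (kernel_integrand K (gJ(l := w)) x) (T (gJ(l := w)) x)"
        using elim(3,4) x supp_w by blast
      have "has_bochner_integral lebesgue (\<lambda>y. (kernel_integrand K g x y - kernel_integrand K gJ x y) + kernel_integrand K (gJ(l := w)) x y)
        ((T g x - T gJ x) + T (gJ(l := w)) x)" by (rule has_bochner_integral_add[OF 1 2])
      moreover have "(\<lambda>y. (kernel_integrand K g x y - kernel_integrand K gJ x y) + kernel_integrand K (gJ(l := w)) x y)
        = (\<lambda>y. kernel_integrand K g x y - kernel_integrand K gI x y)" by (simp add: lin)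
      moreover have "(T g x - T gJ x) + T (gJ(l := w)) x = T g x - T gI x" using elim(2) by simp
      ultimately show "has_bochner_integral lebesgue (\<lambda>y. kernel_integrand K g x y - kernel_integrand K gI x y) (T g x - T gI x)" by simp
    qed
  qed
qed

abbreviation Q where "Q i z \<equiv> {x :: real ^ 'n. grid (\<lambda>_. False) 1 i x = z}"

definition piece :: "('m \<Rightarrow> real ^ 'n \<Rightarrow> complex) \<Rightarrow> nat \<Rightarrow> nat \<Rightarrow> 'm \<Rightarrow> real ^ 'n \<Rightarrow> complex"
  where "piece g i z j y = indicator (Q i z) y * g j y"

text \<open>By \<open>localize\<close>, the difference between \<open>T\<close> and the kernel
  integral is the same for \<open>g\<close> and for its restriction to the cell of \<open>x\<close>,
  in every generation. The integral of the restriction tends to 0 by dominated convergence;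
  \<open>T\<close> of the restriction does so almost everywhere by the weak type bound and
  Borel-Cantelli.\<close>

lemma kernel_representation:
  assumes g: "\<And>j. g j \<in> borel_measurable lebesgue"
    and Lr: "\<And>j \<rho>. 1 \<le> \<rho> \<Longrightarrow> (\<integral>\<^sup>+x. ennreal (cmod (g j x)) powe \<rho> \<partial>lebesgue) < top"
    and cs: "\<And>j x. x \<notin> cube 0 k0 \<Longrightarrow> g j x = 0" and k0: "0 \<le> k0"
    and fin: "AE x in lebesgue. integrable lebesgue (kernel_integrand K g x)"
  shows "AE x in lebesgue. T g x = (LINT y|lebesgue. kernel_integrand K g x y)"
proof -
  interpret dyadic "grid (\<lambda>_. False) 1 :: nat \<Rightarrow> real ^ 'n \<Rightarrow> nat" 1 by (rule dyadic_grid) simp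
  note g [measurable]
  let ?c = "grid (\<lambda>_. False) 1 :: nat \<Rightarrow> real ^ 'n \<Rightarrow> nat"
  define n where "n = real CARD('n)"
  have n: "0 < n" by (simp add: n_def)
  define m where "m = real CARD('m)"
  have m: "0 < m" by (simp add: m_def)
  have gL: "g j \<in> Lp_space (s j) (\<lambda>x. 1)" for j
    using g Lr[OF s[of j]] by (simp add: Lp_space_1_iff[OF s_pos])
  have Qm [measurable]: "Q i z \<in> sets lebesgue" for i z by (rule cell_lebesgue)
  have pm [measurable]: "piece g i z j \<in> borel_measurable lebesgue" for i z j
    unfolding piece_def by measurable
  have pL: "piece g i z j \<in> Lp_space (s j) (\<lambda>x. 1)" for i z j
    by (rule Lp_space_1_dominated[OF s_pos gL pm]) (auto simp: piece_def indicator_def)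
  \<comment> \<open>An auxiliary exponent above \<open>m n / \<alpha>\<close> and above every
    \<open>s j\<close>; by \<open>Lr\<close> the functions \<open>g j\<close> are integrable to this
    power.\<close>
  define \<rho> where "\<rho> = m * n / \<alpha> + 1 + (\<Sum>j\<in>UNIV. s j)"
  have s0: "0 \<le> (\<Sum>j\<in>UNIV. s j)" using s_pos by (intro sum_nonneg) (simp add: less_imp_le)
  have \<rho>: "1 \<le> \<rho>" "m * n / \<alpha> < \<rho>" "s j \<le> \<rho>" for j
  proof -
    have a: "0 < m * n / \<alpha>" using m n \<alpha> by simp
    show "1 \<le> \<rho>" "m * n / \<alpha> < \<rho>" using a s0 by (auto simp: \<rho>_def)
    have "s j \<le> (\<Sum>j\<in>UNIV. s j)" using s_pos by (intro member_le_sum) (auto simp: less_imp_le)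
    then show "s j \<le> \<rho>" using a by (simp add: \<rho>_def)
  qed
  \<comment> \<open>By the weak type bound, a level set coming from one cell has measure of order
    \<open>vol i powr \<eta>\<close>. Since \<open>\<alpha> > 0\<close>, a large
    \<open>\<rho>\<close> makes \<open>\<eta> > 1\<close>, so that the sum over all cells near the
    support still decays in \<open>i\<close>.\<close>
  define \<eta> where "\<eta> = (1 / S - m / \<rho>) * q"
  have \<eta>: "1 < \<eta>"
  proof -
    have "m / \<rho> < \<alpha> / n" using \<rho>(1,2) \<alpha> n by (simp add: field_simps)
    then have "1 / q < 1 / S - m / \<rho>" unfolding q(2) n_def by simp
    then have "1 / q * q < (1 / S - m / \<rho>) * q" using q(1) by (rule mult_strict_right_mono)
    then show ?thesis using q(1) by (simp add: \<eta>_def)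
  qed
  define G where "G j = (\<integral>\<^sup>+x. ennreal (cmod (g j x)) powe \<rho> \<partial>lebesgue) powe (1 / \<rho>)" for j
  define GG where "GG = (\<Prod>j\<in>UNIV. G j)"
  have GG: "GG < top" unfolding GG_def G_def using Lr[OF \<rho>(1)] by (auto simp: less_top[symmetric] ennreal_prod_eq_top)
  \<comment> \<open>Cells have side at most 1, so those that meet \<open>cube 0 k0\<close> lie in
    this cube.\<close>
  define C' where "C' = cube (0 :: real ^ 'n) (k0 + 2)"
  have piece_norm: "(\<Prod>j\<in>UNIV. Lp_norm (s j) (\<lambda>x. 1) (piece g i z j)) powe q
    \<le> ennreal (vol i powr (\<eta> - 1)) * GG powe q * emeasure lebesgue (Q i z \<inter> C')" for i z
  proof (cases "Q i z \<inter> cube 0 k0 = {}")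
    case True
    then have "piece g i z j y = 0" for j y using cs[of y j] by (auto simp: piece_def indicator_def)
    then have "Lp_norm (s j) (\<lambda>x. 1) (piece g i z j) = 0" for j
      using s_pos[of j] by (simp add: Lp_norm_1)
    then show ?thesis by (simp add: power_0_left)
  next
    case False
    then obtain x where x: "x \<in> Q i z" "x \<in> cube 0 k0" by blast
    have Qx: "Q i z = cell i x" using x by (auto simp: cell_def)
    have "cell i x \<subseteq> C'"
    proof
      fix y assume "y \<in> cell i x"
      obtain w where w: "cell i x \<subseteq> cube w (1 / 2 ^ i)" using cell_subset_cube[of i x] unfolding cell_def by blast
      have "\<bar>y $ l\<bar> \<le> (k0 + 2) / 2" for l
      proof -
        have b: "\<bar>y $ l - w $ l\<bar> \<le> 1 / 2 ^ i / 2" "\<bar>x $ l - w $ l\<bar> \<le> 1 / 2 ^ i / 2"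
          using w \<open>y \<in> cell i x\<close> cell_self[of x i] unfolding cube_def by blast+
        have "(1::real) / 2 ^ i / 2 \<le> 1 / 2" by (simp add: field_simps)
        then have "\<bar>y $ l - w $ l\<bar> \<le> 1 / 2" "\<bar>x $ l - w $ l\<bar> \<le> 1 / 2"
          using b[THEN order_trans] by blast+
        moreover have "\<bar>x $ l\<bar> \<le> k0 / 2" using x(2) by (simp add: cube_def)
        ultimately show ?thesis unfolding abs_le_iff add_divide_distrib by (elim conjE, intro conjI) argo+
      qed
      then show "y \<in> C'" by (simp add: C'_def cube_def)
    qed
    then have Qc: "emeasure lebesgue (Q i z \<inter> C') = ennreal (vol i)"
      unfolding Qx using lebesgue_cell[of i x] by (simp add: Int_absorb2)
    have one: "Lp_norm (s j) (\<lambda>x. 1) (piece g i z j) \<le> ennreal (vol i powr (1 / s j - 1 / \<rho>)) * G j" for j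
    proof -
      let ?f = "\<lambda>y. ennreal (cmod (g j y))"
      have "Lp_norm (s j) (\<lambda>x. 1) (piece g i z j) = (\<integral>\<^sup>+y\<in>cell i x. (?f y powe s j) \<partial>lebesgue) powe (1 / s j)"
        unfolding Lp_norm_1[OF s_pos] Qx[symmetric]
        by (intro arg_cong2[where f=ennreal_powr] nn_integral_cong refl) (auto simp: piece_def indicator_def)
      also have "\<dots> = (cavg lebesgue i (\<lambda>y. ?f y powe s j) x * ennreal (vol i)) powe (1 / s j)"
        using cavg_mult_eq[OF refl, of "\<lambda>y. ?f y powe s j" i x] by (simp add: lebesgue_cell)
      also have "\<dots> = cavg lebesgue i (\<lambda>y. ?f y powe s j) x powe (1 / s j) * ennreal (vol i powr (1 / s j))"
        using s_pos[of j] vol_pos[of i] by (simp add: powe_mult powe_ennreal)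
      also have "\<dots> \<le> cavg lebesgue i (\<lambda>y. ?f y powe \<rho>) x powe (1 / \<rho>) * ennreal (vol i powr (1 / s j))"
        using s_pos[of j] \<rho>(3)[of j] by (intro mult_right_mono cavg_power_mean[OF refl]) auto
      also have "\<dots> = (cavg lebesgue i (\<lambda>y. ?f y powe \<rho>) x * ennreal (vol i)) powe (1 / \<rho>) * ennreal (vol i powr (1 / s j - 1 / \<rho>))"
      proof -
        have "ennreal (vol i powr (1 / s j)) = ennreal (vol i) powe (1 / \<rho>) * ennreal (vol i powr (1 / s j - 1 / \<rho>))"
          using vol_pos[of i] by (simp add: powe_ennreal ennreal_mult[symmetric] powr_add[symmetric])
        then show ?thesis using \<rho>(1) by (simp add: powe_mult mult_ac)
      qed
      also have "cavg lebesgue i (\<lambda>y. ?f y powe \<rho>) x * ennreal (vol i) = (\<integral>\<^sup>+y\<in>cell i x. (?f y powe \<rho>) \<partial>lebesgue)"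
        using cavg_mult_eq[OF refl, of "\<lambda>y. ?f y powe \<rho>" i x] by (simp add: lebesgue_cell)
      also have "\<dots> powe (1 / \<rho>) * ennreal (vol i powr (1 / s j - 1 / \<rho>)) \<le> G j * ennreal (vol i powr (1 / s j - 1 / \<rho>))"
        unfolding G_def using \<rho>(1) by (intro mult_right_mono powe_mono nn_integral_mono) (auto simp: indicator_def)
      finally show ?thesis by (simp add: mult.commute)
    qed
    have "(\<Prod>j\<in>UNIV. Lp_norm (s j) (\<lambda>x. 1) (piece g i z j)) \<le> (\<Prod>j\<in>UNIV. ennreal (vol i powr (1 / s j - 1 / \<rho>)) * G j)"
      by (intro prod_mono_ennreal one)
    also have "\<dots> = ennreal (vol i powr (1 / S - m / \<rho>)) * GG"
    proof -
      have "(\<Prod>j\<in>(UNIV::'m set). vol i powr (1 / s j - 1 / \<rho>)) = vol i powr (\<Sum>j\<in>UNIV. 1 / s j - 1 / \<rho>)"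
        using vol_pos[of i] by (intro powr_sum[symmetric]) auto
      also have "(\<Sum>j\<in>(UNIV::'m set). 1 / s j - 1 / \<rho>) = 1 / S - m / \<rho>"
        by (simp add: sum_subtractf S m_def)
      finally show ?thesis by (simp add: prod.distrib prod_ennreal GG_def)
    qed
    finally have "(\<Prod>j\<in>UNIV. Lp_norm (s j) (\<lambda>x. 1) (piece g i z j)) powe q \<le> (ennreal (vol i powr (1 / S - m / \<rho>)) * GG) powe q"
      using q(1) by (intro powe_mono)
    also have "\<dots> = ennreal (vol i powr \<eta>) * GG powe q"
      using q(1) by (simp add: powe_mult powe_ennreal powr_powr \<eta>_def)
    also have "vol i powr \<eta> = vol i powr (\<eta> - 1) * vol i"
      using vol_pos[of i] powr_add[of "vol i" "\<eta> - 1" 1] by simp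
    finally show ?thesis unfolding Qc using vol_pos[of i] by (simp add: ennreal_mult mult_ac)
  qed
  \<comment> \<open>Each point is tested against the restriction of \<open>g\<close> to its own cell
    of generation \<open>i\<close>.\<close>
  define E where "E k i = {x. 1 / real (Suc k) < cmod (T (piece g i (?c i x)) x)}" for k i
  have Tp [measurable]: "T (piece g i z) \<in> borel_measurable lebesgue" for i z by (rule T_measurable[OF pL])
  have E_eq: "E k i = (\<Union>z. Q i z \<inter> {x. 1 / real (Suc k) < cmod (T (piece g i z) x)})" for k i
    by (auto simp: E_def)
  have Fm: "{x. 1 / real (Suc k) < cmod (T (piece g i z) x)} \<in> sets lebesgue" for k i z
  proof -
    have "{x\<in>space lebesgue. 1 / real (Suc k) < cmod (T (piece g i z) x)} \<in> sets lebesgue" by measurable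
    then show ?thesis by simp
  qed
  have Em: "E k i \<in> sets lebesgue" for k i unfolding E_eq using Qm Fm by auto
  have E_le: "emeasure lebesgue (E k i) \<le> ennreal ((B * real (Suc k)) powr q) * GG powe q * emeasure lebesgue C' * ennreal (vol i powr (\<eta> - 1))" for k i
  proof -
    let ?l = "1 / real (Suc k)"
    have piece_le: "emeasure lebesgue {x. ?l < cmod (T (piece g i z) x)}
      \<le> ennreal ((B * real (Suc k)) powr q) * (\<Prod>j\<in>UNIV. Lp_norm (s j) (\<lambda>x. 1) (piece g i z j)) powe q" for z
    proof -
      let ?A = "emeasure lebesgue {x. ?l < cmod (T (piece g i z) x)}"
      have wm: "weight_measure (\<lambda>x. 1) {x. ?l < cmod (T (piece g i z) x)} = ?A"
        unfolding weight_measure_def using Fm[of k i z] by simp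
      have "ennreal ?l * ?A powe (1 / q) \<le> weak_Lp_norm q (\<lambda>x. 1) (T (piece g i z))"
        unfolding weak_Lp_norm_def wm[symmetric] by (rule SUP_upper) simp
      also have "\<dots> \<le> ennreal B * (\<Prod>j\<in>UNIV. Lp_norm (s j) (\<lambda>x. 1) (piece g i z j))" by (rule T_weak[OF pL])
      finally have "ennreal (real (Suc k)) * (ennreal ?l * ?A powe (1 / q)) \<le> ennreal (real (Suc k)) * (ennreal B * (\<Prod>j\<in>UNIV. Lp_norm (s j) (\<lambda>x. 1) (piece g i z j)))"
        by (rule mult_left_mono) simp
      moreover have "ennreal (real (Suc k)) * (ennreal ?l * ?A powe (1 / q)) = ?A powe (1 / q)"
        by (simp add: mult.assoc[symmetric] ennreal_mult[symmetric] del: of_nat_Suc)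
      moreover have "ennreal (real (Suc k)) * (ennreal B * (\<Prod>j\<in>UNIV. Lp_norm (s j) (\<lambda>x. 1) (piece g i z j)))
        = ennreal (B * real (Suc k)) * (\<Prod>j\<in>UNIV. Lp_norm (s j) (\<lambda>x. 1) (piece g i z j))"
        using B by (simp add: ennreal_mult mult_ac del: of_nat_Suc)
      ultimately have "(?A powe (1 / q)) powe q \<le> (ennreal (B * real (Suc k)) * (\<Prod>j\<in>UNIV. Lp_norm (s j) (\<lambda>x. 1) (piece g i z j))) powe q"
        using q(1) by (intro powe_mono) simp_all
      then show ?thesis using q(1) B by (simp add: powe_powe powe_mult powe_ennreal del: of_nat_Suc)
    qed
    have "emeasure lebesgue (E k i) \<le> (\<Sum>z. emeasure lebesgue (Q i z \<inter> {x. ?l < cmod (T (piece g i z) x)}))"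
      unfolding E_eq using Qm Fm by (intro emeasure_subadditive_countably) auto
    also have "\<dots> \<le> (\<Sum>z. ennreal ((B * real (Suc k)) powr q) * (ennreal (vol i powr (\<eta> - 1)) * GG powe q * emeasure lebesgue (Q i z \<inter> C')))"
    proof (intro suminf_le)
      fix z
      have "emeasure lebesgue (Q i z \<inter> {x. ?l < cmod (T (piece g i z) x)}) \<le> emeasure lebesgue {x. ?l < cmod (T (piece g i z) x)}"
        using Fm by (intro emeasure_mono) auto
      also note piece_le
      also have "ennreal ((B * real (Suc k)) powr q) * (\<Prod>j\<in>UNIV. Lp_norm (s j) (\<lambda>x. 1) (piece g i z j)) powe q
        \<le> ennreal ((B * real (Suc k)) powr q) * (ennreal (vol i powr (\<eta> - 1)) * GG powe q * emeasure lebesgue (Q i z \<inter> C'))"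
        by (intro mult_left_mono piece_norm) simp
      finally show "emeasure lebesgue (Q i z \<inter> {x. ?l < cmod (T (piece g i z) x)}) \<le> \<dots>" .
    qed auto
    also have "\<dots> = ennreal ((B * real (Suc k)) powr q) * (ennreal (vol i powr (\<eta> - 1)) * GG powe q * (\<Sum>z. emeasure lebesgue (Q i z \<inter> C')))"
      by (simp only: ennreal_suminf_cmult)
    also have "(\<Sum>z. emeasure lebesgue (Q i z \<inter> C')) = emeasure lebesgue (\<Union>z. Q i z \<inter> C')"
      using Qm by (intro suminf_emeasure) (auto simp: disjoint_family_on_def C'_def)
    also have "(\<Union>z. Q i z \<inter> C') = C'" by auto
    finally show ?thesis by (simp only: mult_ac)
  qed
  have "AE x in lebesgue. \<forall>\<^sub>F i in sequentially. x \<in> space lebesgue - E k i" for k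
  proof (rule borel_cantelli_AE1)
    show "E k i \<in> sets lebesgue" for i by (rule Em)
    define c where "c = enn2real (ennreal ((B * real (Suc k)) powr q) * GG powe q * emeasure lebesgue C')"
    have "ennreal ((B * real (Suc k)) powr q) * GG powe q * emeasure lebesgue C' < top"
      using GG k0 by (simp add: ennreal_mult_less_top C'_def)
    then have c: "ennreal ((B * real (Suc k)) powr q) * GG powe q * emeasure lebesgue C' = ennreal c" "0 \<le> c"
      by (auto simp: c_def)
    have le: "emeasure lebesgue (E k i) \<le> ennreal (c * vol i powr (\<eta> - 1))" for i
      using E_le[of k i] c by (simp add: ennreal_mult)
    then show "emeasure lebesgue (E k i) < \<infinity>" for i
      by (rule le_less_trans) simp
    have "vol i powr (\<eta> - 1) = ((1 / 2) powr (n * (\<eta> - 1))) ^ i" for i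
    proof -
      have "vol i = (1 / 2) powr (n * real i)"
      proof -
        have "vol i = (1 / 2) ^ (i * CARD('n))" by (simp add: vol_def side_def power_one_over power_mult)
        also have "\<dots> = (1 / 2) powr real (i * CARD('n))" by (rule powr_realpow[symmetric]) simp
        finally show ?thesis by (simp add: n_def mult.commute)
      qed
      then show ?thesis by (simp add: powr_powr powr_realpow[symmetric] mult_ac)
    qed
    moreover have "(1 / 2 :: real) powr (n * (\<eta> - 1)) < 1"
      using n \<eta> powr_less_mono2[of "n * (\<eta> - 1)" "1 / 2" 1] by simp
    ultimately have "summable (\<lambda>i. c * vol i powr (\<eta> - 1))"
      by (intro summable_mult) (simp add: summable_geometric)
    then show "summable (\<lambda>i. measure lebesgue (E k i))"
    proof (rule summable_comparison_test'[where N=0])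
      fix i
      show "norm (measure lebesgue (E k i)) \<le> c * vol i powr (\<eta> - 1)"
        using le[of i] c(2) by (simp add: measure_def enn2real_leI)
    qed
  qed
  then have BC: "AE x in lebesgue. \<forall>k. \<forall>\<^sub>F i in sequentially. x \<in> space lebesgue - E k i"
    unfolding AE_all_countable by blast
  define gU where "gU i z = (\<lambda>j y. if j \<in> (UNIV::'m set) then indicator (Q i z) y * g j y else g j y)" for i z
  have gU: "gU i z = piece g i z" for i z by (simp add: gU_def piece_def fun_eq_iff)
  have loc: "AE x in lebesgue. x \<in> Q i z \<longrightarrow> has_bochner_integral lebesgue
      (\<lambda>y. kernel_integrand K g x y - kernel_integrand K (piece g i z) x y) (T g x - T (piece g i z) x)" for i z
    using localize[OF gL Qm AE_interior_cell[of 1 "\<lambda>_. False" i z], of UNIV] unfolding gU_def[symmetric] gU by simp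
  then have loc': "AE x in lebesgue. \<forall>i z. x \<in> Q i z \<longrightarrow> has_bochner_integral lebesgue
      (\<lambda>y. kernel_integrand K g x y - kernel_integrand K (piece g i z) x y) (T g x - T (piece g i z) x)"
    unfolding AE_all_countable by blast
  from BC loc' fin show ?thesis
  proof eventually_elim
    case (elim x)
    let ?k = "kernel_integrand K g x"
    define P where "P i = piece g i (?c i x)" for i
    define X where "X i = {y :: real ^ 'n ^ 'm. \<forall>j. y $ j \<in> cell i x}" for i
    have Xm: "X i \<in> sets lebesgue" for i
    proof -
      have "(\<lambda>y :: real ^ 'n ^ 'm. indicator (cell i x) (y $ j) :: real) \<in> borel_measurable lebesgue" for j
        by (rule borel_measurable_proj) measurable
      then have "{y \<in> space lebesgue. \<forall>j\<in>UNIV. (indicator (cell i x) ((y :: real ^ 'n ^ 'm) $ j) :: real) = 1} \<in> sets lebesgue"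
        by measurable
      moreover have "{y \<in> space lebesgue. \<forall>j\<in>UNIV. (indicator (cell i x) ((y :: real ^ 'n ^ 'm) $ j) :: real) = 1} = X i"
        by (auto simp: X_def indicator_def)
      ultimately show ?thesis by (rule back_subst[of "\<lambda>S. S \<in> sets lebesgue"])
    qed
    have PX: "kernel_integrand K (P i) x y = indicator (X i) y *\<^sub>R ?k y" for i y
    proof (cases "y \<in> X i")
      case True
      then show ?thesis by (simp add: kernel_integrand_def P_def piece_def X_def cell_def)
    next
      case False
      then obtain j where "y $ j \<notin> cell i x" by (auto simp: X_def)
      then have "P i j (y $ j) = 0" by (simp add: P_def piece_def cell_def)
      then have "(\<Prod>j\<in>UNIV. P i j (y $ j)) = 0" by (intro prod_zero) (simp, blast)
      then show ?thesis using False by (simp add: kernel_integrand_def)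
    qed
    have kint: "integrable lebesgue ?k" using elim(3) .
    have Xint: "integrable lebesgue (\<lambda>y. indicator (X i) y *\<^sub>R ?k y)" for i
      using Xm kint by (intro integrable_mult_indicator) auto
    have diff: "T g x - (LINT y|lebesgue. ?k y) = T (P i) x - (LINT y|lebesgue. indicator (X i) y *\<^sub>R ?k y)" for i
    proof -
      have "has_bochner_integral lebesgue (\<lambda>y. ?k y - indicator (X i) y *\<^sub>R ?k y) (T g x - T (P i) x)"
        using elim(2)[rule_format, of i "?c i x"] unfolding P_def[symmetric] PX by simp
      then have "(LINT y|lebesgue. ?k y - indicator (X i) y *\<^sub>R ?k y) = T g x - T (P i) x"
        by (rule has_bochner_integral_integral_eq)
      then show ?thesis using Bochner_Integration.integral_diff[OF kint Xint[of i]] by (simp add: algebra_simps)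
    qed
    have "(\<lambda>i. LINT y|lebesgue. indicator (X i) y *\<^sub>R ?k y) \<longlonglongrightarrow> (LINT y|(lebesgue :: (real ^ 'n ^ 'm) measure). 0)"
    proof (rule integral_dominated_convergence[where w="\<lambda>y. norm (?k y)"])
      \<comment> \<open>The products of the cells around \<open>x\<close> shrink to the diagonal
        point, a null set.\<close>
      have "negligible {(\<chi> j. x) :: real ^ 'n ^ 'm}" by simp
      then have "AE y in lebesgue. y \<notin> {(\<chi> j. x) :: real ^ 'n ^ 'm}"
        by (intro AE_not_in) (simp only: negligible_iff_null_sets)
      then show "AE y in lebesgue. (\<lambda>i. indicator (X i) y *\<^sub>R ?k y) \<longlonglongrightarrow> 0"
      proof (rule eventually_mono)
        fix y :: "real ^ 'n ^ 'm" assume "y \<notin> {\<chi> j. x}"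
        then obtain j where "y $ j \<noteq> x" by (auto simp: vec_eq_iff)
        then obtain i0 where i0: "cell i0 x \<subseteq> - {y $ j}" using cell_subset_open[of "- {y $ j}" x 0] by auto
        have "indicator (X i) y *\<^sub>R ?k y = 0" if "i0 \<le> i" for i
        proof -
          have "y $ j \<notin> cell i x" using cell_mono[OF that, of x] i0 by blast
          then show ?thesis by (auto simp: X_def indicator_def)
        qed
        then show "(\<lambda>i. indicator (X i) y *\<^sub>R ?k y) \<longlonglongrightarrow> 0"
          by (intro tendsto_eventually) (auto simp: eventually_sequentially)
      qed
      show "AE y in lebesgue. norm (indicator (X i) y *\<^sub>R ?k y) \<le> norm (?k y)" for i
        by (intro AE_I2) (auto simp: indicator_def)
    qed (use kint Xint in \<open>auto intro: borel_measurable_integrable\<close>)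
    then have V: "(\<lambda>i. norm (LINT y|lebesgue. indicator (X i) y *\<^sub>R ?k y)) \<longlonglongrightarrow> 0"
      by (intro tendsto_norm_zero) simp
    have U: "(\<lambda>i. norm (T (P i) x)) \<longlonglongrightarrow> 0"
    proof (rule LIMSEQ_I)
      fix d :: real assume "0 < d"
      then obtain k where k: "1 / real (Suc k) < d" using nat_approx_posE by blast
      have "\<forall>\<^sub>F i in sequentially. x \<in> space lebesgue - E k i" using elim(1) by blast
      then obtain i0 where "\<And>i. i0 \<le> i \<Longrightarrow> x \<notin> E k i" by (auto simp: eventually_sequentially)
      then have "norm (T (P i) x) < d" if "i0 \<le> i" for i
        using that k unfolding E_def P_def by force
      then show "\<exists>no. \<forall>i\<ge>no. norm (norm (T (P i) x) - 0) < d" by auto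
    qed
    have "norm (T g x - (LINT y|lebesgue. ?k y)) \<le> 0"
    proof (rule norm_le_of_decay[OF _ U V])
      show "norm (T g x - (LINT y|lebesgue. ?k y)) \<le> norm (T (P i) x) + norm (LINT y|lebesgue. indicator (X i) y *\<^sub>R ?k y)" for i
        unfolding diff[of i] by (rule norm_triangle_ineq4)
    qed
    then show ?case by simp
  qed
qed

end

subsection \<open>The commutator\<close>

lemma lebesgue_measurable_AE_cong:
  fixes f g :: "real ^ 'n \<Rightarrow> complex"
  assumes f: "f \<in> borel_measurable lebesgue" and ae: "AE x in lebesgue. f x = g x"
  shows "g \<in> borel_measurable lebesgue"
proof (rule measurableI)
  obtain N where N: "N \<in> null_sets lebesgue" "{x. f x \<noteq> g x} \<subseteq> N"
    using ae by (auto simp: eventually_ae_filter)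
  fix A :: "complex set" assume A: "A \<in> sets borel"
  have s1: "f -` A \<inter> space lebesgue \<in> sets lebesgue" by (rule measurable_sets[OF f A])
  have s2: "g -` A \<inter> N \<in> sets lebesgue"
    using null_sets_completion_subset[of "g -` A \<inter> N" N lborel] N(1) by (auto simp: null_sets_def)
  have eq: "g -` A \<inter> space lebesgue = ((f -` A \<inter> space lebesgue) - N) \<union> (g -` A \<inter> N)"
  proof -
    have "g x = f x" if "x \<notin> N" for x using N(2) that by force
    then show ?thesis by auto
  qed
  have s3: "N \<in> sets lebesgue" using N(1) by blast
  show "g -` A \<inter> space lebesgue \<in> sets lebesgue"
    unfolding eq by (intro sets.Un sets.Diff s1 s2 s3)
qed simp

text \<open>A telescoping sum in which every summand has one factor \<open>u i - w i\<close>. The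
  other factors are bounded through \<open>u j - w j\<close> and \<open>w j\<close> alone, since in
  the application the size of \<open>u\<close> is known only through its distance to
  \<open>w\<close>.\<close>

lemma norm_prod_diff_le:
  fixes u w :: "'i \<Rightarrow> complex"
  assumes "finite I"
  shows "norm ((\<Prod>j\<in>I. u j) - (\<Prod>j\<in>I. w j))
    \<le> (\<Sum>i\<in>I. \<Prod>j\<in>I. if j = i then norm (u j - w j) else norm (u j - w j) + 2 * norm (w j))"
  using assms
proof (induction I rule: finite_induct)
  case (insert l I)
  let ?d = "\<lambda>j. norm (u j - w j)" and ?e = "\<lambda>j. norm (u j - w j) + 2 * norm (w j)"
  have ul: "norm (u j) \<le> ?e j" for j
  proof -
    have "norm (u j) \<le> norm (u j - w j) + norm (w j)" using norm_triangle_ineq[of "u j - w j" "w j"] by simp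
    then show ?thesis using norm_ge_zero[of "w j"] by linarith
  qed
  have wl: "norm (w j) \<le> ?e j" for j by simp
  have "norm ((\<Prod>j\<in>insert l I. u j) - (\<Prod>j\<in>insert l I. w j))
    = norm (u l * ((\<Prod>j\<in>I. u j) - (\<Prod>j\<in>I. w j)) + (u l - w l) * (\<Prod>j\<in>I. w j))"
    using insert.hyps by (simp add: algebra_simps)
  also have "\<dots> \<le> norm (u l) * norm ((\<Prod>j\<in>I. u j) - (\<Prod>j\<in>I. w j)) + ?d l * norm (\<Prod>j\<in>I. w j)"
    by (intro order_trans[OF norm_triangle_ineq]) (simp add: norm_mult)
  also have "\<dots> \<le> ?e l * (\<Sum>i\<in>I. \<Prod>j\<in>I. if j = i then ?d j else ?e j) + ?d l * (\<Prod>j\<in>I. ?e j)"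
    using wl by (intro add_mono mult_mono ul insert.IH mult_left_mono) (auto simp: prod_norm[symmetric] intro!: prod_mono)
  also have "?e l * (\<Sum>i\<in>I. \<Prod>j\<in>I. if j = i then ?d j else ?e j) = (\<Sum>i\<in>I. \<Prod>j\<in>insert l I. if j = i then ?d j else ?e j)"
    unfolding sum_distrib_left using insert.hyps by (intro sum.cong) auto
  also have "?d l * (\<Prod>j\<in>I. ?e j) = (\<Prod>j\<in>insert l I. if j = l then ?d j else ?e j)"
  proof -
    have "(\<Prod>j\<in>I. if j = l then ?d j else ?e j) = (\<Prod>j\<in>I. ?e j)" using insert.hyps by (intro prod.cong) auto
    then show ?thesis using insert.hyps by simp
  qed
  finally show ?case using insert.hyps by (simp add: add.commute)
qed simp

text \<open>Without integrability the Bochner integral is 0 by convention, so the bound is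
  unconditional.\<close>

lemma norm_integral_le_nn_integral:
  fixes f :: "'a \<Rightarrow> complex"
  shows "ennreal (norm (LINT y|M. f y)) \<le> (\<integral>\<^sup>+y. ennreal (norm (f y)) \<partial>M)"
  by (cases "integrable M f") (auto intro: integral_norm_bound_ennreal simp: not_integrable_integral_eq)

lemma bcs_dest:
  assumes "f \<in> bounded_compact_support"
  obtains N k where "f \<in> borel_measurable lebesgue" "0 \<le> N" "\<And>x. cmod (f x) \<le> N" "0 < k" "\<And>x. x \<notin> cube 0 (real (k :: nat)) \<Longrightarrow> f x = 0"
proof -
  have f: "f \<in> borel_measurable lebesgue" "bounded (range f)" "compact (supp f)"
    using assms by (auto simp: bounded_compact_support_def)
  obtain N where N: "\<And>x. cmod (f x) \<le> N" using f(2) by (auto simp: bounded_iff)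
  have "bounded (supp f)" using f(3) by (rule compact_imp_bounded)
  then obtain B where B: "\<And>y. y \<in> supp f \<Longrightarrow> norm y \<le> B" by (auto simp: bounded_iff)
  obtain k :: nat where k: "2 * \<bar>B\<bar> + 1 \<le> real k" using real_arch_simple by blast
  have "f x = 0" if "x \<notin> cube 0 (real k)" for x
  proof (rule ccontr)
    assume "f x \<noteq> 0"
    then have "x \<in> supp f" unfolding supp_def using closure_subset[of "{x. f x \<noteq> 0}"] by blast
    then have "\<bar>x $ i\<bar> \<le> real k / 2" for i
      using component_le_norm_cart[of x i] B[of x] k by linarith
    then show False using that by (simp add: cube_def)
  qed
  moreover have "0 < k" using k by (cases k) auto
  moreover have "0 \<le> N" using N[of 0] norm_ge_zero order_trans by blast
  ultimately show ?thesis using that f(1) N by blast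
qed

text \<open>John-Nirenberg, in a cell containing the whole cube.\<close>

lemma BMO_locally_integrable_powers:
  fixes b :: "real ^ 'n \<Rightarrow> complex"
  assumes b: "b \<in> BMO" and r: "1 \<le> r" and k: "0 < k"
  shows "(\<integral>\<^sup>+x\<in>cube 0 k. (ennreal (cmod (b x)) powe r) \<partial>lebesgue) < top"
proof -
  obtain \<beta>0 where \<beta>0: "bmo_norm b = ennreal \<beta>0" "0 \<le> \<beta>0" using b unfolding BMO_def by (cases "bmo_norm b") auto
  define \<beta> where "\<beta> = \<beta>0 + 1"
  have \<beta>: "bmo_norm b \<le> ennreal \<beta>" "0 < \<beta>" using \<beta>0 by (auto simp: \<beta>_def intro!: ennreal_leI)
  have bi: "b absolutely_integrable_on S" if "compact S" for S using b that by (auto simp: BMO_def)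
  have [measurable]: "b \<in> borel_measurable lebesgue" by (rule locally_integrable_measurable[OF bi])
  \<comment> \<open>Any value above \<open>3 * k\<close> lets the cube fit into one cell of
    generation 0 of some shifted grid.\<close>
  define h where "h = 4 * k"
  have h: "0 < h" using k by (simp add: h_def)
  have "y $ l - y' $ l < h / 2 ^ 0 / 3" if "y \<in> cube 0 k" "y' \<in> cube 0 k" for y y' :: "real ^ 'n" and l
  proof -
    have "\<bar>y $ l\<bar> \<le> k / 2" "\<bar>y' $ l\<bar> \<le> k / 2" using that by (auto simp: cube_def)
    then have "y $ l - y' $ l \<le> k" unfolding abs_le_iff by argo
    then show ?thesis using k by (simp add: h_def)
  qed
  then obtain \<tau> where \<tau>: "\<And>y y'. y \<in> cube 0 k \<Longrightarrow> y' \<in> cube 0 k \<Longrightarrow> grid \<tau> h 0 y = grid \<tau> h 0 (y' :: real ^ 'n)"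
    using one_third_trick[OF h, of "cube 0 k" 0] by blast
  interpret dyadic "grid \<tau> h" h by (rule dyadic_grid[OF h])
  interpret W: dyadic_weight "grid \<tau> h" h lebesgue 2
    by unfold_locales (auto simp: lebesgue_cell)
  interpret D: dyadic_bmo "grid \<tau> h" h lebesgue 2 b "\<lambda>i x. mean (envelope i x) b" \<beta>
    by (rule W.dyadic_bmo_mean[OF bi \<beta>])
  define c where "c = mean (envelope 0 0) b"
  have z: "0 \<in> cube (0 :: real ^ 'n) k" using k by (simp add: cube_def)
  have sub: "cube 0 k \<subseteq> cell 0 0" using \<tau>[OF _ z] by (auto simp: cell_def)
  have pt: "ennreal (cmod (b x)) powe r * indicator (cube 0 k) x
    \<le> ennreal (2 powr r) * (D.B 0 x powe r * indicator (cell 0 0) x + ennreal (cmod c) powe r * indicator (cell 0 0) x)" for x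
  proof (cases "x \<in> cube 0 k")
    case True
    then have x: "x \<in> cell 0 0" using sub by blast
    have "cmod (b x) \<le> (cmod (b x - c) + \<beta>) + cmod c"
      using norm_triangle_ineq[of "b x - c" c] \<beta>(2) by simp
    moreover have "D.B 0 x = ennreal (cmod (b x - c) + \<beta>)"
      unfolding D.B_def c_def using cellwiseD[OF cellwise_envelope x] by simp
    ultimately have "ennreal (cmod (b x)) \<le> D.B 0 x + ennreal (cmod c)"
      using \<beta>(2) by (simp add: ennreal_plus[symmetric] ennreal_leI del: ennreal_plus)
    then have "ennreal (cmod (b x)) powe r \<le> (D.B 0 x + ennreal (cmod c)) powe r" using r by (intro powe_mono) auto
    also have "\<dots> \<le> ennreal (2 powr r) * (D.B 0 x powe r + ennreal (cmod c) powe r)" using r by (intro powe_add_le) auto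
    finally show ?thesis using True x by simp
  qed simp
  have "(\<integral>\<^sup>+x\<in>cube 0 k. (ennreal (cmod (b x)) powe r) \<partial>lebesgue)
    \<le> (\<integral>\<^sup>+x. ennreal (2 powr r) * (D.B 0 x powe r * indicator (cell 0 0) x + ennreal (cmod c) powe r * indicator (cell 0 0) x) \<partial>lebesgue)"
    by (intro nn_integral_mono pt)
  also have "\<dots> = ennreal (2 powr r) * ((\<integral>\<^sup>+x\<in>cell 0 0. (D.B 0 x powe r) \<partial>lebesgue) + ennreal (cmod c) powe r * emeasure lebesgue (cell 0 0))"
  proof -
    have m: "(\<lambda>x. D.B 0 x powe r * indicator (cell 0 0) x) \<in> borel_measurable lebesgue"
      by (intro borel_measurable_times_ennreal measurable_powe D.B_measurable(1) borel_measurable_indicator cell_sets)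
    have m2: "(\<lambda>x. ennreal (cmod c) powe r * indicator (cell 0 0) x) \<in> borel_measurable lebesgue"
      by (intro borel_measurable_times_ennreal borel_measurable_const borel_measurable_indicator cell_sets)
    show ?thesis
      by (simp only: nn_integral_cmult[OF borel_measurable_add[OF m m2]] nn_integral_add[OF m m2] nn_integral_cmult_indicator[OF cell_sets])
  qed
  also have "\<dots> < top"
  proof -
    have "(\<integral>\<^sup>+x\<in>cell 0 0. (D.B 0 x powe r) \<partial>lebesgue) \<le> ennreal (jn_const CARD('n) 2 r * \<beta> powr r) * emeasure lebesgue (cell 0 0)"
      using r by (intro D.B_moment) auto
    also have "\<dots> < top" by (simp add: lebesgue_cell ennreal_mult_less_top)
    finally show ?thesis by (simp add: ennreal_mult_less_top lebesgue_cell)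
  qed
  finally show ?thesis .
qed

lemma BMO_measurable: "b \<in> BMO \<Longrightarrow> b \<in> borel_measurable lebesgue"
  by (rule locally_integrable_measurable) (simp add: BMO_def)

lemma bcs_powers:
  fixes f b :: "real ^ 'n \<Rightarrow> complex"
  assumes f: "f \<in> bounded_compact_support" and r: "1 \<le> r"
  shows "(\<integral>\<^sup>+x. ennreal (cmod (f x)) powe r \<partial>lebesgue) < top"
    and "b \<in> BMO \<Longrightarrow> (\<integral>\<^sup>+x. ennreal (cmod (b x * f x)) powe r \<partial>lebesgue) < top"
proof -
  obtain N k where f': "f \<in> borel_measurable lebesgue" "0 \<le> N" "\<And>x. cmod (f x) \<le> N" "0 < k" "\<And>x. x \<notin> cube 0 (real (k :: nat)) \<Longrightarrow> f x = 0"
    by (rule bcs_dest[OF f]) (rule that)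
  have "(\<integral>\<^sup>+x. ennreal (cmod (f x)) powe r \<partial>lebesgue) \<le> (\<integral>\<^sup>+x\<in>cube (0 :: real ^ 'n) (real k). (ennreal N powe r) \<partial>lebesgue)"
  proof (rule nn_integral_mono)
    fix x
    show "ennreal (cmod (f x)) powe r \<le> ennreal N powe r * indicator (cube 0 (real k)) x"
      using f'(5)[of x] f'(3)[of x] r by (cases "x \<in> cube 0 (real k)") (auto intro!: powe_mono ennreal_leI)
  qed
  also have "\<dots> = ennreal N powe r * emeasure lebesgue (cube (0 :: real ^ 'n) (real k))" by (rule nn_integral_cmult_indicator) simp
  also have "\<dots> < top" using f'(4) by (simp add: ennreal_mult_less_top)
  finally show "(\<integral>\<^sup>+x. ennreal (cmod (f x)) powe r \<partial>lebesgue) < top" .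
  assume b: "b \<in> BMO"
  note BMO_measurable[OF b, measurable]
  have "(\<integral>\<^sup>+x. ennreal (cmod (b x * f x)) powe r \<partial>lebesgue) \<le> (\<integral>\<^sup>+x. ennreal N powe r * (ennreal (cmod (b x)) powe r * indicator (cube 0 (real k)) x) \<partial>lebesgue)"
  proof (rule nn_integral_mono)
    fix x
    have "ennreal (cmod (b x * f x)) powe r \<le> (ennreal N * ennreal (cmod (b x))) powe r"
      using f'(2,3) r by (intro powe_mono) (auto simp: norm_mult ennreal_mult[symmetric] mult.commute[of N] intro!: ennreal_leI mult_left_mono)
    then show "ennreal (cmod (b x * f x)) powe r \<le> ennreal N powe r * (ennreal (cmod (b x)) powe r * indicator (cube 0 (real k)) x)"
      using f'(5)[of x] r by (cases "x \<in> cube 0 (real k)") (auto simp: powe_mult)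
  qed
  also have "\<dots> = ennreal N powe r * (\<integral>\<^sup>+x\<in>cube 0 (real k). (ennreal (cmod (b x)) powe r) \<partial>lebesgue)"
    by (rule nn_integral_cmult) measurable
  also have "\<dots> < top"
    using BMO_locally_integrable_powers[OF b r, of "real k"] f'(4) by (simp add: ennreal_mult_less_top)
  finally show "(\<integral>\<^sup>+x. ennreal (cmod (b x * f x)) powe r \<partial>lebesgue) < top" .
qed

lemma weak_Lp_norm_le:
  assumes q: "0 < q" and [measurable]: "f \<in> borel_measurable lebesgue" "w \<in> borel_measurable lebesgue"
  shows "weak_Lp_norm q w f \<le> Lp_norm q w f"
  unfolding weak_Lp_norm_def
proof (rule SUP_least)
  fix l :: real assume "l \<in> {0<..}"
  then have l: "0 < l" by simp
  have [measurable]: "{x. l < cmod (f x)} \<in> sets lebesgue"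
  proof -
    have "{x\<in>space lebesgue. l < cmod (f x)} \<in> sets lebesgue" by measurable
    then show ?thesis by simp
  qed
  have "ennreal l * weight_measure w {x. l < cmod (f x)} powe (1 / q)
    = (ennreal (l powr q) * (\<integral>\<^sup>+x\<in>{x. l < cmod (f x)}. ennreal (w x) \<partial>lebesgue)) powe (1 / q)"
    using l q by (simp add: weight_measure_def powe_mult powe_ennreal powr_powr)
  also have "ennreal (l powr q) * (\<integral>\<^sup>+x\<in>{x. l < cmod (f x)}. ennreal (w x) \<partial>lebesgue)
    = (\<integral>\<^sup>+x. ennreal (l powr q) * (ennreal (w x) * indicator {x. l < cmod (f x)} x) \<partial>lebesgue)"
    by (rule nn_integral_cmult[symmetric]) measurable
  also have "\<dots> \<le> (\<integral>\<^sup>+x. ennreal (cmod (f x) powr q) * ennreal (w x) \<partial>lebesgue)"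
    using l q by (intro nn_integral_mono) (auto simp: indicator_def intro!: mult_right_mono ennreal_leI powr_mono2)
  finally show "ennreal l * weight_measure w {x. l < cmod (f x)} powe (1 / q) \<le> Lp_norm q w f"
    unfolding Lp_norm_def using q by (simp add: powe_le_iff)
qed

section \<open>The commutator in the weighted setting\<close>

context kernel_operator
begin

lemma bcs_Lp_space: "f \<in> bounded_compact_support \<Longrightarrow> f \<in> Lp_space (s j) (\<lambda>x. 1)"
  using bcs_powers(1)[of f "s j"] s[of j] by (auto simp: Lp_space_1_iff[OF s_pos] bounded_compact_support_def)

lemma bcs_BMO_Lp_space: "f \<in> bounded_compact_support \<Longrightarrow> b \<in> BMO \<Longrightarrow> (\<lambda>x. b x * f x) \<in> Lp_space (s j) (\<lambda>x. 1)"
  using bcs_powers(2)[of f "s j" b] s[of j] BMO_measurable[of b]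
  by (auto simp: Lp_space_1_iff[OF s_pos] bounded_compact_support_def)

lemma commutator_measurable:
  assumes f: "\<And>j. f j \<in> bounded_compact_support" and b: "\<And>j. b j \<in> BMO"
  shows "commutator T b f \<in> borel_measurable lebesgue"
proof -
  note [measurable] = BMO_measurable[OF b]
  have [measurable]: "T f \<in> borel_measurable lebesgue" by (intro T_measurable bcs_Lp_space f)
  have [measurable]: "T (f(i := \<lambda>y. b i y * f i y)) \<in> borel_measurable lebesgue" for i
    by (intro T_measurable) (auto intro: bcs_Lp_space f bcs_BMO_Lp_space b)
  show ?thesis unfolding commutator_def[abs_def] by measurable
qed

end

locale weighted_commutator =
  W: multiple_weight \<omega> R U + KO: kernel_operator \<alpha> K s T S q0 B
  for \<omega> :: "'m::finite \<Rightarrow> real ^ 'n \<Rightarrow> real" and R :: "'m \<Rightarrow> real" and U :: real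
    and \<alpha> :: real and K :: "real ^ 'n \<Rightarrow> real ^ 'n ^ 'm \<Rightarrow> complex" and s :: "'m \<Rightarrow> real"
    and T :: "('m \<Rightarrow> real ^ 'n \<Rightarrow> complex) \<Rightarrow> real ^ 'n \<Rightarrow> complex" and S q0 B :: real +
  fixes p :: "'m \<Rightarrow> real" and t P q A :: real
  assumes t: "1 < t" and p: "\<And>j. t \<le> p j" and Rp: "\<And>j. R j = p j / t"
    and P: "1 / P = (\<Sum>j\<in>UNIV. 1 / p j)" and q: "1 / q = 1 / P - \<alpha> / real CARD('n)" "0 < q" "U = q / t"
    and \<alpha>_less: "\<alpha> < real CARD('m) * real CARD('n)"
    and A: "0 < A" "\<And>x y. (\<exists>j. y $ j \<noteq> x) \<Longrightarrow> cmod (K x y) \<le> A * rad x y powr (- (real CARD('m) * real CARD('n) - \<alpha>))"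
    and K_measurable: "\<And>x. K x \<in> borel_measurable lebesgue"
begin

abbreviation weight where "weight \<equiv> \<lambda>j x. \<omega> j x powr (p j / t)"
abbreviation target where "target \<equiv> \<lambda>x. weight_prod \<omega> x powr (q / t)"

definition NN :: "'m \<Rightarrow> (real ^ 'n \<Rightarrow> ennreal) \<Rightarrow> ennreal"
  where "NN j h = (\<integral>\<^sup>+x. (h x * ennreal (\<omega> j x) powe (1 / t)) powe p j \<partial>lebesgue) powe (1 / p j)"

text \<open>The summand \<open>\<beta>\<close> makes \<open>D\<close> dominate also the kernel
  integral without oscillation, so that finiteness of \<open>D\<close> gives integrability of both
  parts of the commutator.\<close>

definition D :: "(real ^ 'n \<Rightarrow> complex) \<Rightarrow> real \<Rightarrow> 'm \<Rightarrow> ('m \<Rightarrow> real ^ 'n \<Rightarrow> ennreal) \<Rightarrow> real ^ 'n \<Rightarrow> ennreal"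
  where "D b \<beta> l h x = (\<integral>\<^sup>+y. ennreal (cmod (b x - b (y $ l)) + \<beta>)
    * ennreal (rad x y powr (- (real CARD('m) * real CARD('n) - \<alpha>))) * (\<Prod>j\<in>UNIV. h j (y $ j)) \<partial>lebesgue)"

text \<open>This formula will be the continuous extension of the commutator: its integrals converge
  absolutely almost everywhere on the whole weighted product, whose members need not lie in the
  domain on which \<open>T\<close> is controlled.\<close>

definition comm :: "('m \<Rightarrow> real ^ 'n \<Rightarrow> complex) \<Rightarrow> ('m \<Rightarrow> real ^ 'n \<Rightarrow> complex) \<Rightarrow> real ^ 'n \<Rightarrow> complex"
  where "comm b f x = (\<Sum>l\<in>UNIV. LINT y|lebesgue. (b l x - b l (y $ l)) * kernel_integrand K f x y)"

lemma p_pos: "0 < p j" using p[of j] t by simp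

lemma Lp_norm_weight: "Lp_norm (p j) (weight j) f = NN j (\<lambda>x. ennreal (cmod (f x)))"
  unfolding Lp_norm_def NN_def
  using p_pos[of j] W.omega_nonneg t
  by (intro arg_cong2[where f=ennreal_powr] nn_integral_cong refl) (simp add: powe_mult powe_powe powe_ennreal powr_powr)

lemma Lp_space_weight_iff:
  "f \<in> Lp_space (p j) (weight j) \<longleftrightarrow> f \<in> borel_measurable lebesgue \<and> NN j (\<lambda>x. ennreal (cmod (f x))) < top"
  unfolding Lp_space_def Lp_norm_weight by auto

lemma NN_mono: "(\<And>x. h x \<le> h' x) \<Longrightarrow> NN j h \<le> NN j h'"
  unfolding NN_def using p_pos[of j] by (intro powe_mono nn_integral_mono mult_right_mono) auto

lemma NN_add_le:
  assumes [measurable]: "h \<in> borel_measurable lebesgue" "h' \<in> borel_measurable lebesgue"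
  shows "NN j (\<lambda>x. h x + h' x) \<le> 2 * (NN j h + NN j h')"
proof -
  define w where "w x = ennreal (\<omega> j x) powe (1 / t)" for x
  have [measurable]: "w \<in> borel_measurable lebesgue" unfolding w_def[abs_def] by measurable
  have "(\<integral>\<^sup>+x. ((h x + h' x) * w x) powe p j \<partial>lebesgue) \<le> (\<integral>\<^sup>+x. ennreal (2 powr p j) * ((h x * w x) powe p j + (h' x * w x) powe p j) \<partial>lebesgue)"
    unfolding distrib_right using p_pos by (intro nn_integral_mono powe_add_le) auto
  also have "\<dots> = ennreal (2 powr p j) * ((\<integral>\<^sup>+x. (h x * w x) powe p j \<partial>lebesgue) + (\<integral>\<^sup>+x. (h' x * w x) powe p j \<partial>lebesgue))"
    by (subst nn_integral_cmult, measurable, subst nn_integral_add) auto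
  finally have "NN j (\<lambda>x. h x + h' x) \<le> (ennreal (2 powr p j) * ((\<integral>\<^sup>+x. (h x * w x) powe p j \<partial>lebesgue) + (\<integral>\<^sup>+x. (h' x * w x) powe p j \<partial>lebesgue))) powe (1 / p j)"
    unfolding NN_def w_def using p_pos[of j] by (intro powe_mono) auto
  also have "\<dots> = 2 * ((\<integral>\<^sup>+x. (h x * w x) powe p j \<partial>lebesgue) + (\<integral>\<^sup>+x. (h' x * w x) powe p j \<partial>lebesgue)) powe (1 / p j)"
    using p_pos[of j] by (simp add: powe_mult powe_ennreal powr_powr)
  also have "\<dots> \<le> 2 * (NN j h + NN j h')"
    unfolding NN_def w_def[symmetric] using p_pos[of j] p[of j] t by (intro mult_left_mono powe_add_le_concave) auto
  finally show ?thesis .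
qed

lemma NN_cmult:
  assumes [measurable]: "h \<in> borel_measurable lebesgue"
  shows "NN j (\<lambda>x. 2 * h x) \<le> 4 * NN j h"
proof -
  have "2 * (NN j h + NN j h) = 4 * NN j h" by (metis mult.assoc mult_2 numeral_Bit0 one_add_one)
  then show ?thesis using NN_add_le[OF assms assms, of j] by (simp only: mult_2)
qed

text \<open>The order of the quantifiers matters: \<open>C\<close> is fixed before \<open>b\<close>,
  \<open>\<beta>\<close>, \<open>l\<close> and \<open>h\<close>.\<close>

lemma domination_exists:
  "\<exists>C. \<forall>b \<beta> l h. b \<in> BMO \<and> bmo_norm b \<le> ennreal \<beta> \<and> 0 < \<beta> \<and> (\<forall>j. h j \<in> borel_measurable lebesgue) \<longrightarrow>
    (\<exists>V\<in>borel_measurable lebesgue. (\<forall>x. D b \<beta> l h x \<le> V x) \<and>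
      (\<integral>\<^sup>+x. V x powe q \<partial>W.M) \<le> ennreal (C * \<beta> powr q) * (\<Prod>j\<in>UNIV. NN j (h j)) powe q)"
proof -
  \<comment> \<open>Any exponent strictly between 1 and \<open>t\<close> would do.\<close>
  define r where "r = (1 + t) / 2"
  have r: "1 < r" "r < t" using t by (auto simp: r_def)
  obtain N where N: "sparse_gap \<alpha> r CARD('m) N"
    using sparse_gap_exists[of \<alpha> r "CARD('m)"] KO.\<alpha> r by auto
  have prod: "(\<Prod>j\<in>UNIV. (\<integral>\<^sup>+x. (h j x * ennreal (\<omega> j x) powe (1 / t)) powe p j \<partial>lebesgue) powe (q / p j)) = (\<Prod>j\<in>UNIV. NN j (h j)) powe q"
    for h :: "'m \<Rightarrow> real ^ 'n \<Rightarrow> ennreal"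
    using q by (simp add: powe_prod NN_def powe_powe)
  show ?thesis
  proof (rule exI, intro allI impI, elim conjE)
    fix b :: "real ^ 'n \<Rightarrow> complex" and \<beta> :: real and l :: 'm and h :: "'m \<Rightarrow> real ^ 'n \<Rightarrow> ennreal"
    assume "b \<in> BMO" and \<beta>: "bmo_norm b \<le> ennreal \<beta>" "0 < \<beta>" and h: "\<forall>j. h j \<in> borel_measurable lebesgue"
    then have b: "\<And>S. compact S \<Longrightarrow> b absolutely_integrable_on S" by (simp add: BMO_def)
    show "\<exists>V\<in>borel_measurable lebesgue. (\<forall>x. D b \<beta> l h x \<le> V x) \<and>
      (\<integral>\<^sup>+x. V x powe q \<partial>W.M) \<le> ennreal (W.C2 p t P q \<alpha> r N * \<beta> powr q) * (\<Prod>j\<in>UNIV. NN j (h j)) powe q"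
      unfolding prod[symmetric] D_def
      by (rule W.kernel_domination[OF t r p Rp P q KO.\<alpha> N b \<beta> _ refl]) (use h \<alpha>_less in auto)
  qed
qed

definition DC :: real
  where "DC = max 0 (SOME C. \<forall>b \<beta> l h. b \<in> BMO \<and> bmo_norm b \<le> ennreal \<beta> \<and> 0 < \<beta> \<and> (\<forall>j. h j \<in> borel_measurable lebesgue) \<longrightarrow>
    (\<exists>V\<in>borel_measurable lebesgue. (\<forall>x. D b \<beta> l h x \<le> V x) \<and>
      (\<integral>\<^sup>+x. V x powe q \<partial>W.M) \<le> ennreal (C * \<beta> powr q) * (\<Prod>j\<in>UNIV. NN j (h j)) powe q))"

lemma domination:
  assumes "b \<in> BMO" "bmo_norm b \<le> ennreal \<beta>" "0 < \<beta>" "\<And>j. h j \<in> borel_measurable lebesgue"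
  shows "\<exists>V\<in>borel_measurable lebesgue. (\<forall>x. D b \<beta> l h x \<le> V x) \<and>
    (\<integral>\<^sup>+x. V x powe q \<partial>W.M) \<le> ennreal (DC * \<beta> powr q) * (\<Prod>j\<in>UNIV. NN j (h j)) powe q"
proof -
  obtain C where "C \<le> DC" "\<exists>V\<in>borel_measurable lebesgue. (\<forall>x. D b \<beta> l h x \<le> V x) \<and>
    (\<integral>\<^sup>+x. V x powe q \<partial>W.M) \<le> ennreal (C * \<beta> powr q) * (\<Prod>j\<in>UNIV. NN j (h j)) powe q"
    using someI_ex[OF domination_exists] assms unfolding DC_def by (meson max.cobounded2)
  moreover from this have "ennreal (C * \<beta> powr q) * (\<Prod>j\<in>UNIV. NN j (h j)) powe q \<le> ennreal (DC * \<beta> powr q) * (\<Prod>j\<in>UNIV. NN j (h j)) powe q"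
    by (intro mult_right_mono ennreal_leI) auto
  ultimately show ?thesis by (meson order_trans)
qed

text \<open>Finiteness is read off the measurable majorant, and it passes from the weighted measure
  to Lebesgue measure because \<open>v\<close> is positive almost everywhere.\<close>

lemma D_finite:
  assumes b: "b \<in> BMO" "bmo_norm b \<le> ennreal \<beta>" "0 < \<beta>" and h: "\<And>j. h j \<in> borel_measurable lebesgue" "\<And>j. NN j (h j) < top"
  shows "\<exists>G\<in>sets lebesgue. (AE x in lebesgue. x \<in> G) \<and> (\<forall>x\<in>G. D b \<beta> l h x < top)"
proof -
  obtain V where V: "V \<in> borel_measurable lebesgue" "\<And>x. D b \<beta> l h x \<le> V x"
      "(\<integral>\<^sup>+x. V x powe q \<partial>W.M) \<le> ennreal (DC * \<beta> powr q) * (\<Prod>j\<in>UNIV. NN j (h j)) powe q"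
    using domination[OF b, of h l] h(1) by blast
  note V(1) [measurable]
  have VM: "V \<in> borel_measurable W.M" using V(1) W.sets_M measurable_cong_sets by blast
  note V(3)
  also have "ennreal (DC * \<beta> powr q) * (\<Prod>j\<in>UNIV. NN j (h j)) powe q < top"
  proof -
    have "(\<Prod>j\<in>UNIV. NN j (h j)) \<noteq> top" using h(2) by (auto simp: ennreal_prod_eq_top less_top)
    then show ?thesis by (auto simp: ennreal_mult_less_top ennreal_powr_def)
  qed
  finally have "AE x in W.M. V x powe q \<noteq> \<infinity>"
    using VM by (intro nn_integral_noteq_infinite measurable_powe) auto
  then have "AE x in lebesgue. V x powe q \<noteq> \<infinity>" by (rule W.AE_of_AE_M)
  then have ae: "AE x in lebesgue. x \<in> {x. V x < top}" by (auto elim!: eventually_mono simp: less_top[symmetric])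
  have "{x\<in>space lebesgue. V x < top} \<in> sets lebesgue" by measurable
  then have "{x. V x < top} \<in> sets lebesgue" by simp
  then show ?thesis using ae V(2) by (intro bexI[of _ "{x. V x < top}"]) (auto intro: le_less_trans)
qed

text \<open>The size condition leaves out a single diagonal point, which is a null set.\<close>

lemma kernel_le:
  "AE y in lebesgue. ennreal (cmod (K x y)) \<le> ennreal A * ennreal (rad x y powr (- (real CARD('m) * real CARD('n) - \<alpha>)))"
proof -
  have "negligible {(\<chi> j. x) :: real ^ 'n ^ 'm}" by simp
  then have "AE y in lebesgue. y \<notin> {(\<chi> j. x) :: real ^ 'n ^ 'm}"
    by (intro AE_not_in) (simp only: negligible_iff_null_sets)
  then show ?thesis
  proof (rule eventually_mono)
    fix y :: "real ^ 'n ^ 'm" assume "y \<notin> {\<chi> j. x}"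
    then have "\<exists>j. y $ j \<noteq> x" by (auto simp: vec_eq_iff)
    then show "ennreal (cmod (K x y)) \<le> ennreal A * ennreal (rad x y powr (- (real CARD('m) * real CARD('n) - \<alpha>)))"
      using A(2)[of y x] A(1) by (simp add: ennreal_mult[symmetric] ennreal_leI)
  qed
qed

lemma kernel_term_le:
  assumes m: "\<And>j. h j \<in> borel_measurable lebesgue" and b: "b \<in> borel_measurable lebesgue"
    and F: "\<And>y. cmod (F y) \<le> (cmod (b x - b (y $ l)) + \<beta>) * cmod (K x y) * G y" and G: "\<And>y. 0 \<le> G y" "\<And>y. ennreal (G y) = (\<Prod>j\<in>UNIV. h j (y $ j))"
    and \<beta>: "0 < \<beta>"
  shows "(\<integral>\<^sup>+y. ennreal (cmod (F y)) \<partial>lebesgue) \<le> ennreal A * D b \<beta> l h x"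
proof -
  let ?g = "real CARD('m) * real CARD('n) - \<alpha>"
  let ?I = "\<lambda>y. ennreal (cmod (b x - b (y $ l)) + \<beta>) * ennreal (rad x y powr (- ?g)) * (\<Prod>j\<in>UNIV. h j (y $ j))"
  have Im: "?I \<in> borel_measurable lebesgue"
  proof -
    have "(\<lambda>z. ennreal (cmod (b x - b z) + \<beta>)) \<in> borel_measurable lebesgue" using b by measurable
    then have 1: "(\<lambda>y :: real ^ 'n ^ 'm. ennreal (cmod (b x - b (y $ l)) + \<beta>)) \<in> borel_measurable lebesgue"
      by (rule borel_measurable_proj)
    have 2: "(\<lambda>y :: real ^ 'n ^ 'm. \<Prod>j\<in>UNIV. h j (y $ j)) \<in> borel_measurable lebesgue"
      by (intro borel_measurable_prod_ennreal borel_measurable_proj m)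
    have 3: "(\<lambda>y :: real ^ 'n ^ 'm. ennreal (rad x y powr (- ?g))) \<in> borel_measurable lebesgue" by measurable
    show ?thesis by (intro borel_measurable_times_ennreal 1 2 3)
  qed
  have "(\<integral>\<^sup>+y. ennreal (cmod (F y)) \<partial>lebesgue) \<le> (\<integral>\<^sup>+y. ennreal A * ?I y \<partial>lebesgue)"
  proof (rule nn_integral_mono_AE, use kernel_le[of x] in \<open>rule eventually_mono\<close>)
    fix y assume k: "ennreal (cmod (K x y)) \<le> ennreal A * ennreal (rad x y powr (- ?g))"
    have "ennreal (cmod (F y)) \<le> ennreal ((cmod (b x - b (y $ l)) + \<beta>) * cmod (K x y) * G y)" by (intro ennreal_leI F)
    also have "\<dots> = ennreal (cmod (b x - b (y $ l)) + \<beta>) * ennreal (cmod (K x y)) * (\<Prod>j\<in>UNIV. h j (y $ j))"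
      using \<beta> G(1)[of y] by (simp add: ennreal_mult G(2)[symmetric] del: ennreal_plus)
    also have "\<dots> \<le> ennreal (cmod (b x - b (y $ l)) + \<beta>) * (ennreal A * ennreal (rad x y powr (- ?g))) * (\<Prod>j\<in>UNIV. h j (y $ j))"
      by (intro mult_right_mono mult_left_mono k) auto
    finally show "ennreal (cmod (F y)) \<le> ennreal A * ?I y" by (simp only: mult_ac)
  qed
  also have "\<dots> = ennreal A * D b \<beta> l h x" unfolding D_def by (rule nn_integral_cmult[OF Im])
  finally show ?thesis .
qed

lemma kernel_integrand_measurable:
  assumes "\<And>j. f j \<in> borel_measurable lebesgue"
  shows "kernel_integrand K f x \<in> borel_measurable lebesgue"
  unfolding kernel_integrand_def[abs_def]
  by (intro borel_measurable_times K_measurable borel_measurable_prod borel_measurable_proj assms)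

abbreviation ab where "ab f \<equiv> \<lambda>j x. ennreal (cmod (f j x))"

lemma comm_term_le:
  assumes f: "\<And>j. f j \<in> borel_measurable lebesgue" and b: "b \<in> borel_measurable lebesgue" and \<beta>: "0 < \<beta>"
  shows "(\<integral>\<^sup>+y. ennreal (cmod ((b x - b (y $ l)) * kernel_integrand K f x y)) \<partial>lebesgue) \<le> ennreal A * D b \<beta> l (ab f) x"
proof -
  let ?G = "\<lambda>y. \<Prod>j\<in>UNIV. cmod (f j (y $ j))"
  have G: "0 \<le> ?G y" "ennreal (?G y) = (\<Prod>j\<in>UNIV. ab f j (y $ j))" for y
    by (auto intro: prod_nonneg simp: prod_ennreal)
  have am: "ab f j \<in> borel_measurable lebesgue" for j using f by measurable
  show ?thesis
  proof (rule kernel_term_le[OF am b _ G \<beta>])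
    fix y
    have "cmod ((b x - b (y $ l)) * kernel_integrand K f x y) = cmod (b x - b (y $ l)) * (cmod (K x y) * ?G y)"
      by (simp add: kernel_integrand_def norm_mult prod_norm)
    also have "\<dots> \<le> (cmod (b x - b (y $ l)) + \<beta>) * (cmod (K x y) * ?G y)"
      using \<beta> G(1)[of y] by (intro mult_right_mono) auto
    finally show "cmod ((b x - b (y $ l)) * kernel_integrand K f x y) \<le> (cmod (b x - b (y $ l)) + \<beta>) * cmod (K x y) * ?G y"
      by (simp add: mult.assoc)
  qed
qed

lemma comm_integrable:
  assumes f: "\<And>j. f j \<in> borel_measurable lebesgue" and b: "b \<in> borel_measurable lebesgue" and \<beta>: "0 < \<beta>" and fin: "D b \<beta> l (ab f) x < top"
  shows "integrable lebesgue (\<lambda>y. (b x - b (y $ l)) * kernel_integrand K f x y)" (is ?A)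
    and "integrable lebesgue (kernel_integrand K f x)" (is ?B)
proof -
  let ?G = "\<lambda>y. \<Prod>j\<in>UNIV. cmod (f j (y $ j))"
  have G: "0 \<le> ?G y" "ennreal (?G y) = (\<Prod>j\<in>UNIV. ab f j (y $ j))" for y
    by (auto intro: prod_nonneg simp: prod_ennreal)
  have am: "ab f j \<in> borel_measurable lebesgue" for j using f by measurable
  have lt: "ennreal c * (ennreal A * D b \<beta> l (ab f) x) < \<infinity>" for c using fin by (simp add: ennreal_mult_less_top)
  have bm: "(\<lambda>y :: real ^ 'n ^ 'm. b x - b (y $ l)) \<in> borel_measurable lebesgue"
    using b by (intro borel_measurable_diff borel_measurable_const borel_measurable_proj)
  have km: "kernel_integrand K f x \<in> borel_measurable lebesgue" by (rule kernel_integrand_measurable[OF f])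
  show ?A using comm_term_le[where f=f, OF f b \<beta>, of x l] lt[of 1] bm km by (intro integrableI_bounded) (auto intro: le_less_trans)
  have "(\<integral>\<^sup>+y. ennreal (cmod (of_real \<beta> * kernel_integrand K f x y)) \<partial>lebesgue) \<le> ennreal A * D b \<beta> l (ab f) x"
  proof (rule kernel_term_le[OF am b _ G \<beta>])
    fix y
    have "cmod (of_real \<beta> * kernel_integrand K f x y) = \<beta> * (cmod (K x y) * ?G y)"
      using \<beta> by (simp add: kernel_integrand_def norm_mult prod_norm)
    also have "\<dots> \<le> (cmod (b x - b (y $ l)) + \<beta>) * (cmod (K x y) * ?G y)"
      using G(1)[of y] by (intro mult_right_mono) auto
    finally show "cmod (of_real \<beta> * kernel_integrand K f x y) \<le> (cmod (b x - b (y $ l)) + \<beta>) * cmod (K x y) * ?G y"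
      by (simp add: mult.assoc)
  qed
  then have "integrable lebesgue (\<lambda>y. of_real \<beta> * kernel_integrand K f x y)"
    using lt[of 1] km by (intro integrableI_bounded) (auto intro: le_less_trans)
  then have "integrable lebesgue (\<lambda>y. inverse (of_real \<beta>) * (of_real \<beta> * kernel_integrand K f x y))" by (rule integrable_mult_right)
  then show ?B using \<beta> by (simp add: mult.assoc[symmetric])
qed

text \<open>The kernel formula is applied to \<open>f\<close> and to each tuple with
  \<open>f l\<close> replaced by \<open>b l * f l\<close>; the required integrability comes from
  finiteness of \<open>D\<close>.\<close>

lemma comm_eq_commutator:
  assumes f: "\<And>j. f j \<in> Lp_space (p j) (weight j) \<inter> bounded_compact_support" and b: "\<And>j. b j \<in> BMO"
    and \<beta>: "\<And>j. bmo_norm (b j) \<le> ennreal \<beta>" "0 < \<beta>"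
  shows "AE x in lebesgue. comm b f x = commutator T b f x"
proof -
  have fm: "f j \<in> borel_measurable lebesgue" for j using f[of j] by (simp add: bounded_compact_support_def)
  have fN: "NN j (ab f j) < top" for j using f[of j] Lp_space_weight_iff by auto
  have bm: "b j \<in> borel_measurable lebesgue" for j by (rule BMO_measurable[OF b])
  have am: "ab f j \<in> borel_measurable lebesgue" for j using fm by measurable
  have ae: "AE x in lebesgue. D (b l) \<beta> l (ab f) x < top" for l
  proof -
    obtain G where G: "AE x in lebesgue. x \<in> G" "\<forall>x\<in>G. D (b l) \<beta> l (ab f) x < top"
      using D_finite[OF b \<beta> am fN, of l l] by blast
    show ?thesis using G(1) by (rule eventually_mono) (use G(2) in blast)
  qed
  have "\<exists>k::nat. \<forall>j x. x \<notin> cube 0 (real k) \<longrightarrow> f j x = 0"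
  proof -
    have "\<exists>k::nat. \<forall>x. x \<notin> cube 0 (real k) \<longrightarrow> f j x = 0" for j
    proof -
      have "f j \<in> bounded_compact_support" using f[of j] by blast
      then show ?thesis by (rule bcs_dest) blast
    qed
    then obtain k where k: "\<And>j x. x \<notin> cube 0 (real (k j)) \<Longrightarrow> f j x = 0" by metis
    have "f j x = 0" if "x \<notin> cube 0 (real (\<Sum>j\<in>UNIV. k j))" for j x
    proof -
      have "k j \<le> (\<Sum>j\<in>UNIV. k j)" by (rule member_le_sum) auto
      then have "cube 0 (real (k j)) \<subseteq> (cube 0 (real (\<Sum>j\<in>UNIV. k j)) :: (real ^ 'n) set)" by (intro W.cube_mono of_nat_mono)
      then show ?thesis using that k by blast
    qed
    then show ?thesis by blast
  qed
  then obtain k0 :: nat where k0: "\<And>j x. x \<notin> cube 0 (real k0) \<Longrightarrow> f j x = 0" by blast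
  have T1: "AE x in lebesgue. T f x = (LINT y|lebesgue. kernel_integrand K f x y)"
  proof (rule KO.kernel_representation[OF fm _ k0])
    show "(\<integral>\<^sup>+x. ennreal (cmod (f j x)) powe \<rho> \<partial>lebesgue) < top" if "1 \<le> \<rho>" for j \<rho>
      using f[of j] that by (intro bcs_powers) auto
    \<comment> \<open>Every index serves here, as \<open>D\<close> dominates the kernel integral
      without oscillation; \<open>undefined\<close> names one.\<close>
    show "AE x in lebesgue. integrable lebesgue (kernel_integrand K f x)"
      using ae[of undefined] by (rule eventually_mono) (rule comm_integrable(2)[OF fm bm \<beta>(2)])
  qed auto
  define bf where "bf l = f(l := \<lambda>y. b l y * f l y)" for l
  have bfm: "bf l j \<in> borel_measurable lebesgue" for l j unfolding bf_def using fm bm by auto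
  have kbf: "kernel_integrand K (bf l) x y = b l (y $ l) * kernel_integrand K f x y" for l x y
  proof -
    have "(\<Prod>j\<in>UNIV. bf l j (y $ j)) = bf l l (y $ l) * (\<Prod>j\<in>UNIV - {l}. bf l j (y $ j))"
      by (subst prod.remove[of _ l]) auto
    also have "(\<Prod>j\<in>UNIV - {l}. bf l j (y $ j)) = (\<Prod>j\<in>UNIV - {l}. f j (y $ j))" by (intro prod.cong) (auto simp: bf_def)
    also have "bf l l (y $ l) * (\<Prod>j\<in>UNIV - {l}. f j (y $ j)) = b l (y $ l) * (\<Prod>j\<in>UNIV. f j (y $ j))"
      by (subst (2) prod.remove[of _ l]) (auto simp: bf_def mult.assoc)
    finally show ?thesis by (simp add: kernel_integrand_def)
  qed
  have ibf: "integrable lebesgue (kernel_integrand K (bf l) x)" if "D (b l) \<beta> l (ab f) x < top" for l x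
  proof -
    have "integrable lebesgue (\<lambda>y. b l x * kernel_integrand K f x y - (b l x - b l (y $ l)) * kernel_integrand K f x y)"
      using comm_integrable[OF fm bm \<beta>(2) that] by (intro Bochner_Integration.integrable_diff integrable_mult_right)
    then show ?thesis unfolding kbf by (simp add: algebra_simps)
  qed
  have T2: "AE x in lebesgue. T (bf l) x = (LINT y|lebesgue. kernel_integrand K (bf l) x y)" for l
  proof (rule KO.kernel_representation[OF bfm])
    show "(\<integral>\<^sup>+x. ennreal (cmod (bf l j x)) powe \<rho> \<partial>lebesgue) < top" if "1 \<le> \<rho>" for j \<rho>
      using bcs_powers(2)[of "f l" \<rho> "b l"] bcs_powers(1)[of "f j" \<rho>] f[of j] that b by (cases "j = l") (auto simp: bf_def)
    show "bf l j x = 0" if "x \<notin> cube 0 (real k0)" for j x using k0[OF that] by (simp add: bf_def)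
    show "AE x in lebesgue. integrable lebesgue (kernel_integrand K (bf l) x)"
      using ae[of l] by (rule eventually_mono) (rule ibf)
  qed auto
  have "AE x in lebesgue. \<forall>l\<in>UNIV. D (b l) \<beta> l (ab f) x < top" by (subst AE_finite_all) (use ae in auto)
  moreover have "AE x in lebesgue. \<forall>l\<in>UNIV. T (bf l) x = (LINT y|lebesgue. kernel_integrand K (bf l) x y)"
    by (subst AE_finite_all) (use T2 in auto)
  ultimately show ?thesis using T1
  proof eventually_elim
    case (elim x)
    have "(LINT y|lebesgue. (b l x - b l (y $ l)) * kernel_integrand K f x y) = b l x * T f x - T (bf l) x" for l
    proof -
      have fin: "D (b l) \<beta> l (ab f) x < top" using elim(1) by blast
      have i1: "integrable lebesgue (\<lambda>y. b l x * kernel_integrand K f x y)"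
        using comm_integrable(2)[OF fm bm \<beta>(2) fin] by (rule integrable_mult_right)
      have "(LINT y|lebesgue. (b l x - b l (y $ l)) * kernel_integrand K f x y)
        = (LINT y|lebesgue. b l x * kernel_integrand K f x y - kernel_integrand K (bf l) x y)"
        unfolding kbf by (simp add: algebra_simps)
      also have "\<dots> = (LINT y|lebesgue. b l x * kernel_integrand K f x y) - (LINT y|lebesgue. kernel_integrand K (bf l) x y)"
        by (rule Bochner_Integration.integral_diff[OF i1 ibf[OF fin]])
      also have "\<dots> = b l x * T f x - T (bf l) x" using elim(2,3) by simp
      finally show ?thesis .
    qed
    then show ?case by (simp add: comm_def commutator_def bf_def)
  qed
qed

text \<open>The number \<open>k * m\<close> of majorants enters twice: as the cost of a power of a
  sum, and under the root as the number of integrals that are added.\<close>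

definition CF :: "nat \<Rightarrow> real"
  where "CF k = A * real (k * CARD('m)) * (real (k * CARD('m)) * DC) powr (1 / q)"

lemma DC_nonneg: "0 \<le> DC"
  by (simp add: DC_def)

lemma CF_nonneg: "0 \<le> CF k"
  using A(1) by (simp add: CF_def)

lemma Lp_norm_target_le:
  assumes I: "finite I" and b: "\<And>l. b l \<in> BMO" and \<beta>: "\<And>l. bmo_norm (b l) \<le> ennreal \<beta>" "0 < \<beta>"
    and h: "\<And>i j. h i j \<in> borel_measurable lebesgue"
    and le: "AE x in lebesgue. ennreal (cmod (g x)) \<le> ennreal A * (\<Sum>z\<in>I \<times> UNIV. D (b (snd z)) \<beta> (snd z) (h (fst z)) x)"
  shows "Lp_norm q target g \<le> ennreal (CF (card I) * \<beta>) * (\<Sum>i\<in>I. \<Prod>j\<in>UNIV. NN j (h i j))"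
proof -
  define Pw where "Pw = (\<Sum>i\<in>I. \<Prod>j\<in>UNIV. NN j (h i j))"
  define Z where "Z = I \<times> (UNIV :: 'm set)"
  define n where "n = real (card Z)"
  have Z: "finite Z" using I by (simp add: Z_def)
  have n: "0 \<le> n" "n = real (card I * CARD('m))" by (simp_all add: n_def Z_def card_cartesian_product del: UNIV_Times_UNIV)
  have "\<forall>z. \<exists>V. V \<in> borel_measurable lebesgue \<and> (\<forall>x. D (b (snd z)) \<beta> (snd z) (h (fst z)) x \<le> V x) \<and>
    (\<integral>\<^sup>+x. V x powe q \<partial>W.M) \<le> ennreal (DC * \<beta> powr q) * (\<Prod>j\<in>UNIV. NN j (h (fst z) j)) powe q"
    (is "\<forall>z. ?X z")
  proof
    fix z show "?X z" using domination[of "b (snd z)" \<beta> "h (fst z)" "snd z"] b \<beta> h by blast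
  qed
  from choice[OF this] obtain V where V': "\<forall>z. V z \<in> borel_measurable lebesgue \<and> (\<forall>x. D (b (snd z)) \<beta> (snd z) (h (fst z)) x \<le> V z x) \<and>
    (\<integral>\<^sup>+x. V z x powe q \<partial>W.M) \<le> ennreal (DC * \<beta> powr q) * (\<Prod>j\<in>UNIV. NN j (h (fst z) j)) powe q"
    by blast
  then have V: "\<And>z. V z \<in> borel_measurable lebesgue" "\<And>z x. D (b (snd z)) \<beta> (snd z) (h (fst z)) x \<le> V z x"
    "\<And>z. (\<integral>\<^sup>+x. V z x powe q \<partial>W.M) \<le> ennreal (DC * \<beta> powr q) * (\<Prod>j\<in>UNIV. NN j (h (fst z) j)) powe q"
    by blast+
  note V(1) [measurable]
  have VM [measurable]: "V z \<in> borel_measurable W.M" for z using V(1) W.sets_M measurable_cong_sets by blast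
  have "(\<integral>\<^sup>+x. ennreal (cmod (g x) powr q) * ennreal (target x) \<partial>lebesgue)
    \<le> (\<integral>\<^sup>+x. ennreal (W.v x powr U) * (ennreal A * (\<Sum>z\<in>Z. V z x)) powe q \<partial>lebesgue)"
  proof (rule nn_integral_mono_AE, use le in \<open>rule eventually_mono\<close>)
    fix x assume *: "ennreal (cmod (g x)) \<le> ennreal A * (\<Sum>z\<in>I \<times> UNIV. D (b (snd z)) \<beta> (snd z) (h (fst z)) x)"
    also have "\<dots> \<le> ennreal A * (\<Sum>z\<in>Z. V z x)" unfolding Z_def by (intro mult_left_mono sum_mono V) simp
    finally have "ennreal (cmod (g x)) powe q \<le> (ennreal A * (\<Sum>z\<in>Z. V z x)) powe q" using q(2) by (intro powe_mono)
    then have "ennreal (cmod (g x) powr q) \<le> (ennreal A * (\<Sum>z\<in>Z. V z x)) powe q" by (simp add: powe_ennreal)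
    then show "ennreal (cmod (g x) powr q) * ennreal (target x) \<le> ennreal (W.v x powr U) * (ennreal A * (\<Sum>z\<in>Z. V z x)) powe q"
      unfolding q(3) by (subst mult.commute) (rule mult_left_mono, auto)
  qed
  also have "\<dots> = (\<integral>\<^sup>+x. (ennreal A * (\<Sum>z\<in>Z. V z x)) powe q \<partial>W.M)"
    unfolding W.M_def by (rule nn_integral_density[symmetric]) measurable
  also have "\<dots> \<le> (\<integral>\<^sup>+x. ennreal (A powr q) * (ennreal (n powr q) * (\<Sum>z\<in>Z. V z x powe q)) \<partial>W.M)"
    using q(2) A(1) powe_sum_le[OF q(2) Z]
    by (intro nn_integral_mono) (auto simp: powe_mult powe_ennreal n_def intro!: mult_left_mono)
  also have "\<dots> = ennreal (A powr q) * (ennreal (n powr q) * (\<Sum>z\<in>Z. \<integral>\<^sup>+x. V z x powe q \<partial>W.M))"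
    by (subst nn_integral_cmult, measurable, subst nn_integral_cmult, measurable, subst nn_integral_sum) auto
  also have "\<dots> \<le> ennreal (A powr q) * (ennreal (n powr q) * (\<Sum>z\<in>Z. ennreal (DC * \<beta> powr q) * Pw powe q))"
  proof (intro mult_left_mono sum_mono)
    fix z assume z: "z \<in> Z"
    have "(\<Prod>j\<in>UNIV. NN j (h (fst z) j)) \<le> Pw"
      unfolding Pw_def using z I by (intro member_le_sum) (auto simp: Z_def)
    then show "(\<integral>\<^sup>+x. V z x powe q \<partial>W.M) \<le> ennreal (DC * \<beta> powr q) * Pw powe q"
      using q(2) by (intro order_trans[OF V(3)] mult_left_mono powe_mono) auto
  qed auto
  also have "\<dots> = ennreal ((A * n * \<beta>) powr q * (n * DC)) * Pw powe q"
    using A(1) n \<beta>(2) DC_nonneg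
    by (simp add: n_def[symmetric] ennreal_mult powr_mult mult_ac ennreal_of_nat_eq_real_of_nat)
  finally have "Lp_norm q target g \<le> (ennreal ((A * n * \<beta>) powr q * (n * DC)) * Pw powe q) powe (1 / q)"
    unfolding Lp_norm_def using q(2) by (intro powe_mono) auto
  also have "\<dots> = ennreal (((A * n * \<beta>) powr q * (n * DC)) powr (1 / q)) * Pw"
    using q(2) A(1) n \<beta>(2) DC_nonneg by (simp add: powe_mult powe_powe powe_ennreal)
  also have "((A * n * \<beta>) powr q * (n * DC)) powr (1 / q) = CF (card I) * \<beta>"
    using q(2) A(1) n(1) \<beta>(2) DC_nonneg by (simp add: CF_def n(2)[symmetric] powr_mult powr_powr mult_ac del: of_nat_mult)
  finally show ?thesis unfolding Pw_def .
qed

lemma BMO_bound: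
  fixes b :: "'m \<Rightarrow> real ^ 'n \<Rightarrow> complex"
  assumes b: "\<And>l. b l \<in> BMO"
  obtains \<beta> where "0 \<le> \<beta>" "bmo_vec_norm b = ennreal \<beta>" "\<And>l. bmo_norm (b l) \<le> ennreal \<beta>"
proof -
  have fin: "finite (range (\<lambda>i. bmo_norm (b i)))" by simp
  have "Max (range (\<lambda>i. bmo_norm (b i))) \<in> range (\<lambda>i. bmo_norm (b i))" by (intro Max_in) auto
  then have "bmo_vec_norm b < top" using b by (auto simp: bmo_vec_norm_def BMO_def)
  then obtain \<beta> where \<beta>: "0 \<le> \<beta>" "bmo_vec_norm b = ennreal \<beta>" by (cases "bmo_vec_norm b") auto
  moreover have "bmo_norm (b l) \<le> ennreal \<beta>" for l
    unfolding \<beta>(2)[symmetric] bmo_vec_norm_def by (intro Max_ge[OF fin]) auto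
  ultimately show ?thesis by (rule that)
qed

lemma comm_Lp_norm_le:
  assumes f: "\<And>j. f j \<in> Lp_space (p j) (weight j)" and b: "\<And>l. b l \<in> BMO"
  shows "Lp_norm q target (comm b f) \<le> ennreal (CF 1) * bmo_vec_norm b * (\<Prod>j\<in>UNIV. Lp_norm (p j) (weight j) (f j))"
proof -
  obtain \<beta> where \<beta>: "0 \<le> \<beta>" "bmo_vec_norm b = ennreal \<beta>" "\<And>l. bmo_norm (b l) \<le> ennreal \<beta>"
    by (rule BMO_bound[OF b]) (rule that)
  have fm: "f j \<in> borel_measurable lebesgue" and fN: "NN j (ab f j) < top" for j
    using f[of j] Lp_space_weight_iff by auto
  have am: "ab f j \<in> borel_measurable lebesgue" for j using fm by measurable
  have bm: "b j \<in> borel_measurable lebesgue" for j by (rule BMO_measurable[OF b])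
  have "(\<Prod>j\<in>UNIV. NN j (ab f j)) \<noteq> top" using fN by (auto simp: ennreal_prod_eq_top less_top)
  then obtain \<pi> where \<pi>: "0 \<le> \<pi>" "(\<Prod>j\<in>UNIV. NN j (ab f j)) = ennreal \<pi>" by (cases "\<Prod>j\<in>UNIV. NN j (ab f j)") auto
  \<comment> \<open>The domination needs a positive constant, whereas all \<open>b l\<close> may
    have norm 0; so it is applied with every \<open>\<gamma> > \<beta>\<close>.\<close>
  have bd: "Lp_norm q target (comm b f) \<le> ennreal (CF 1 * \<gamma> * \<pi>)" if \<gamma>: "\<beta> < \<gamma>" for \<gamma>
  proof -
    have \<gamma>': "bmo_norm (b l) \<le> ennreal \<gamma>" "0 < \<gamma>" for l
      using \<beta>(1) \<gamma> by (auto intro: order_trans[OF \<beta>(3)] ennreal_leI)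
    have "ennreal (cmod (comm b f x)) \<le> ennreal A * (\<Sum>z\<in>{()} \<times> UNIV. D (b (snd z)) \<gamma> (snd z) (ab f) x)" for x
    proof -
      have "ennreal (cmod (comm b f x)) \<le> ennreal (\<Sum>l\<in>UNIV. cmod (LINT y|lebesgue. (b l x - b l (y $ l)) * kernel_integrand K f x y))"
        unfolding comm_def by (intro ennreal_leI norm_sum)
      also have "\<dots> = (\<Sum>l\<in>UNIV. ennreal (cmod (LINT y|lebesgue. (b l x - b l (y $ l)) * kernel_integrand K f x y)))"
        by (rule sum_ennreal[symmetric]) simp
      also have "\<dots> \<le> (\<Sum>l\<in>UNIV. ennreal A * D (b l) \<gamma> l (ab f) x)"
        by (intro sum_mono order_trans[OF norm_integral_le_nn_integral comm_term_le] fm bm \<gamma>')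
      also have "\<dots> = ennreal A * (\<Sum>l\<in>UNIV. D (b l) \<gamma> l (ab f) x)" by (rule sum_distrib_left[symmetric])
      also have "(\<Sum>l\<in>UNIV. D (b l) \<gamma> l (ab f) x) = (\<Sum>z\<in>{()} \<times> UNIV. D (b (snd z)) \<gamma> (snd z) (ab f) x)"
        by (rule sum.reindex_bij_witness[of _ snd "Pair ()"]) auto
      finally show ?thesis .
    qed
    then have "Lp_norm q target (comm b f) \<le> ennreal (CF (card {()}) * \<gamma>) * (\<Sum>i\<in>{()}. \<Prod>j\<in>UNIV. NN j (ab f j))"
      by - (rule Lp_norm_target_le[where b=b and h="\<lambda>_. ab f", OF _ b \<gamma>' am], simp_all)
    then show ?thesis using \<pi> \<gamma>'(2) CF_nonneg by (simp add: ennreal_mult)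
  qed
  have "Lp_norm q target (comm b f) \<le> ennreal (CF 1 * \<beta> * \<pi>)"
  proof (rule ennreal_le_epsilon)
    fix e :: real assume e: "0 < e"
    \<comment> \<open>The added 1 admits \<open>CF 1 * \<pi> = 0\<close>.\<close>
    define d where "d = e / (CF 1 * \<pi> + 1)"
    have c: "0 < CF 1 * \<pi> + 1" using CF_nonneg[of 1] \<pi>(1) by (intro add_nonneg_pos mult_nonneg_nonneg) auto
    have d: "0 < d" using e c by (simp add: d_def)
    have "CF 1 * \<pi> * d \<le> e" using e c by (simp add: d_def field_simps)
    then have "CF 1 * (\<beta> + d) * \<pi> \<le> CF 1 * \<beta> * \<pi> + e" by (simp add: algebra_simps)
    then have "ennreal (CF 1 * (\<beta> + d) * \<pi>) \<le> ennreal (CF 1 * \<beta> * \<pi> + e)" by (rule ennreal_leI)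
    also have "\<dots> = ennreal (CF 1 * \<beta> * \<pi>) + ennreal e" using e CF_nonneg \<beta> \<pi> by (intro ennreal_plus) auto
    finally show "Lp_norm q target (comm b f) \<le> ennreal (CF 1 * \<beta> * \<pi>) + ennreal e"
      using bd[of "\<beta> + d"] d by (auto intro: order_trans)
  qed
  also have "\<dots> = ennreal (CF 1) * bmo_vec_norm b * (\<Prod>j\<in>UNIV. Lp_norm (p j) (weight j) (f j))"
    using \<beta>(1,2) \<pi> CF_nonneg[of 1] by (simp add: Lp_norm_weight ennreal_mult)
  finally show ?thesis .
qed

text \<open>Measurability in \<open>x\<close> is inherited from \<open>T\<close>: for tuples
  truncated in height and to a cube, \<open>comm\<close> is almost everywhere the commutator, and
  dominated convergence passes to the limit on a set of full measure.\<close>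

lemma comm_measurable:
  assumes f: "\<And>j. f j \<in> Lp_space (p j) (weight j)" and b: "\<And>l. b l \<in> BMO"
  shows "comm b f \<in> borel_measurable lebesgue"
proof -
  obtain \<beta>0 where \<beta>0: "0 \<le> \<beta>0" "bmo_vec_norm b = ennreal \<beta>0" "\<And>l. bmo_norm (b l) \<le> ennreal \<beta>0"
    by (rule BMO_bound[OF b]) (rule that)
  define \<beta> where "\<beta> = \<beta>0 + 1"
  have \<beta>: "bmo_norm (b l) \<le> ennreal \<beta>" "0 < \<beta>" for l
    using \<beta>0(1) by (auto simp: \<beta>_def intro!: order_trans[OF \<beta>0(3)] ennreal_leI)
  have fm: "f j \<in> borel_measurable lebesgue" and fN: "NN j (ab f j) < top" for j
    using f[of j] Lp_space_weight_iff by auto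
  have am: "ab f j \<in> borel_measurable lebesgue" for j using fm by measurable
  have bm: "b j \<in> borel_measurable lebesgue" for j by (rule BMO_measurable[OF b])
  note fm [measurable]
  define g where "g N j x = (if cmod (f j x) \<le> real N \<and> x \<in> cube 0 (real N) then f j x else 0)" for N :: nat and j x
  have gm: "g N j \<in> borel_measurable lebesgue" for N j unfolding g_def[abs_def] by measurable
  have gle: "cmod (g N j x) \<le> cmod (f j x)" for N j x by (simp add: g_def)
  have gL: "g N j \<in> Lp_space (p j) (weight j)" for N j
    unfolding Lp_space_weight_iff using gm NN_mono[of "ab (g N) j" "ab f j" j] fN[of j]
    by (auto intro: le_less_trans simp: gle ennreal_leI)
  have gb: "g N j \<in> bounded_compact_support" for N j
  proof -
    have "bounded (range (g N j))" by (rule boundedI[of _ "real N"]) (auto simp: g_def)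
    moreover have "bounded {x. g N j x \<noteq> 0}"
      by (rule bounded_subset[OF W.bounded_cube[of 0 "real N"]]) (auto simp: g_def)
    ultimately show ?thesis unfolding bounded_compact_support_def supp_def using gm by (simp add: compact_closure)
  qed
  have cm: "comm b (g N) \<in> borel_measurable lebesgue" for N
  proof (rule lebesgue_measurable_AE_cong)
    show "commutator T b (g N) \<in> borel_measurable lebesgue" by (intro KO.commutator_measurable gb b)
    have "AE x in lebesgue. comm b (g N) x = commutator T b (g N) x" by (rule comm_eq_commutator[OF _ b \<beta>]) (use gL gb in blast)
    then show "AE x in lebesgue. commutator T b (g N) x = comm b (g N) x" by (rule eventually_mono) simp
  qed
  have "\<forall>l. \<exists>G. G \<in> sets lebesgue \<and> (AE x in lebesgue. x \<in> G) \<and> (\<forall>x\<in>G. D (b l) \<beta> l (ab f) x < top)"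
    (is "\<forall>l. ?X l")
  proof
    fix l show "?X l" using D_finite[of "b l" \<beta> "ab f" l] b \<beta> am fN by blast
  qed
  from choice[OF this] obtain G where G: "\<And>l. G l \<in> sets lebesgue" "\<And>l. AE x in lebesgue. x \<in> G l"
    "\<And>l x. x \<in> G l \<Longrightarrow> D (b l) \<beta> l (ab f) x < top" by blast
  define GG where "GG = (\<Inter>l. G l)"
  have GG: "GG \<in> sets lebesgue" unfolding GG_def using G(1) by (intro sets.finite_INT) auto
  have aeG: "AE x in lebesgue. x \<in> GG"
  proof -
    have "AE x in lebesgue. \<forall>l\<in>UNIV. x \<in> G l" by (subst AE_finite_all) (use G(2) in auto)
    then show ?thesis by (rule eventually_mono) (auto simp: GG_def)
  qed
  have lim: "(\<lambda>N. comm b (g N) x) \<longlonglongrightarrow> comm b f x" if x: "x \<in> GG" for x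
    unfolding comm_def
  proof (rule tendsto_sum)
    fix l :: 'm
    have fin: "D (b l) \<beta> l (ab f) x < top" using x G(3) by (auto simp: GG_def)
    have bml: "(\<lambda>y :: real ^ 'n ^ 'm. b l x - b l (y $ l)) \<in> borel_measurable lebesgue"
      using bm by (intro borel_measurable_diff borel_measurable_const borel_measurable_proj)
    show "(\<lambda>N. LINT y|lebesgue. (b l x - b l (y $ l)) * kernel_integrand K (g N) x y)
      \<longlonglongrightarrow> (LINT y|lebesgue. (b l x - b l (y $ l)) * kernel_integrand K f x y)"
    proof (rule integral_dominated_convergence)
      show "integrable lebesgue (\<lambda>y. cmod ((b l x - b l (y $ l)) * kernel_integrand K f x y))"
        by (intro integrable_norm comm_integrable(1)[OF fm bm \<beta>(2) fin])
      show "(\<lambda>y. (b l x - b l (y $ l)) * kernel_integrand K f x y) \<in> borel_measurable lebesgue"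
        by (intro borel_measurable_times bml kernel_integrand_measurable fm)
      show "(\<lambda>y. (b l x - b l (y $ l)) * kernel_integrand K (g N) x y) \<in> borel_measurable lebesgue" for N
        by (intro borel_measurable_times bml kernel_integrand_measurable gm)
      show "AE y in lebesgue. (\<lambda>N. (b l x - b l (y $ l)) * kernel_integrand K (g N) x y) \<longlonglongrightarrow> (b l x - b l (y $ l)) * kernel_integrand K f x y"
      proof (rule AE_I2)
        fix y :: "real ^ 'n ^ 'm"
        have "(\<lambda>N. g N j z) \<longlonglongrightarrow> f j z" for j z
        proof (rule tendsto_eventually)
          obtain N0 :: nat where N0: "cmod (f j z) + 2 * norm z \<le> real N0" using real_arch_simple by blast
          have "g N j z = f j z" if "N0 \<le> N" for N
          proof -
            have N: "cmod (f j z) + 2 * norm z \<le> real N" using N0 that by linarith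
            then have "cmod (f j z) \<le> real N" using norm_ge_zero[of z] by linarith
            moreover have "2 * \<bar>z $ i\<bar> \<le> real N" for i
              using component_le_norm_cart[of z i] N norm_ge_zero[of "f j z"] by linarith
            then have "z \<in> cube 0 (real N)" by (simp add: cube_def mult.commute)
            ultimately show ?thesis by (simp add: g_def)
          qed
          then show "eventually (\<lambda>N. g N j z = f j z) sequentially" by (rule eventually_sequentiallyI)
        qed
        then show "(\<lambda>N. (b l x - b l (y $ l)) * kernel_integrand K (g N) x y) \<longlonglongrightarrow> (b l x - b l (y $ l)) * kernel_integrand K f x y"
          unfolding kernel_integrand_def by (intro tendsto_intros)
      qed
      show "AE y in lebesgue. norm ((b l x - b l (y $ l)) * kernel_integrand K (g N) x y) \<le> cmod ((b l x - b l (y $ l)) * kernel_integrand K f x y)" for N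
        by (rule AE_I2) (auto simp: kernel_integrand_def norm_mult prod_norm[symmetric] gle intro!: mult_left_mono prod_mono)
    qed
  qed
  \<comment> \<open>Setting the functions to 0 outside \<open>GG\<close> makes the convergence hold
    at every point.\<close>
  have "(\<lambda>x. if x \<in> GG then comm b f x else 0) \<in> borel_measurable lebesgue"
  proof (rule borel_measurable_LIMSEQ_metric)
    show "(\<lambda>x. if x \<in> GG then comm b (g N) x else 0) \<in> borel_measurable lebesgue" for N
      using cm GG by measurable
    show "(\<lambda>N. if x \<in> GG then comm b (g N) x else 0) \<longlonglongrightarrow> (if x \<in> GG then comm b f x else 0)" for x
      using lim[of x] by simp
  qed
  then show ?thesis
    by (rule lebesgue_measurable_AE_cong) (use aeG in \<open>rule eventually_mono\<close>, simp)
qed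

lemma comm_diff_le:
  fixes F f :: "'m \<Rightarrow> real ^ 'n \<Rightarrow> complex"
  assumes F: "\<And>j. F j \<in> borel_measurable lebesgue" and f: "\<And>j. f j \<in> borel_measurable lebesgue"
    and b: "\<And>l. b l \<in> borel_measurable lebesgue" and \<beta>: "0 < \<beta>"
    and fin: "\<And>l. D (b l) \<beta> l (ab F) x < top" "\<And>l. D (b l) \<beta> l (ab f) x < top"
  defines "e \<equiv> \<lambda>i j z. if j = i then cmod (F j z - f j z) else cmod (F j z - f j z) + 2 * cmod (f j z)"
  shows "ennreal (cmod (comm b F x - comm b f x)) \<le> ennreal A * (\<Sum>z\<in>UNIV \<times> UNIV. D (b (snd z)) \<beta> (snd z) (\<lambda>j w. ennreal (e (fst z) j w)) x)"
proof -
  have em: "(\<lambda>w. e i j w) \<in> borel_measurable lebesgue" for i j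
    unfolding e_def using F[of j] f[of j] by (cases "j = i") auto
  have e0: "0 \<le> e i j w" for i j w by (simp add: e_def)
  have hm: "(\<lambda>w. ennreal (e i j w)) \<in> borel_measurable lebesgue" for i j using em by measurable
  define H where "H l i y = cmod (b l x - b l (y $ l)) * (cmod (K x y) * (\<Prod>j\<in>UNIV. e i j (y $ j)))" for l i and y :: "real ^ 'n ^ 'm"
  have pe0: "0 \<le> (\<Prod>j\<in>UNIV. e i j (y $ j))" for i and y :: "real ^ 'n ^ 'm" by (intro prod_nonneg ballI e0)
  have H0: "0 \<le> H l i y" for l i y unfolding H_def by (intro mult_nonneg_nonneg pe0 norm_ge_zero)
  have Hm: "H l i \<in> borel_measurable lebesgue" for l i
  proof -
    have bml: "(\<lambda>y :: real ^ 'n ^ 'm. b l x - b l (y $ l)) \<in> borel_measurable lebesgue"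
      using b by (intro borel_measurable_diff borel_measurable_const borel_measurable_proj)
    have n: "(\<lambda>y. cmod (b l x - b l (y $ l))) \<in> borel_measurable lebesgue" "(\<lambda>y. cmod (K x y)) \<in> borel_measurable lebesgue"
      using bml K_measurable[of x] by measurable
    show ?thesis unfolding H_def[abs_def]
      by (intro borel_measurable_times n borel_measurable_prod borel_measurable_proj em)
  qed
  have one: "ennreal (cmod ((LINT y|lebesgue. (b l x - b l (y $ l)) * kernel_integrand K F x y)
      - (LINT y|lebesgue. (b l x - b l (y $ l)) * kernel_integrand K f x y)))
    \<le> ennreal A * (\<Sum>i\<in>UNIV. D (b l) \<beta> l (\<lambda>j w. ennreal (e i j w)) x)" for l
  proof -
    have "(LINT y|lebesgue. (b l x - b l (y $ l)) * kernel_integrand K F x y) - (LINT y|lebesgue. (b l x - b l (y $ l)) * kernel_integrand K f x y)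
      = (LINT y|lebesgue. (b l x - b l (y $ l)) * kernel_integrand K F x y - (b l x - b l (y $ l)) * kernel_integrand K f x y)"
      by (rule Bochner_Integration.integral_diff[symmetric]) (intro comm_integrable(1)[OF _ b \<beta>] F f fin)+
    then have "ennreal (cmod ((LINT y|lebesgue. (b l x - b l (y $ l)) * kernel_integrand K F x y)
      - (LINT y|lebesgue. (b l x - b l (y $ l)) * kernel_integrand K f x y)))
      \<le> (\<integral>\<^sup>+y. ennreal (cmod ((b l x - b l (y $ l)) * kernel_integrand K F x y - (b l x - b l (y $ l)) * kernel_integrand K f x y)) \<partial>lebesgue)"
      by (simp only: norm_integral_le_nn_integral)
    also have "\<dots> \<le> (\<integral>\<^sup>+y. (\<Sum>i\<in>UNIV. ennreal (H l i y)) \<partial>lebesgue)"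
    proof (rule nn_integral_mono)
      fix y :: "real ^ 'n ^ 'm"
      have "cmod ((b l x - b l (y $ l)) * kernel_integrand K F x y - (b l x - b l (y $ l)) * kernel_integrand K f x y)
        = cmod (b l x - b l (y $ l)) * (cmod (K x y) * cmod ((\<Prod>j\<in>UNIV. F j (y $ j)) - (\<Prod>j\<in>UNIV. f j (y $ j))))"
        unfolding kernel_integrand_def right_diff_distrib[symmetric] norm_mult ..
      also have "\<dots> \<le> cmod (b l x - b l (y $ l)) * (cmod (K x y) * (\<Sum>i\<in>UNIV. \<Prod>j\<in>UNIV. e i j (y $ j)))"
        unfolding e_def by (intro mult_left_mono norm_prod_diff_le norm_ge_zero) simp
      also have "\<dots> = (\<Sum>i\<in>UNIV. H l i y)" by (simp only: H_def sum_distrib_left)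
      finally show "ennreal (cmod ((b l x - b l (y $ l)) * kernel_integrand K F x y - (b l x - b l (y $ l)) * kernel_integrand K f x y))
        \<le> (\<Sum>i\<in>UNIV. ennreal (H l i y))" using H0 by (subst sum_ennreal) (auto intro: ennreal_leI)
    qed
    also have "\<dots> = (\<Sum>i\<in>UNIV. \<integral>\<^sup>+y. ennreal (H l i y) \<partial>lebesgue)"
      using Hm by (intro nn_integral_sum) measurable
    also have "\<dots> \<le> (\<Sum>i\<in>UNIV. ennreal A * D (b l) \<beta> l (\<lambda>j w. ennreal (e i j w)) x)"
    proof (rule sum_mono)
      fix i
      have "(\<integral>\<^sup>+y. ennreal (cmod (of_real (H l i y))) \<partial>lebesgue) \<le> ennreal A * D (b l) \<beta> l (\<lambda>j w. ennreal (e i j w)) x"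
      proof (rule kernel_term_le[OF hm b _ pe0 _ \<beta>])
        fix y :: "real ^ 'n ^ 'm"
        have "cmod (of_real (H l i y)) = cmod (b l x - b l (y $ l)) * (cmod (K x y) * (\<Prod>j\<in>UNIV. e i j (y $ j)))"
          using H0[of l i y] unfolding norm_of_real by (simp add: H_def)
        also have "\<dots> \<le> (cmod (b l x - b l (y $ l)) + \<beta>) * (cmod (K x y) * (\<Prod>j\<in>UNIV. e i j (y $ j)))"
          using \<beta> by (intro mult_right_mono mult_nonneg_nonneg pe0) auto
        finally show "cmod (of_real (H l i y)) \<le> (cmod (b l x - b l (y $ l)) + \<beta>) * cmod (K x y) * (\<Prod>j\<in>UNIV. e i j (y $ j))"
          by (simp only: mult.assoc)
        show "ennreal (\<Prod>j\<in>UNIV. e i j (y $ j)) = (\<Prod>j\<in>UNIV. ennreal (e i j (y $ j)))" by (rule prod_ennreal[symmetric]) (rule e0)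
      qed
      then show "(\<integral>\<^sup>+y. ennreal (H l i y) \<partial>lebesgue) \<le> ennreal A * D (b l) \<beta> l (\<lambda>j w. ennreal (e i j w)) x"
        using H0 by simp
    qed
    finally show ?thesis by (simp only: sum_distrib_left)
  qed
  have "ennreal (cmod (comm b F x - comm b f x)) \<le> (\<Sum>l\<in>UNIV. ennreal (cmod ((LINT y|lebesgue. (b l x - b l (y $ l)) * kernel_integrand K F x y)
      - (LINT y|lebesgue. (b l x - b l (y $ l)) * kernel_integrand K f x y))))"
    unfolding comm_def sum_subtractf[symmetric] by (subst sum_ennreal) (auto intro!: ennreal_leI norm_sum)
  also have "\<dots> \<le> (\<Sum>l\<in>UNIV. ennreal A * (\<Sum>i\<in>UNIV. D (b l) \<beta> l (\<lambda>j w. ennreal (e i j w)) x))"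
    by (intro sum_mono one)
  also have "\<dots> = ennreal A * (\<Sum>i\<in>UNIV. \<Sum>l\<in>UNIV. D (b l) \<beta> l (\<lambda>j w. ennreal (e i j w)) x)"
    unfolding sum_distrib_left[symmetric] by (subst sum.swap) (rule refl)
  also have "(\<Sum>i\<in>UNIV. \<Sum>l\<in>UNIV. D (b l) \<beta> l (\<lambda>j w. ennreal (e i j w)) x) = (\<Sum>z\<in>UNIV \<times> UNIV. D (b (snd z)) \<beta> (snd z) (\<lambda>j w. ennreal (e (fst z) j w)) x)"
    unfolding sum.cartesian_product by (intro sum.cong) (auto simp del: UNIV_Times_UNIV)
  finally show ?thesis .
qed

lemma comm_tendsto:
  assumes f: "\<And>j. f j \<in> Lp_space (p j) (weight j)" and F: "\<And>k j. F k j \<in> Lp_space (p j) (weight j)" and b: "\<And>l. b l \<in> BMO"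
    and lim: "\<And>j. (\<lambda>k :: nat. Lp_norm (p j) (weight j) (\<lambda>x. F k j x - f j x)) \<longlonglongrightarrow> 0"
  shows "(\<lambda>k. Lp_norm q target (\<lambda>x. comm b (F k) x - comm b f x)) \<longlonglongrightarrow> 0"
proof -
  obtain \<beta>0 where \<beta>0: "0 \<le> \<beta>0" "bmo_vec_norm b = ennreal \<beta>0" "\<And>l. bmo_norm (b l) \<le> ennreal \<beta>0"
    by (rule BMO_bound[OF b]) (rule that)
  define \<beta> where "\<beta> = \<beta>0 + 1"
  have \<beta>: "bmo_norm (b l) \<le> ennreal \<beta>" "0 < \<beta>" for l
    using \<beta>0(1) by (auto simp: \<beta>_def intro!: order_trans[OF \<beta>0(3)] ennreal_leI)
  have fm [measurable]: "f j \<in> borel_measurable lebesgue" and fN: "NN j (ab f j) < top" for j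
    using f[of j] Lp_space_weight_iff by auto
  have Fm [measurable]: "F k j \<in> borel_measurable lebesgue" and FN: "NN j (ab (F k) j) < top" for k j
    using F[of k j] Lp_space_weight_iff by auto
  have bm: "b j \<in> borel_measurable lebesgue" for j by (rule BMO_measurable[OF b])
  have abm: "ab f j \<in> borel_measurable lebesgue" "ab (F k) j \<in> borel_measurable lebesgue" for k j by measurable
  have finAE: "AE x in lebesgue. \<forall>l\<in>UNIV. D (b l) \<beta> l (ab g) x < top"
    if g: "\<And>j. ab g j \<in> borel_measurable lebesgue" "\<And>j. NN j (ab g j) < top" for g :: "'m \<Rightarrow> real ^ 'n \<Rightarrow> complex"
  proof (subst AE_finite_all, simp, intro ballI)
    fix l
    obtain G where G: "AE x in lebesgue. x \<in> G" "\<forall>x\<in>G. D (b l) \<beta> l (ab g) x < top"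
      using D_finite[of "b l" \<beta> "ab g" l] b \<beta> g by blast
    show "AE x in lebesgue. D (b l) \<beta> l (ab g) x < top" using G(1) by (rule eventually_mono) (use G(2) in blast)
  qed
  define d where "d k j = NN j (\<lambda>x. ennreal (cmod (F k j x - f j x)))" for k j
  define e where "e k i j w = (if j = i then cmod (F k j w - f j w) else cmod (F k j w - f j w) + 2 * cmod (f j w))" for k i j w
  \<comment> \<open>Once all distances \<open>d k j\<close> are below 1, the factors other than the
    \<open>i\<close>-th have product at most \<open>c i\<close>, independently of \<open>k\<close>,
    while the remaining factor \<open>d k i\<close> tends to 0.\<close>
  define c where "c i = (\<Prod>j\<in>UNIV - {i}. 2 * (1 + 4 * NN j (ab f j)))" for i
  have dlim: "(\<lambda>k. d k j) \<longlonglongrightarrow> 0" for j using lim[of j] by (simp only: d_def Lp_norm_weight)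
  have em: "(\<lambda>w. ennreal (e k i j w)) \<in> borel_measurable lebesgue" for k i j unfolding e_def by (cases "j = i") auto
  have c: "c i < top" for i
  proof -
    have "2 * (1 + 4 * NN j (ab f j)) \<noteq> top" for j using fN[of j] by (auto simp: ennreal_mult_eq_top_iff less_top)
    then show ?thesis unfolding c_def less_top[symmetric] by (simp add: ennreal_prod_eq_top)
  qed
  have bound: "Lp_norm q target (\<lambda>x. comm b (F k) x - comm b f x) \<le> ennreal (CF CARD('m) * \<beta>) * (\<Sum>i\<in>UNIV. c i * d k i)"
    if k: "\<And>j. d k j < 1" for k
  proof -
    have "AE x in lebesgue. ennreal (cmod (comm b (F k) x - comm b f x))
      \<le> ennreal A * (\<Sum>z\<in>UNIV \<times> UNIV. D (b (snd z)) \<beta> (snd z) (\<lambda>j w. ennreal (e k (fst z) j w)) x)"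
      using finAE[OF abm(1) fN] finAE[OF abm(2)[of k] FN[of _ k]]
    proof eventually_elim
      case (elim x)
      show ?case unfolding e_def by (rule comm_diff_le[OF Fm fm bm \<beta>(2)]) (use elim in auto)
    qed
    then have "Lp_norm q target (\<lambda>x. comm b (F k) x - comm b f x) \<le> ennreal (CF (card (UNIV :: 'm set)) * \<beta>) * (\<Sum>i\<in>UNIV. \<Prod>j\<in>UNIV. NN j (\<lambda>w. ennreal (e k i j w)))"
      by - (rule Lp_norm_target_le[where b=b and h="\<lambda>i j w. ennreal (e k i j w)", OF _ b \<beta> em], simp_all del: UNIV_Times_UNIV)
    also have "\<dots> \<le> ennreal (CF CARD('m) * \<beta>) * (\<Sum>i\<in>UNIV. c i * d k i)"
    proof (intro mult_left_mono sum_mono)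
      fix i :: 'm
      have "(\<Prod>j\<in>UNIV. NN j (\<lambda>w. ennreal (e k i j w))) = NN i (\<lambda>w. ennreal (e k i i w)) * (\<Prod>j\<in>UNIV - {i}. NN j (\<lambda>w. ennreal (e k i j w)))"
        by (rule prod.remove) auto
      also have "\<dots> \<le> d k i * c i"
        unfolding c_def
      proof (intro mult_mono prod_mono_ennreal)
        show "NN i (\<lambda>w. ennreal (e k i i w)) \<le> d k i" by (simp add: e_def d_def)
        fix j assume "j \<in> UNIV - {i}"
        then have "(\<lambda>w. ennreal (e k i j w)) = (\<lambda>w. ennreal (cmod (F k j w - f j w)) + 2 * ab f j w)"
          by (auto simp: e_def fun_eq_iff ennreal_mult)
        then have "NN j (\<lambda>w. ennreal (e k i j w)) \<le> 2 * (d k j + NN j (\<lambda>w. 2 * ab f j w))"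
          unfolding d_def by (simp only:) (rule NN_add_le; measurable)
        also have "\<dots> \<le> 2 * (1 + 4 * NN j (ab f j))"
          using k[of j] by (intro mult_left_mono add_mono NN_cmult abm) auto
        finally show "NN j (\<lambda>w. ennreal (e k i j w)) \<le> 2 * (1 + 4 * NN j (ab f j))" .
      qed auto
      finally show "(\<Prod>j\<in>UNIV. NN j (\<lambda>w. ennreal (e k i j w))) \<le> c i * d k i" by (simp only: mult.commute)
    qed simp
    finally show ?thesis .
  qed
  have "eventually (\<lambda>k. \<forall>j\<in>UNIV. d k j < 1) sequentially"
    by (intro eventually_ball_finite ballI order_tendstoD(2)[OF dlim]) auto
  then have ev: "eventually (\<lambda>k. Lp_norm q target (\<lambda>x. comm b (F k) x - comm b f x) \<le> ennreal (CF CARD('m) * \<beta>) * (\<Sum>i\<in>UNIV. c i * d k i)) sequentially"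
    by (rule eventually_mono) (rule bound, blast)
  have "(\<lambda>k. ennreal (CF CARD('m) * \<beta>) * (\<Sum>i\<in>UNIV. c i * d k i)) \<longlonglongrightarrow> ennreal (CF CARD('m) * \<beta>) * (\<Sum>i\<in>(UNIV :: 'm set). c i * 0)"
    by (intro ennreal_tendsto_cmult tendsto_sum c dlim) simp
  then have up: "(\<lambda>k. ennreal (CF CARD('m) * \<beta>) * (\<Sum>i\<in>UNIV. c i * d k i)) \<longlonglongrightarrow> 0" by simp
  show ?thesis by (rule tendsto_sandwich[OF _ ev tendsto_const up]) simp
qed

lemma continuous_extension_comm:
  assumes b: "\<And>l. b l \<in> BMO"
  shows "continuous_extension (Lp_norm q target) p weight (commutator T b) (comm b)"
proof -
  obtain \<beta>0 where \<beta>0: "0 \<le> \<beta>0" "bmo_vec_norm b = ennreal \<beta>0" "\<And>l. bmo_norm (b l) \<le> ennreal \<beta>0"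
    by (rule BMO_bound[OF b]) (rule that)
  have \<beta>: "bmo_norm (b l) \<le> ennreal (\<beta>0 + 1)" "0 < \<beta>0 + 1" for l
    using \<beta>0(1) by (auto intro!: order_trans[OF \<beta>0(3)] ennreal_leI)
  show ?thesis unfolding continuous_extension_def
  proof (intro conjI allI impI)
    fix f assume f: "\<forall>j. f j \<in> Lp_space (p j) (weight j) \<inter> bounded_compact_support"
    show "AE x in lebesgue. comm b f x = commutator T b f x" by (rule comm_eq_commutator[OF f[rule_format] b \<beta>])
  next
    fix f assume f: "\<forall>j. f j \<in> Lp_space (p j) (weight j)"
    show "comm b f \<in> borel_measurable lebesgue" by (rule comm_measurable[OF f[rule_format] b])
    fix F assume "(\<forall>k j. F k j \<in> Lp_space (p j) (weight j)) \<and> (\<forall>j. (\<lambda>k. Lp_norm (p j) (weight j) (\<lambda>x. F k j x - f j x)) \<longlonglongrightarrow> 0)"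
    then have F: "\<And>k j. F k j \<in> Lp_space (p j) (weight j)" "\<And>j. (\<lambda>k. Lp_norm (p j) (weight j) (\<lambda>x. F k j x - f j x)) \<longlonglongrightarrow> 0" by simp_all
    show "(\<lambda>k. Lp_norm q target (\<lambda>x. comm b (F k) x - comm b f x)) \<longlonglongrightarrow> 0" by (rule comm_tendsto[OF f[rule_format] F(1) b F(2)])
  qed
qed

end

section \<open>Weak norms, degenerate weights and the final assembly\<close>

lemma continuous_extension_weak:
  assumes S: "continuous_extension (Lp_norm q w) p u Op S" and q: "0 < q" and w: "w \<in> borel_measurable lebesgue"
  shows "continuous_extension (weak_Lp_norm q w) p u Op S"
  unfolding continuous_extension_def
proof (intro conjI allI impI)
  fix f assume "\<forall>j. f j \<in> Lp_space (p j) (u j) \<inter> bounded_compact_support"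
  then show "AE x in lebesgue. S f x = Op f x" using S unfolding continuous_extension_def by blast
next
  have m: "S f \<in> borel_measurable lebesgue" if "\<forall>j. f j \<in> Lp_space (p j) (u j)" for f
    using S that unfolding continuous_extension_def by blast
  fix f assume f: "\<forall>j. f j \<in> Lp_space (p j) (u j)"
  then show "S f \<in> borel_measurable lebesgue" by (rule m)
  fix F assume F: "(\<forall>k j. F k j \<in> Lp_space (p j) (u j)) \<and> (\<forall>j. (\<lambda>k. Lp_norm (p j) (u j) (\<lambda>x. F k j x - f j x)) \<longlonglongrightarrow> 0)"
  then have lim: "(\<lambda>k. Lp_norm q w (\<lambda>x. S (F k) x - S f x)) \<longlonglongrightarrow> 0"
    using S f unfolding continuous_extension_def by blast
  have "weak_Lp_norm q w (\<lambda>x. S (F k) x - S f x) \<le> Lp_norm q w (\<lambda>x. S (F k) x - S f x)" for k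
    using F by (intro weak_Lp_norm_le q w borel_measurable_diff m[OF f] m) blast
  then have "eventually (\<lambda>k. weak_Lp_norm q w (\<lambda>x. S (F k) x - S f x) \<le> Lp_norm q w (\<lambda>x. S (F k) x - S f x)) sequentially"
    by simp
  then show "(\<lambda>k. weak_Lp_norm q w (\<lambda>x. S (F k) x - S f x)) \<longlonglongrightarrow> 0"
    by (intro tendsto_sandwich[OF _ _ tendsto_const lim]) simp_all
qed

lemma Lp_norm_null_weight:
  fixes w :: "real ^ 'n \<Rightarrow> real"
  assumes "AE x in lebesgue. w x = 0"
  shows "Lp_norm q w f = 0"
proof -
  have "(\<integral>\<^sup>+x. ennreal (cmod (f x) powr q) * ennreal (w x) \<partial>lebesgue) = (\<integral>\<^sup>+(x :: real ^ 'n). 0 \<partial>lebesgue)"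
    by (rule nn_integral_cong_AE) (use assms in \<open>rule eventually_mono\<close>, simp)
  then show ?thesis by (simp add: Lp_norm_def)
qed

text \<open>From \<open>s j \<le> p0'\<close> and \<open>\<alpha> * p0' < m n\<close> follows
  \<open>\<alpha> / n < 1 / S\<close>, so that the target exponent of the weak type bound is
  positive.\<close>

lemma fractional_integral_operator_kernel_operator:
  fixes K :: "real ^ 'n \<Rightarrow> real ^ 'n ^ 'm \<Rightarrow> complex"
  assumes p0': "1 < p0'" and T: "fractional_integral_operator \<alpha> p0 p0' K Ck s T0 T"
  shows "\<exists>S q B. kernel_operator \<alpha> K s T S q B"
proof -
  define S where "S = 1 / (\<Sum>j\<in>UNIV. 1 / s j)"
  define n where "n = real CARD('n)"
  define q where "q = S * n / (n - S * \<alpha>)"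
  have n: "0 < n" by (simp add: n_def)
  have a: "0 < \<alpha> * p0'" "\<alpha> * p0' < real CARD('m) * n" and s: "\<And>j. 1 \<le> s j" "\<And>j. s j \<le> p0'" and bd: "bounded_extension \<alpha> K s T0 T"
    using T unfolding fractional_integral_operator_def n_def by blast+
  have \<alpha>: "0 < \<alpha>" using a(1) p0' by (simp add: zero_less_mult_iff)
  have "\<alpha> / n < real CARD('m) * (1 / p0')" using a(2) n p0' by (simp add: field_simps)
  also have "real CARD('m) * (1 / p0') = (\<Sum>j\<in>(UNIV :: 'm set). 1 / p0')" by simp
  also have "\<dots> \<le> (\<Sum>j\<in>UNIV. 1 / s j)"
  proof (rule sum_mono)
    fix j show "1 / p0' \<le> 1 / s j" using s[of j] by (intro divide_left_mono) auto
  qed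
  finally have less: "\<alpha> / n < 1 / S" by (simp add: S_def)
  have "0 < 1 / S" using less \<alpha> n by (meson divide_pos_pos less_trans)
  then have S: "0 < S" by simp
  have "S * \<alpha> < n" using less S n by (simp add: field_simps)
  then have q: "0 < q" "1 / q = 1 / S - \<alpha> / n" using S n by (auto simp: q_def field_simps)
  obtain B where B: "0 < B" "\<And>f. (\<forall>j. f j \<in> Lp_space (s j) (\<lambda>x. 1)) \<Longrightarrow>
      weak_Lp_norm q (\<lambda>x. 1) (T f) \<le> ennreal B * (\<Prod>j\<in>UNIV. Lp_norm (s j) (\<lambda>x. 1) (f j))"
    using bd unfolding bounded_extension_def Let_def q_def S_def n_def by blast
  have T: "T f \<in> borel_measurable lebesgue"
      "\<And>i g h a b. g \<in> Lp_space (s i) (\<lambda>x. 1) \<Longrightarrow> h \<in> Lp_space (s i) (\<lambda>x. 1) \<Longrightarrow> AE x in lebesgue.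
          T (f(i := \<lambda>x. a * g x + b * h x)) x = a * T (f(i := g)) x + b * T (f(i := h)) x"
      "AE x in lebesgue. x \<notin> (\<Inter>j. supp (f j)) \<longrightarrow> has_bochner_integral lebesgue (kernel_integrand K f x) (T f x)"
    if "\<And>j. f j \<in> Lp_space (s j) (\<lambda>x. 1)" for f
    using bd that unfolding bounded_extension_def by blast+
  have "kernel_operator \<alpha> K s T S q B"
  proof
    fix f :: "'m \<Rightarrow> real ^ 'n \<Rightarrow> complex" and u w :: "real ^ 'n \<Rightarrow> complex" and i
    assume "\<And>j. f j \<in> Lp_space (s j) (\<lambda>x. 1)" "u \<in> Lp_space (s i) (\<lambda>x. 1)" "w \<in> Lp_space (s i) (\<lambda>x. 1)"
    from T(2)[OF this, of 1 1] show "AE x in lebesgue. T (f(i := \<lambda>x. u x + w x)) x = T (f(i := u)) x + T (f(i := w)) x"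
      by simp
  next
    show "1 / S = (\<Sum>j\<in>UNIV. 1 / s j)" by (simp add: S_def)
    show "1 / q = 1 / S - \<alpha> / real CARD('n)" using q by (simp add: n_def)
  qed (use s \<alpha> q B T in auto)
  then show ?thesis by blast
qed

text \<open>The strong bound in the whole range \<open>t \<le> p j\<close>, from which both parts of
  the theorem are read off.\<close>

lemma commutator_bound:
  fixes \<alpha> p0 p0' t P q :: real
    and K :: "real ^ 'n \<Rightarrow> real ^ 'n ^ 'm \<Rightarrow> complex"
    and s p :: "'m \<Rightarrow> real"
    and T :: "('m \<Rightarrow> real ^ 'n \<Rightarrow> complex) \<Rightarrow> real ^ 'n \<Rightarrow> complex"
    and \<omega> :: "'m \<Rightarrow> real ^ 'n \<Rightarrow> real"
  assumes p0': "1 < p0'" and t: "p0' < t" and \<alpha>t: "\<alpha> * t < real CARD('m) * real CARD('n)"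
    and T: "fractional_integral_operator \<alpha> p0 p0' K Ck s T0 T"
    and p: "\<And>j. t \<le> p j" and P: "1 / P = (\<Sum>j\<in>UNIV. 1 / p j)"
    and q: "1 / q = 1 / P - \<alpha> / real CARD('n)" "0 < q"
    and \<omega>: "\<omega> \<in> A_class (\<lambda>j. p j / t) (q / t)"
  shows "\<exists>C>0. \<forall>b. (\<forall>j. b j \<in> BMO) \<longrightarrow>
    (\<exists>S. continuous_extension (Lp_norm q (\<lambda>x. weight_prod \<omega> x powr (q / t))) p (\<lambda>j x. \<omega> j x powr (p j / t)) (commutator T b) S \<and>
      (\<forall>f. (\<forall>j. f j \<in> Lp_space (p j) (\<lambda>x. \<omega> j x powr (p j / t))) \<longrightarrow>
        Lp_norm q (\<lambda>x. weight_prod \<omega> x powr (q / t)) (S f)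
          \<le> ennreal C * bmo_vec_norm b * (\<Prod>j\<in>UNIV. Lp_norm (p j) (\<lambda>x. \<omega> j x powr (p j / t)) (f j))))"
    (is "\<exists>C>0. \<forall>b. ?B b \<longrightarrow> (\<exists>S. ?E b S \<and> ?N C b S)")
proof -
  obtain S q0 B where KO: "kernel_operator \<alpha> K s T S q0 B"
    using fractional_integral_operator_kernel_operator[OF p0' T] by blast
  interpret KO: kernel_operator \<alpha> K s T S q0 B by (rule KO)
  show ?thesis
  proof (cases "AE x in lebesgue. weight_prod \<omega> x = 0")
    case True
    \<comment> \<open>All norms on the left vanish, while the weight condition says nothing: in \<open>ennreal\<close>, \<open>0 * top = 0\<close>.\<close>
    have z: "Lp_norm q (\<lambda>x. weight_prod \<omega> x powr (q / t)) g = 0" for g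
      by (rule Lp_norm_null_weight) (use True in \<open>rule eventually_mono\<close>, simp)
    \<comment> \<open>On the dense class the extension has to agree with the commutator; elsewhere
      only measurability has to be arranged, as all distances are 0.\<close>
    have "?E b (\<lambda>f. if \<forall>j. f j \<in> bounded_compact_support then commutator T b f else (\<lambda>_. 0))" if "?B b" for b
      unfolding continuous_extension_def z using KO.commutator_measurable[of _ b] that by auto
    then show ?thesis by (intro exI[of _ 1]) (auto simp only: z zero_less_one zero_le)
  next
    case False
    have t1: "1 < t" using p0' t by simp
    obtain A where A: "0 < A" "\<And>x y. (\<exists>j. y $ j \<noteq> x) \<Longrightarrow>
        cmod (K x y) \<le> A * (\<Sum>j\<in>UNIV. norm (x - y $ j)) powr (- (real CARD('m) * real CARD('n) - \<alpha>))"
      using T unfolding fractional_integral_operator_def kernel_size_def by blast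
    have Km: "K x \<in> borel_measurable lebesgue" for x
      using T unfolding fractional_integral_operator_def kernel_loc_integrable_def by blast
    have "\<alpha> * 1 < \<alpha> * t" using KO.\<alpha> t1 by (intro mult_strict_left_mono)
    then have \<alpha>: "\<alpha> < real CARD('m) * real CARD('n)" using \<alpha>t by simp
    interpret weighted_commutator \<omega> "\<lambda>j. p j / t" "q / t" \<alpha> K s T S q0 B p t P q A
    proof (intro weighted_commutator.intro KO multiple_weight.intro weighted_commutator_axioms.intro)
      show "1 \<le> p j / t" for j using p[of j] t1 by simp
      show "cmod (K x y) \<le> A * rad x y powr (- (real CARD('m) * real CARD('n) - \<alpha>))" if "\<exists>j. y $ j \<noteq> x" for x y
        unfolding rad_def using A(2)[OF that] .
    qed (use t1 p P q \<omega> False \<alpha> A(1) Km in auto)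
    show ?thesis
    \<comment> \<open>\<open>CF 1\<close> may be 0, while the constant has to be positive.\<close>
    proof (intro exI[of _ "CF 1 + 1"] conjI allI impI)
      show "0 < CF 1 + 1" using CF_nonneg[of 1] by linarith
      fix b assume b: "?B b"
      have "?N (CF 1 + 1) b (comm b)"
      proof (intro allI impI)
        fix f assume "\<forall>j. f j \<in> Lp_space (p j) (\<lambda>x. \<omega> j x powr (p j / t))"
        then have "Lp_norm q target (comm b f) \<le> ennreal (CF 1) * bmo_vec_norm b * (\<Prod>j\<in>UNIV. Lp_norm (p j) (weight j) (f j))"
          using b by (intro comm_Lp_norm_le) blast+
        also have "\<dots> \<le> ennreal (CF 1 + 1) * bmo_vec_norm b * (\<Prod>j\<in>UNIV. Lp_norm (p j) (weight j) (f j))"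
          by (intro mult_right_mono ennreal_leI) auto
        finally show "Lp_norm q target (comm b f) \<le> ennreal (CF 1 + 1) * bmo_vec_norm b * (\<Prod>j\<in>UNIV. Lp_norm (p j) (weight j) (f j))" .
      qed
      moreover have "?E b (comm b)" using b by (intro continuous_extension_comm) blast
      ultimately show "\<exists>S. ?E b S \<and> ?N (CF 1 + 1) b S" by blast
    qed
  qed
qed

theorem theorem2p4:
  fixes \<alpha> p0 p0' t P q :: real
    and K :: "real ^ 'n \<Rightarrow> real ^ 'n ^ 'm \<Rightarrow> complex"
    and Ck :: "nat \<Rightarrow> real"
    and s p :: "'m \<Rightarrow> real"
    and T0 :: "('m \<Rightarrow> real ^ 'n \<Rightarrow> complex) \<Rightarrow> (real ^ 'n \<Rightarrow> complex) \<Rightarrow> complex"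
    and T :: "('m \<Rightarrow> real ^ 'n \<Rightarrow> complex) \<Rightarrow> real ^ 'n \<Rightarrow> complex"
    and \<omega> :: "'m \<Rightarrow> real ^ 'n \<Rightarrow> real"
  assumes "2 \<le> CARD('m)"
    and "1 < p0" and "1 / p0 + 1 / p0' = 1" and "p0' < t"
    and "0 < \<alpha> * t" and "\<alpha> * t < real CARD('m) * real CARD('n)"
    and "fractional_integral_operator \<alpha> p0 p0' K Ck s T0 T"
    and "summable (\<lambda>k. real (Suc k) * Ck (Suc k))"
    and "\<forall>j. t \<le> p j"
    and "1 / P = (\<Sum>j\<in>UNIV. 1 / p j)"
    and "1 / q = 1 / P - \<alpha> / real CARD('n)" and "1 / q > 0"
    and "\<omega> \<in> A_class (\<lambda>j. p j / t) (q / t)"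
  shows "((\<forall>j. t < p j) \<longrightarrow>
      (\<exists>C>0. \<forall>b. (\<forall>j. b j \<in> BMO) \<longrightarrow>
        (\<exists>S. continuous_extension (Lp_norm q (\<lambda>x. weight_prod \<omega> x powr (q / t)))
              p (\<lambda>j x. \<omega> j x powr (p j / t)) (commutator T b) S \<and>
          (\<forall>f. (\<forall>j. f j \<in> Lp_space (p j) (\<lambda>x. \<omega> j x powr (p j / t))) \<longrightarrow>
            Lp_norm q (\<lambda>x. weight_prod \<omega> x powr (q / t)) (S f)
              \<le> ennreal C * bmo_vec_norm b
                * (\<Prod>j\<in>UNIV. Lp_norm (p j) (\<lambda>x. \<omega> j x powr (p j / t)) (f j)))))) \<and>
    ((\<forall>j. t \<le> p j) \<and> (\<exists>j. p j = t) \<longrightarrow>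
      (\<exists>C>0. \<forall>b. (\<forall>j. b j \<in> BMO) \<longrightarrow>
        (\<exists>S. continuous_extension (weak_Lp_norm q (\<lambda>x. weight_prod \<omega> x powr (q / t)))
              p (\<lambda>j x. \<omega> j x powr (p j / t)) (commutator T b) S \<and>
          (\<forall>f. (\<forall>j. f j \<in> Lp_space (p j) (\<lambda>x. \<omega> j x powr (p j / t))) \<longrightarrow>
            weak_Lp_norm q (\<lambda>x. weight_prod \<omega> x powr (q / t)) (S f)
              \<le> ennreal C * bmo_vec_norm b
                * (\<Prod>j\<in>UNIV. Lp_norm (p j) (\<lambda>x. \<omega> j x powr (p j / t)) (f j))))))"
proof -
  have "1 / p0 < 1" using assms(2) by simp
  then have pos: "0 < 1 / p0'" using assms(3) by linarith
  have "1 / p0' < 1" using assms(2,3) by (smt (verit) divide_pos_pos)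
  then have p0': "1 < p0'" using pos by (simp add: divide_less_eq_1 zero_less_divide_iff)
  have q: "0 < q" using assms(12) by simp
  have p: "\<And>j. t \<le> p j" using assms(9) by blast
  have "\<And>j. \<omega> j \<in> borel_measurable lebesgue" using assms(13) by (simp add: A_class_def)
  then have w: "(\<lambda>x. weight_prod \<omega> x powr (q / t)) \<in> borel_measurable lebesgue"
    unfolding weight_prod_def by measurable
  obtain C where C: "0 < C" "\<And>b. (\<forall>j. b j \<in> BMO) \<Longrightarrow>
    (\<exists>S. continuous_extension (Lp_norm q (\<lambda>x. weight_prod \<omega> x powr (q / t))) p (\<lambda>j x. \<omega> j x powr (p j / t)) (commutator T b) S \<and>
      (\<forall>f. (\<forall>j. f j \<in> Lp_space (p j) (\<lambda>x. \<omega> j x powr (p j / t))) \<longrightarrow>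
        Lp_norm q (\<lambda>x. weight_prod \<omega> x powr (q / t)) (S f)
          \<le> ennreal C * bmo_vec_norm b * (\<Prod>j\<in>UNIV. Lp_norm (p j) (\<lambda>x. \<omega> j x powr (p j / t)) (f j))))"
    using commutator_bound[OF p0' assms(4,6,7) p assms(10,11) q assms(13)] by blast
  show ?thesis
  proof (intro conjI impI)
    show "\<exists>C>0. \<forall>b. (\<forall>j. b j \<in> BMO) \<longrightarrow>
        (\<exists>S. continuous_extension (Lp_norm q (\<lambda>x. weight_prod \<omega> x powr (q / t)))
              p (\<lambda>j x. \<omega> j x powr (p j / t)) (commutator T b) S \<and>
          (\<forall>f. (\<forall>j. f j \<in> Lp_space (p j) (\<lambda>x. \<omega> j x powr (p j / t))) \<longrightarrow>
            Lp_norm q (\<lambda>x. weight_prod \<omega> x powr (q / t)) (S f)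
              \<le> ennreal C * bmo_vec_norm b
                * (\<Prod>j\<in>UNIV. Lp_norm (p j) (\<lambda>x. \<omega> j x powr (p j / t)) (f j))))"
      using C by (intro exI[of _ C] conjI allI impI) blast+
    show "\<exists>C>0. \<forall>b. (\<forall>j. b j \<in> BMO) \<longrightarrow>
        (\<exists>S. continuous_extension (weak_Lp_norm q (\<lambda>x. weight_prod \<omega> x powr (q / t)))
              p (\<lambda>j x. \<omega> j x powr (p j / t)) (commutator T b) S \<and>
          (\<forall>f. (\<forall>j. f j \<in> Lp_space (p j) (\<lambda>x. \<omega> j x powr (p j / t))) \<longrightarrow>
            weak_Lp_norm q (\<lambda>x. weight_prod \<omega> x powr (q / t)) (S f)
              \<le> ennreal C * bmo_vec_norm b
                * (\<Prod>j\<in>UNIV. Lp_norm (p j) (\<lambda>x. \<omega> j x powr (p j / t)) (f j))))"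
    proof (intro exI[of _ C] conjI allI impI C(1))
      fix b :: "'m \<Rightarrow> real ^ 'n \<Rightarrow> complex" assume "\<forall>j. b j \<in> BMO"
      then obtain S where S: "continuous_extension (Lp_norm q (\<lambda>x. weight_prod \<omega> x powr (q / t))) p (\<lambda>j x. \<omega> j x powr (p j / t)) (commutator T b) S"
        and N: "\<And>f. (\<forall>j. f j \<in> Lp_space (p j) (\<lambda>x. \<omega> j x powr (p j / t))) \<Longrightarrow>
          Lp_norm q (\<lambda>x. weight_prod \<omega> x powr (q / t)) (S f)
            \<le> ennreal C * bmo_vec_norm b * (\<Prod>j\<in>UNIV. Lp_norm (p j) (\<lambda>x. \<omega> j x powr (p j / t)) (f j))"
        using C(2) by blast
      show "\<exists>S. continuous_extension (weak_Lp_norm q (\<lambda>x. weight_prod \<omega> x powr (q / t)))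
              p (\<lambda>j x. \<omega> j x powr (p j / t)) (commutator T b) S \<and>
          (\<forall>f. (\<forall>j. f j \<in> Lp_space (p j) (\<lambda>x. \<omega> j x powr (p j / t))) \<longrightarrow>
            weak_Lp_norm q (\<lambda>x. weight_prod \<omega> x powr (q / t)) (S f)
              \<le> ennreal C * bmo_vec_norm b
                * (\<Prod>j\<in>UNIV. Lp_norm (p j) (\<lambda>x. \<omega> j x powr (p j / t)) (f j)))"
      proof (intro exI[of _ S] conjI allI impI)
        show "continuous_extension (weak_Lp_norm q (\<lambda>x. weight_prod \<omega> x powr (q / t))) p (\<lambda>j x. \<omega> j x powr (p j / t)) (commutator T b) S"
          by (rule continuous_extension_weak[OF S q w])
        fix f assume f: "\<forall>j. f j \<in> Lp_space (p j) (\<lambda>x. \<omega> j x powr (p j / t))"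
        then have "S f \<in> borel_measurable lebesgue" using S unfolding continuous_extension_def by blast
        \<comment> \<open>Chebyshev's inequality reduces the weak bound to the strong one.\<close>
        then have "weak_Lp_norm q (\<lambda>x. weight_prod \<omega> x powr (q / t)) (S f) \<le> Lp_norm q (\<lambda>x. weight_prod \<omega> x powr (q / t)) (S f)"
          using q w by (intro weak_Lp_norm_le)
        also note N[OF f]
        finally show "weak_Lp_norm q (\<lambda>x. weight_prod \<omega> x powr (q / t)) (S f)
          \<le> ennreal C * bmo_vec_norm b * (\<Prod>j\<in>UNIV. Lp_norm (p j) (\<lambda>x. \<omega> j x powr (p j / t)) (f j))" .
      qed
    qed
  qed
qed

end
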